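(* Let $V \in L^\infty(\mathbb{R}^3)$ be cylindrically symmetric, $V = V(r,x_3)$ with $r=\sqrt{x_1^2+x_2^2}$, $1$-periodic in $x_3$, and such that $\inf \sigma\left(-\Delta + \frac{1}{r^2} + V(r,x_3)\right) > 0$. Let $\widetilde{f} : \mathbb{R}^3 \times \mathbb{R} \to \mathbb{R}$ be measurable and $O(2)\times\{I\}$-invariant in $x \in \mathbb{R}^3$, continuous in $u \in \mathbb{R}$, and satisfy, for some constant $c>0$, $|\widetilde{f}(x,u)| \leq c(|u| + |u|^5)$ for all $u\in\mathbb{R}$ and a.e. $x \in \mathbb{R}^3$. Let $h:\mathbb{R}^3\times\mathbb{R}^3\to\mathbb{R}^3$ be of the form $h(x,\alpha w) = \widetilde{f}(x,\alpha) w$ for all $w\in\mathbb{R}^3$ with $|w|=1$, all $\alpha\in\mathbb{R}$ and a.e. $x\in\mathbb{R}^3$. Consider the equations $$(M)\quad \nabla\times(\nabla\times \mathbf{E}) + V(x)\mathbf{E} = h(x,\mathbf{E}) \text{ in } \mathbb{R}^3, \qquad (S)\quad -\Delta u + \frac{u}{r^2} + V(r,x_3)u = \widetilde{f}(x,u) \text{ in } \mathbb{R}^3,$$ and the ansatz $$(A)\quad \mathbf{E}(x) = \frac{u(r,x_3)}{r}\begin{pmatrix} -x_2\\ x_1\\ 0\end{pmatrix}.$$ (1) If $\mathbf{E}\in H^1(\mathbb{R}^3;\mathbb{R}^3)$, of the form (A) for some cylindrically symmetric $u$, is a weak solution to (M), then $u\in H^1(\mathbb{R}^3)$ and $u$ is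 a weak solution to (S). (2) If $u\in H^1(\mathbb{R}^3)$ is a cylindrically symmetric weak solution to (S), then $\mathbf{E}$ given by (A) belongs to $H^1(\mathbb{R}^3;\mathbb{R}^3)$ and is a weak solution to (M). Moreover, in both cases $\operatorname{div}\mathbf{E}=0$ and $\mathcal{E}(\mathbf{E}) = \mathcal{J}(u)$.
   Context: Write $x=(x_1,x_2,x_3)\in\mathbb{R}^3$, $r=\sqrt{x_1^2+x_2^2}$. A function on $\mathbb{R}^3$ is cylindrically symmetric if it depends only on $(r,x_3)$. $O(2)\times\{I\}$-invariance in $x$ of $\widetilde f$ means $\widetilde f(gx,u)=\widetilde f(x,u)$ for all $g\in O(2)\times\{I\}$ ($O(2)$ acting on $(x_1,x_2)$ and the identity on $x_3$). $\sigma(\cdot)$ denotes the spectrum of the self-adjoint operator on $L^2(\mathbb{R}^3)$ associated with the quadratic form $\int_{\mathbb{R}^3}|\nabla u|^2+\frac{u^2}{r^2}+Vu^2\,dx$. $X$ is the Hilbert space of all cylindrically symmetric $u\in H^1(\mathbb{R}^3)$ with $\int_{\mathbb{R}^3}\frac{u^2}{r^2}\,dx<+\infty$, with norm $\|u\|_X^2=\int_{\mathbb{R}^3}|\nabla u|^2+\frac{u^2}{r^2}+u^2\,dx$. With $\widetilde F(x,u)=\int_0^u\widetilde f(x,s)\,ds$, define $\mathcal{J}:X\to\mathbb{R}$ by $$\mathcal{J}(u)=\frac12\int_{\mathbb{R}^3}|\nabla u|^2+\frac{u^2}{r^2}+V(r,x_3)u^2\,dx-\int_{\mathbb{R}^3}\widetilde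 F(x,u)\,dx.$$ A (cylindrically symmetric) weak solution to (S) is by definition a critical point $u\in X$ of $\mathcal{J}$ on $X$. With $H(x,\mathbf{E})=\int_0^1 h(x,t\mathbf{E})\cdot\mathbf{E}\,dt$, define $\mathcal{E}:H^1(\mathbb{R}^3;\mathbb{R}^3)\to\mathbb{R}$ by $$\mathcal{E}(\mathbf{E})=\frac12\int_{\mathbb{R}^3}|\nabla\times\mathbf{E}|^2\,dx+\frac12\int_{\mathbb{R}^3}V(x)|\mathbf{E}|^2\,dx-\int_{\mathbb{R}^3}H(x,\mathbf{E})\,dx.$$ A weak solution to (M) is by definition a critical point of $\mathcal{E}$ on $H^1(\mathbb{R}^3;\mathbb{R}^3)$. The divergence is distributional. *)

theory Defs
  imports "HOL-Analysis.Analysis"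
begin

type_synonym R3 = "real ^ 3"

section \<open>Cylindrical symmetry\<close>

definition radius :: "R3 \<Rightarrow> real" where
  "radius x = sqrt ((x $ 1)\<^sup>2 + (x $ 2)\<^sup>2)"

text \<open>Elements of Lebesgue and Sobolev spaces are represented by functions, and two functions
  represent the same element iff they agree almost everywhere. Properties of such elements
  are therefore stated up to null sets.\<close>

definition cyl_sym :: "(R3 \<Rightarrow> real) \<Rightarrow> bool" where
  "cyl_sym u \<longleftrightarrow> (\<exists>p. AE x in lebesgue. u x = p (radius x) (x $ 3))"

text \<open>The action of the block matrix \<open>diag(g, 1)\<close>.\<close>

definition O2_act :: "real ^ 2 ^ 2 \<Rightarrow> R3 \<Rightarrow> R3" where
  "O2_act g x = vector [g $ 1 $ 1 * x $ 1 + g $ 1 $ 2 * x $ 2,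
                        g $ 2 $ 1 * x $ 1 + g $ 2 $ 2 * x $ 2,
                        x $ 3]"

definition O2_invariant :: "(R3 \<Rightarrow> real \<Rightarrow> real) \<Rightarrow> bool" where
  "O2_invariant f \<longleftrightarrow> (\<forall>g x s. orthogonal_matrix g \<longrightarrow> f (O2_act g x) s = f x s)"

section \<open>Sobolev spaces\<close>

definition L2 :: "(R3 \<Rightarrow> real) set" where
  "L2 = {u. u \<in> borel_measurable lebesgue \<and> integrable lebesgue (\<lambda>x. (u x)\<^sup>2)}"

definition L2_norm :: "(R3 \<Rightarrow> real) \<Rightarrow> real" where
  "L2_norm u = sqrt (LINT x|lebesgue. (u x)\<^sup>2)"

definition Linf :: "(R3 \<Rightarrow> real) set" where
  "Linf = {u. u \<in> borel_measurable lebesgue \<and> (\<exists>C. AE x in lebesgue. \<bar>u x\<bar> \<le> C)}"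

definition partial :: "3 \<Rightarrow> (R3 \<Rightarrow> real) \<Rightarrow> R3 \<Rightarrow> real" where
  "partial i p x = frechet_derivative p (at x) (axis i 1)"

definition smooth :: "(R3 \<Rightarrow> real) \<Rightarrow> bool" where
  "smooth p \<longleftrightarrow> (\<forall>js x. foldr partial js p differentiable (at x))"

definition test_functions :: "(R3 \<Rightarrow> real) set" where
  "test_functions = {p. smooth p \<and> compact (closure {x. p x \<noteq> 0})}"

definition locally_integrable :: "(R3 \<Rightarrow> real) \<Rightarrow> bool" where
  "locally_integrable u \<longleftrightarrow> (\<forall>K. compact K \<longrightarrow> u absolutely_integrable_on K)"

definition is_weak_partial :: "3 \<Rightarrow> (R3 \<Rightarrow> real) \<Rightarrow> (R3 \<Rightarrow> real) \<Rightarrow> bool" where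
  "is_weak_partial i u v \<longleftrightarrow> locally_integrable u \<and> locally_integrable v \<and>
     (\<forall>p\<in>test_functions.
        (LINT x|lebesgue. u x * partial i p x) = - (LINT x|lebesgue. v x * p x))"

definition H1 :: "(R3 \<Rightarrow> real) set" where
  "H1 = {u \<in> L2. \<forall>i. \<exists>v\<in>L2. is_weak_partial i u v}"

text \<open>Weak derivatives are unique up to null sets, so the choice below is immaterial.\<close>

definition weak_partial :: "3 \<Rightarrow> (R3 \<Rightarrow> real) \<Rightarrow> R3 \<Rightarrow> real" where
  "weak_partial i u = (SOME v. is_weak_partial i u v)"

definition weak_grad :: "(R3 \<Rightarrow> real) \<Rightarrow> R3 \<Rightarrow> R3" where
  "weak_grad u x = (\<chi> i. weak_partial i u x)"

definition H1_vec :: "(R3 \<Rightarrow> R3) set" where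
  "H1_vec = {E. \<forall>i. (\<lambda>x. E x $ i) \<in> H1}"

definition H1_vec_norm :: "(R3 \<Rightarrow> R3) \<Rightarrow> real" where
  "H1_vec_norm E = sqrt (LINT x|lebesgue.
     (\<Sum>i\<in>UNIV. (norm (weak_grad (\<lambda>y. E y $ i) x))\<^sup>2) + (norm (E x))\<^sup>2)"

definition weak_curl :: "(R3 \<Rightarrow> R3) \<Rightarrow> R3 \<Rightarrow> R3" where
  "weak_curl E x = (let D = (\<lambda>i j. weak_partial i (\<lambda>y. E y $ j) x)
     in vector [D 2 3 - D 3 2, D 3 1 - D 1 3, D 1 2 - D 2 1])"

definition distr_div :: "(R3 \<Rightarrow> R3) \<Rightarrow> (R3 \<Rightarrow> real) \<Rightarrow> real" where
  "distr_div E p = - (LINT x|lebesgue. E x \<bullet> (\<chi> i. partial i p x))"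

definition div_free :: "(R3 \<Rightarrow> R3) \<Rightarrow> bool" where
  "div_free E \<longleftrightarrow> (\<forall>i. locally_integrable (\<lambda>x. E x $ i)) \<and>
     (\<forall>p\<in>test_functions. distr_div E p = 0)"

section \<open>The operator \<open>- \<Delta> + 1 / r\<^sup>2 + V\<close> and its spectrum\<close>

definition form_domain :: "(R3 \<Rightarrow> real) set" where
  "form_domain = {u \<in> H1. integrable lebesgue (\<lambda>x. (u x)\<^sup>2 / (radius x)\<^sup>2)}"

text \<open>The symmetric bilinear form whose diagonal is the quadratic form
  \<open>\<integral> \<bar>\<nabla>u\<bar>\<^sup>2 + u\<^sup>2 / r\<^sup>2 + V u\<^sup>2\<close>.\<close>

definition schroedinger_form ::
    "(R3 \<Rightarrow> real) \<Rightarrow> (R3 \<Rightarrow> real) \<Rightarrow> (R3 \<Rightarrow> real) \<Rightarrow> real" where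
  "schroedinger_form V u v = (LINT x|lebesgue.
     weak_grad u x \<bullet> weak_grad v x + u x * v x / (radius x)\<^sup>2 + V x * u x * v x)"

text \<open>The graph of the self-adjoint operator \<open>A\<close> associated with the form: \<open>u\<close> is in the
  domain of \<open>A\<close>, and \<open>w = A u\<close>. The domain is not restricted to cylindrically symmetric
  functions.\<close>

definition schroedinger_op ::
    "(R3 \<Rightarrow> real) \<Rightarrow> (R3 \<Rightarrow> real) \<Rightarrow> (R3 \<Rightarrow> real) \<Rightarrow> bool" where
  "schroedinger_op V u w \<longleftrightarrow> u \<in> form_domain \<and> w \<in> L2 \<and>
     (\<forall>v\<in>form_domain. schroedinger_form V u v = (LINT x|lebesgue. w x * v x))"

text \<open>\<open>\<lambda>\<close> is in the resolvent set iff \<open>A - \<lambda>\<close> is a bijection from the domain of \<open>A\<close> onto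
  \<open>L\<^sup>2\<close> with bounded inverse. As \<open>A\<close> is self-adjoint, its spectrum is contained in the reals,
  and working over the real space \<open>L\<^sup>2\<close> loses nothing.\<close>

definition schroedinger_resolvent_set :: "(R3 \<Rightarrow> real) \<Rightarrow> real set" where
  "schroedinger_resolvent_set V = {l.
     (\<forall>g\<in>L2. \<exists>u. schroedinger_op V u (\<lambda>x. l * u x + g x)) \<and>
     (\<forall>g\<in>L2. \<forall>u u'. schroedinger_op V u (\<lambda>x. l * u x + g x) \<longrightarrow>
        schroedinger_op V u' (\<lambda>x. l * u' x + g x) \<longrightarrow> (AE x in lebesgue. u x = u' x)) \<and>
     (\<exists>C. \<forall>g\<in>L2. \<forall>u. schroedinger_op V u (\<lambda>x. l * u x + g x) \<longrightarrow>
        L2_norm u \<le> C * L2_norm g)}"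

definition schroedinger_spectrum :: "(R3 \<Rightarrow> real) \<Rightarrow> real set" where
  "schroedinger_spectrum V = - schroedinger_resolvent_set V"

section \<open>Critical points and weak solutions\<close>

text \<open>\<open>u\<close> is a critical point of \<open>J\<close> on the space \<open>S\<close> with norm \<open>N\<close>: \<open>J\<close> is Frechet
  differentiable at \<open>u\<close> with derivative zero.\<close>

definition critical_point ::
    "(R3 \<Rightarrow> 'b::real_vector) set \<Rightarrow> ((R3 \<Rightarrow> 'b) \<Rightarrow> real) \<Rightarrow> ((R3 \<Rightarrow> 'b) \<Rightarrow> real) \<Rightarrow>
     (R3 \<Rightarrow> 'b) \<Rightarrow> bool" where
  "critical_point S N J u \<longleftrightarrow> u \<in> S \<and>
     (\<forall>e>0. \<exists>d>0. \<forall>v\<in>S. N v < d \<longrightarrow> \<bar>J (\<lambda>x. u x + v x) - J u\<bar> \<le> e * N v)"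

definition X_space :: "(R3 \<Rightarrow> real) set" where
  "X_space = {u \<in> H1. cyl_sym u \<and> integrable lebesgue (\<lambda>x. (u x)\<^sup>2 / (radius x)\<^sup>2)}"

definition X_norm :: "(R3 \<Rightarrow> real) \<Rightarrow> real" where
  "X_norm u = sqrt (LINT x|lebesgue.
     (norm (weak_grad u x))\<^sup>2 + (u x)\<^sup>2 / (radius x)\<^sup>2 + (u x)\<^sup>2)"

text \<open>The interval integral is oriented, so this is also right for negative \<open>s\<close>.\<close>

definition prim_f :: "(R3 \<Rightarrow> real \<Rightarrow> real) \<Rightarrow> R3 \<Rightarrow> real \<Rightarrow> real" where
  "prim_f f x s = (LBINT t=ereal 0..ereal s. f x t)"

definition energy_S ::
    "(R3 \<Rightarrow> real) \<Rightarrow> (R3 \<Rightarrow> real \<Rightarrow> real) \<Rightarrow> (R3 \<Rightarrow> real) \<Rightarrow> real" where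
  "energy_S V f u =
     1 / 2 * (LINT x|lebesgue.
        (norm (weak_grad u x))\<^sup>2 + (u x)\<^sup>2 / (radius x)\<^sup>2 + V x * (u x)\<^sup>2)
     - (LINT x|lebesgue. prim_f f x (u x))"

definition weak_solution_S ::
    "(R3 \<Rightarrow> real) \<Rightarrow> (R3 \<Rightarrow> real \<Rightarrow> real) \<Rightarrow> (R3 \<Rightarrow> real) \<Rightarrow> bool" where
  "weak_solution_S V f u \<longleftrightarrow> critical_point X_space X_norm (energy_S V f) u"

definition prim_h :: "(R3 \<Rightarrow> R3 \<Rightarrow> R3) \<Rightarrow> R3 \<Rightarrow> R3 \<Rightarrow> real" where
  "prim_h h x w = (LBINT t=ereal 0..ereal 1. h x (t *\<^sub>R w) \<bullet> w)"

definition energy_M ::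
    "(R3 \<Rightarrow> real) \<Rightarrow> (R3 \<Rightarrow> R3 \<Rightarrow> R3) \<Rightarrow> (R3 \<Rightarrow> R3) \<Rightarrow> real" where
  "energy_M V h E =
     1 / 2 * (LINT x|lebesgue. (norm (weak_curl E x))\<^sup>2)
     + 1 / 2 * (LINT x|lebesgue. V x * (norm (E x))\<^sup>2)
     - (LINT x|lebesgue. prim_h h x (E x))"

definition weak_solution_M ::
    "(R3 \<Rightarrow> real) \<Rightarrow> (R3 \<Rightarrow> R3 \<Rightarrow> R3) \<Rightarrow> (R3 \<Rightarrow> R3) \<Rightarrow> bool" where
  "weak_solution_M V h E \<longleftrightarrow> critical_point H1_vec H1_vec_norm (energy_M V h) E"

text \<open>The value on the null set \<open>r = 0\<close> is \<open>0\<close>, by the convention for division by zero.\<close>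

definition ansatz :: "(R3 \<Rightarrow> real) \<Rightarrow> R3 \<Rightarrow> R3" where
  "ansatz u x = (u x / radius x) *\<^sub>R vector [- (x $ 2), x $ 1, 0]"

end

theory Submission
  imports Defs
begin

text \<open>
  For a field \<open>E\<close> of the form of the ansatz, \<open>div E = 0\<close> and
  \<open>\<integral> \<bar>\<nabla> \<times> E\<bar>\<^sup>2 = \<integral> \<bar>\<nabla>E\<bar>\<^sup>2 - (div E)\<^sup>2 = \<integral> \<bar>\<nabla>u\<bar>\<^sup>2 + u\<^sup>2 / r\<^sup>2\<close>,
  so \<open>u \<mapsto> E\<close> is an isometry of \<open>X\<close> into \<open>H\<^sup>1\<close> that carries one energy to the other. A critical
  point of the energy of fields therefore restricts to one of the energy on \<open>X\<close>. The converse is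
  an instance of symmetric criticality: the energy of fields is Frechet differentiable by the
  Sobolev embedding into \<open>L\<^sup>6\<close>, and its derivative at \<open>E\<close> in an arbitrary direction \<open>W\<close> equals the
  one in the direction obtained from \<open>W\<close> by averaging over rotations and projecting to the ansatz.
  That direction may fail to be smooth on the axis, so the averaging is carried out for smooth \<open>W\<close> of
  compact support with \<open>1 / r\<close> regularised, and density does the rest.
\<close>

section \<open>Continuously differentiable functions of compact support\<close>

text \<open>The growth \<open>\<bar>s\<bar> ^ 5\<close> is critical in dimension three: the
  potential grows like \<open>\<bar>s\<bar> ^ 6\<close>, which the embedding just controls.
  Hoelder's inequality alone then bounds the remainder of the energy without making it small;
  smallness comes from pointwise differentiability and dominated convergence along a sequence that
  violates the claim. The axis is the other obstacle. The azimuthal unit vector is bounded but its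
  derivatives grow like \<open>1 / r\<close>, so \<open>ansatz v\<close> is in H^1 only if
  \<open>v / r\<close> is square integrable. Averaged directions meet this because
  \<open>x $ 1\<close> and \<open>x $ 2\<close> have mean zero on every circle about the axis: for
  smooth \<open>p\<close> the average of \<open>sg a b * p\<close> is of order \<open>r^2\<close>,
  one order more than its factors show. The symmetry of \<open>u\<close>, known up to null sets
  only, is used through integrals, by moving the average from one factor to the other. The curl
  controls only part of a gradient; but as \<open>E\<close> is divergence free, pairing its curl
  with that of any \<open>W\<close> amounts to pairing the gradients, so the components of
  \<open>W\<close> can be tested one at a time by scalar functions.\<close>

lemma measure_preserving_lebesgue:
  fixes T :: "'a::euclidean_space \<Rightarrow> 'a"
  assumes T: "T \<in> borel_measurable borel" and d: "distr lborel borel T = lborel"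
  shows "T \<in> lebesgue \<rightarrow>\<^sub>M lebesgue" "distr lebesgue lebesgue T = lebesgue"
proof -
  have cm: "complete_measure (lebesgue :: 'a measure)" by standard
  have m: "T \<in> lebesgue \<rightarrow>\<^sub>M lborel"
    using T by (simp add: measurable_completion)
  have "distr lebesgue lborel T = distr lborel lborel T"
    by (rule distr_completion) (use T in simp)
  also have "\<dots> = lborel"
    using d by (metis distr_cong sets_lborel)
  finally have d': "distr lebesgue lborel T = lborel" .
  show "T \<in> lebesgue \<rightarrow>\<^sub>M lebesgue"
    by (rule complete_measure.measurable_completion2[OF cm m]) (simp add: d')
  show "distr lebesgue lebesgue T = lebesgue"
    using complete_measure.completion_distr_eq[OF cm m] d' by simp
qed

lemma distr_lborel_reflect: "distr lborel borel (\<lambda>x. c - x) = (lborel :: 'a::euclidean_space measure)"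
proof -
  have "(lborel :: 'a measure) = density (distr lborel borel (\<lambda>x. c + (-1) *\<^sub>R x)) (\<lambda>_. 1)"
    using lborel_affine[of "-1" c] by simp
  then show ?thesis by (simp add: density_1)
qed

lemma measure_preserving_reflect:
  "(\<lambda>x. c - x :: 'a::euclidean_space) \<in> lebesgue \<rightarrow>\<^sub>M lebesgue"
  "distr lebesgue lebesgue (\<lambda>x. c - x :: 'a) = lebesgue"
  using measure_preserving_lebesgue[OF _ distr_lborel_reflect[of c]] by auto

definition grad :: "(R3 \<Rightarrow> real) \<Rightarrow> R3 \<Rightarrow> R3" where
  "grad p x = (\<chi> i. partial i p x)"

lemma grad_nth [simp]: "grad p x $ i = partial i p x"
  by (simp add: grad_def)

lemma partial_eqI: "(p has_derivative D) (at x) \<Longrightarrow> partial i p x = D (axis i 1)"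
  unfolding partial_def by (metis frechet_derivative_at)

lemma grad_eqI:
  assumes "(p has_derivative (\<lambda>h. G \<bullet> h)) (at x)" shows "grad p x = G"
  using partial_eqI[OF assms] by (simp add: vec_eq_iff inner_axis)

lemma has_derivative_grad:
  assumes "p differentiable at x"
  shows "(p has_derivative (\<lambda>h. grad p x \<bullet> h)) (at x)"
proof -
  let ?D = "frechet_derivative p (at x)"
  have D: "(p has_derivative ?D) (at x)"
    using assms frechet_derivative_works by blast
  then have "linear ?D" by (rule has_derivative_linear)
  have "?D h = grad p x \<bullet> h" for h
  proof -
    have "?D h = ?D (\<Sum>i\<in>UNIV. (h $ i) *\<^sub>R axis i 1)"
      by (metis basis_expansion scalar_mult_eq_scaleR)
    also have "\<dots> = (\<Sum>i\<in>UNIV. h $ i * ?D (axis i 1))"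
      by (simp add: linear_sum[OF \<open>linear ?D\<close>] linear_cmul[OF \<open>linear ?D\<close>])
    finally show ?thesis by (simp add: inner_vec_def partial_def mult.commute)
  qed
  then show ?thesis using D by (metis (no_types, lifting) ext)
qed

definition C1 :: "(R3 \<Rightarrow> real) set" where
  "C1 = {p. (\<forall>x. p differentiable at x) \<and> continuous_on UNIV (grad p)}"

text \<open>A larger class of test functions than \<open>test_functions\<close>: the cutoffs
  \<open>chi\<close> and the averages over rotations are only shown to be once continuously
  differentiable. \<open>is_weak_partial_C1c\<close> extends the defining identity of weak
  derivatives to this class.\<close>

definition C1c :: "(R3 \<Rightarrow> real) set" where
  "C1c = {p \<in> C1. \<exists>R. \<forall>x. norm x > R \<longrightarrow> p x = 0}"

lemma C1I:
  assumes "\<And>x. (p has_derivative (\<lambda>h. G x \<bullet> h)) (at x)" "continuous_on UNIV G"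
  shows "p \<in> C1" "grad p = G"
proof -
  show g: "grad p = G" using grad_eqI[OF assms(1)] by auto
  then have "continuous_on UNIV (grad p)" using assms(2) by simp
  then show "p \<in> C1" using assms(1) unfolding C1_def by (auto simp: differentiable_def)
qed

lemma C1_has_derivative: "p \<in> C1 \<Longrightarrow> (p has_derivative (\<lambda>h. grad p x \<bullet> h)) (at x)"
  unfolding C1_def by (auto intro: has_derivative_grad)

lemma C1_continuous_grad: "p \<in> C1 \<Longrightarrow> continuous_on S (grad p)"
  unfolding C1_def by (auto intro: continuous_on_subset)

lemma C1_continuous_partial: "p \<in> C1 \<Longrightarrow> continuous_on S (partial i p)"
  using continuous_on_component[OF C1_continuous_grad, of p S i] by simp

lemma C1_continuous: "p \<in> C1 \<Longrightarrow> continuous_on S p"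
  by (meson C1_has_derivative has_derivative_continuous continuous_at_imp_continuous_on)

lemma C1_mult:
  assumes "p \<in> C1" "q \<in> C1"
  shows "(\<lambda>x. p x * q x) \<in> C1" "grad (\<lambda>x. p x * q x) = (\<lambda>x. p x *\<^sub>R grad q x + q x *\<^sub>R grad p x)"
proof -
  have d: "((\<lambda>x. p x * q x) has_derivative (\<lambda>h. (p x *\<^sub>R grad q x + q x *\<^sub>R grad p x) \<bullet> h)) (at x)" for x
    by (auto intro!: derivative_eq_intros C1_has_derivative[OF assms(1)] C1_has_derivative[OF assms(2)]
        simp: inner_add_left algebra_simps)
  have c: "continuous_on UNIV (\<lambda>x. p x *\<^sub>R grad q x + q x *\<^sub>R grad p x)"
    by (intro continuous_intros C1_continuous C1_continuous_grad assms)
  show "(\<lambda>x. p x * q x) \<in> C1" "grad (\<lambda>x. p x * q x) = (\<lambda>x. p x *\<^sub>R grad q x + q x *\<^sub>R grad p x)"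
    using C1I[OF d c] by auto
qed

lemma C1_add:
  assumes "p \<in> C1" "q \<in> C1"
  shows "(\<lambda>x. p x + q x) \<in> C1" "grad (\<lambda>x. p x + q x) = (\<lambda>x. grad p x + grad q x)"
proof -
  have d: "((\<lambda>x. p x + q x) has_derivative (\<lambda>h. (grad p x + grad q x) \<bullet> h)) (at x)" for x
    by (auto intro!: derivative_eq_intros C1_has_derivative[OF assms(1)] C1_has_derivative[OF assms(2)]
        simp: inner_add_left algebra_simps)
  have c: "continuous_on UNIV (\<lambda>x. grad p x + grad q x)"
    by (intro continuous_intros C1_continuous C1_continuous_grad assms)
  show "(\<lambda>x. p x + q x) \<in> C1" "grad (\<lambda>x. p x + q x) = (\<lambda>x. grad p x + grad q x)"
    using C1I[OF d c] by auto
qed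

lemma C1_const: "(\<lambda>x. c) \<in> C1" "grad (\<lambda>x. c) = (\<lambda>x. 0)"
  using C1I[of "\<lambda>x. c" "\<lambda>x. 0"] by auto

lemma C1_coord: "(\<lambda>x. x $ i) \<in> C1" "grad (\<lambda>x. x $ i) = (\<lambda>x. axis i 1)"
proof -
  have d: "((\<lambda>x. x $ i) has_derivative (\<lambda>h. axis i 1 \<bullet> h)) (at x)" for x :: R3
    using bounded_linear_imp_has_derivative[OF bounded_linear_vec_nth[of i]] by (simp add: inner_axis')
  show "(\<lambda>x. x $ i) \<in> C1" "grad (\<lambda>x. x $ i) = (\<lambda>x. axis i 1)"
    using C1I[OF d] by auto
qed

lemma C1_cmult:
  assumes "p \<in> C1"
  shows "(\<lambda>x. c * p x) \<in> C1" "grad (\<lambda>x. c * p x) = (\<lambda>x. c *\<^sub>R grad p x)"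
  using C1_mult[OF C1_const(1)[of c] assms] by (auto simp: C1_const)

lemma C1_compose:
  assumes "p \<in> C1" and g: "\<And>t. (g has_real_derivative g' t) (at t)" and "continuous_on UNIV g'"
  shows "(\<lambda>x. g (p x)) \<in> C1" "grad (\<lambda>x. g (p x)) = (\<lambda>x. g' (p x) *\<^sub>R grad p x)"
proof -
  have d: "((\<lambda>x. g (p x)) has_derivative (\<lambda>h. (g' (p x) *\<^sub>R grad p x) \<bullet> h)) (at x)" for x
    using has_derivative_compose[OF C1_has_derivative[OF assms(1)], of g "\<lambda>h. g' (p x) * h" x]
      g[of "p x"] by (simp add: has_field_derivative_def)
  have c: "continuous_on UNIV (\<lambda>x. g' (p x) *\<^sub>R grad p x)"
    by (intro continuous_intros C1_continuous_grad assms
        continuous_on_compose2[OF assms(3) C1_continuous[OF assms(1)]]) auto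
  show "(\<lambda>x. g (p x)) \<in> C1" "grad (\<lambda>x. g (p x)) = (\<lambda>x. g' (p x) *\<^sub>R grad p x)"
    using C1I[OF d c] by auto
qed

lemma grad_zero_outside:
  assumes "\<And>x. norm x > R \<Longrightarrow> p x = 0" "norm x > R"
  shows "grad p x = (0::R3)"
proof -
  have "open {x::R3. norm x > R}"
    by (intro open_Collect_less continuous_intros)
  then have "(p has_derivative (\<lambda>h. 0)) (at x)"
    by (rule has_derivative_transform_within_open[OF has_derivative_const[of 0]])
      (use assms in auto)
  then show ?thesis by (intro grad_eqI) simp
qed

lemma C1cD: "p \<in> C1c \<Longrightarrow> p \<in> C1" by (simp add: C1c_def)

lemma C1cE:
  assumes "p \<in> C1c"
  obtains R where "\<And>x. norm x > R \<Longrightarrow> p x = 0" "\<And>x. norm x > R \<Longrightarrow> grad p x = 0" "R > 0"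
proof -
  obtain R where R: "\<And>x. norm x > R \<Longrightarrow> p x = 0" using assms by (auto simp: C1c_def)
  show thesis
    by (rule that[of "max R 1"]) (use R grad_zero_outside[of R p] in auto)
qed

lemma C1c_mult:
  assumes "p \<in> C1" "q \<in> C1c"
  shows "(\<lambda>x. p x * q x) \<in> C1c"
  using C1_mult(1)[of p q] assms by (auto simp: C1c_def)

text \<open>Values range over any normed space, so that boundedness and uniform continuity of a
  function and of its gradient are instances of the same lemmas.\<close>

definition Cc :: "(R3 \<Rightarrow> 'b::real_normed_vector) set" where
  "Cc = {p. continuous_on UNIV p \<and> (\<exists>R. \<forall>x. norm x > R \<longrightarrow> p x = 0)}"

lemma C1c_Cc: "p \<in> C1c \<Longrightarrow> p \<in> Cc"
  by (auto simp: C1c_def Cc_def C1_continuous)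

lemma C1c_grad_Cc: "p \<in> C1c \<Longrightarrow> grad p \<in> Cc"
  by (rule C1cE[of p]) (auto simp: C1c_def Cc_def C1_continuous_grad)

lemma C1c_partial_Cc: "p \<in> C1c \<Longrightarrow> partial i p \<in> Cc"
  by (rule C1cE[of p]) (auto simp: C1c_def Cc_def C1_continuous_partial vec_eq_iff)

lemma Cc_bounded:
  assumes "p \<in> Cc"
  obtains B where "\<And>x. norm (p x) \<le> B" "B > 0"
proof -
  obtain R where R: "\<And>x. norm x > R \<Longrightarrow> p x = 0" and c: "continuous_on UNIV p"
    using assms by (auto simp: Cc_def)
  have "compact (p ` cball 0 R)"
    by (intro compact_continuous_image continuous_on_subset[OF c]) auto
  then obtain B where B: "\<And>x. x \<in> cball 0 R \<Longrightarrow> norm (p x) \<le> B"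
    by (meson compact_imp_bounded bounded_iff imageI)
  show thesis
  proof (rule that[of "max B 1"])
    show "norm (p x) \<le> max B 1" for x
      using R[of x] B[of x] by (cases "norm x > R") (auto simp: not_less le_max_iff_disj)
  qed auto
qed

lemma Cc_uniformly_continuous:
  assumes "p \<in> Cc" "e > 0"
  obtains d where "d > 0" "\<And>x y. norm (x - y) < d \<Longrightarrow> norm (p x - p y) < e"
proof -
  obtain R where R: "\<And>x. norm x > R \<Longrightarrow> p x = 0" and c: "continuous_on UNIV p"
    using assms by (auto simp: Cc_def)
  \<comment> \<open>One unit of slack around the support: two points at distance less than 1 either
    both lie in the larger ball or both lie where \<open>p\<close> vanishes.\<close>
  have "uniformly_continuous_on (cball 0 (R+1)) p"
    by (intro compact_uniformly_continuous continuous_on_subset[OF c]) auto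
  then obtain d where d: "d > 0" "\<And>x y. x \<in> cball 0 (R+1) \<Longrightarrow> y \<in> cball 0 (R+1) \<Longrightarrow> dist x y < d \<Longrightarrow> dist (p x) (p y) < e"
    unfolding uniformly_continuous_on_def using assms(2) by metis
  show thesis
  proof (rule that[of "min d 1"])
    show "min d 1 > 0" using d by auto
    fix x y :: R3 assume xy: "norm (x - y) < min d 1"
    show "norm (p x - p y) < e"
    proof (cases "x \<in> cball 0 (R+1) \<and> y \<in> cball 0 (R+1)")
      case True
      then show ?thesis using d(2)[of x y] xy by (auto simp: dist_norm)
    next
      case False
      have "norm x \<le> norm y + norm (x - y)" "norm y \<le> norm x + norm (x - y)"
        using norm_triangle_sub[of x y] norm_triangle_sub[of y x] by (auto simp: norm_minus_commute)
      then have "norm x > R" "norm y > R" using False xy by (auto)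
      then show ?thesis using R assms(2) by simp
    qed
  qed
qed

text \<open>The mean value inequality bounds the error by the oscillation of the gradient, which is
  uniformly small. Because \<open>d\<close> serves all base points \<open>a\<close>, the bound can
  be integrated over translates or rotations of the argument; this is how derivatives are taken
  under integrals in \<open>conv_C1\<close>, \<open>integral_partial_C1c\<close> and
  \<open>avg_C1\<close>.\<close>

lemma C1c_uniform_taylor:
  assumes "p \<in> C1c" "e > 0"
  obtains d where "d > 0" "\<And>a h. norm h < d \<Longrightarrow> \<bar>p (a + h) - p a - grad p a \<bullet> h\<bar> \<le> e * norm h"
proof -
  obtain d where d: "d > 0" "\<And>x y. norm (x - y) < d \<Longrightarrow> norm (grad p x - grad p y) < e"
    using Cc_uniformly_continuous[OF C1c_grad_Cc[OF assms(1)] assms(2)] by metis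
  have "\<bar>p (a + h) - p a - grad p a \<bullet> h\<bar> \<le> e * norm h" if h: "norm h < d" for a h
  proof -
    have "norm (p (a+h) - p a - (\<lambda>h. grad p a \<bullet> h) ((a+h) - a)) \<le> norm ((a+h) - a) * e"
    proof (rule differentiable_bound_linearization[where S = "ball a d" and f' = "\<lambda>x h. grad p x \<bullet> h"])
      fix t :: real assume "t \<in> {0..1}"
      then have "norm (t *\<^sub>R h) \<le> norm h" by (simp add: mult_left_le_one_le)
      then show "a + t *\<^sub>R ((a+h) - a) \<in> ball a d" using h by (simp add: dist_norm)
    next
      show "(p has_derivative (\<lambda>h. grad p x \<bullet> h)) (at x within ball a d)" for x
        using C1_has_derivative[OF C1cD[OF assms(1)]] has_derivative_at_withinI by blast
    next
      fix x assume "x \<in> ball a d"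
      then have "norm (grad p x - grad p a) < e" using d(2)[of x a] by (simp add: dist_norm norm_minus_commute)
      then show "onorm ((\<lambda>h. grad p x \<bullet> h) - (\<lambda>h. grad p a \<bullet> h)) \<le> e"
        by (intro onorm_le)
          (smt (verit) Cauchy_Schwarz_ineq2 fun_diff_def inner_diff_left mult_right_mono norm_ge_zero real_norm_def)
    qed (use d in auto)
    then show ?thesis by (simp add: mult.commute)
  qed
  then show thesis using that d(1) by blast
qed

section \<open>Local integrability and pairing with functions of compact support\<close>

lemma locally_integrable_cball:
  assumes "locally_integrable u" shows "integrable lebesgue (\<lambda>x. indicat_real (cball a R) x * u x)"
  using assms unfolding locally_integrable_def set_integrable_def by (auto simp: compact_cball)

lemma locally_integrable_measurable:
  assumes "locally_integrable u" shows "u \<in> borel_measurable lebesgue"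
proof (rule borel_measurable_LIMSEQ_real)
  show "(\<lambda>x. indicat_real (cball 0 (real n)) x * u x) \<in> borel_measurable lebesgue" for n
    using locally_integrable_cball[OF assms] by blast
  show "(\<lambda>n. indicat_real (cball 0 (real n)) x * u x) \<longlonglongrightarrow> u x" for x
  proof (rule tendsto_eventually)
    obtain N where "norm x \<le> real N" using real_arch_simple by blast
    then show "\<forall>\<^sub>F n in sequentially. indicat_real (cball 0 (real n)) x * u x = u x"
      by (intro eventually_sequentiallyI[of N]) (auto simp: indicator_def)
  qed
qed

lemma integrable_cball_lebesgue: "integrable lebesgue (indicat_real (cball (a::R3) R))"
proof -
  have "cball a R \<in> lmeasurable" by (rule lmeasurable_cball)
  then show ?thesis using lmeasurable_iff_integrable by blast
qed

lemma locally_integrable_bound: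
  assumes "v \<in> borel_measurable lebesgue" "\<And>R. integrable lebesgue (\<lambda>x. indicat_real (cball 0 R) x * g x)"
    "AE x in lebesgue. \<bar>v x\<bar> \<le> g x"
  shows "locally_integrable v"
  unfolding locally_integrable_def
proof (intro allI impI)
  fix K :: "R3 set" assume K: "compact K"
  then obtain R where R: "K \<subseteq> cball 0 R"
    using compact_imp_bounded[OF K] by (auto simp: bounded_any_center[of _ 0] subset_eq)
  show "v absolutely_integrable_on K"
    unfolding set_integrable_def
  proof (rule Bochner_Integration.integrable_bound[OF assms(2)[of R]])
    have [measurable]: "K \<in> sets lebesgue" using K by (simp add: borel_compact)
    show "(\<lambda>x. indicat_real K x *\<^sub>R v x) \<in> borel_measurable lebesgue" using assms(1) by measurable
    show "AE x in lebesgue. norm (indicat_real K x *\<^sub>R v x) \<le> norm (indicat_real (cball 0 R) x * g x)"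
      using assms(3) by eventually_elim (use R in \<open>auto simp: indicator_def\<close>)
  qed
qed

lemma locally_integrable_mult_bounded:
  assumes "locally_integrable u" "p \<in> borel_measurable lebesgue" "\<And>x. \<bar>p x\<bar> \<le> B"
  shows "locally_integrable (\<lambda>x. p x * u x)"
proof (rule locally_integrable_bound[where g = "\<lambda>x. B * \<bar>u x\<bar>"])
  show "(\<lambda>x. p x * u x) \<in> borel_measurable lebesgue"
    using assms(2) locally_integrable_measurable[OF assms(1)] by measurable
  show "integrable lebesgue (\<lambda>x. indicat_real (cball 0 R) x * (B * \<bar>u x\<bar>))" for R
    using integrable_mult_right[OF integrable_abs[OF locally_integrable_cball[OF assms(1), of 0 R]], of B]
    by (simp add: abs_mult mult.left_commute)
  show "AE x in lebesgue. \<bar>p x * u x\<bar> \<le> B * \<bar>u x\<bar>"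
    using assms(3) by (intro AE_I2) (auto simp: abs_mult intro: mult_right_mono)
qed

lemma integrable_cutoff:
  assumes "locally_integrable u" "p \<in> borel_measurable lebesgue" "\<And>x. \<bar>p x\<bar> \<le> B"
    "\<And>x. norm x > R \<Longrightarrow> p x = 0"
  shows "integrable lebesgue (\<lambda>x. u x * p x)"
proof -
  have "integrable lebesgue (\<lambda>x. indicat_real (cball 0 R) x * (p x * u x))"
    by (rule locally_integrable_cball[OF locally_integrable_mult_bounded[OF assms(1-3)]])
  also have "(\<lambda>x. indicat_real (cball 0 R) x * (p x * u x)) = (\<lambda>x. u x * p x)"
    using assms(4) by (auto simp: indicator_def fun_eq_iff not_le)
  finally show ?thesis .
qed

lemma continuous_measurable_lebesgue:
  "continuous_on UNIV (p :: 'a::euclidean_space \<Rightarrow> 'b::euclidean_space) \<Longrightarrow> p \<in> borel_measurable lebesgue"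
  by (simp add: borel_measurable_continuous_onI measurable_completion)

lemma integrable_Cc:
  assumes "locally_integrable u" "p \<in> Cc"
  shows "integrable lebesgue (\<lambda>x. u x * p x)"
proof -
  obtain B where "\<And>x. norm (p x) \<le> B" using Cc_bounded[OF assms(2)] by metis
  moreover obtain R where "\<And>x. norm x > R \<Longrightarrow> p x = 0" "continuous_on UNIV p" using assms(2) by (auto simp: Cc_def)
  ultimately show ?thesis
    by (intro integrable_cutoff[OF assms(1), of p B R] continuous_measurable_lebesgue) auto
qed

lemma locally_integrable_const: "locally_integrable (\<lambda>x. c)"
  by (rule locally_integrable_bound[of _ "\<lambda>x. \<bar>c\<bar>"]) (auto simp: integrable_cball_lebesgue)

lemma Cc_locally_integrable: 
  assumes "p \<in> Cc" shows "locally_integrable p"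
proof -
  obtain B where "\<And>x. norm (p x) \<le> B" using Cc_bounded[OF assms] by metis
  then show ?thesis
    using locally_integrable_mult_bounded[OF locally_integrable_const[of 1], of p B] assms
    by (auto simp: Cc_def continuous_measurable_lebesgue)
qed

lemma L2_locally_integrable:
  assumes "u \<in> L2" shows "locally_integrable u"
proof (rule locally_integrable_bound)
  show "u \<in> borel_measurable lebesgue" using assms by (simp add: L2_def)
  have i: "integrable lebesgue (\<lambda>x. (u x)\<^sup>2)" using assms by (simp add: L2_def)
  show "integrable lebesgue (\<lambda>x. indicat_real (cball 0 R) x * ((u x)\<^sup>2 + 1))" for R
  proof -
    have "integrable lebesgue (\<lambda>x. indicat_real (cball 0 R) x *\<^sub>R (u x)\<^sup>2)"
      by (rule integrable_mult_indicator[OF _ i]) auto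
    then show ?thesis
      using integrable_cball_lebesgue[of 0 R] by (simp add: distrib_left)
  qed
  show "AE x in lebesgue. \<bar>u x\<bar> \<le> (u x)\<^sup>2 + 1"
  proof (rule AE_I2)
    fix x show "\<bar>u x\<bar> \<le> (u x)\<^sup>2 + 1"
      using zero_le_power2[of "\<bar>u x\<bar> - 1/2"] by (simp add: power2_eq_square algebra_simps)
  qed
qed

section \<open>Convolution and mollifiers\<close>

lemma lebesgue_integral_reflect:
  assumes "f \<in> borel_measurable lebesgue"
  shows "(LINT y|lebesgue. f (c - y :: R3) :: real) = (LINT y|lebesgue. f y)"
  using integral_distr[OF measure_preserving_reflect(1)[of c], of f] assms
  by (simp add: measure_preserving_reflect(2))

lemma measurable_reflect:
  assumes "f \<in> borel_measurable lebesgue"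
  shows "(\<lambda>y. f (c - y :: R3) :: real) \<in> borel_measurable lebesgue"
  using measurable_compose[OF measure_preserving_reflect(1) assms] .

lemma lebesgue_integral_translate:
  assumes "f \<in> borel_measurable lebesgue"
  shows "(LINT y|lebesgue. f (y + c :: R3) :: real) = (LINT y|lebesgue. f y)"
  using lebesgue_integral_reflect[OF measurable_reflect[OF assms, of c], of 0]
    lebesgue_integral_reflect[OF assms, of c] by (simp add: add.commute)

text \<open>Only a uniform bound and a support radius of \<open>k\<close> enter the right-hand side.
  With \<open>S\<close> fixed and \<open>e\<close> small, uniform convergence of kernels or test
  functions becomes convergence of integrals, for \<open>u\<close> merely locally
  integrable.\<close>

lemma abs_integral_cutoff:
  assumes u: "locally_integrable u" and "k \<in> borel_measurable lebesgue" "\<And>x. \<bar>k x\<bar> \<le> e"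
    "\<And>x. norm x > S \<Longrightarrow> k x = 0"
  shows "\<bar>LINT x|lebesgue. u x * k x\<bar> \<le> e * (LINT x|lebesgue. indicat_real (cball 0 S) x * \<bar>u x\<bar>)"
proof -
  have "\<bar>LINT x|lebesgue. u x * k x\<bar> \<le> (LINT x|lebesgue. \<bar>u x * k x\<bar>)"
    by (rule integral_abs_bound)
  also have "\<dots> \<le> (LINT x|lebesgue. e * (indicat_real (cball 0 S) x * \<bar>u x\<bar>))"
  proof (rule integral_mono)
    show "integrable lebesgue (\<lambda>x. \<bar>u x * k x\<bar>)"
      by (rule integrable_abs[OF integrable_cutoff[OF assms]])
    have "integrable lebesgue (\<lambda>x. \<bar>indicat_real (cball 0 S) x * u x\<bar>)"
      by (rule integrable_abs[OF locally_integrable_cball[OF u]])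
    then show "integrable lebesgue (\<lambda>x. e * (indicat_real (cball 0 S) x * \<bar>u x\<bar>))"
      by (auto simp: abs_mult)
    show "\<bar>u x * k x\<bar> \<le> e * (indicat_real (cball 0 S) x * \<bar>u x\<bar>)" for x
      using assms(3)[of x] assms(4)[of x]
      by (cases "norm x > S") (auto simp: abs_mult mult.commute indicator_def not_less intro: mult_right_mono)
  qed
  finally show ?thesis by simp
qed

definition conv :: "(R3 \<Rightarrow> real) \<Rightarrow> (R3 \<Rightarrow> real) \<Rightarrow> R3 \<Rightarrow> real" where
  "conv u g x = (LINT y|lebesgue. u y * g (x - y))"

lemma Cc_measurable: "p \<in> Cc \<Longrightarrow> (p :: R3 \<Rightarrow> real) \<in> borel_measurable lebesgue"
  by (auto simp: Cc_def continuous_measurable_lebesgue)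

lemma Cc_reflect:
  assumes "g \<in> Cc" shows "(\<lambda>y. g (x - y)) \<in> Cc"
proof -
  obtain R where R: "\<And>x. norm x > R \<Longrightarrow> g x = 0" and c: "continuous_on UNIV g" using assms by (auto simp: Cc_def)
  have "\<forall>y. norm y > R + norm x \<longrightarrow> g (x - y) = 0"
  proof (intro allI impI R)
    fix y :: R3 assume "norm y > R + norm x"
    then show "norm (x - y) > R" using norm_triangle_ineq2[of y x] by (simp add: norm_minus_commute)
  qed
  moreover have "continuous_on UNIV (\<lambda>y. g (x - y))"
    by (intro continuous_on_compose2[OF c] continuous_intros) auto
  ultimately show ?thesis by (auto simp: Cc_def)
qed

lemma conv_integrable:
  assumes "locally_integrable u" "g \<in> Cc"
  shows "integrable lebesgue (\<lambda>y. u y * g (x - y))"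
  by (rule integrable_Cc[OF assms(1) Cc_reflect[OF assms(2)]])

lemma conv_continuous:
  assumes u: "locally_integrable u" and g: "g \<in> Cc"
  shows "continuous_on S (conv u g)"
proof -
  obtain R where R: "\<And>x. norm x > R \<Longrightarrow> g x = 0" using g by (auto simp: Cc_def)
  have "continuous (at x) (conv u g)" for x
    unfolding continuous_at_eps_delta dist_norm
  proof (intro allI impI)
    fix e :: real assume e: "e > 0"
    \<comment> \<open>Points \<open>x'\<close> are kept within distance 1 of \<open>x\<close>, so
      both translated kernels vanish outside this ball. The divisor \<open>K + 1\<close> below
      avoids dividing by zero.\<close>
    define S where "S = norm x + R + 1"
    define K where "K = (LINT x|lebesgue. indicat_real (cball 0 S) x * \<bar>u x\<bar>)"
    have K: "K \<ge> 0" unfolding K_def by (intro integral_nonneg_AE) auto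
    obtain d where d: "d > 0" "\<And>x y. norm (x - y) < d \<Longrightarrow> norm (g x - g y) < e / (K + 1)"
      using Cc_uniformly_continuous[OF g, of "e / (K+1)"] e K by (auto simp: divide_pos_pos)
    show "\<exists>d>0. \<forall>x'. norm (x' - x) < d \<longrightarrow> norm (conv u g x' - conv u g x) < e"
    proof (intro exI conjI allI impI)
      show "min d 1 > 0" using d by simp
      fix x' assume x': "norm (x' - x) < min d 1"
      have "conv u g x' - conv u g x = (LINT y|lebesgue. u y * (g (x' - y) - g (x - y)))"
        unfolding conv_def
        by (subst Bochner_Integration.integral_diff[symmetric])
          (auto intro!: conv_integrable u g simp: right_diff_distrib)
      also have "\<bar>\<dots>\<bar> \<le> e / (K + 1) * K"
        unfolding K_def
      proof (rule abs_integral_cutoff[OF u])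
        show "(\<lambda>y. g (x' - y) - g (x - y)) \<in> borel_measurable lebesgue"
          using Cc_measurable[OF Cc_reflect[OF g]] by measurable
        show "\<bar>g (x' - y) - g (x - y)\<bar> \<le> e / ((LINT x|lebesgue. indicat_real (cball 0 S) x * \<bar>u x\<bar>) + 1)" for y
          using d(2)[of "x' - y" "x - y"] x' by (auto simp: K_def)
        show "g (x' - y) - g (x - y) = 0" if y: "norm y > S" for y
        proof -
          have "norm y \<le> norm (x - y) + norm x" "norm y \<le> norm (x' - y) + norm x + norm (x' - x)"
            using norm_triangle_ineq4[of x "x - y"] norm_triangle_ineq4[of x' "x' - y"]
               norm_triangle_ineq[of x "x' - x"] by auto
          then have "norm (x - y) > R" "norm (x' - y) > R" using y x' by (auto simp: S_def)
          then show ?thesis using R by auto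
        qed
      qed
      also have "\<dots> < e" using e K by (simp add: divide_simps mult_strict_left_mono)
      finally show "norm (conv u g x' - conv u g x) < e" by simp
    qed
  qed
  then show ?thesis by (simp add: continuous_at_imp_continuous_on)
qed

text \<open>All derivatives fall on the kernel, so \<open>u\<close> carries no regularity. By
  linearity the Taylor error of \<open>conv u g\<close> is the integral of \<open>u\<close> against
  the Taylor error of \<open>g\<close>, which is uniformly small and supported in one ball.\<close>

lemma conv_C1:
  assumes u: "locally_integrable u" and g: "g \<in> C1c"
  shows "conv u g \<in> C1" "partial i (conv u g) = conv u (partial i g)"
proof -
  define G where "G x = (\<chi> i. conv u (partial i g) x)" for x
  obtain R where R: "\<And>x. norm x > R \<Longrightarrow> g x = 0" "\<And>x. norm x > R \<Longrightarrow> grad g x = 0" using C1cE[OF g] by metis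
  have gc: "g \<in> Cc" using C1c_Cc[OF g] .
  have pc: "partial i g \<in> Cc" for i using C1c_partial_Cc[OF g] .
  have Gh: "G x \<bullet> h = (LINT y|lebesgue. u y * (grad g (x - y) \<bullet> h))" for x h
  proof -
    have "G x \<bullet> h = (\<Sum>i\<in>UNIV. (LINT y|lebesgue. (u y * partial i g (x - y)) * h $ i))"
      by (simp add: G_def inner_vec_def conv_def)
    also have "\<dots> = (LINT y|lebesgue. (\<Sum>i\<in>UNIV. (u y * partial i g (x - y)) * h $ i))"
      by (rule Bochner_Integration.integral_sum[symmetric]) (auto intro!: conv_integrable u pc)
    finally show ?thesis by (simp add: inner_vec_def sum_distrib_left mult.assoc)
  qed
  have Ghi: "integrable lebesgue (\<lambda>y. u y * (grad g (x - y) \<bullet> h))" for x h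
  proof -
    have "integrable lebesgue (\<lambda>y. (\<Sum>i\<in>UNIV. (u y * partial i g (x - y)) * h $ i))"
      by (intro Bochner_Integration.integrable_sum integrable_mult_left conv_integrable u pc)
    then show ?thesis by (simp add: inner_vec_def sum_distrib_left mult.assoc)
  qed
  have d: "(conv u g has_derivative (\<lambda>h. G x \<bullet> h)) (at x)" for x
    unfolding has_derivative_at_alt
  proof (intro conjI allI impI)
    show "bounded_linear (\<lambda>h. G x \<bullet> h)" by (rule bounded_linear_inner_right)
    fix e :: real assume e: "e > 0"
    define S where "S = norm x + R + 1"
    define K where "K = (LINT x|lebesgue. indicat_real (cball 0 S) x * \<bar>u x\<bar>)"
    have K: "K \<ge> 0" unfolding K_def by (intro integral_nonneg_AE) auto
    obtain d where d: "d > 0" "\<And>a h. norm h < d \<Longrightarrow> \<bar>g (a + h) - g a - grad g a \<bullet> h\<bar> \<le> e / (K + 1) * norm h"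
      using C1c_uniform_taylor[OF g, of "e / (K+1)"] e K by (auto simp: divide_pos_pos)
    show "\<exists>d>0. \<forall>x'. norm (x' - x) < d \<longrightarrow> norm (conv u g x' - conv u g x - G x \<bullet> (x' - x)) \<le> e * norm (x' - x)"
    proof (intro exI conjI allI impI)
      show "min d 1 > 0" using d by simp
      fix x' assume x': "norm (x' - x) < min d 1"
      let ?h = "x' - x"
      have "conv u g x' - conv u g x - G x \<bullet> ?h = (LINT y|lebesgue. u y * (g (x' - y) - g (x - y) - grad g (x - y) \<bullet> ?h))"
        unfolding Gh conv_def
        by (simp add: right_diff_distrib conv_integrable[OF u gc] Ghi)
      also have "\<bar>\<dots>\<bar> \<le> (e / (K + 1) * norm ?h) * K"
        unfolding K_def
      proof (rule abs_integral_cutoff[OF u])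
        have "(\<lambda>y. \<Sum>i\<in>UNIV. partial i g (x - y) * ?h $ i) \<in> borel_measurable lebesgue"
          using Cc_measurable[OF Cc_reflect[OF pc]] by measurable
        then have "(\<lambda>y. grad g (x - y) \<bullet> ?h) \<in> borel_measurable lebesgue" by (simp add: inner_vec_def)
        then show "(\<lambda>y. g (x' - y) - g (x - y) - grad g (x - y) \<bullet> ?h) \<in> borel_measurable lebesgue"
          using Cc_measurable[OF Cc_reflect[OF gc]] by measurable
        show "\<bar>g (x' - y) - g (x - y) - grad g (x - y) \<bullet> ?h\<bar> \<le> e / ((LINT x|lebesgue. indicat_real (cball 0 S) x * \<bar>u x\<bar>) + 1) * norm ?h" for y
          using d(2)[of ?h "x - y"] x' by (auto simp: K_def algebra_simps)
        show "g (x' - y) - g (x - y) - grad g (x - y) \<bullet> ?h = 0" if y: "norm y > S" for y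
        proof -
          have "norm y \<le> norm (x - y) + norm x" "norm y \<le> norm (x' - y) + norm x + norm (x' - x)"
            using norm_triangle_ineq4[of x "x - y"] norm_triangle_ineq4[of x' "x' - y"]
               norm_triangle_ineq[of x "x' - x"] by auto
          then have "norm (x - y) > R" "norm (x' - y) > R" using y x' by (auto simp: S_def)
          then show ?thesis using R by auto
        qed
      qed
      also have "\<dots> \<le> e * norm ?h" using e K by (auto simp: divide_simps mult_left_mono intro!: mult_right_mono)
      finally show "norm (conv u g x' - conv u g x - G x \<bullet> (x' - x)) \<le> e * norm (x' - x)" by simp
    qed
  qed
  have c: "continuous_on UNIV G"
    unfolding G_def by (intro continuous_on_vec_lambda conv_continuous u pc)
  show "conv u g \<in> C1" by (rule C1I(1)[OF d c])
  show "partial i (conv u g) = conv u (partial i g)"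
    using C1I(2)[OF d c] by (metis G_def grad_nth vec_lambda_beta ext)
qed

lemma conv_zero_outside:
  assumes "\<And>x. norm x > R \<Longrightarrow> u x = 0" "\<And>x. norm x > S \<Longrightarrow> g x = 0" "norm x > R + S"
  shows "conv u g x = 0"
proof -
  have "(\<lambda>y. u y * g (x - y)) = (\<lambda>y. 0)"
  proof
    fix y show "u y * g (x - y) = 0"
      using assms(1)[of y] assms(2)[of "x - y"] assms(3) norm_triangle_ineq[of y "x - y"]
      by (cases "norm y > R") auto
  qed
  then show ?thesis by (simp add: conv_def)
qed

lemma conv_C1c:
  assumes "locally_integrable u" "\<And>x. norm x > R \<Longrightarrow> u x = 0" "g \<in> C1c"
  shows "conv u g \<in> C1c"
proof -
  obtain S where "\<And>x. norm x > S \<Longrightarrow> g x = 0" using C1cE[OF assms(3)] by metis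
  then have "\<forall>x. norm x > R + S \<longrightarrow> conv u g x = 0" using conv_zero_outside assms by blast
  then show ?thesis using conv_C1(1)[OF assms(1,3)] by (auto simp: C1c_def)
qed

section \<open>Iterated partial derivatives and the standard bump\<close>

lemma test_functionsI:
  assumes "\<And>js. foldr partial js p \<in> C1c"
  shows "p \<in> test_functions"
proof -
  have "smooth p" using assms unfolding smooth_def C1c_def C1_def by auto
  moreover obtain R where "\<And>x. norm x > R \<Longrightarrow> p x = 0" using C1cE[OF assms[of "[]", simplified]] by metis
  then have "{x. p x \<noteq> 0} \<subseteq> cball 0 R" by (force simp: not_less)
  then have "bounded {x. p x \<noteq> 0}" using bounded_subset bounded_cball by blast
  ultimately show ?thesis by (simp add: test_functions_def compact_closure)
qed

text \<open>The complement of the ball is open, so vanishing there passes to each further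
  derivative; continuity of the gradient comes from differentiability one order higher.\<close>

lemma test_functions_foldr:
  assumes "p \<in> test_functions"
  shows "foldr partial js p \<in> C1c"
proof -
  have sm: "foldr partial js p differentiable at x" for js x
    using assms unfolding test_functions_def smooth_def by blast
  have "bounded {x. p x \<noteq> 0}" using assms by (simp add: test_functions_def compact_closure)
  then obtain R where R: "\<And>x. norm x > R \<Longrightarrow> p x = 0"
    unfolding bounded_iff by (smt (verit) mem_Collect_eq)
  have z: "norm x > R \<Longrightarrow> foldr partial js p x = 0" for x js
  proof (induction js arbitrary: x)
    case Nil then show ?case using R by simp
  next
    case (Cons j js)
    have "grad (foldr partial js p) x = 0"
      by (rule grad_zero_outside[of R]) (use Cons in auto)
    then show ?case by (metis foldr_Cons comp_apply grad_nth zero_index)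
  qed
  have "continuous_on UNIV (partial i (foldr partial js p))" for i
    using sm[of "i # js"] by (auto intro!: continuous_at_imp_continuous_on differentiable_imp_continuous_within)
  then have "continuous_on UNIV (grad (foldr partial js p))"
    unfolding grad_def[abs_def] by (intro continuous_on_vec_lambda)
  then show ?thesis using sm z unfolding C1c_def C1_def by blast
qed

lemma test_functions_C1c: "p \<in> test_functions \<Longrightarrow> p \<in> C1c"
  using test_functions_foldr[of p "[]"] by simp

lemma conv_test_functions:
  assumes "locally_integrable u" "\<And>x. norm x > R \<Longrightarrow> u x = 0" "g \<in> test_functions"
  shows "conv u g \<in> test_functions"
proof (rule test_functionsI)
  fix js
  have "foldr partial js (conv u g) = conv u (foldr partial js g)"
    by (induction js) (simp_all add: conv_C1(2)[OF assms(1) test_functions_foldr[OF assms(3)]])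
  then show "foldr partial js (conv u g) \<in> C1c"
    using conv_C1c[OF assms(1,2) test_functions_foldr[OF assms(3)]] by simp
qed

text \<open>The profile \<open>exp (- 1 / t)\<close> of the standard bump with a power of
  \<open>1 / t\<close> attached. Differentiation maps the family into its own linear combinations,
  so every derivative of the bump is explicit.\<close>

definition flat :: "nat \<Rightarrow> real \<Rightarrow> real" where
  "flat k t = (if t > 0 then exp (- inverse t) * inverse t ^ k else 0)"

lemma flat_tendsto_0: "(flat k \<longlongrightarrow> 0) (at_right 0)"
proof -
  have "((\<lambda>x::real. x ^ k / exp x) \<longlongrightarrow> 0) at_top" by (rule tendsto_power_div_exp_0)
  then have "((\<lambda>t::real. inverse t ^ k / exp (inverse t)) \<longlongrightarrow> 0) (at_right 0)"
    by (rule filterlim_compose[OF _ filterlim_inverse_at_top_right])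
  then show ?thesis
    by (rule Lim_transform_eventually)
      (auto simp: eventually_at_filter flat_def exp_minus field_simps)
qed

lemma DERIV_flat: "(flat k has_real_derivative (flat (k+2) t - real k * flat (k+1) t)) (at t)"
proof -
  consider "t > 0" | "t < 0" | "t = 0" by linarith
  then show ?thesis
  proof cases
    case 1
    have "((\<lambda>t. exp (- inverse t) * inverse t ^ k) has_real_derivative
        exp (- inverse t) * inverse t ^ 2 * inverse t ^ k - exp (- inverse t) * (real k * inverse t ^ (k - 1) * inverse t ^ 2)) (at t)"
      using 1 by (auto intro!: derivative_eq_intros simp: power2_eq_square algebra_simps)
    also have "exp (- inverse t) * inverse t ^ 2 * inverse t ^ k - exp (- inverse t) * (real k * inverse t ^ (k - 1) * inverse t ^ 2)
      = flat (k+2) t - real k * flat (k+1) t"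
      using 1 by (cases k) (auto simp: flat_def power2_eq_square algebra_simps)
    finally have "((\<lambda>t. exp (- inverse t) * inverse t ^ k) has_real_derivative
        (flat (k+2) t - real k * flat (k+1) t)) (at t)" .
    then show ?thesis
      by (rule DERIV_cong_ev[THEN iffD1, rotated 3])
        (use 1 in \<open>auto simp: flat_def eventually_nhds intro!: exI[of _ "{0<..}"]\<close>)
  next
    case 2
    have "((\<lambda>t. 0) has_real_derivative (flat (k+2) t - real k * flat (k+1) t)) (at t)"
      using 2 by (simp add: flat_def)
    then show ?thesis
      by (rule DERIV_cong_ev[THEN iffD1, rotated 3])
        (use 2 in \<open>auto simp: flat_def eventually_nhds intro!: exI[of _ "{..<0}"]\<close>)
  next
    case 3
    have "((\<lambda>h. flat k h / h) \<longlongrightarrow> 0) (at 0)"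
      unfolding filterlim_at_split
    proof
      show "((\<lambda>h. flat k h / h) \<longlongrightarrow> 0) (at_left 0)"
        by (rule tendsto_eventually) (auto simp: flat_def eventually_at_filter)
      \<comment> \<open>For \<open>h > 0\<close> the difference quotient is
        \<open>flat (Suc k) h\<close>, which tends to 0 because the exponential beats every
        power.\<close>
      show "((\<lambda>h. flat k h / h) \<longlongrightarrow> 0) (at_right 0)"
        using flat_tendsto_0[of "Suc k"]
        by (rule Lim_transform_eventually) (auto simp: flat_def eventually_at_filter field_simps)
    qed
    then show ?thesis using 3 by (simp add: DERIV_def flat_def)
  qed
qed

lemma continuous_flat: "continuous_on S (flat k)"
  using DERIV_flat DERIV_isCont continuous_at_imp_continuous_on by blast

lemma bump_partial:
  "(\<lambda>x::R3. flat k (e\<^sup>2 - x \<bullet> x)) \<in> C1"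
  "partial i (\<lambda>x. flat k (e\<^sup>2 - x \<bullet> x)) =
     (\<lambda>x. x $ i * (-2 * (flat (k+2) (e\<^sup>2 - x \<bullet> x) - real k * flat (k+1) (e\<^sup>2 - x \<bullet> x))))"
proof -
  have d0: "((\<lambda>x. e\<^sup>2 - x \<bullet> x) has_derivative (\<lambda>h. ((-2) *\<^sub>R x) \<bullet> h)) (at x)" for x :: R3
    by (auto intro!: derivative_eq_intros simp: inner_commute)
  have c0: "(\<lambda>x::R3. e\<^sup>2 - x \<bullet> x) \<in> C1" "grad (\<lambda>x::R3. e\<^sup>2 - x \<bullet> x) = (\<lambda>x. (-2) *\<^sub>R x)"
    using C1I[OF d0] continuous_on_scaleR[OF continuous_on_const continuous_on_id] by blast+
  have cf: "continuous_on UNIV (\<lambda>t. flat (k+2) t - real k * flat (k+1) t)"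
    by (intro continuous_intros continuous_flat)
  note c = C1_compose[OF c0(1) DERIV_flat[of k] cf]
  show "(\<lambda>x::R3. flat k (e\<^sup>2 - x \<bullet> x)) \<in> C1" by (rule c(1))
  show "partial i (\<lambda>x. flat k (e\<^sup>2 - x \<bullet> x)) =
     (\<lambda>x. x $ i * (-2 * (flat (k+2) (e\<^sup>2 - x \<bullet> x) - real k * flat (k+1) (e\<^sup>2 - x \<bullet> x))))"
    using c(2)[unfolded c0(2)] by (auto simp: fun_eq_iff vec_eq_iff algebra_simps)
qed

text \<open>A class closed under \<^const>\<open>partial\<close>, so that smoothness of the bump follows by induction.\<close>

inductive bump_class :: "real \<Rightarrow> (R3 \<Rightarrow> real) \<Rightarrow> bool" for e where
  base: "bump_class e (\<lambda>x. flat k (e\<^sup>2 - x \<bullet> x))"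
| add: "bump_class e p \<Longrightarrow> bump_class e q \<Longrightarrow> bump_class e (\<lambda>x. p x + q x)"
| cmult: "bump_class e p \<Longrightarrow> bump_class e (\<lambda>x. c * p x)"
| coord: "bump_class e p \<Longrightarrow> bump_class e (\<lambda>x. x $ i * p x)"

lemma bump_class_partial:
  assumes "bump_class e p"
  shows "p \<in> C1 \<and> (\<forall>i. bump_class e (partial i p))"
  using assms
proof induction
  case (base k)
  have "bump_class e (partial i (\<lambda>x. flat k (e\<^sup>2 - x \<bullet> x)))" for i
    using bump_class.coord[OF bump_class.cmult[OF bump_class.add[OF bump_class.base[of e "k+2"]
         bump_class.cmult[OF bump_class.base[of e "k+1"], of "- real k"]], of "-2"], of i]
    by (simp add: bump_partial(2))
  then show ?case using bump_partial(1) by blast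
next
  case (add p q)
  then have "partial i (\<lambda>x. p x + q x) = (\<lambda>x. partial i p x + partial i q x)" for i
    using C1_add(2)[of p q] by (auto simp: fun_eq_iff vec_eq_iff)
  then show ?case using add C1_add(1)[of p q] by (auto intro: bump_class.add)
next
  case (cmult p c)
  then have "partial i (\<lambda>x. c * p x) = (\<lambda>x. c * partial i p x)" for i
    using C1_cmult(2)[of p c] by (auto simp: fun_eq_iff vec_eq_iff)
  then show ?case using cmult C1_cmult(1)[of p c] by (auto intro: bump_class.cmult)
next
  case (coord p j)
  have eq: "partial i (\<lambda>x. x $ j * p x) = (\<lambda>x. x $ j * partial i p x + (if i = j then 1 else 0) * p x)" for i
    using coord C1_mult(2)[OF C1_coord(1)[of j], of p] by (auto simp: fun_eq_iff vec_eq_iff C1_coord(2) axis_def)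
  show ?case
    unfolding eq using coord C1_mult(1)[OF C1_coord(1)[of j], of p]
    by (auto intro!: bump_class.add bump_class.coord bump_class.cmult)
qed

lemma bump_class_zero:
  assumes "bump_class e p" "e > 0" "norm x > e" shows "p x = 0"
proof -
  have "e\<^sup>2 \<le> (norm x)\<^sup>2" using assms by (intro power_mono) auto
  then have "e\<^sup>2 - x \<bullet> x \<le> 0" by (simp add: dot_square_norm)
  with assms(1) show ?thesis by induction (auto simp: flat_def)
qed

lemma bump_class_test_functions:
  assumes "bump_class e p" "e > 0" shows "p \<in> test_functions"
proof (rule test_functionsI)
  fix js
  have "bump_class e (foldr partial js p)"
    by (induction js) (use assms bump_class_partial in auto)
  then show "foldr partial js p \<in> C1c"
    using bump_class_partial bump_class_zero assms(2) unfolding C1c_def by blast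
qed

text \<open>Symmetry of the second partial derivatives is an explicit computation for the bump, and
  convolutions inherit it. This replaces a general Schwarz theorem.\<close>

definition mollifier :: "real \<Rightarrow> (R3 \<Rightarrow> real) \<Rightarrow> bool" where
  "mollifier e g \<longleftrightarrow> g \<in> test_functions \<and> (\<forall>x. g x \<ge> 0) \<and> (LINT x|lebesgue. g x) = 1 \<and>
     (\<forall>x. norm x > e \<longrightarrow> g x = 0) \<and> (\<forall>i j. partial i (partial j g) = partial j (partial i g))"

lemma partial_cmult: "p \<in> C1 \<Longrightarrow> partial i (\<lambda>x. c * p x) = (\<lambda>x. c * partial i p x)"
  using C1_cmult(2)[of p c] by (auto simp: fun_eq_iff vec_eq_iff)

lemma partial_coord_mult:
  "p \<in> C1 \<Longrightarrow> partial i (\<lambda>x. x $ j * p x) = (\<lambda>x. x $ j * partial i p x + (if i = j then p x else 0))"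
  using C1_mult(2)[OF C1_coord(1)[of j], of p] by (auto simp: fun_eq_iff vec_eq_iff C1_coord(2) axis_def)

lemma bump_partial_commute:
  "partial i (partial j (\<lambda>x. c * flat 0 (e\<^sup>2 - x \<bullet> x))) = partial j (partial i (\<lambda>x. c * flat 0 (e\<^sup>2 - x \<bullet> x)))"
proof -
  have 1: "partial j (\<lambda>x. c * flat 0 (e\<^sup>2 - x \<bullet> x)) = (\<lambda>x. x $ j * ((-2 * c) * flat 2 (e\<^sup>2 - x \<bullet> x)))" for j
    unfolding partial_cmult[OF bump_partial(1)] bump_partial(2) by (simp add: fun_eq_iff numeral_2_eq_2)
  have C: "(\<lambda>x::R3. (-2 * c) * flat 2 (e\<^sup>2 - x \<bullet> x)) \<in> C1" by (rule C1_cmult(1)[OF bump_partial(1)])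
  show ?thesis
    unfolding 1 partial_coord_mult[OF C] partial_cmult[OF bump_partial(1)] bump_partial(2)
    by (auto simp: fun_eq_iff)
qed

lemma mollifier_exists:
  assumes "e > 0" obtains g where "mollifier e g"
proof -
  let ?g = "\<lambda>x::R3. flat 0 (e\<^sup>2 - x \<bullet> x)"
  define I where "I = (LINT x|lebesgue. ?g x)"
  have t: "?g \<in> test_functions" by (rule bump_class_test_functions[OF bump_class.base assms])
  have nn: "?g x \<ge> 0" for x by (simp add: flat_def)
  have int: "integrable lebesgue ?g"
    using integrable_Cc[OF locally_integrable_const[of 1] C1c_Cc[OF test_functions_C1c[OF t]]] by simp
  \<comment> \<open>Were the integral zero, the nonnegative bump would vanish almost everywhere,
    although it is positive on an open ball, which is not negligible.\<close>
  have "I > 0"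
  proof (rule ccontr)
    assume "\<not> I > 0"
    moreover have "I \<ge> 0" unfolding I_def using nn by (intro integral_nonneg_AE) auto
    ultimately have "I = 0" by simp
    then have "AE x in lebesgue. ?g x = 0"
      using integral_nonneg_eq_0_iff_AE[OF int] nn by (auto simp: I_def)
    then have "AE x in lebesgue. x \<notin> ball (0::R3) e"
    proof eventually_elim
      case (elim x)
      show ?case
      proof
        assume "x \<in> ball 0 e"
        then have "(norm x)\<^sup>2 < e\<^sup>2" by (intro power_strict_mono) auto
        then show False using elim by (auto simp: flat_def dot_square_norm)
      qed
    qed
    then have "ball (0::R3) e \<in> null_sets lebesgue" by (subst AE_iff_null_sets) auto
    then have "negligible (ball (0::R3) e)" by (simp add: negligible_iff_null_sets)
    then show False using assms open_not_negligible[of "ball (0::R3) e"] by auto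
  qed
  have "bump_class e (\<lambda>x. inverse I * ?g x)" by (intro bump_class.intros)
  then have "(\<lambda>x. inverse I * ?g x) \<in> test_functions" "\<forall>x. norm x > e \<longrightarrow> inverse I * ?g x = 0"
    using bump_class_test_functions bump_class_zero assms by blast+
  moreover have "(LINT x|lebesgue. inverse I * ?g x) = 1" using \<open>I > 0\<close> by (simp add: I_def)
  ultimately have "mollifier e (\<lambda>x. inverse I * ?g x)"
    using nn \<open>I > 0\<close> bump_partial_commute unfolding mollifier_def by auto
  then show thesis using that by blast
qed

section \<open>Weak derivatives\<close>

text \<open>The last step of the density arguments below: \<open>K\<close> is fixed in advance and
  the tolerance \<open>d\<close> is arbitrary.\<close>

lemma eq_0_if_abs_le_all_mult:
  fixes D K :: real
  assumes "\<And>d. d > 0 \<Longrightarrow> \<bar>D\<bar> \<le> d * K" shows "D = 0"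
proof -
  have "(\<lambda>n. inverse (real (Suc n)) * K) \<longlonglongrightarrow> 0 * K"
    by (intro tendsto_intros LIMSEQ_inverse_real_of_nat)
  then have "\<bar>D\<bar> \<le> 0 * K"
    by (rule LIMSEQ_le_const) (use assms in auto)
  then show ?thesis by simp
qed

lemma conv_commute:
  assumes "u \<in> borel_measurable lebesgue" "g \<in> borel_measurable lebesgue"
  shows "conv u g x = conv g u x"
proof -
  have "(\<lambda>y. u y * g (x - y)) \<in> borel_measurable lebesgue"
    using assms(1) measurable_reflect[OF assms(2), of x] by measurable
  from lebesgue_integral_reflect[OF this, of x] show ?thesis
    by (simp add: conv_def mult.commute)
qed

lemma mollifier_mono: "mollifier e g \<Longrightarrow> e \<le> e' \<Longrightarrow> mollifier e' g"
  unfolding mollifier_def by auto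

lemma mollifier_Cc: "mollifier e g \<Longrightarrow> g \<in> Cc"
  unfolding mollifier_def by (auto intro: C1c_Cc test_functions_C1c)

lemma mollifier_integrable: "mollifier e g \<Longrightarrow> integrable lebesgue (\<lambda>y. g (x - y))"
  using conv_integrable[OF locally_integrable_const[of 1] mollifier_Cc] by simp

lemma mollifier_integral:
  assumes "mollifier e g" shows "(LINT y|lebesgue. g (x - y)) = 1"
  using lebesgue_integral_reflect[OF Cc_measurable[OF mollifier_Cc[OF assms]]] assms
  by (simp add: mollifier_def)

lemma mollify_uniform:
  assumes "p \<in> Cc" "d > 0"
  obtains e where "e > 0" "\<And>g x. mollifier e g \<Longrightarrow> \<bar>conv p g x - p x\<bar> \<le> d"
proof -
  obtain e where e: "e > 0" "\<And>x y. norm (x - y) < e \<Longrightarrow> norm (p x - p y) < d"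
    using Cc_uniformly_continuous[OF assms] by metis
  \<comment> \<open>The radius is halved because a mollifier vanishes only strictly beyond its
    radius, while the modulus of continuity requires distance less than \<open>e\<close>.\<close>
  have "\<bar>conv p g x - p x\<bar> \<le> d" if g: "mollifier (e/2) g" for g x
  proof -
    have i: "integrable lebesgue (\<lambda>y. g (x - y))" "(LINT y|lebesgue. g (x - y)) = 1"
      using mollifier_integrable[OF g] mollifier_integral[OF g] by auto
    have "conv p g x - p x = conv p g x - (LINT y|lebesgue. p x * g (x - y))" using i by simp
    also have "\<dots> = (LINT y|lebesgue. p y * g (x - y) - p x * g (x - y))"
      unfolding conv_def using conv_integrable[OF Cc_locally_integrable[OF assms(1)] mollifier_Cc[OF g]] i
      by simp
    also have "\<bar>\<dots>\<bar> \<le> (LINT y|lebesgue. \<bar>p y * g (x - y) - p x * g (x - y)\<bar>)"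
      by (rule integral_abs_bound)
    also have "\<dots> \<le> (LINT y|lebesgue. d * g (x - y))"
    proof (rule integral_mono)
      show "integrable lebesgue (\<lambda>y. \<bar>p y * g (x - y) - p x * g (x - y)\<bar>)"
        using conv_integrable[OF Cc_locally_integrable[OF assms(1)] mollifier_Cc[OF g]] i by simp
      show "integrable lebesgue (\<lambda>y. d * g (x - y))" using i by simp
      show "\<bar>p y * g (x - y) - p x * g (x - y)\<bar> \<le> d * g (x - y)" for y
      proof (cases "norm (x - y) > e / 2")
        case True then show ?thesis using g by (simp add: mollifier_def)
      next
        case False
        then have "\<bar>p y - p x\<bar> \<le> d" using e(2)[of y x] \<open>e > 0\<close> by (simp add: norm_minus_commute)
        moreover have "g (x - y) \<ge> 0" using g by (simp add: mollifier_def)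
        ultimately show ?thesis
          by (metis abs_mult abs_of_nonneg left_diff_distrib mult_right_mono)
      qed
    qed
    also have "\<dots> = d" using i by simp
    finally show ?thesis .
  qed
  then show thesis using that[of "e/2"] e(1) by auto
qed

text \<open>\<open>R\<close> is chosen before \<open>d\<close>, so that all errors live in one ball
  and \<open>abs_integral_cutoff\<close> applies with a fixed constant. Since convolution is
  commutative, the derivative may be put on \<open>p\<close> instead of the kernel, and a single
  mollifier approximates \<open>p\<close> and \<open>partial i p\<close> together.\<close>

lemma C1c_approx_test_function:
  assumes "p \<in> C1c"
  obtains R where "\<And>d. d > 0 \<Longrightarrow> \<exists>q\<in>test_functions. (\<forall>x. \<bar>q x - p x\<bar> \<le> d) \<and>
    (\<forall>x. \<bar>partial i q x - partial i p x\<bar> \<le> d) \<and>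
    (\<forall>x. norm x > R \<longrightarrow> q x - p x = 0 \<and> partial i q x - partial i p x = 0)"
proof -
  obtain R where R: "\<And>x. norm x > R \<Longrightarrow> p x = 0" "\<And>x. norm x > R \<Longrightarrow> grad p x = 0" using C1cE[OF assms] by metis
  have pR: "partial i p x = 0" if "norm x > R" for x using R(2)[OF that] by (simp add: vec_eq_iff)
  show thesis
  \<comment> \<open>Mollifiers of radius at most 1 enlarge the support by at most 1.\<close>
  proof (rule that[of "R + 1"])
    fix d :: real assume d: "d > 0"
    obtain e1 where e1: "e1 > 0" "\<And>g x. mollifier e1 g \<Longrightarrow> \<bar>conv p g x - p x\<bar> \<le> d"
      using mollify_uniform[OF C1c_Cc[OF assms] d] by metis
    obtain e2 where e2: "e2 > 0" "\<And>g x. mollifier e2 g \<Longrightarrow> \<bar>conv (partial i p) g x - partial i p x\<bar> \<le> d"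
      using mollify_uniform[OF C1c_partial_Cc[OF assms] d] by metis
    define e where "e = min 1 (min e1 e2)"
    obtain g where g: "mollifier e g" using mollifier_exists[of e] e1 e2 by (auto simp: e_def)
    have gt: "g \<in> test_functions" using g by (simp add: mollifier_def)
    have gz: "norm x > 1 \<Longrightarrow> g x = 0" for x using g by (auto simp: mollifier_def e_def)
    let ?q = "conv p g"
    have q: "?q \<in> test_functions"
      by (rule conv_test_functions[OF Cc_locally_integrable[OF C1c_Cc[OF assms]] R(1) gt])
    have m: "p \<in> borel_measurable lebesgue" "partial i p \<in> borel_measurable lebesgue" "g \<in> borel_measurable lebesgue"
      using Cc_measurable C1c_Cc C1c_partial_Cc assms mollifier_Cc[OF g] by auto
    have "?q = conv g p" using conv_commute m by blast
    then have "partial i ?q = conv g (partial i p)"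
      using conv_C1(2)[OF Cc_locally_integrable[OF mollifier_Cc[OF g]] assms] by simp
    then have pq: "partial i ?q = conv (partial i p) g" using conv_commute m by auto
    show "\<exists>q\<in>test_functions. (\<forall>x. \<bar>q x - p x\<bar> \<le> d) \<and>
      (\<forall>x. \<bar>partial i q x - partial i p x\<bar> \<le> d) \<and>
      (\<forall>x. norm x > R+1 \<longrightarrow> q x - p x = 0 \<and> partial i q x - partial i p x = 0)"
    proof (rule bexI[OF _ q], intro conjI allI impI)
      show "\<bar>?q x - p x\<bar> \<le> d" for x
        using e1(2)[OF mollifier_mono[OF g]] by (simp add: e_def)
      show "\<bar>partial i ?q x - partial i p x\<bar> \<le> d" for x
        unfolding pq using e2(2)[OF mollifier_mono[OF g]] by (simp add: e_def)
      fix x :: R3 assume x: "norm x > R + 1"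
      show "?q x - p x = 0" using conv_zero_outside[OF R(1) gz x] R(1)[of x] x by simp
      show "partial i ?q x - partial i p x = 0"
        unfolding pq using conv_zero_outside[OF pR gz x] pR[of x] x by simp
    qed
  qed
qed

text \<open>Both sides depend continuously on \<open>p\<close> and \<open>partial i p\<close> in the
  uniform norm as long as the supports stay in one ball, and \<open>C1c_approx_test_function\<close>
  provides such approximations.\<close>

lemma is_weak_partial_C1c:
  assumes w: "is_weak_partial i u v" and p: "p \<in> C1c"
  shows "(LINT x|lebesgue. u x * partial i p x) = - (LINT x|lebesgue. v x * p x)"
proof -
  have u: "locally_integrable u" and v: "locally_integrable v" using w by (auto simp: is_weak_partial_def)
  obtain R where R: "\<And>d. d > 0 \<Longrightarrow> \<exists>q\<in>test_functions. (\<forall>x. \<bar>q x - p x\<bar> \<le> d) \<and>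
    (\<forall>x. \<bar>partial i q x - partial i p x\<bar> \<le> d) \<and>
    (\<forall>x. norm x > R \<longrightarrow> q x - p x = 0 \<and> partial i q x - partial i p x = 0)"
    using C1c_approx_test_function[OF p, of i] by metis
  define K where "K = (LINT x|lebesgue. indicat_real (cball 0 R) x * \<bar>u x\<bar>) + (LINT x|lebesgue. indicat_real (cball 0 R) x * \<bar>v x\<bar>)"
  have K: "K \<ge> 0" unfolding K_def by (intro add_nonneg_nonneg integral_nonneg_AE) auto
  let ?D = "(LINT x|lebesgue. u x * partial i p x) + (LINT x|lebesgue. v x * p x)"
  have D: "\<bar>?D\<bar> \<le> d * K" if d: "d > 0" for d
  proof -
    obtain q where q: "q \<in> test_functions" "\<And>x. \<bar>q x - p x\<bar> \<le> d" "\<And>x. \<bar>partial i q x - partial i p x\<bar> \<le> d"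
      "\<And>x. norm x > R \<Longrightarrow> q x - p x = 0" "\<And>x. norm x > R \<Longrightarrow> partial i q x - partial i p x = 0"
      using R[OF d] by blast
    have qc: "q \<in> C1c" using q test_functions_C1c by blast
    have int: "integrable lebesgue (\<lambda>x. u x * partial i p x)" "integrable lebesgue (\<lambda>x. v x * p x)"
      "integrable lebesgue (\<lambda>x. u x * partial i q x)" "integrable lebesgue (\<lambda>x. v x * q x)"
      using u v by (auto intro!: integrable_Cc C1c_Cc C1c_partial_Cc p qc)
    have m: "(\<lambda>x. q x - p x) \<in> borel_measurable lebesgue" "(\<lambda>x. partial i q x - partial i p x) \<in> borel_measurable lebesgue"
      using Cc_measurable C1c_Cc C1c_partial_Cc p qc by (auto intro!: borel_measurable_diff)
    have "(LINT x|lebesgue. u x * partial i q x) + (LINT x|lebesgue. v x * q x) = 0"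
      using w q(1) by (simp add: is_weak_partial_def)
    then have "?D = - ((LINT x|lebesgue. u x * (partial i q x - partial i p x)) + (LINT x|lebesgue. v x * (q x - p x)))"
      using int by (simp add: right_diff_distrib)
    then show ?thesis
      using abs_integral_cutoff[OF u m(2) q(3) q(5), where S = R] abs_integral_cutoff[OF v m(1) q(2) q(4), where S = R]
      unfolding K_def distrib_left by linarith
  qed
  have "?D = 0" using D by (rule eq_0_if_abs_le_all_mult)
  then show ?thesis by simp
qed

lemma continuous_approx_AE:
  assumes "u \<in> borel_measurable lebesgue"
  obtains g :: "nat \<Rightarrow> R3 \<Rightarrow> real" where "\<And>n. continuous_on UNIV (g n)" "AE x in lebesgue. (\<lambda>n. g n x) \<longlonglongrightarrow> u x"
proof -
  obtain N g where N: "negligible N" and g: "\<And>n. continuous_on UNIV (g n)" "\<And>x. x \<notin> N \<Longrightarrow> (\<lambda>n. g n x) \<longlonglongrightarrow> u x"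
    using lebesgue_measurable_imp_measurable_on_real[OF assms, of UNIV]
    unfolding measurable_on_def by auto
  have "AE x in lebesgue. (\<lambda>n. g n x) \<longlonglongrightarrow> u x"
    by (rule AE_I'[of N]) (use N g(2) in \<open>auto simp: negligible_iff_null_sets\<close>)
  with g(1) that show thesis by blast
qed

definition cutc :: "nat \<Rightarrow> R3 \<Rightarrow> real" where
  "cutc n x = max 0 (min 1 (real n + 1 - norm x))"

lemma cutc_Cc: "cutc n \<in> Cc"
  unfolding Cc_def cutc_def by (auto intro!: continuous_intros exI[of _ "real n + 1"])

lemma cutc_bounds: "0 \<le> cutc n x" "cutc n x \<le> 1" "norm x \<le> real n \<Longrightarrow> cutc n x = 1"
  by (auto simp: cutc_def)

lemma Cc_mult_continuous: "p \<in> Cc \<Longrightarrow> continuous_on UNIV q \<Longrightarrow> (\<lambda>x. p x * q x :: real) \<in> Cc"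
  unfolding Cc_def by (auto intro!: continuous_intros)

lemma orthogonal_test_functions_Cc:
  assumes w: "locally_integrable w" and 0: "\<And>p. p \<in> test_functions \<Longrightarrow> (LINT x|lebesgue. w x * p x) = 0"
    and p: "p \<in> Cc"
  shows "(LINT x|lebesgue. w x * p x) = 0"
proof -
  obtain R where R: "\<And>x. norm x > R \<Longrightarrow> p x = 0" using p by (auto simp: Cc_def)
  define K where "K = (LINT x|lebesgue. indicat_real (cball 0 (R + 1)) x * \<bar>w x\<bar>)"
  have K: "K \<ge> 0" unfolding K_def by (intro integral_nonneg_AE) auto
  let ?D = "LINT x|lebesgue. w x * p x"
  have D: "\<bar>?D\<bar> \<le> d * K" if d: "d > 0" for d
  proof -
    obtain e1 where e1: "e1 > 0" "\<And>g x. mollifier e1 g \<Longrightarrow> \<bar>conv p g x - p x\<bar> \<le> d"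
      using mollify_uniform[OF p d] by metis
    obtain g where g: "mollifier (min 1 e1) g" using mollifier_exists[of "min 1 e1"] e1 by auto
    have gt: "g \<in> test_functions" using g by (simp add: mollifier_def)
    have gz: "norm x > 1 \<Longrightarrow> g x = 0" for x using g by (auto simp: mollifier_def)
    have q: "conv p g \<in> test_functions"
      by (rule conv_test_functions[OF Cc_locally_integrable[OF p] R(1) gt])
    have m: "(\<lambda>x. conv p g x - p x) \<in> borel_measurable lebesgue"
      using Cc_measurable C1c_Cc test_functions_C1c p q by (auto intro!: borel_measurable_diff)
    have "?D = - (LINT x|lebesgue. w x * (conv p g x - p x))"
      using 0[OF q] integrable_Cc[OF w] C1c_Cc test_functions_C1c p q by (simp add: right_diff_distrib)
    also have "\<bar>\<dots>\<bar> \<le> d * K"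
      unfolding K_def abs_minus_cancel
      by (rule abs_integral_cutoff[OF w m])
        (use e1(2)[OF mollifier_mono[OF g]] conv_zero_outside[OF R gz] R in auto)
    finally show ?thesis .
  qed
  show ?thesis using D by (rule eq_0_if_abs_le_all_mult)
qed

text \<open>The fundamental lemma of the calculus of variations. Testing against continuous
  approximations of \<open>sgn (w x)\<close>, clipped to \<open>[-1, 1]\<close> and multiplied by a
  cutoff, shows in the limit that the integral of \<open>\<bar>w x * cutc m x\<bar>\<close>
  vanishes; clipping provides the dominating function.\<close>

lemma orthogonal_test_functions_AE_zero:
  assumes w: "locally_integrable w" and 0: "\<And>p. p \<in> test_functions \<Longrightarrow> (LINT x|lebesgue. w x * p x) = 0"
  shows "AE x in lebesgue. w x = 0"
proof -
  have wm [measurable]: "w \<in> borel_measurable lebesgue" by (rule locally_integrable_measurable[OF w])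
  define s where "s x = sgn (w x)" for x
  have s: "s \<in> borel_measurable lebesgue" unfolding s_def by measurable
  obtain g where g: "\<And>n. continuous_on UNIV (g n)" "AE x in lebesgue. (\<lambda>n. g n x) \<longlonglongrightarrow> s x"
    by (rule continuous_approx_AE[OF s]) blast
  have "AE x in lebesgue. w x * cutc m x = 0" for m
  proof -
    have int: "integrable lebesgue (\<lambda>x. \<bar>w x * cutc m x\<bar>)"
      by (rule integrable_abs[OF integrable_Cc[OF w cutc_Cc]])
    let ?c = "\<lambda>k x. max (-1) (min 1 (g k x))"
    have c: "(\<lambda>x. cutc m x * ?c k x) \<in> Cc" for k
      by (intro Cc_mult_continuous cutc_Cc continuous_intros g)
    have "(\<lambda>k. LINT x|lebesgue. w x * (cutc m x * ?c k x)) \<longlonglongrightarrow> (LINT x|lebesgue. \<bar>w x * cutc m x\<bar>)"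
    proof (rule integral_dominated_convergence[OF _ _ int])
      show "(\<lambda>x. w x * (cutc m x * ?c k x)) \<in> borel_measurable lebesgue" for k
        using Cc_measurable[OF c[of k]] by measurable
      show "AE x in lebesgue. (\<lambda>k. w x * (cutc m x * ?c k x)) \<longlonglongrightarrow> \<bar>w x * cutc m x\<bar>"
        using g(2)
      proof eventually_elim
        case (elim x)
        have "(\<lambda>k. w x * (cutc m x * ?c k x)) \<longlonglongrightarrow> w x * (cutc m x * max (-1) (min 1 (s x)))"
          by (intro tendsto_intros elim)
        also have "w x * (cutc m x * max (-1) (min 1 (s x))) = \<bar>w x * cutc m x\<bar>"
          using cutc_bounds(1)[of m x] by (auto simp: s_def sgn_if abs_mult)
        finally show ?case .
      qed
      have "\<bar>?c k x\<bar> \<le> 1" for k x by (auto simp: abs_le_iff)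
      then have "\<bar>w x * cutc m x\<bar> * \<bar>?c k x\<bar> \<le> \<bar>w x * cutc m x\<bar>" for k x
        by (intro mult_right_le_one_le) auto
      then show "AE x in lebesgue. norm (w x * (cutc m x * ?c k x)) \<le> \<bar>w x * cutc m x\<bar>" for k
        by (auto simp: abs_mult mult.assoc)
    qed (use borel_measurable_integrable[OF int] in simp)
    moreover have "(LINT x|lebesgue. w x * (cutc m x * ?c k x)) = 0" for k
      by (rule orthogonal_test_functions_Cc[OF w 0 c])
    ultimately have "(\<lambda>k::nat. 0) \<longlonglongrightarrow> (LINT x|lebesgue. \<bar>w x * cutc m x\<bar>)" by simp
    then have "(LINT x|lebesgue. \<bar>w x * cutc m x\<bar>) = 0"
      using LIMSEQ_unique[OF tendsto_const] by metis
    then have "AE x in lebesgue. \<bar>w x * cutc m x\<bar> = 0"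
      using integral_nonneg_eq_0_iff_AE[OF int] by auto
    then show ?thesis by simp
  qed
  then have "AE x in lebesgue. \<forall>m. w x * cutc m x = 0" by (subst AE_all_countable) blast
  then show ?thesis
  proof eventually_elim
    case (elim x)
    obtain N where "norm x \<le> real N" using real_arch_simple by blast
    then show ?case using elim cutc_bounds(3)[of x N] by (metis mult.right_neutral)
  qed
qed

lemma is_weak_partial_unique:
  assumes "is_weak_partial i u v" "is_weak_partial i u v'"
  shows "AE x in lebesgue. v x = v' x"
proof -
  have v: "locally_integrable v" "locally_integrable v'" using assms by (auto simp: is_weak_partial_def)
  have "locally_integrable (\<lambda>x. v x - v' x)"
    using v unfolding locally_integrable_def by (auto intro: set_integral_diff)
  moreover have "(LINT x|lebesgue. (v x - v' x) * p x) = 0" if "p \<in> test_functions" for p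
    using assms that v integrable_Cc[OF _ C1c_Cc[OF test_functions_C1c[OF that]]]
    by (simp add: is_weak_partial_def left_diff_distrib)
  ultimately have "AE x in lebesgue. v x - v' x = 0" by (rule orthogonal_test_functions_AE_zero)
  then show ?thesis by simp
qed

lemma measurable_lebesgue_cong_AE:
  assumes "u \<in> borel_measurable lebesgue" "AE x in lebesgue. u x = v x"
  shows "(v :: R3 \<Rightarrow> real) \<in> borel_measurable lebesgue"
proof (rule measurableI)
  fix A :: "real set" assume A: "A \<in> sets borel"
  have "u -` A \<inter> space lebesgue \<in> sets lebesgue" using assms(1) A by (rule measurable_sets)
  then show "v -` A \<inter> space lebesgue \<in> sets lebesgue"
    by (rule completion.in_sets_AE[rotated]) (use assms(2) in auto)
qed auto

lemma locally_integrable_cong_AE: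
  assumes "locally_integrable u" "AE x in lebesgue. u x = v x"
  shows "locally_integrable v"
proof (rule locally_integrable_bound[where g="\<lambda>x. \<bar>u x\<bar>"])
  show "v \<in> borel_measurable lebesgue"
    by (rule measurable_lebesgue_cong_AE[OF locally_integrable_measurable[OF assms(1)] assms(2)])
  show "integrable lebesgue (\<lambda>x. indicat_real (cball 0 R) x * \<bar>u x\<bar>)" for R
    using integrable_abs[OF locally_integrable_cball[OF assms(1), of 0 R]] by (simp add: abs_mult)
  show "AE x in lebesgue. \<bar>v x\<bar> \<le> \<bar>u x\<bar>" using assms(2) by eventually_elim auto
qed

lemma is_weak_partial_cong:
  assumes "is_weak_partial i u v" "AE x in lebesgue. u x = u' x" "AE x in lebesgue. v x = v' x"
  shows "is_weak_partial i u' v'"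
proof -
  have l: "locally_integrable u'" "locally_integrable v'"
    using assms locally_integrable_cong_AE by (auto simp: is_weak_partial_def)
  have "(LINT x|lebesgue. u' x * partial i p x) = - (LINT x|lebesgue. v' x * p x)" if p: "p \<in> test_functions" for p
  proof -
    have [measurable]: "p \<in> borel_measurable lebesgue" "partial i p \<in> borel_measurable lebesgue"
      using Cc_measurable C1c_Cc C1c_partial_Cc test_functions_C1c[OF p] by auto
    have [measurable]: "u \<in> borel_measurable lebesgue" "u' \<in> borel_measurable lebesgue"
       "v \<in> borel_measurable lebesgue" "v' \<in> borel_measurable lebesgue"
      using l assms locally_integrable_measurable by (auto simp: is_weak_partial_def)
    have "(LINT x|lebesgue. u' x * partial i p x) = (LINT x|lebesgue. u x * partial i p x)"
      by (rule integral_cong_AE; measurable?) (use assms(2) in auto)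
    moreover have "(LINT x|lebesgue. v' x * p x) = (LINT x|lebesgue. v x * p x)"
      by (rule integral_cong_AE; measurable?) (use assms(3) in auto)
    ultimately show ?thesis using assms(1) p by (simp add: is_weak_partial_def)
  qed
  then show ?thesis using l by (simp add: is_weak_partial_def)
qed

lemma locally_integrable_add:
  "locally_integrable u \<Longrightarrow> locally_integrable v \<Longrightarrow> locally_integrable (\<lambda>x. u x + v x)"
  unfolding locally_integrable_def by (auto intro: set_integral_add)

lemma locally_integrable_cmult:
  "locally_integrable u \<Longrightarrow> locally_integrable (\<lambda>x. c * u x)"
  unfolding locally_integrable_def by auto

lemma is_weak_partial_add:
  assumes "is_weak_partial i u v" "is_weak_partial i u' v'"
  shows "is_weak_partial i (\<lambda>x. u x + u' x) (\<lambda>x. v x + v' x)"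
  using assms integrable_Cc C1c_Cc[OF test_functions_C1c] C1c_partial_Cc[OF test_functions_C1c]
  unfolding is_weak_partial_def by (auto simp: locally_integrable_add distrib_right)

lemma is_weak_partial_cmult:
  assumes "is_weak_partial i u v"
  shows "is_weak_partial i (\<lambda>x. c * u x) (\<lambda>x. c * v x)"
  using assms unfolding is_weak_partial_def by (auto simp: locally_integrable_cmult mult.assoc)

lemma locally_integrable_mult_continuous:
  assumes u: "locally_integrable u" and m: "continuous_on UNIV m"
  shows "locally_integrable (\<lambda>x. m x * u x)"
proof (rule locally_integrable_bound[where g="\<lambda>x. \<bar>m x * u x\<bar>"])
  show "(\<lambda>x. m x * u x) \<in> borel_measurable lebesgue"
    using continuous_measurable_lebesgue[OF m] locally_integrable_measurable[OF u] by measurable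
  show "integrable lebesgue (\<lambda>x. indicat_real (cball 0 R) x * \<bar>m x * u x\<bar>)" for R
  proof -
    obtain N where N: "R \<le> real N" using real_arch_simple by blast
    have "integrable lebesgue (\<lambda>x. indicat_real (cball 0 R) x *\<^sub>R (u x * (cutc N x * m x)))"
      by (intro integrable_mult_indicator integrable_Cc u Cc_mult_continuous cutc_Cc m) auto
    also have "(\<lambda>x. indicat_real (cball 0 R) x *\<^sub>R (u x * (cutc N x * m x))) = (\<lambda>x. indicat_real (cball 0 R) x * (m x * u x))"
      using N cutc_bounds(3)[of _ N] by (auto simp: indicator_def fun_eq_iff)
    finally have "integrable lebesgue (\<lambda>x. indicat_real (cball 0 R) x * (m x * u x))" .
    from integrable_abs[OF this] show ?thesis by (simp add: abs_mult)
  qed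
qed auto

text \<open>The Leibniz rule comes from testing with \<open>m * p\<close>. This product has in
  general one continuous derivative only, which is why the identity is required for all of
  \<open>C1c\<close>.\<close>

lemma is_weak_partial_mult_C1:
  assumes w: "is_weak_partial i u v" and m: "m \<in> C1"
  shows "is_weak_partial i (\<lambda>x. m x * u x) (\<lambda>x. m x * v x + partial i m x * u x)"
  unfolding is_weak_partial_def
proof (intro conjI ballI)
  have u: "locally_integrable u" and v: "locally_integrable v" using w by (auto simp: is_weak_partial_def)
  show "locally_integrable (\<lambda>x. m x * u x)" "locally_integrable (\<lambda>x. m x * v x + partial i m x * u x)"
    by (intro locally_integrable_add locally_integrable_mult_continuous u v C1_continuous C1_continuous_partial m)+
  fix p assume "p \<in> test_functions"
  then have p: "p \<in> C1c" by (rule test_functions_C1c)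
  have mp: "partial i (\<lambda>x. m x * p x) x = m x * partial i p x + p x * partial i m x" for x
    using fun_cong[OF C1_mult(2)[OF m C1cD[OF p]], of x] by (simp add: vec_eq_iff)
  have w': "(LINT x|lebesgue. u x * partial i (\<lambda>x. m x * p x) x) = - (LINT x|lebesgue. v x * (m x * p x))"
    by (rule is_weak_partial_C1c[OF w C1c_mult[OF m p]])
  have i: "integrable lebesgue (\<lambda>x. u x * partial i (\<lambda>x. m x * p x) x)"
     "integrable lebesgue (\<lambda>x. u x * (p x * partial i m x))" "integrable lebesgue (\<lambda>x. v x * (m x * p x))"
    by (intro integrable_Cc u v Cc_mult_continuous C1_continuous_partial C1c_Cc C1c_partial_Cc m p C1c_mult)+
  have "(LINT x|lebesgue. m x * u x * partial i p x) =
      (LINT x|lebesgue. u x * partial i (\<lambda>x. m x * p x) x - u x * (p x * partial i m x))"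
    by (rule Bochner_Integration.integral_cong) (simp_all add: mp algebra_simps)
  also have "\<dots> = (LINT x|lebesgue. u x * partial i (\<lambda>x. m x * p x) x) - (LINT x|lebesgue. u x * (p x * partial i m x))"
    by (rule Bochner_Integration.integral_diff[OF i(1,2)])
  also have "\<dots> = - ((LINT x|lebesgue. v x * (m x * p x)) + (LINT x|lebesgue. u x * (p x * partial i m x)))"
    using w' by simp
  also have "\<dots> = - (LINT x|lebesgue. v x * (m x * p x) + u x * (p x * partial i m x))"
    by (subst Bochner_Integration.integral_add[OF i(3,2)]) simp
  also have "(LINT x|lebesgue. v x * (m x * p x) + u x * (p x * partial i m x)) =
      (LINT x|lebesgue. (m x * v x + partial i m x * u x) * p x)"
    by (rule Bochner_Integration.integral_cong) (simp_all add: algebra_simps)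
  finally show "(LINT x|lebesgue. m x * u x * partial i p x) = - (LINT x|lebesgue. (m x * v x + partial i m x * u x) * p x)" .
qed

text \<open>A difference quotient of \<open>p\<close> has integral zero by translation invariance,
  and its distance from the derivative is the Taylor remainder, uniformly small on a fixed
  ball.\<close>

lemma integral_partial_C1c:
  assumes p: "p \<in> C1c" shows "(LINT x|lebesgue. partial i p x) = 0"
proof -
  obtain R where R: "\<And>x. norm x > R \<Longrightarrow> p x = 0" "\<And>x. norm x > R \<Longrightarrow> grad p x = 0" using C1cE[OF p] by metis
  have pm: "p \<in> borel_measurable lebesgue" and dm [measurable]: "partial i p \<in> borel_measurable lebesgue"
    using Cc_measurable C1c_Cc C1c_partial_Cc p by auto
  define K where "K = (LINT x|lebesgue. indicat_real (cball (0::R3) (R+1)) x)"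
  have K: "K \<ge> 0" unfolding K_def by (intro integral_nonneg_AE) auto
  let ?I = "LINT x|lebesgue. partial i p x"
  have D: "\<bar>?I\<bar> \<le> e * K" if e: "e > 0" for e
  proof -
    obtain d where d: "d > 0" "\<And>a h. norm h < d \<Longrightarrow> \<bar>p (a + h) - p a - grad p a \<bullet> h\<bar> \<le> e * norm h"
      using C1c_uniform_taylor[OF p e] by metis
    define t where "t = min d 1 / 2"
    have t: "0 < t" "t < d" "t < 1" using d by (auto simp: t_def)
    let ?h = "t *\<^sub>R axis i 1 :: R3"
    have nh: "norm ?h = t" using t by simp
    have int: "integrable lebesgue p" "integrable lebesgue (partial i p)"
      using integrable_Cc[OF locally_integrable_const[of 1]] C1c_Cc C1c_partial_Cc p by auto
    have tr: "(LINT x|lebesgue. p (x + ?h)) = (LINT x|lebesgue. p x)"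
      by (rule lebesgue_integral_translate[OF pm])
    have "(\<lambda>x. p (x - (- ?h))) \<in> Cc"
      using Cc_reflect[OF Cc_reflect[OF C1c_Cc[OF p], of 0], of "- ?h"] by (simp add: add.commute)
    then have Ch: "(\<lambda>x. p (x + ?h)) \<in> Cc" by simp
    have int2: "integrable lebesgue (\<lambda>x. p (x + ?h))"
      using integrable_Cc[OF locally_integrable_const[of 1] Ch] by simp
    have "t * ?I = - (LINT x|lebesgue. 1 * (p (x + ?h) - p x - grad p x \<bullet> ?h))"
      using int int2 tr by (simp add: inner_axis)
    also have "\<bar>\<dots>\<bar> \<le> (e * t) * (LINT x|lebesgue. indicat_real (cball (0::R3) (R+1)) x * \<bar>1\<bar>)"
      unfolding abs_minus_cancel
    proof (rule abs_integral_cutoff[OF locally_integrable_const])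
      show "(\<lambda>x. p (x + ?h) - p x - grad p x \<bullet> ?h) \<in> borel_measurable lebesgue"
        using Cc_measurable[OF Ch] pm by (simp add: inner_axis)
      show "\<bar>p (x + ?h) - p x - grad p x \<bullet> ?h\<bar> \<le> e * t" for x
        using d(2)[of ?h x] nh t by simp
      show "p (x + ?h) - p x - grad p x \<bullet> ?h = 0" if "norm x > R + 1" for x
        using R(1)[of "x + ?h"] R(1)[of x] R(2)[of x] that nh t norm_triangle_ineq4[of "x + ?h" ?h] by simp
    qed
    finally have "t * \<bar>?I\<bar> \<le> t * (e * K)" using t by (simp add: abs_mult K_def algebra_simps)
    then show ?thesis using t by simp
  qed
  show ?thesis using D by (rule eq_0_if_abs_le_all_mult)
qed

text \<open>The case \<open>m = 1\<close> is \<open>integral_partial_C1c\<close>; the Leibniz rule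
  multiplies it by \<open>m\<close>.\<close>

lemma is_weak_partial_C1:
  assumes m: "m \<in> C1" shows "is_weak_partial i m (partial i m)"
proof -
  have "is_weak_partial i (\<lambda>x. 1) (\<lambda>x. 0)"
    unfolding is_weak_partial_def
    using locally_integrable_const integral_partial_C1c test_functions_C1c by auto
  from is_weak_partial_mult_C1[OF this m] show ?thesis by simp
qed

section \<open>\<open>L\<^sup>2\<close> and \<open>H\<^sup>1\<close>\<close>

lemma L2_measurable: "u \<in> L2 \<Longrightarrow> u \<in> borel_measurable lebesgue" by (simp add: L2_def)
lemma L2_square: "u \<in> L2 \<Longrightarrow> integrable lebesgue (\<lambda>x. (u x)\<^sup>2)" by (simp add: L2_def)

lemma L2_bound:
  assumes "v \<in> borel_measurable lebesgue" "integrable lebesgue g" "AE x in lebesgue. (v x)\<^sup>2 \<le> g x"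
  shows "v \<in> L2"
proof -
  have "integrable lebesgue (\<lambda>x. (v x)\<^sup>2)"
    by (rule Bochner_Integration.integrable_bound[OF assms(2)]) (use assms in auto)
  then show ?thesis using assms(1) by (simp add: L2_def)
qed

lemma L2_add:
  assumes "u \<in> L2" "v \<in> L2" shows "(\<lambda>x. u x + v x) \<in> L2"
proof (rule L2_bound)
  show "(\<lambda>x. u x + v x) \<in> borel_measurable lebesgue" using assms L2_measurable by measurable
  show "integrable lebesgue (\<lambda>x. 2 * (u x)\<^sup>2 + 2 * (v x)\<^sup>2)" using assms L2_square by simp
  have "(u x + v x)\<^sup>2 \<le> 2 * (u x)\<^sup>2 + 2 * (v x)\<^sup>2" for x
    using zero_le_power2[of "u x - v x"] by (simp add: power2_eq_square algebra_simps)
  then show "AE x in lebesgue. (u x + v x)\<^sup>2 \<le> 2 * (u x)\<^sup>2 + 2 * (v x)\<^sup>2" by simp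
qed

lemma L2_cmult: "u \<in> L2 \<Longrightarrow> (\<lambda>x. c * u x) \<in> L2"
  by (auto simp: L2_def power_mult_distrib)

lemma L2_minus: "u \<in> L2 \<Longrightarrow> (\<lambda>x. - u x) \<in> L2"
  using L2_cmult[of u "-1"] by simp

lemma L2_diff: "u \<in> L2 \<Longrightarrow> v \<in> L2 \<Longrightarrow> (\<lambda>x. u x - v x) \<in> L2"
  using L2_add[OF _ L2_minus, of u v] by simp

lemma L2_abs: "u \<in> L2 \<Longrightarrow> (\<lambda>x. \<bar>u x\<bar>) \<in> L2"
  by (auto simp: L2_def)

lemma L2_cong_AE:
  assumes "u \<in> L2" "AE x in lebesgue. u x = v x" shows "v \<in> L2"
proof (rule L2_bound[OF measurable_lebesgue_cong_AE[OF L2_measurable[OF assms(1)] assms(2)] L2_square[OF assms(1)]])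
  show "AE x in lebesgue. (v x)\<^sup>2 \<le> (u x)\<^sup>2" using assms(2) by eventually_elim simp
qed

lemma L2_mono:
  assumes "u \<in> L2" "v \<in> borel_measurable lebesgue" "AE x in lebesgue. \<bar>v x\<bar> \<le> \<bar>u x\<bar>"
  shows "v \<in> L2"
proof (rule L2_bound[OF assms(2) L2_square[OF assms(1)]])
  show "AE x in lebesgue. (v x)\<^sup>2 \<le> (u x)\<^sup>2" using assms(3) by eventually_elim (simp add: abs_le_square_iff)
qed

lemma L2_mult_integrable:
  assumes "u \<in> L2" "v \<in> L2" shows "integrable lebesgue (\<lambda>x. u x * v x)"
proof (rule Bochner_Integration.integrable_bound)
  show "integrable lebesgue (\<lambda>x. (u x)\<^sup>2 + (v x)\<^sup>2)" using assms L2_square by simp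
  show "(\<lambda>x. u x * v x) \<in> borel_measurable lebesgue" using assms L2_measurable by measurable
  have "2 * \<bar>u x * v x\<bar> \<le> (u x)\<^sup>2 + (v x)\<^sup>2" for x
    using zero_le_power2[of "\<bar>u x\<bar> - \<bar>v x\<bar>"] by (simp add: power2_eq_square abs_mult algebra_simps)
  then have "\<bar>u x * v x\<bar> \<le> (u x)\<^sup>2 + (v x)\<^sup>2" for x
    by (smt (verit, ccfv_SIG) abs_ge_zero)
  then show "AE x in lebesgue. norm (u x * v x) \<le> norm ((u x)\<^sup>2 + (v x)\<^sup>2)" by simp
qed

lemma L2_bounded_mult:
  assumes "u \<in> L2" "p \<in> borel_measurable lebesgue" "\<And>x. \<bar>p x\<bar> \<le> B"
  shows "(\<lambda>x. p x * u x) \<in> L2"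
proof (rule L2_mono[OF L2_cmult[OF assms(1), of B]])
  show "(\<lambda>x. p x * u x) \<in> borel_measurable lebesgue" using assms L2_measurable by measurable
  show "AE x in lebesgue. \<bar>p x * u x\<bar> \<le> \<bar>B * u x\<bar>"
    using assms(3) by (intro AE_I2) (metis abs_ge_zero abs_le_D1 abs_mult abs_of_nonneg dual_order.trans mult_right_mono)
qed

lemma Cc_L2: assumes "p \<in> Cc" shows "p \<in> L2"
proof -
  have "continuous_on UNIV p" using assms by (simp add: Cc_def)
  then have "(\<lambda>x. p x * p x) \<in> Cc" by (rule Cc_mult_continuous[OF assms])
  then have "integrable lebesgue (\<lambda>x. p x * p x)"
    using integrable_Cc[OF locally_integrable_const[of 1]] by force
  then show ?thesis using Cc_measurable[OF assms] by (simp add: L2_def power2_eq_square)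
qed

lemma L2_Cauchy_Schwarz:
  assumes "u \<in> L2" "v \<in> L2"
  shows "(LINT x|lebesgue. \<bar>u x * v x\<bar>)\<^sup>2 \<le> (LINT x|lebesgue. (u x)\<^sup>2) * (LINT x|lebesgue. (v x)\<^sup>2)"
proof -
  have [measurable]: "u \<in> borel_measurable lebesgue" "v \<in> borel_measurable lebesgue"
    using assms L2_measurable by auto
  have e: "ennreal (LINT x|lebesgue. \<bar>u x * v x\<bar>) = (\<integral>\<^sup>+x. ennreal \<bar>u x\<bar> * ennreal \<bar>v x\<bar> \<partial>lebesgue)"
    using nn_integral_eq_integral[OF integrable_abs[OF L2_mult_integrable[OF assms]]]
    by (simp add: abs_mult ennreal_mult)
  have "(\<integral>\<^sup>+x. ennreal \<bar>u x\<bar> * ennreal \<bar>v x\<bar> \<partial>lebesgue)\<^sup>2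
      \<le> (\<integral>\<^sup>+x. ennreal \<bar>u x\<bar> ^ 2 \<partial>lebesgue) * (\<integral>\<^sup>+x. ennreal \<bar>v x\<bar> ^ 2 \<partial>lebesgue)"
    by (rule Cauchy_Schwarz_nn_integral) measurable
  also have "\<dots> = ennreal ((LINT x|lebesgue. (u x)\<^sup>2) * (LINT x|lebesgue. (v x)\<^sup>2))"
    using nn_integral_eq_integral[OF L2_square[OF assms(1)]] nn_integral_eq_integral[OF L2_square[OF assms(2)]]
    by (simp add: ennreal_power ennreal_mult)
  finally show ?thesis
    unfolding e[symmetric] by (simp add: ennreal_power)
qed

lemma H1_iff: "u \<in> H1 \<longleftrightarrow> u \<in> L2 \<and> (\<forall>i. \<exists>v\<in>L2. is_weak_partial i u v)"
  by (simp add: H1_def)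

lemma weak_partial_AE:
  assumes "is_weak_partial i u v" shows "AE x in lebesgue. weak_partial i u x = v x"
  unfolding weak_partial_def by (rule is_weak_partial_unique[OF someI[of "is_weak_partial i u", OF assms] assms])

lemma is_weak_partial_weak_partial: "is_weak_partial i u v \<Longrightarrow> is_weak_partial i u (weak_partial i u)"
  unfolding weak_partial_def by (rule someI[of "is_weak_partial i u"])

lemma H1_L2: "u \<in> H1 \<Longrightarrow> u \<in> L2" by (simp add: H1_def)

lemma H1_is_weak_partial: "u \<in> H1 \<Longrightarrow> is_weak_partial i u (weak_partial i u)"
  unfolding H1_iff using is_weak_partial_weak_partial by blast

lemma H1_weak_partial_L2:
  assumes "u \<in> H1" shows "weak_partial i u \<in> L2"
proof -
  obtain v where v: "v \<in> L2" "is_weak_partial i u v" using assms by (auto simp: H1_iff)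
  have "AE x in lebesgue. v x = weak_partial i u x" using weak_partial_AE[OF v(2)] by eventually_elim simp
  then show ?thesis by (rule L2_cong_AE[OF v(1)])
qed

text \<open>Equality holds everywhere: the two predicates under the choice operator coincide, so the
  chosen functions do.\<close>

lemma weak_partial_cong:
  assumes "AE x in lebesgue. u x = u' x" shows "weak_partial i u = weak_partial i u'"
proof -
  have "AE x in lebesgue. u' x = u x" using assms by eventually_elim simp
  then have "is_weak_partial i u v \<longleftrightarrow> is_weak_partial i u' v" for v
    using is_weak_partial_cong assms by blast
  then show ?thesis by (simp add: weak_partial_def)
qed

lemma H1_cong_AE:
  assumes "u \<in> H1" "AE x in lebesgue. u x = u' x" shows "u' \<in> H1"
  unfolding H1_iff
  using assms L2_cong_AE[OF H1_L2] is_weak_partial_cong[OF H1_is_weak_partial[OF assms(1)] assms(2)]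
    H1_weak_partial_L2[OF assms(1)] by blast

lemma H1_add:
  assumes "u \<in> H1" "v \<in> H1"
  shows "(\<lambda>x. u x + v x) \<in> H1"
    "AE x in lebesgue. weak_partial i (\<lambda>x. u x + v x) x = weak_partial i u x + weak_partial i v x"
proof -
  have *: "is_weak_partial i (\<lambda>x. u x + v x) (\<lambda>x. weak_partial i u x + weak_partial i v x)" for i
    by (intro is_weak_partial_add H1_is_weak_partial assms)
  show "(\<lambda>x. u x + v x) \<in> H1"
    unfolding H1_iff using * L2_add[OF H1_weak_partial_L2[OF assms(1)] H1_weak_partial_L2[OF assms(2)]]
      L2_add[OF H1_L2[OF assms(1)] H1_L2[OF assms(2)]] by blast
  show "AE x in lebesgue. weak_partial i (\<lambda>x. u x + v x) x = weak_partial i u x + weak_partial i v x"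
    by (rule weak_partial_AE[OF *])
qed

lemma H1_cmult:
  assumes "u \<in> H1"
  shows "(\<lambda>x. c * u x) \<in> H1" "AE x in lebesgue. weak_partial i (\<lambda>x. c * u x) x = c * weak_partial i u x"
proof -
  have *: "is_weak_partial i (\<lambda>x. c * u x) (\<lambda>x. c * weak_partial i u x)" for i
    by (intro is_weak_partial_cmult H1_is_weak_partial assms)
  show "(\<lambda>x. c * u x) \<in> H1"
    unfolding H1_iff using * L2_cmult[OF H1_weak_partial_L2[OF assms]] L2_cmult[OF H1_L2[OF assms]] by blast
  show "AE x in lebesgue. weak_partial i (\<lambda>x. c * u x) x = c * weak_partial i u x"
    by (rule weak_partial_AE[OF *])
qed

lemma C1c_H1:
  assumes "p \<in> C1c"
  shows "p \<in> H1" "AE x in lebesgue. weak_partial i p x = partial i p x"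
proof -
  have *: "is_weak_partial i p (partial i p)" for i by (rule is_weak_partial_C1[OF C1cD[OF assms]])
  show "p \<in> H1" unfolding H1_iff using * Cc_L2 C1c_Cc[OF assms] C1c_partial_Cc[OF assms] by blast
  show "AE x in lebesgue. weak_partial i p x = partial i p x" by (rule weak_partial_AE[OF *])
qed

text \<open>Dominated convergence against each fixed test function, so majorants that are only
  locally integrable suffice. This carries product rules from the regularised \<open>kap\<close> to
  \<open>1 / radius\<close>.\<close>

lemma is_weak_partial_limit:
  assumes w: "\<And>n::nat. is_weak_partial i (u n) (v n)"
    and u: "AE x in lebesgue. (\<lambda>n. u n x) \<longlonglongrightarrow> u' x" "\<And>n. AE x in lebesgue. \<bar>u n x\<bar> \<le> U x" "locally_integrable U"
    and v: "AE x in lebesgue. (\<lambda>n. v n x) \<longlonglongrightarrow> v' x" "\<And>n. AE x in lebesgue. \<bar>v n x\<bar> \<le> W x" "locally_integrable W"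
    and m: "u' \<in> borel_measurable lebesgue" "v' \<in> borel_measurable lebesgue"
  shows "is_weak_partial i u' v'"
proof -
  have lim: "locally_integrable z' \<and> (\<forall>p\<in>Cc. (\<lambda>n. LINT x|lebesgue. z n x * p x) \<longlonglongrightarrow> (LINT x|lebesgue. z' x * p x))"
    if z: "AE x in lebesgue. (\<lambda>n. z n x) \<longlonglongrightarrow> z' x" "\<And>n. AE x in lebesgue. \<bar>z n x\<bar> \<le> Z x" "locally_integrable Z"
      "z' \<in> borel_measurable lebesgue" "\<And>n. z n \<in> borel_measurable lebesgue"
    for z :: "nat \<Rightarrow> R3 \<Rightarrow> real" and z' Z
  proof
    have ae: "AE x in lebesgue. \<forall>n. \<bar>z n x\<bar> \<le> Z x" using z(2) by (subst AE_all_countable) blast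
    have "AE x in lebesgue. \<bar>z' x\<bar> \<le> Z x"
      using ae z(1)
    proof eventually_elim
      case (elim x)
      then show ?case by (intro LIMSEQ_le_const2[OF tendsto_rabs]) auto
    qed
    then show "locally_integrable z'"
      by (rule locally_integrable_bound[OF z(4) locally_integrable_cball[OF z(3)]])
    show "\<forall>p\<in>Cc. (\<lambda>n. LINT x|lebesgue. z n x * p x) \<longlonglongrightarrow> (LINT x|lebesgue. z' x * p x)"
    proof
      fix p :: "R3 \<Rightarrow> real" assume p: "p \<in> Cc"
      have [measurable]: "p \<in> borel_measurable lebesgue" by (rule Cc_measurable[OF p])
      note [measurable] = z(4,5)
      have "integrable lebesgue (\<lambda>x. Z x * \<bar>p x\<bar>)"
      proof (rule integrable_Cc[OF z(3)])
        show "(\<lambda>x. \<bar>p x\<bar>) \<in> Cc" using p by (auto simp: Cc_def intro!: continuous_intros)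
      qed
      then show "(\<lambda>n. LINT x|lebesgue. z n x * p x) \<longlonglongrightarrow> (LINT x|lebesgue. z' x * p x)"
      proof (rule integral_dominated_convergence[rotated 2])
        show "AE x in lebesgue. (\<lambda>n. z n x * p x) \<longlonglongrightarrow> z' x * p x"
          using z(1) by eventually_elim (intro tendsto_intros)
        show "AE x in lebesgue. norm (z n x * p x) \<le> Z x * \<bar>p x\<bar>" for n
          using z(2)[of n] by eventually_elim (auto simp: abs_mult intro: mult_right_mono)
      qed measurable
    qed
  qed
  have mn: "u n \<in> borel_measurable lebesgue" "v n \<in> borel_measurable lebesgue" for n
    using w[of n] locally_integrable_measurable by (auto simp: is_weak_partial_def)
  note U = lim[OF u m(1) mn(1)] and V = lim[OF v m(2) mn(2)]
  have "(LINT x|lebesgue. u' x * partial i p x) = - (LINT x|lebesgue. v' x * p x)" if p: "p \<in> test_functions" for p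
  proof -
    have c: "p \<in> Cc" "partial i p \<in> Cc" using C1c_Cc C1c_partial_Cc test_functions_C1c[OF p] by auto
    have "(\<lambda>n. LINT x|lebesgue. u n x * partial i p x) \<longlonglongrightarrow> (LINT x|lebesgue. u' x * partial i p x)"
      using U c by blast
    moreover have "(\<lambda>n. - (LINT x|lebesgue. v n x * p x)) \<longlonglongrightarrow> - (LINT x|lebesgue. v' x * p x)"
      using V c by (intro tendsto_minus) blast
    moreover have "(LINT x|lebesgue. u n x * partial i p x) = - (LINT x|lebesgue. v n x * p x)" for n
      using w p by (simp add: is_weak_partial_def)
    ultimately show ?thesis using LIMSEQ_unique by simp blast
  qed
  then show ?thesis using U V by (simp add: is_weak_partial_def)
qed

section \<open>Mollification in the L^2 norm\<close>

lemma conv_square_le: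
  assumes v: "v \<in> L2" and g: "mollifier e g"
  shows "(conv v g x)\<^sup>2 \<le> (LINT y|lebesgue. (v y)\<^sup>2 * g (x - y))"
proof -
  let ?m = "conv v g x"
  have vl: "locally_integrable v" by (rule L2_locally_integrable[OF v])
  have v2: "locally_integrable (\<lambda>x. (v x)\<^sup>2)"
    unfolding locally_integrable_def set_integrable_def
    using integrable_mult_indicator[OF _ L2_square[OF v]] by (simp add: borel_compact)
  have i: "integrable lebesgue (\<lambda>y. v y * g (x - y))" "integrable lebesgue (\<lambda>y. (v y)\<^sup>2 * g (x - y))"
    "integrable lebesgue (\<lambda>y. g (x - y))" "(LINT y|lebesgue. g (x - y)) = 1"
    using conv_integrable[OF vl mollifier_Cc[OF g]] conv_integrable[OF v2 mollifier_Cc[OF g]]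
      mollifier_integrable[OF g] mollifier_integral[OF g] by auto
  \<comment> \<open>Jensen's inequality as the nonnegativity of a variance: \<open>g (x - y)\<close>
    is a probability density in \<open>y\<close>, and \<open>?m\<close> is the mean of
    \<open>v\<close> under it.\<close>
  have "0 \<le> (LINT y|lebesgue. (v y - ?m)\<^sup>2 * g (x - y))"
    using g by (intro integral_nonneg_AE) (auto simp: mollifier_def)
  also have "\<dots> = (LINT y|lebesgue. ((v y)\<^sup>2 * g (x - y) - (2 * ?m) * (v y * g (x - y))) + ?m\<^sup>2 * g (x - y))"
    by (rule Bochner_Integration.integral_cong) (auto simp: power2_eq_square algebra_simps)
  also have "\<dots> = (LINT y|lebesgue. (v y)\<^sup>2 * g (x - y)) - 2 * ?m * (LINT y|lebesgue. v y * g (x - y)) + ?m\<^sup>2"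
    using i by simp
  finally show ?thesis by (simp add: conv_def[symmetric] power2_eq_square)
qed

text \<open>After Jensen's inequality the order of integration is exchanged, and the kernel has unit
  mass in \<open>x\<close> as well as in \<open>y\<close>.\<close>

lemma nn_integral_conv_square_le:
  assumes v: "v \<in> L2" and g: "mollifier e g"
  shows "(\<integral>\<^sup>+x. (conv v g x)\<^sup>2 \<partial>lebesgue) \<le> (\<integral>\<^sup>+x. (v x)\<^sup>2 \<partial>lebesgue)"
proof -
  \<comment> \<open>Tonelli's theorem is applied to the product of the Borel measures, hence the
    Borel representative \<open>v'\<close>; the convolution does not see the change.\<close>
  obtain v' where v' [measurable]: "v' \<in> borel_measurable lborel" and ae: "AE x in lborel. v x = v' x"
    using completion_ex_borel_measurable_real[OF L2_measurable[OF v]] by blast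
  have aeL: "AE x in lebesgue. v x = v' x" using AE_completion[OF ae] .
  have v'2: "v' \<in> L2" by (rule L2_cong_AE[OF v aeL])
  have gm: "g \<in> borel_measurable borel"
    using mollifier_Cc[OF g] by (auto simp: Cc_def intro: borel_measurable_continuous_onI)
  have gn: "g x \<ge> 0" for x using g by (simp add: mollifier_def)
  have c: "conv v g = conv v' g"
  proof
    fix x
    have m [measurable]: "(\<lambda>y. g (x - y)) \<in> borel_measurable lebesgue" "v \<in> borel_measurable lebesgue" "v' \<in> borel_measurable lebesgue"
      using Cc_measurable[OF Cc_reflect[OF mollifier_Cc[OF g]]] v v'2 L2_measurable by auto
    show "conv v g x = conv v' g x"
      unfolding conv_def by (rule integral_cong_AE; measurable?) (use aeL in auto)
  qed
  have v2: "locally_integrable (\<lambda>x. (v' x)\<^sup>2)"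
    unfolding locally_integrable_def set_integrable_def
    using integrable_mult_indicator[OF _ L2_square[OF v'2]] by (simp add: borel_compact)
  have "(\<integral>\<^sup>+x. (conv v' g x)\<^sup>2 \<partial>lebesgue) \<le> (\<integral>\<^sup>+x. \<integral>\<^sup>+y. ennreal ((v' y)\<^sup>2 * g (x - y)) \<partial>lebesgue \<partial>lebesgue)"
  proof (rule nn_integral_mono)
    fix x :: R3
    have "(\<integral>\<^sup>+y. ennreal ((v' y)\<^sup>2 * g (x - y)) \<partial>lebesgue) = ennreal (LINT y|lebesgue. (v' y)\<^sup>2 * g (x - y))"
      using gn by (intro nn_integral_eq_integral conv_integrable[OF v2 mollifier_Cc[OF g]]) auto
    then show "ennreal ((conv v' g x)\<^sup>2) \<le> (\<integral>\<^sup>+y. ennreal ((v' y)\<^sup>2 * g (x - y)) \<partial>lebesgue)"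
      using conv_square_le[OF v'2 g] by (simp add: ennreal_leI)
  qed
  also have "\<dots> = (\<integral>\<^sup>+x. \<integral>\<^sup>+y. ennreal ((v' y)\<^sup>2 * g (x - y)) \<partial>lborel \<partial>lborel)"
    by (simp add: nn_integral_completion)
  also have "\<dots> = (\<integral>\<^sup>+y. \<integral>\<^sup>+x. ennreal ((v' y)\<^sup>2 * g (x - y)) \<partial>lborel \<partial>lborel)"
  proof (rule lborel_pair.Fubini'[symmetric])
    have "(\<lambda>z. g (fst z - snd z)) \<in> borel_measurable (lborel \<Otimes>\<^sub>M lborel)"
      by (rule measurable_compose[OF _ gm]) measurable
    then show "(\<lambda>(x, y). ennreal ((v' y)\<^sup>2 * g (x - y))) \<in> borel_measurable (lborel \<Otimes>\<^sub>M lborel)"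
      unfolding split_beta' by measurable
  qed
  also have "\<dots> = (\<integral>\<^sup>+y. ennreal ((v' y)\<^sup>2) \<partial>lborel)"
  proof (rule nn_integral_cong)
    fix y :: R3
    have gi: "integrable lebesgue (\<lambda>x. g (x - y))" "(LINT x|lebesgue. g (x - y)) = 1"
    proof -
      have "(\<lambda>x. g (- y - (0 - x))) \<in> Cc"
        using Cc_reflect[OF Cc_reflect[OF mollifier_Cc[OF g], of "-y"], of 0] by simp
      then show "integrable lebesgue (\<lambda>x. g (x - y))"
        using integrable_Cc[OF locally_integrable_const[of 1], of "\<lambda>x. g (x - y)"] by (simp add: algebra_simps)
      show "(LINT x|lebesgue. g (x - y)) = 1"
        using lebesgue_integral_translate[OF Cc_measurable[OF mollifier_Cc[OF g]], of "- y"] g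
        by (simp add: mollifier_def)
    qed
    have "(\<integral>\<^sup>+x. ennreal ((v' y)\<^sup>2 * g (x - y)) \<partial>lborel) = (\<integral>\<^sup>+x. ennreal ((v' y)\<^sup>2 * g (x - y)) \<partial>lebesgue)"
      by (simp add: nn_integral_completion)
    also have "\<dots> = ennreal (LINT x|lebesgue. (v' y)\<^sup>2 * g (x - y))"
      using gn gi by (intro nn_integral_eq_integral) auto
    finally show "(\<integral>\<^sup>+x. ennreal ((v' y)\<^sup>2 * g (x - y)) \<partial>lborel) = ennreal ((v' y)\<^sup>2)"
      using gi by simp
  qed
  also have "\<dots> = (\<integral>\<^sup>+y. ennreal ((v' y)\<^sup>2) \<partial>lebesgue)"
    by (simp add: nn_integral_completion)
  also have "\<dots> = (\<integral>\<^sup>+y. ennreal ((v y)\<^sup>2) \<partial>lebesgue)"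
    by (rule nn_integral_cong_AE) (use aeL in auto)
  finally show ?thesis by (simp add: c)
qed

lemma conv_L2:
  assumes v: "v \<in> L2" and g: "mollifier e g"
  shows "conv v g \<in> L2" "(LINT x|lebesgue. (conv v g x)\<^sup>2) \<le> (LINT x|lebesgue. (v x)\<^sup>2)"
proof -
  have m [measurable]: "conv v g \<in> borel_measurable lebesgue"
    by (intro continuous_measurable_lebesgue conv_continuous L2_locally_integrable v mollifier_Cc[OF g])
  have e: "(\<integral>\<^sup>+x. (v x)\<^sup>2 \<partial>lebesgue) = ennreal (LINT x|lebesgue. (v x)\<^sup>2)"
    by (rule nn_integral_eq_integral[OF L2_square[OF v]]) auto
  have "integrable lebesgue (\<lambda>x. (conv v g x)\<^sup>2)"
    by (rule integrableI_bounded)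
      (use nn_integral_conv_square_le[OF v g] e in \<open>auto simp: le_less_trans\<close>)
  then show c: "conv v g \<in> L2" using m by (simp add: L2_def)
  have "ennreal (LINT x|lebesgue. (conv v g x)\<^sup>2) \<le> ennreal (LINT x|lebesgue. (v x)\<^sup>2)"
    using nn_integral_conv_square_le[OF v g] nn_integral_eq_integral[OF L2_square[OF c]] e by simp
  then show "(LINT x|lebesgue. (conv v g x)\<^sup>2) \<le> (LINT x|lebesgue. (v x)\<^sup>2)"
    by (simp add: ennreal_le_iff)
qed

text \<open>Two approximations in a fixed order: truncation in space and in value at level
  \<open>k\<close>, with square error dominated by \<open>4 * (u x)^2\<close>, then continuous
  approximation of the truncated function, with square error dominated by a multiple of
  \<open>cutc k\<close>. The second majorant is integrable because \<open>k\<close> is already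
  fixed.\<close>

lemma L2_approx_Cc:
  assumes u: "u \<in> L2" and d: "d > 0"
  obtains p where "p \<in> Cc" "(LINT x|lebesgue. (u x - p x)\<^sup>2) < d"
proof -
  have um [measurable]: "u \<in> borel_measurable lebesgue" by (rule L2_measurable[OF u])
  define cl where "cl k t = max (- real k) (min (real k) t)" for k t
  have cl: "\<bar>cl k t\<bar> \<le> real k" "\<bar>t - cl k t\<bar> \<le> \<bar>t\<bar>" "\<bar>t\<bar> \<le> real k \<Longrightarrow> cl k t = t" for k t
    unfolding cl_def by (auto simp: max_def min_def)
  have clc: "continuous_on UNIV (cl k)" for k unfolding cl_def by (intro continuous_intros)
  have [measurable]: "cl k \<in> borel_measurable borel" for k by (rule borel_measurable_continuous_onI[OF clc])
  have [measurable]: "cutc k \<in> borel_measurable lebesgue" for k by (rule Cc_measurable[OF cutc_Cc])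
  define w where "w k x = cutc k x * cl k (u x)" for k x
  have wm [measurable]: "w k \<in> borel_measurable lebesgue" for k unfolding w_def by measurable
  have wu: "\<bar>u x - w k x\<bar> \<le> 2 * \<bar>u x\<bar>" for k x
  proof -
    have "\<bar>cutc k x * cl k (u x)\<bar> \<le> \<bar>cl k (u x)\<bar>"
      using cutc_bounds(1,2)[of k x] by (auto simp: abs_mult intro: mult_left_le_one_le)
    moreover have "\<bar>cl k (u x)\<bar> \<le> \<bar>u x\<bar>" unfolding cl_def by auto
    ultimately show ?thesis unfolding w_def by linarith
  qed
  have "(\<lambda>k. LINT x|lebesgue. (u x - w k x)\<^sup>2) \<longlonglongrightarrow> (LINT x|(lebesgue :: R3 measure). (0::real))"
  proof (rule integral_dominated_convergence[where s = "\<lambda>k x. (u x - w k x)\<^sup>2" and f = "\<lambda>x. 0" and w = "\<lambda>x. 4 * (u x)\<^sup>2"])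
    show "integrable lebesgue (\<lambda>x. 4 * (u x)\<^sup>2)" using L2_square[OF u] by simp
    show "AE x in lebesgue. (\<lambda>k. (u x - w k x)\<^sup>2) \<longlonglongrightarrow> 0"
    proof (rule AE_I2, rule tendsto_eventually)
      fix x :: R3
      obtain N where N: "max (norm x) \<bar>u x\<bar> \<le> real N" using real_arch_simple by blast
      show "\<forall>\<^sub>F k in sequentially. (u x - w k x)\<^sup>2 = 0"
        by (rule eventually_sequentiallyI[of N]) (use N in \<open>auto simp: w_def cutc_bounds(3) cl(3)\<close>)
    qed
    show "AE x in lebesgue. norm ((u x - w k x)\<^sup>2) \<le> 4 * (u x)\<^sup>2" for k
    proof (rule AE_I2)
      fix x show "norm ((u x - w k x)\<^sup>2) \<le> 4 * (u x)\<^sup>2"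
        using power_mono[OF wu[of x k], of 2] by (simp add: power_mult_distrib)
    qed
  qed measurable
  then have "\<forall>\<^sub>F k in sequentially. (LINT x|lebesgue. (u x - w k x)\<^sup>2) < d / 4"
    using d by (intro order_tendstoD(2)[where a = "d/4"]) auto
  then obtain k where k: "(LINT x|lebesgue. (u x - w k x)\<^sup>2) < d / 4"
    by (auto simp: eventually_sequentially)
  obtain g where g: "\<And>n. continuous_on UNIV (g n)" "AE x in lebesgue. (\<lambda>n. g n x) \<longlonglongrightarrow> u x"
    by (rule continuous_approx_AE[OF um]) blast
  define p where "p n x = cutc k x * cl k (g n x)" for n x
  have p: "p n \<in> Cc" for n
    unfolding p_def by (intro Cc_mult_continuous cutc_Cc continuous_on_compose2[OF clc g(1)]) auto
  have pm [measurable]: "p n \<in> borel_measurable lebesgue" for n by (rule Cc_measurable[OF p])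
  have wp: "(w k x - p n x)\<^sup>2 \<le> 4 * (real k)\<^sup>2 * cutc k x" for n x
  proof -
    have "\<bar>cl k (u x) - cl k (g n x)\<bar> \<le> 2 * real k" using cl(1)[of k "u x"] cl(1)[of k "g n x"] by linarith
    then have "(cl k (u x) - cl k (g n x))\<^sup>2 \<le> (2 * real k)\<^sup>2" by (metis abs_ge_zero power2_abs power_mono)
    moreover have "(cutc k x)\<^sup>2 \<le> cutc k x" using cutc_bounds(1,2)[of k x] by (simp add: power2_eq_square mult_left_le_one_le)
    ultimately have "(cutc k x)\<^sup>2 * (cl k (u x) - cl k (g n x))\<^sup>2 \<le> cutc k x * (2 * real k)\<^sup>2"
      by (intro mult_mono) (auto simp: cutc_bounds)
    then show ?thesis unfolding w_def p_def
      by (simp add: power_mult_distrib right_diff_distrib[symmetric] mult.commute)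
  qed
  have "(\<lambda>n. LINT x|lebesgue. (w k x - p n x)\<^sup>2) \<longlonglongrightarrow> (LINT x|(lebesgue :: R3 measure). (0::real))"
  proof (rule integral_dominated_convergence[where s = "\<lambda>n x. (w k x - p n x)\<^sup>2" and f = "\<lambda>x. 0" and w = "\<lambda>x. 4 * (real k)\<^sup>2 * cutc k x"])
    show "integrable lebesgue (\<lambda>x. 4 * (real k)\<^sup>2 * cutc k x)"
      using integrable_Cc[OF locally_integrable_const[of "4 * (real k)\<^sup>2"] cutc_Cc] .
    show "AE x in lebesgue. (\<lambda>n. (w k x - p n x)\<^sup>2) \<longlonglongrightarrow> 0"
      using g(2)
    proof eventually_elim
      case (elim x)
      have "(\<lambda>n. cl k (g n x)) \<longlonglongrightarrow> cl k (u x)"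
        unfolding cl_def by (intro tendsto_intros elim)
      then have "(\<lambda>n. (w k x - p n x)\<^sup>2) \<longlonglongrightarrow> (w k x - cutc k x * cl k (u x))\<^sup>2"
        unfolding p_def by (intro tendsto_intros)
      then show ?case by (simp add: w_def)
    qed
    show "AE x in lebesgue. norm ((w k x - p n x)\<^sup>2) \<le> 4 * (real k)\<^sup>2 * cutc k x" for n
      using wp by simp
  qed measurable
  then have "\<forall>\<^sub>F n in sequentially. (LINT x|lebesgue. (w k x - p n x)\<^sup>2) < d / 4"
    using d by (intro order_tendstoD(2)[where a = "d/4"]) auto
  then obtain n where n: "(LINT x|lebesgue. (w k x - p n x)\<^sup>2) < d / 4"
    by (auto simp: eventually_sequentially)
  have wL: "w k \<in> L2"
  proof (rule L2_mono[OF u wm])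
    have "\<bar>cutc k x * cl k (u x)\<bar> \<le> \<bar>cl k (u x)\<bar>" for x
      using cutc_bounds(1,2)[of k x] by (auto simp: abs_mult intro: mult_left_le_one_le)
    moreover have "\<bar>cl k (u x)\<bar> \<le> \<bar>u x\<bar>" for x unfolding cl_def by auto
    ultimately show "AE x in lebesgue. \<bar>w k x\<bar> \<le> \<bar>u x\<bar>" unfolding w_def by (meson AE_I2 order_trans)
  qed
  have i: "integrable lebesgue (\<lambda>x. (u x - w k x)\<^sup>2)" "integrable lebesgue (\<lambda>x. (w k x - p n x)\<^sup>2)"
    "integrable lebesgue (\<lambda>x. (u x - p n x)\<^sup>2)"
    using L2_square L2_diff u wL Cc_L2[OF p[of n]] by auto
  have "(LINT x|lebesgue. (u x - p n x)\<^sup>2) \<le> (LINT x|lebesgue. 2 * (u x - w k x)\<^sup>2 + 2 * (w k x - p n x)\<^sup>2)"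
  proof (rule integral_mono[OF i(3)])
    show "integrable lebesgue (\<lambda>x. 2 * (u x - w k x)\<^sup>2 + 2 * (w k x - p n x)\<^sup>2)" using i by simp
    show "(u x - p n x)\<^sup>2 \<le> 2 * (u x - w k x)\<^sup>2 + 2 * (w k x - p n x)\<^sup>2" for x
      using zero_le_power2[of "(u x - w k x) - (w k x - p n x)"] by (simp add: power2_eq_square algebra_simps)
  qed
  also have "\<dots> < d" using i k n by simp
  finally show thesis using that p by blast
qed

lemma conv_diff:
  assumes "locally_integrable u" "locally_integrable v" "g \<in> Cc"
  shows "conv (\<lambda>x. u x - v x) g x = conv u g x - conv v g x"
  using conv_integrable[OF assms(1,3)] conv_integrable[OF assms(2,3)]
  by (simp add: conv_def left_diff_distrib)

text \<open>The error for \<open>v\<close> is made of the error for a continuous \<open>p\<close>,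
  which is uniform on a ball, and of two copies of \<open>v - p\<close>, one of them mollified.
  Mollification does not increase the norm, so both copies are small.\<close>

lemma mollify_L2:
  assumes v: "v \<in> L2" and d: "d > 0"
  obtains e where "e > 0" "\<And>g. mollifier e g \<Longrightarrow> (LINT x|lebesgue. (v x - conv v g x)\<^sup>2) < d"
proof -
  \<comment> \<open>Three errors, and a factor 3 from squaring a sum of three terms.\<close>
  obtain p where p: "p \<in> Cc" "(LINT x|lebesgue. (v x - p x)\<^sup>2) < d / 9"
    using L2_approx_Cc[OF v, of "d / 9"] d by auto
  obtain R where R: "\<And>x. norm x > R \<Longrightarrow> p x = 0" using p by (auto simp: Cc_def)
  define K where "K = (LINT x|lebesgue. indicat_real (cball (0::R3) (R + 1)) x * \<bar>1\<bar>)"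
  have K: "K \<ge> 0" unfolding K_def by (intro integral_nonneg_AE) auto
  \<comment> \<open>Capped at 1 so that the square of an error below \<open>a\<close> is again below
    \<open>a\<close>.\<close>
  define a where "a = min 1 (d / (9 * (K + 1)))"
  have a: "a > 0" "a \<le> 1" "a * K \<le> d / 9"
  proof -
    show "a > 0" "a \<le> 1" using d K by (auto simp: a_def)
    have "a * K \<le> (d / (9 * (K + 1))) * K" using K by (intro mult_right_mono) (auto simp: a_def)
    also have "\<dots> \<le> d / 9" using K d by (simp add: divide_simps mult_left_mono)
    finally show "a * K \<le> d / 9" .
  qed
  obtain e where e: "e > 0" "\<And>g x. mollifier e g \<Longrightarrow> \<bar>conv p g x - p x\<bar> \<le> a"
    using mollify_uniform[OF p(1) a(1)] by metis
  have "(LINT x|lebesgue. (v x - conv v g x)\<^sup>2) < d" if g: "mollifier (min 1 e) g" for g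
  proof -
    have gz: "norm x > 1 \<Longrightarrow> g x = 0" for x using g by (auto simp: mollifier_def)
    let ?b = "\<lambda>x. conv p g x - p x"
    have pL: "p \<in> L2" by (rule Cc_L2[OF p(1)])
    have dL: "(\<lambda>x. v x - p x) \<in> L2" by (rule L2_diff[OF v pL])
    have bL: "?b \<in> L2" by (intro L2_diff conv_L2[OF _ g] pL)
    have cL: "conv (\<lambda>x. v x - p x) g \<in> L2" by (rule conv_L2[OF dL g])
    have vcL: "(\<lambda>x. v x - conv v g x) \<in> L2" by (intro L2_diff v conv_L2[OF _ g])
    have b: "(LINT x|lebesgue. (?b x)\<^sup>2) \<le> a * K"
    proof -
      have "\<bar>LINT x|lebesgue. 1 * (?b x)\<^sup>2\<bar> \<le> a * (LINT x|lebesgue. indicat_real (cball (0::R3) (R + 1)) x * \<bar>1\<bar>)"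
      proof (rule abs_integral_cutoff[OF locally_integrable_const])
        show "(\<lambda>x. (?b x)\<^sup>2) \<in> borel_measurable lebesgue" using L2_measurable[OF bL] by measurable
        show "\<bar>(?b x)\<^sup>2\<bar> \<le> a" for x
        proof -
          have "\<bar>?b x\<bar> \<le> a" using e(2)[OF mollifier_mono[OF g]] by simp
          then have "\<bar>?b x\<bar> * \<bar>?b x\<bar> \<le> a * 1" using a by (intro mult_mono) auto
          then show ?thesis by (simp add: power2_eq_square abs_mult)
        qed
        show "(?b x)\<^sup>2 = 0" if "norm x > R + 1" for x
          using conv_zero_outside[OF R gz that] R[of x] that by simp
      qed
      then show ?thesis by (simp add: K_def)
    qed
    have eq: "v x - conv v g x = (v x - p x) - ?b x - conv (\<lambda>x. v x - p x) g x" for x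
      using conv_diff[OF L2_locally_integrable[OF v] L2_locally_integrable[OF pL] mollifier_Cc[OF g]] by simp
    have "(LINT x|lebesgue. (v x - conv v g x)\<^sup>2) \<le>
        (LINT x|lebesgue. 3 * (v x - p x)\<^sup>2 + 3 * (?b x)\<^sup>2 + 3 * (conv (\<lambda>x. v x - p x) g x)\<^sup>2)"
    proof (rule integral_mono[OF L2_square[OF vcL]])
      show "integrable lebesgue (\<lambda>x. 3 * (v x - p x)\<^sup>2 + 3 * (?b x)\<^sup>2 + 3 * (conv (\<lambda>x. v x - p x) g x)\<^sup>2)"
        using L2_square[OF dL] L2_square[OF bL] L2_square[OF cL] by simp
      have sq: "(a - b - c)\<^sup>2 \<le> 3 * a\<^sup>2 + 3 * b\<^sup>2 + 3 * c\<^sup>2" for a b c :: real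
        using zero_le_power2[of "a + b"] zero_le_power2[of "a + c"] zero_le_power2[of "b - c"]
        by (simp add: power2_eq_square algebra_simps)
      show "(v x - conv v g x)\<^sup>2 \<le> 3 * (v x - p x)\<^sup>2 + 3 * (?b x)\<^sup>2 + 3 * (conv (\<lambda>x. v x - p x) g x)\<^sup>2" for x
        unfolding eq[of x] by (rule sq)
    qed
    also have "\<dots> = 3 * (LINT x|lebesgue. (v x - p x)\<^sup>2) + 3 * (LINT x|lebesgue. (?b x)\<^sup>2) + 3 * (LINT x|lebesgue. (conv (\<lambda>x. v x - p x) g x)\<^sup>2)"
      using L2_square[OF dL] L2_square[OF bL] L2_square[OF cL] by simp
    also have "\<dots> < d" using p(2) b a conv_L2(2)[OF dL g] by linarith
    finally show ?thesis .
  qed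
  then show thesis using that[of "min 1 e"] e(1) by auto
qed

section \<open>Smooth cutoffs and the density of test functions in H^1\<close>

definition chi :: "nat \<Rightarrow> R3 \<Rightarrow> real" where
  "chi n x = (max 0 (1 - inverse (real (Suc n) ^ 2) * (x \<bullet> x)))\<^sup>2"

text \<open>Squaring removes the corner of the positive part, so \<open>chi\<close> is continuously
  differentiable across the sphere that bounds its support.\<close>

lemma DERIV_pos_part_square: "((\<lambda>t::real. (max 0 t)\<^sup>2) has_real_derivative 2 * max 0 t) (at t)"
proof -
  consider "t > 0" | "t < 0" | "t = 0" by linarith
  then show ?thesis
  proof cases
    case 1
    have "((\<lambda>t::real. t\<^sup>2) has_real_derivative 2 * max 0 t) (at t)"
      using 1 by (auto intro!: derivative_eq_intros)
    then show ?thesis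
      by (rule DERIV_cong_ev[THEN iffD1, rotated 3])
        (use 1 in \<open>auto simp: eventually_nhds intro!: exI[of _ "{0<..}"]\<close>)
  next
    case 2
    have "((\<lambda>t::real. 0) has_real_derivative 2 * max 0 t) (at t)"
      using 2 by simp
    then show ?thesis
      by (rule DERIV_cong_ev[THEN iffD1, rotated 3])
        (use 2 in \<open>auto simp: eventually_nhds intro!: exI[of _ "{..<0}"]\<close>)
  next
    case 3
    have "((\<lambda>h::real. (max 0 h)\<^sup>2 / h) \<longlongrightarrow> max 0 0) (at 0)"
      by (rule Lim_transform_eventually[where f = "\<lambda>h. max 0 h"], intro tendsto_intros)
        (auto simp: eventually_at_filter power2_eq_square max_def)
    then show ?thesis using 3 by (simp add: DERIV_def)
  qed
qed

lemma chi_C1c: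
  shows "chi n \<in> C1c"
    "partial i (chi n) x = - 4 * max 0 (1 - inverse (real (Suc n) ^ 2) * (x \<bullet> x)) * (inverse (real (Suc n) ^ 2) * x $ i)"
proof -
  define c where "c = inverse (real (Suc n) ^ 2)"
  have c: "c > 0" by (simp add: c_def)
  have d0: "((\<lambda>x. 1 - c * (x \<bullet> x)) has_derivative (\<lambda>h. ((-2*c) *\<^sub>R x) \<bullet> h)) (at x)" for x :: R3
    by (auto intro!: derivative_eq_intros simp: inner_commute)
  have c0: "(\<lambda>x::R3. 1 - c * (x \<bullet> x)) \<in> C1" "grad (\<lambda>x::R3. 1 - c * (x \<bullet> x)) = (\<lambda>x. (-2*c) *\<^sub>R x)"
    using C1I[OF d0] continuous_on_scaleR[OF continuous_on_const continuous_on_id] by blast+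
  have "continuous_on UNIV (\<lambda>t::real. 2 * max 0 t)" by (intro continuous_intros)
  note C = C1_compose[OF c0(1) DERIV_pos_part_square this]
  have z: "chi n x = 0" if "norm x > real (Suc n)" for x
  proof -
    have "(real (Suc n))\<^sup>2 \<le> (norm x)\<^sup>2" using that by (intro power_mono) auto
    then have "1 \<le> c * (x \<bullet> x)" by (simp add: c_def dot_square_norm field_simps del: of_nat_Suc)
    then show ?thesis by (simp add: chi_def c_def)
  qed
  have "chi n = (\<lambda>x. (max 0 (1 - c * (x \<bullet> x)))\<^sup>2)" by (simp add: chi_def c_def fun_eq_iff)
  then show "chi n \<in> C1c" using C(1) z by (auto simp: C1c_def)
  show "partial i (chi n) x = - 4 * max 0 (1 - inverse (real (Suc n) ^ 2) * (x \<bullet> x)) * (inverse (real (Suc n) ^ 2) * x $ i)"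
    using fun_cong[OF C(2), of x] \<open>chi n = _\<close> unfolding c0(2) c_def[symmetric] by (simp add: vec_eq_iff)
qed

lemma inverse_Suc_square_tendsto: "(\<lambda>n. inverse (real (Suc n) ^ 2)) \<longlonglongrightarrow> 0"
  using tendsto_power[OF LIMSEQ_inverse_real_of_nat, of 2] by (simp add: power_inverse)

lemma chi_bounds: "0 \<le> chi n x" "chi n x \<le> 1" "(\<lambda>n. chi n x) \<longlonglongrightarrow> 1"
  "\<bar>partial i (chi n) x\<bar> \<le> 4" "(\<lambda>n. partial i (chi n) x) \<longlonglongrightarrow> 0"
proof -
  show "0 \<le> chi n x" by (simp add: chi_def)
  show "chi n x \<le> 1" unfolding chi_def by (intro power_le_one) auto
  have l: "(\<lambda>n. max 0 (1 - inverse (real (Suc n) ^ 2) * (x \<bullet> x))) \<longlonglongrightarrow> max 0 (1 - 0 * (x \<bullet> x))"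
    by (intro tendsto_intros inverse_Suc_square_tendsto)
  show "(\<lambda>n. chi n x) \<longlonglongrightarrow> 1"
    unfolding chi_def using tendsto_power[OF l, of 2] by simp
  have "(\<lambda>n. - 4 * max 0 (1 - inverse (real (Suc n) ^ 2) * (x \<bullet> x)) * (inverse (real (Suc n) ^ 2) * x $ i)) \<longlonglongrightarrow> - 4 * max 0 (1 - 0 * (x \<bullet> x)) * (0 * x $ i)"
    by (intro tendsto_intros inverse_Suc_square_tendsto)
  then show "(\<lambda>n. partial i (chi n) x) \<longlonglongrightarrow> 0" by (simp add: chi_C1c(2))
  define c where "c = inverse (real (Suc n) ^ 2)"
  have c: "c > 0" "c \<le> 1" by (auto simp: c_def field_simps)
  have "max 0 (1 - c * (x \<bullet> x)) * \<bar>c * x $ i\<bar> \<le> 1"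
  proof (cases "c * (x \<bullet> x) \<le> 1")
    case True
    have "\<bar>c * x $ i\<bar>\<^sup>2 \<le> c * (c * (x \<bullet> x))"
      using component_le_norm_cart[of x i] c
      by (simp add: power_mult_distrib dot_square_norm power2_eq_square mult_left_mono)
        (metis abs_ge_zero abs_mult_self_eq mult_mono norm_ge_zero)
    also have "\<dots> \<le> 1" using True c by (simp add: mult_le_one)
    finally have "\<bar>c * x $ i\<bar> \<le> 1" by (simp add: abs_square_le_1)
    moreover have "max 0 (1 - c * (x \<bullet> x)) \<le> 1" using c by simp
    ultimately show ?thesis by (metis abs_ge_zero max.cobounded1 mult_le_one)
  qed auto
  then show "\<bar>partial i (chi n) x\<bar> \<le> 4"
    unfolding chi_C1c(2) c_def[symmetric] by (simp add: abs_mult mult.assoc)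
qed

lemma L2_limit_dominated:
  assumes u: "\<And>n::nat. u n \<in> L2" and lim: "AE x in lebesgue. (\<lambda>n. u n x) \<longlonglongrightarrow> 0"
    and b: "\<And>n. AE x in lebesgue. \<bar>u n x\<bar> \<le> w x" and w: "w \<in> L2"
  shows "(\<lambda>n. LINT x|lebesgue. (u n x)\<^sup>2) \<longlonglongrightarrow> 0"
proof -
  have "(\<lambda>n. LINT x|lebesgue. (u n x)\<^sup>2) \<longlonglongrightarrow> (LINT x|(lebesgue :: R3 measure). 0)"
  proof (rule integral_dominated_convergence[where s = "\<lambda>n x. (u n x)\<^sup>2" and f = "\<lambda>x. 0" and w = "\<lambda>x. (w x)\<^sup>2"])
    show "AE x in lebesgue. (\<lambda>n. (u n x)\<^sup>2) \<longlonglongrightarrow> 0"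
      using lim
    proof eventually_elim
      case (elim x) then show ?case using tendsto_power[OF elim, of 2] by simp
    qed
    show "AE x in lebesgue. norm ((u n x)\<^sup>2) \<le> (w x)\<^sup>2" for n
      using b[of n] by eventually_elim (simp add: abs_le_square_iff[symmetric])
  qed (use L2_square[OF w] L2_square[OF u] in auto)
  then show ?thesis by simp
qed

text \<open>A cutoff followed by a mollification. The second partial derivatives of the
  approximation commute because they fall on the mollifier, for which this holds by definition;
  \<open>H1_partial_swap\<close> depends on it. The tolerance is quartered since the square of a sum
  of two costs a factor 2.\<close>

lemma H1_dense:
  assumes u: "u \<in> H1" and d: "d > 0"
  obtains p where "p \<in> test_functions" "\<And>i j. partial i (partial j p) = partial j (partial i p)"
    "(LINT x|lebesgue. (u x - p x)\<^sup>2) < d" "\<And>i. (LINT x|lebesgue. (weak_partial i u x - partial i p x)\<^sup>2) < d"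
proof -
  let ?v = "\<lambda>i. weak_partial i u"
  have uL: "u \<in> L2" and vL: "?v i \<in> L2" and wp: "is_weak_partial i u (?v i)" for i
    using u H1_L2 H1_weak_partial_L2 H1_is_weak_partial by auto
  have cm: "chi n \<in> borel_measurable lebesgue" "partial i (chi n) \<in> borel_measurable lebesgue" for n i
    using Cc_measurable C1c_Cc C1c_partial_Cc chi_C1c(1) by auto
  define un where "un n x = chi n x * u x" for n x
  define vn where "vn n i x = chi n x * ?v i x + partial i (chi n) x * u x" for n i x
  have unL: "un n \<in> L2" for n unfolding un_def
    by (rule L2_bounded_mult[OF uL cm(1), of _ 1]) (use chi_bounds in \<open>auto simp: abs_le_iff intro: order_trans[OF _ chi_bounds(1)]\<close>)
  have vnL: "vn n i \<in> L2" for n i unfolding vn_def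
    by (rule L2_add; rule L2_bounded_mult[OF _ cm(1), of _ _ 1] L2_bounded_mult[OF uL cm(2), of _ _ 4])
      (use vL chi_bounds in \<open>auto simp: abs_le_iff intro: order_trans[OF _ chi_bounds(1)]\<close>)
  have wpn: "is_weak_partial i (un n) (vn n i)" for n i
    unfolding un_def vn_def by (rule is_weak_partial_mult_C1[OF wp C1cD[OF chi_C1c(1)]])
  have lim0: "(\<lambda>n. LINT x|lebesgue. (u x - un n x)\<^sup>2) \<longlonglongrightarrow> 0"
  proof (rule L2_limit_dominated[where w = "\<lambda>x. \<bar>u x\<bar>"])
    show "(\<lambda>x. u x - un n x) \<in> L2" for n by (intro L2_diff uL unL)
    show "AE x in lebesgue. (\<lambda>n. u x - un n x) \<longlonglongrightarrow> 0"
    proof (rule AE_I2)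
      fix x have "(\<lambda>n. u x - chi n x * u x) \<longlonglongrightarrow> u x - 1 * u x" by (intro tendsto_intros chi_bounds)
      then show "(\<lambda>n. u x - un n x) \<longlonglongrightarrow> 0" by (simp add: un_def)
    qed
    show "AE x in lebesgue. \<bar>u x - un n x\<bar> \<le> \<bar>u x\<bar>" for n
    proof (rule AE_I2)
      fix x have "\<bar>u x - un n x\<bar> = (1 - chi n x) * \<bar>u x\<bar>"
        using chi_bounds(2)[of n x] by (simp add: un_def abs_mult[symmetric] left_diff_distrib) (metis abs_mult abs_of_nonneg diff_ge_0_iff_ge left_diff_distrib mult_1)
      then show "\<bar>u x - un n x\<bar> \<le> \<bar>u x\<bar>"
        using chi_bounds(1,2)[of n x] by (simp add: mult_left_le_one_le)
    qed
  qed (rule L2_abs[OF uL])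
  have lim1: "(\<lambda>n. LINT x|lebesgue. (?v i x - vn n i x)\<^sup>2) \<longlonglongrightarrow> 0" for i
  proof (rule L2_limit_dominated[where w = "\<lambda>x. \<bar>?v i x\<bar> + 4 * \<bar>u x\<bar>"])
    show "(\<lambda>x. ?v i x - vn n i x) \<in> L2" for n by (intro L2_diff vL vnL)
    show "AE x in lebesgue. (\<lambda>n. ?v i x - vn n i x) \<longlonglongrightarrow> 0"
    proof (rule AE_I2)
      fix x have "(\<lambda>n. ?v i x - (chi n x * ?v i x + partial i (chi n) x * u x)) \<longlonglongrightarrow> ?v i x - (1 * ?v i x + 0 * u x)"
        by (intro tendsto_intros chi_bounds)
      then show "(\<lambda>n. ?v i x - vn n i x) \<longlonglongrightarrow> 0" by (simp add: vn_def)
    qed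
    show "AE x in lebesgue. \<bar>?v i x - vn n i x\<bar> \<le> \<bar>?v i x\<bar> + 4 * \<bar>u x\<bar>" for n
    proof (rule AE_I2)
      fix x
      have "\<bar>(1 - chi n x) * ?v i x\<bar> \<le> \<bar>?v i x\<bar>"
        using chi_bounds(1,2)[of n x] by (simp add: abs_mult mult_left_le_one_le)
      moreover have "\<bar>partial i (chi n) x * u x\<bar> \<le> 4 * \<bar>u x\<bar>"
        unfolding abs_mult by (intro mult_right_mono chi_bounds) auto
      moreover have "?v i x - vn n i x = (1 - chi n x) * ?v i x - partial i (chi n) x * u x"
        by (simp add: vn_def algebra_simps)
      ultimately show "\<bar>?v i x - vn n i x\<bar> \<le> \<bar>?v i x\<bar> + 4 * \<bar>u x\<bar>" by linarith
    qed
    show "(\<lambda>x. \<bar>?v i x\<bar> + 4 * \<bar>u x\<bar>) \<in> L2" by (intro L2_add L2_cmult L2_abs vL uL)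
  qed
  have "\<forall>\<^sub>F n in sequentially. (LINT x|lebesgue. (u x - un n x)\<^sup>2) < d/4 \<and> (\<forall>i. (LINT x|lebesgue. (?v i x - vn n i x)\<^sup>2) < d/4)"
    by (intro eventually_conj eventually_all_finite order_tendstoD(2)[OF lim0] order_tendstoD(2)[OF lim1]) (use d in auto)
  then obtain n where n: "(LINT x|lebesgue. (u x - un n x)\<^sup>2) < d/4" "\<And>i. (LINT x|lebesgue. (?v i x - vn n i x)\<^sup>2) < d/4"
    by (auto simp: eventually_sequentially)
  have "d / 4 > 0" using d by simp
  obtain e0 where e0: "e0 > 0" "\<And>g. mollifier e0 g \<Longrightarrow> (LINT x|lebesgue. (un n x - conv (un n) g x)\<^sup>2) < d/4"
    using mollify_L2[OF unL[of n] \<open>d / 4 > 0\<close>] by metis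
  have "\<exists>e. e > 0 \<and> (\<forall>g. mollifier e g \<longrightarrow> (LINT x|lebesgue. (vn n i x - conv (vn n i) g x)\<^sup>2) < d/4)" for i
    using mollify_L2[OF vnL[of n i] \<open>d / 4 > 0\<close>] by metis
  then obtain e1 where e1: "\<And>i. e1 i > 0" "\<And>i g. mollifier (e1 i) g \<Longrightarrow> (LINT x|lebesgue. (vn n i x - conv (vn n i) g x)\<^sup>2) < d/4"
    by metis
  \<comment> \<open>One mollifier has to serve the function and its three derivatives.\<close>
  define e where "e = min e0 (Min (range e1))"
  have e: "e > 0" "e \<le> e0" "\<And>i. e \<le> e1 i"
    using e0(1) e1(1) by (auto simp: e_def intro: min.coboundedI2)
  obtain g where g: "mollifier e g" using mollifier_exists[OF e(1)] by blast
  have gt: "g \<in> test_functions" using g by (simp add: mollifier_def)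
  let ?p = "conv (un n) g"
  obtain R where "\<And>x. norm x > R \<Longrightarrow> chi n x = 0" using C1cE[OF chi_C1c(1)] by metis
  then have pt: "?p \<in> test_functions"
    by (intro conv_test_functions[OF L2_locally_integrable[OF unL] _ gt, of R]) (auto simp: un_def)
  \<comment> \<open>The weak identity is tested with \<open>\<lambda>y. g (x - y)\<close>. The minus
    sign of the chain rule cancels the one of the integration by parts.\<close>
  have pp: "partial i ?p = conv (vn n i) g" for i
  proof
    fix x
    have d: "((\<lambda>y. g (x - y)) has_derivative (\<lambda>h. (- grad g (x - y)) \<bullet> h)) (at y)" for y
    proof -
      have "((\<lambda>y. x - y) has_derivative (\<lambda>h. - h)) (at y)" by (auto intro!: derivative_eq_intros)
      from has_derivative_compose[OF this C1_has_derivative[OF C1cD[OF test_functions_C1c[OF gt]]]]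
      show ?thesis by simp
    qed
    have c: "continuous_on UNIV (\<lambda>y. - grad g (x - y))"
      by (intro continuous_intros continuous_on_compose2[OF C1_continuous_grad[OF C1cD[OF test_functions_C1c[OF gt]], of UNIV]]) auto
    note G = C1I[OF d c]
    have "(\<lambda>y. g (x - y)) \<in> C1c"
      using G(1) Cc_reflect[OF mollifier_Cc[OF g], of x] by (auto simp: C1c_def Cc_def)
    from is_weak_partial_C1c[OF wpn[of i n] this]
    have "(LINT y|lebesgue. un n y * partial i (\<lambda>y. g (x - y)) y) = - (LINT y|lebesgue. vn n i y * g (x - y))" .
    moreover have "partial i (\<lambda>y. g (x - y)) y = - partial i g (x - y)" for y
      using fun_cong[OF G(2), of y] by (simp add: vec_eq_iff)
    ultimately show "partial i ?p x = conv (vn n i) g x"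
      by (simp add: conv_C1(2)[OF L2_locally_integrable[OF unL] test_functions_C1c[OF gt]] conv_def)
  qed
  have tri: "(LINT x|lebesgue. (a x - c x)\<^sup>2) < d"
    if "a \<in> L2" "b \<in> L2" "c \<in> L2" "(LINT x|lebesgue. (a x - b x)\<^sup>2) < d/4" "(LINT x|lebesgue. (b x - c x)\<^sup>2) < d/4" for a b c
  proof -
    have i: "integrable lebesgue (\<lambda>x. (a x - b x)\<^sup>2)" "integrable lebesgue (\<lambda>x. (b x - c x)\<^sup>2)" "integrable lebesgue (\<lambda>x. (a x - c x)\<^sup>2)"
      using L2_square[OF L2_diff] that by auto
    have "(LINT x|lebesgue. (a x - c x)\<^sup>2) \<le> (LINT x|lebesgue. 2 * (a x - b x)\<^sup>2 + 2 * (b x - c x)\<^sup>2)"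
    proof (rule integral_mono[OF i(3)])
      show "(a x - c x)\<^sup>2 \<le> 2 * (a x - b x)\<^sup>2 + 2 * (b x - c x)\<^sup>2" for x
        using zero_le_power2[of "(a x - b x) - (b x - c x)"] by (simp add: power2_eq_square algebra_simps)
    qed (use i in simp)
    also have "\<dots> = 2 * (LINT x|lebesgue. (a x - b x)\<^sup>2) + 2 * (LINT x|lebesgue. (b x - c x)\<^sup>2)"
      using i by simp
    also have "\<dots> < d" using that by linarith
    finally show ?thesis .
  qed
  show thesis
  proof (rule that[OF pt])
    fix i j
    have "partial i (partial j ?p) = conv (un n) (partial i (partial j g))" for i j
      using conv_C1(2)[OF L2_locally_integrable[OF unL] test_functions_C1c[OF gt]]
        conv_C1(2)[OF L2_locally_integrable[OF unL] test_functions_foldr[OF gt, of "[j]"]] by simp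
    then show "partial i (partial j ?p) = partial j (partial i ?p)"
      using g by (simp add: mollifier_def)
  next
    show "(LINT x|lebesgue. (u x - ?p x)\<^sup>2) < d"
      by (rule tri[OF uL unL[of n] conv_L2(1)[OF unL g] n(1) e0(2)[OF mollifier_mono[OF g e(2)]]])
    show "(LINT x|lebesgue. (?v i x - partial i ?p x)\<^sup>2) < d" for i
      unfolding pp by (rule tri[OF vL vnL[of n i] conv_L2(1)[OF vnL g] n(2) e1(2)[OF mollifier_mono[OF g e(3)]]])
  qed
qed

text \<open>Summable squared norms make the series of squares integrable, hence finite almost
  everywhere, so its terms tend to 0. The geometric rate spares the extraction of a
  subsequence.\<close>

lemma AE_tendsto_0_if_geometric:
  fixes w :: "nat \<Rightarrow> R3 \<Rightarrow> real"
  assumes w: "\<And>n. w n \<in> L2" and b: "\<And>n. (LINT x|lebesgue. (w n x)\<^sup>2) \<le> (1/2) ^ n"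
  shows "AE x in lebesgue. (\<lambda>n. w n x) \<longlonglongrightarrow> 0"
proof -
  have m [measurable]: "w n \<in> borel_measurable lebesgue" for n by (rule L2_measurable[OF w])
  have "(\<integral>\<^sup>+x. (\<Sum>n. ennreal ((w n x)\<^sup>2)) \<partial>lebesgue) = (\<Sum>n. \<integral>\<^sup>+x. ennreal ((w n x)\<^sup>2) \<partial>lebesgue)"
    by (rule nn_integral_suminf) measurable
  also have "\<dots> \<le> (\<Sum>n. ennreal ((1/2) ^ n))"
  proof (rule suminf_le)
    show "(\<integral>\<^sup>+x. ennreal ((w n x)\<^sup>2) \<partial>lebesgue) \<le> ennreal ((1/2) ^ n)" for n
      using nn_integral_eq_integral[OF L2_square[OF w[of n]]] b[of n] by (simp add: ennreal_leI)
  qed auto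
  also have "\<dots> = ennreal (\<Sum>n. (1/2::real) ^ n)"
    by (intro suminf_ennreal2 summable_geometric) auto
  finally have "(\<integral>\<^sup>+x. (\<Sum>n. ennreal ((w n x)\<^sup>2)) \<partial>lebesgue) \<noteq> \<infinity>"
    using ennreal_less_top le_less_trans by (metis infinity_ennreal_def order_less_irrefl)
  then have "AE x in lebesgue. (\<Sum>n. ennreal ((w n x)\<^sup>2)) \<noteq> \<infinity>"
    by (intro nn_integral_PInf_AE) measurable
  then show ?thesis
  proof eventually_elim
    case (elim x)
    then have "summable (\<lambda>n. (w n x)\<^sup>2)" by (intro summable_suminf_not_top) auto
    then have "(\<lambda>n. (w n x)\<^sup>2) \<longlonglongrightarrow> 0" by (rule summable_LIMSEQ_zero)
    then have "(\<lambda>n. sqrt ((w n x)\<^sup>2)) \<longlonglongrightarrow> sqrt 0" by (intro tendsto_intros)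
    then show ?case by (simp add: tendsto_rabs_zero_iff)
  qed
qed

text \<open>Young's inequality with weight \<open>t\<close>. If the squared norm of \<open>v\<close>
  is at most \<open>t^2\<close>, both terms are of order \<open>t\<close>, the shape that
  \<open>eq_0_if_abs_le_all_mult\<close> asks for.\<close>

lemma L2_weighted_bound:
  assumes "u \<in> L2" "v \<in> L2" "t > 0"
  shows "(LINT x|lebesgue. \<bar>u x * v x\<bar>) \<le> t * (LINT x|lebesgue. (u x)\<^sup>2) + (LINT x|lebesgue. (v x)\<^sup>2) / t"
proof -
  have i: "integrable lebesgue (\<lambda>x. (u x)\<^sup>2)" "integrable lebesgue (\<lambda>x. (v x)\<^sup>2)" using assms L2_square by auto
  have "(LINT x|lebesgue. \<bar>u x * v x\<bar>) \<le> (LINT x|lebesgue. t * (u x)\<^sup>2 + (v x)\<^sup>2 / t)"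
  proof (rule integral_mono[OF integrable_abs[OF L2_mult_integrable[OF assms(1,2)]]])
    show "integrable lebesgue (\<lambda>x. t * (u x)\<^sup>2 + (v x)\<^sup>2 / t)" using i by simp
    fix x
    have "t * \<bar>u x * v x\<bar> \<le> t * (t * (u x)\<^sup>2 + (v x)\<^sup>2 / t)"
    proof -
      have "0 \<le> t * (\<bar>u x\<bar> * \<bar>v x\<bar>)" using assms(3) by simp
      moreover have "t * (\<bar>u x\<bar> * \<bar>v x\<bar>) * 2 \<le> v x * v x + t * (t * (u x * u x))"
        using zero_le_power2[of "t * \<bar>u x\<bar> - \<bar>v x\<bar>"] by (simp add: power2_eq_square algebra_simps)
      ultimately have "t * (\<bar>u x\<bar> * \<bar>v x\<bar>) \<le> v x * v x + t * (t * (u x * u x))" by linarith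
      then show ?thesis using assms(3) by (simp add: power2_eq_square algebra_simps abs_mult)
    qed
    then show "\<bar>u x * v x\<bar> \<le> t * (u x)\<^sup>2 + (v x)\<^sup>2 / t" using assms(3) by simp
  qed
  also have "\<dots> = t * (LINT x|lebesgue. (u x)\<^sup>2) + (LINT x|lebesgue. (v x)\<^sup>2) / t" using i by simp
  finally show ?thesis .
qed

text \<open>With a smooth \<open>p\<close> in place of \<open>v\<close>, integration by parts pairs
  \<open>u\<close> with \<open>partial i (partial j p)\<close>, which is symmetric in
  \<open>i\<close> and \<open>j\<close>. Only \<open>v\<close> has to be approximated. The identity
  makes the mixed terms vanish in \<open>curl_identity\<close>.\<close>

lemma H1_partial_swap:
  assumes u: "u \<in> H1" and v: "v \<in> H1"
  shows "(LINT x|lebesgue. weak_partial i u x * weak_partial j v x) = (LINT x|lebesgue. weak_partial j u x * weak_partial i v x)"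
proof -
  let ?U = "\<lambda>i. weak_partial i u" and ?V = "\<lambda>i. weak_partial i v"
  define D where "D = (LINT x|lebesgue. ?U i x * ?V j x) - (LINT x|lebesgue. ?U j x * ?V i x)"
  define K where "K = (LINT x|lebesgue. (?U i x)\<^sup>2) + 1 + ((LINT x|lebesgue. (?U j x)\<^sup>2) + 1)"
  have L: "?U i \<in> L2" "?V i \<in> L2" for i using assms H1_weak_partial_L2 by auto
  have "\<bar>D\<bar> \<le> t * K" if t: "t > 0" for t
  proof -
    obtain p where p: "p \<in> test_functions" "\<And>i j. partial i (partial j p) = partial j (partial i p)"
       "\<And>i. (LINT x|lebesgue. (?V i x - partial i p x)\<^sup>2) < t\<^sup>2"
      by (rule H1_dense[OF v zero_less_power[OF t, of 2]]) blast
    have pL: "partial i p \<in> L2" for i using p Cc_L2 C1c_partial_Cc test_functions_C1c by blast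
    have s: "(LINT x|lebesgue. ?U i x * partial j p x) = - (LINT x|lebesgue. u x * partial i (partial j p) x)" for i j
      using is_weak_partial_C1c[OF H1_is_weak_partial[OF u, of i] test_functions_foldr[OF p(1), of "[j]"]] by simp
    have e: "(LINT x|lebesgue. ?U i x * ?V j x) = (LINT x|lebesgue. ?U i x * partial j p x) + (LINT x|lebesgue. ?U i x * (?V j x - partial j p x))" for i j
      using L2_mult_integrable[OF L(1) L(2)] L2_mult_integrable[OF L(1) pL] by (simp add: right_diff_distrib)
    have b: "\<bar>LINT x|lebesgue. ?U i x * (?V j x - partial j p x)\<bar> \<le> t * ((LINT x|lebesgue. (?U i x)\<^sup>2) + 1)" for i j
    proof -
      have "\<bar>LINT x|lebesgue. ?U i x * (?V j x - partial j p x)\<bar> \<le> (LINT x|lebesgue. \<bar>?U i x * (?V j x - partial j p x)\<bar>)"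
        by (rule integral_abs_bound)
      also have "\<dots> \<le> t * (LINT x|lebesgue. (?U i x)\<^sup>2) + (LINT x|lebesgue. (?V j x - partial j p x)\<^sup>2) / t"
        by (rule L2_weighted_bound[OF L(1) L2_diff[OF L(2) pL] t])
      also have "(LINT x|lebesgue. (?V j x - partial j p x)\<^sup>2) / t \<le> t"
        using p(3)[of j] t by (simp add: divide_simps power2_eq_square)
      finally show ?thesis by (simp add: algebra_simps)
    qed
    have "D = (LINT x|lebesgue. ?U i x * (?V j x - partial j p x)) - (LINT x|lebesgue. ?U j x * (?V i x - partial i p x))"
      unfolding D_def e s p(2)[of i j] by simp
    then show ?thesis using b[of i j] b[of j i] unfolding K_def distrib_left by linarith
  qed
  then have "D = 0" by (rule eq_0_if_abs_le_all_mult)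
  then show ?thesis by (simp add: D_def)
qed

section \<open>The Sobolev inequality\<close>

text \<open>Carries the product of three lines to space, so that Tonelli's theorem applies
  coordinate by coordinate; later also a constructor for explicit vectors.\<close>

definition tri :: "real \<times> real \<times> real \<Rightarrow> R3" where
  "tri p = fst p *\<^sub>R axis 1 1 + fst (snd p) *\<^sub>R axis 2 1 + snd (snd p) *\<^sub>R axis 3 1"

lemma tri_nth [simp]: "tri p $ 1 = fst p" "tri p $ 2 = fst (snd p)" "tri p $ 3 = snd (snd p)"
  by (auto simp: tri_def axis_def)

lemma continuous_tri: "continuous_on S tri"
  unfolding tri_def[abs_def] by (intro continuous_intros)

lemma Basis_cart_real: "(Basis :: (real ^ 'n) set) = range (\<lambda>i. axis i 1)"
  by (auto simp: Basis_vec_def)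

lemma distr_tri: "distr lborel borel tri = lborel"
proof (rule lborel_eqI[symmetric])
  have m [measurable]: "tri \<in> borel_measurable borel" by (rule borel_measurable_continuous_onI[OF continuous_tri])
  fix l u :: R3 assume lu: "\<And>b. b \<in> Basis \<Longrightarrow> l \<bullet> b \<le> u \<bullet> b"
  have le: "l $ i \<le> u $ i" for i using lu[of "axis i 1"] by (simp add: Basis_cart_real inner_axis)
  have v: "tri -` box l u = {l$1<..<u$1} \<times> ({l$2<..<u$2} \<times> {l$3<..<u$3})"
    by (auto simp: mem_box_cart forall_3)
  have "emeasure (distr lborel borel tri) (box l u) = emeasure (lborel :: (real \<times> real \<times> real) measure) (tri -` box l u)"
    by (subst emeasure_distr) auto
  also have "\<dots> = emeasure (lborel \<Otimes>\<^sub>M lborel) ({l$1<..<u$1} \<times> ({l$2<..<u$2} \<times> {l$3<..<u$3}))"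
    by (simp add: v lborel_prod)
  also have "\<dots> = emeasure lborel {l$1<..<u$1} * emeasure lborel ({l$2<..<u$2} \<times> {l$3<..<u$3})"
    by (rule lborel.emeasure_pair_measure_Times) (auto simp: borel_open open_Times)
  also have "emeasure lborel ({l$2<..<u$2} \<times> {l$3<..<u$3}) = emeasure (lborel \<Otimes>\<^sub>M lborel) ({l$2<..<u$2} \<times> {l$3<..<u$3})"
    by (simp add: lborel_prod)
  also have "\<dots> = emeasure lborel {l$2<..<u$2} * emeasure lborel {l$3<..<u$3}"
    by (rule lborel.emeasure_pair_measure_Times) auto
  also have "emeasure lborel {l$1<..<u$1} * (emeasure lborel {l$2<..<u$2} * emeasure lborel {l$3<..<u$3})
      = ennreal (u$1 - l$1) * (ennreal (u$2 - l$2) * ennreal (u$3 - l$3))"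
    using le by (simp only: emeasure_lborel_Ioo)
  also have "\<dots> = ennreal (\<Prod>b\<in>Basis. (u - l) \<bullet> b)"
  proof -
    have "(\<Prod>b\<in>Basis. (u - l) \<bullet> b) = (\<Prod>i\<in>UNIV. (u - l) $ i)"
      unfolding Basis_cart_real by (subst prod.reindex) (auto simp: inj_on_def axis_eq_axis inner_axis)
    also have "\<dots> = (u$1 - l$1) * ((u$2 - l$2) * (u$3 - l$3))" unfolding UNIV_3 by simp
    finally show ?thesis using le by (simp add: ennreal_mult)
  qed
  finally show "emeasure (distr lborel borel tri) (box l u) = ennreal (\<Prod>b\<in>Basis. (u - l) \<bullet> b)" .
qed simp

lemma nn_integral_tri:
  assumes [measurable]: "F \<in> borel_measurable borel"
  shows "(\<integral>\<^sup>+p. F p \<partial>lborel) = (\<integral>\<^sup>+x. \<integral>\<^sup>+y. \<integral>\<^sup>+z. F (tri (x, y, z)) \<partial>lborel \<partial>lborel \<partial>lborel)"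
proof -
  have [measurable]: "tri \<in> borel_measurable borel" by (rule borel_measurable_continuous_onI[OF continuous_tri])
  have m3: "(\<lambda>p. F (tri p)) \<in> borel_measurable (lborel \<Otimes>\<^sub>M (lborel \<Otimes>\<^sub>M lborel))"
    unfolding lborel_prod by measurable
  have m2: "(\<lambda>p. F (tri (x, p))) \<in> borel_measurable (lborel \<Otimes>\<^sub>M lborel)" for x
    by (rule measurable_compose[OF _ m3]) measurable
  have "(\<integral>\<^sup>+p. F p \<partial>lborel) = (\<integral>\<^sup>+p. F (tri p) \<partial>lborel)"
    by (subst distr_tri[symmetric], rule nn_integral_distr) auto
  also have "\<dots> = (\<integral>\<^sup>+p. F (tri p) \<partial>(lborel \<Otimes>\<^sub>M (lborel \<Otimes>\<^sub>M lborel)))" by (simp add: lborel_prod)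
  also have "\<dots> = (\<integral>\<^sup>+x. \<integral>\<^sup>+p. F (tri (x, p)) \<partial>(lborel \<Otimes>\<^sub>M lborel) \<partial>lborel)"
    using m3 by (subst lborel_prod, subst sigma_finite_measure.nn_integral_fst[OF sigma_finite_lborel, symmetric])
      (auto simp: lborel_prod)
  also have "\<dots> = (\<integral>\<^sup>+x. \<integral>\<^sup>+y. \<integral>\<^sup>+z. F (tri (x, y, z)) \<partial>lborel \<partial>lborel \<partial>lborel)"
    using m2 by (subst lborel.nn_integral_fst[symmetric]) auto
  finally show ?thesis .
qed

text \<open>Total on \<open>ennreal\<close>, since the line integrals are not known to be finite
  when the root is taken.\<close>

definition esqrt :: "ennreal \<Rightarrow> ennreal" where
  "esqrt a = (if a = top then top else ennreal (sqrt (enn2real a)))"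

lemma esqrt_power2 [simp]: "(esqrt a)\<^sup>2 = a"
  by (cases a) (auto simp: esqrt_def ennreal_power power2_eq_square ennreal_mult[symmetric])

lemma measurable_esqrt [measurable]: "esqrt \<in> borel_measurable borel"
  unfolding esqrt_def[abs_def] by measurable

lemma ennreal_power2_le_imp_le:
  fixes a b :: ennreal
  assumes "a\<^sup>2 \<le> b\<^sup>2" shows "a \<le> b"
proof (cases b)
  case (real r)
  then have "a \<noteq> top" using assms by (auto simp: ennreal_power top_unique power2_eq_square ennreal_mult_top ennreal_mult[symmetric])
  then obtain q where "a = ennreal q" "q \<ge> 0" by (cases a) auto
  then show ?thesis using assms real by (auto simp: ennreal_power ennreal_leI abs_le_square_iff[symmetric])
qed auto

lemma Cauchy_Schwarz_esqrt:
  assumes [measurable]: "f \<in> borel_measurable M" "g \<in> borel_measurable M"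
  shows "(\<integral>\<^sup>+x. f x * g x \<partial>M) \<le> esqrt (\<integral>\<^sup>+x. (f x)\<^sup>2 \<partial>M) * esqrt (\<integral>\<^sup>+x. (g x)\<^sup>2 \<partial>M)"
  by (rule ennreal_power2_le_imp_le) (simp add: power_mult_distrib Cauchy_Schwarz_nn_integral)

text \<open>Cauchy-Schwarz in \<open>z\<close> separates \<open>a1\<close> from \<open>a2\<close>.
  What remains beside \<open>a3\<close> is a function of \<open>y\<close> times a function of
  \<open>x\<close>, so a second application in \<open>(x, y)\<close> factors completely.\<close>

lemma Loomis_Whitney:
  fixes a1 a2 a3 :: "real \<Rightarrow> real \<Rightarrow> ennreal"
  assumes m1: "(\<lambda>p. a1 (fst p) (snd p)) \<in> borel_measurable (lborel \<Otimes>\<^sub>M lborel)"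
    and m2: "(\<lambda>p. a2 (fst p) (snd p)) \<in> borel_measurable (lborel \<Otimes>\<^sub>M lborel)"
    and m3: "(\<lambda>p. a3 (fst p) (snd p)) \<in> borel_measurable (lborel \<Otimes>\<^sub>M lborel)"
  shows "(\<integral>\<^sup>+x. \<integral>\<^sup>+y. \<integral>\<^sup>+z. a3 x y * (a1 y z * a2 x z) \<partial>lborel \<partial>lborel \<partial>lborel)\<^sup>2 \<le>
    (\<integral>\<^sup>+x. \<integral>\<^sup>+y. (a3 x y)\<^sup>2 \<partial>lborel \<partial>lborel) * ((\<integral>\<^sup>+x. \<integral>\<^sup>+z. (a2 x z)\<^sup>2 \<partial>lborel \<partial>lborel) * (\<integral>\<^sup>+y. \<integral>\<^sup>+z. (a1 y z)\<^sup>2 \<partial>lborel \<partial>lborel))"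
proof -
  define b1 where "b1 y = esqrt (\<integral>\<^sup>+z. (a1 y z)\<^sup>2 \<partial>lborel)" for y
  define b2 where "b2 x = esqrt (\<integral>\<^sup>+z. (a2 x z)\<^sup>2 \<partial>lborel)" for x
  have s1 [measurable]: "a1 y \<in> borel_measurable lborel" for y
    using measurable_compose[OF measurable_Pair1' m1, of y] by simp
  have s2 [measurable]: "a2 y \<in> borel_measurable lborel" for y
    using measurable_compose[OF measurable_Pair1' m2, of y] by simp
  have s3 [measurable]: "a3 y \<in> borel_measurable lborel" for y
    using measurable_compose[OF measurable_Pair1' m3, of y] by simp
  have "(\<lambda>y. \<integral>\<^sup>+z. (a1 y z)\<^sup>2 \<partial>lborel) \<in> borel_measurable lborel"
    by (rule lborel.borel_measurable_nn_integral) (use m1 in \<open>simp add: split_beta'\<close>)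
  then have b1m [measurable]: "b1 \<in> borel_measurable lborel" unfolding b1_def by measurable
  have "(\<lambda>y. \<integral>\<^sup>+z. (a2 y z)\<^sup>2 \<partial>lborel) \<in> borel_measurable lborel"
    by (rule lborel.borel_measurable_nn_integral) (use m2 in \<open>simp add: split_beta'\<close>)
  then have b2m [measurable]: "b2 \<in> borel_measurable lborel" unfolding b2_def by measurable
  have inner: "(\<integral>\<^sup>+z. a3 x y * (a1 y z * a2 x z) \<partial>lborel) \<le> a3 x y * (b1 y * b2 x)" for x y
  proof -
    have "(\<integral>\<^sup>+z. a3 x y * (a1 y z * a2 x z) \<partial>lborel) = a3 x y * (\<integral>\<^sup>+z. a1 y z * a2 x z \<partial>lborel)"
      by (rule nn_integral_cmult) measurable
    also have "\<dots> \<le> a3 x y * (b1 y * b2 x)"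
      unfolding b1_def b2_def by (intro mult_left_mono Cauchy_Schwarz_esqrt) auto
    finally show ?thesis .
  qed
  have mb: "(\<lambda>p. b1 (snd p) * b2 (fst p)) \<in> borel_measurable (lborel \<Otimes>\<^sub>M lborel)" by measurable
  have "(\<integral>\<^sup>+x. \<integral>\<^sup>+y. \<integral>\<^sup>+z. a3 x y * (a1 y z * a2 x z) \<partial>lborel \<partial>lborel \<partial>lborel) \<le> (\<integral>\<^sup>+x. \<integral>\<^sup>+y. a3 x y * (b1 y * b2 x) \<partial>lborel \<partial>lborel)"
    by (intro nn_integral_mono inner)
  also have "\<dots> = (\<integral>\<^sup>+p. a3 (fst p) (snd p) * (b1 (snd p) * b2 (fst p)) \<partial>(lborel \<Otimes>\<^sub>M lborel))"
    using lborel.nn_integral_fst[OF borel_measurable_times_ennreal[OF m3 mb]] by simp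
  finally have "(\<integral>\<^sup>+x. \<integral>\<^sup>+y. \<integral>\<^sup>+z. a3 x y * (a1 y z * a2 x z) \<partial>lborel \<partial>lborel \<partial>lborel)\<^sup>2 \<le>
     (\<integral>\<^sup>+p. a3 (fst p) (snd p) * (b1 (snd p) * b2 (fst p)) \<partial>(lborel \<Otimes>\<^sub>M lborel))\<^sup>2"
    by (rule power_mono) auto
  also have "\<dots> \<le> (\<integral>\<^sup>+p. (a3 (fst p) (snd p))\<^sup>2 \<partial>(lborel \<Otimes>\<^sub>M lborel)) * (\<integral>\<^sup>+p. (b1 (snd p) * b2 (fst p))\<^sup>2 \<partial>(lborel \<Otimes>\<^sub>M lborel))"
    by (rule Cauchy_Schwarz_nn_integral[OF m3 mb])
  also have "(\<integral>\<^sup>+p. (a3 (fst p) (snd p))\<^sup>2 \<partial>(lborel \<Otimes>\<^sub>M lborel)) = (\<integral>\<^sup>+x. \<integral>\<^sup>+y. (a3 x y)\<^sup>2 \<partial>lborel \<partial>lborel)"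
    using lborel.nn_integral_fst[OF borel_measurable_power_ennreal[OF m3, of 2]] by simp
  also have "(\<integral>\<^sup>+p. (b1 (snd p) * b2 (fst p))\<^sup>2 \<partial>(lborel \<Otimes>\<^sub>M lborel)) = (\<integral>\<^sup>+x. \<integral>\<^sup>+y. (b1 y)\<^sup>2 * (b2 x)\<^sup>2 \<partial>lborel \<partial>lborel)"
    using lborel.nn_integral_fst[OF borel_measurable_power_ennreal[OF mb, of 2]] by (simp add: power_mult_distrib)
  also have "\<dots> = (\<integral>\<^sup>+x. (b2 x)\<^sup>2 \<partial>lborel) * (\<integral>\<^sup>+y. (b1 y)\<^sup>2 \<partial>lborel)"
  proof -
    have "(\<integral>\<^sup>+y. (b1 y)\<^sup>2 * (b2 x)\<^sup>2 \<partial>lborel) = (b2 x)\<^sup>2 * (\<integral>\<^sup>+y. (b1 y)\<^sup>2 \<partial>lborel)" for x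
      by (subst mult.commute, rule nn_integral_cmult) measurable
    then show ?thesis by (simp add: nn_integral_multc)
  qed
  finally show ?thesis by (simp add: b1_def b2_def)
qed

lemma abs_le_nn_integral_deriv:
  assumes d: "\<And>t. (q has_real_derivative q' t) (at t)" and c: "continuous_on UNIV q'" and z: "\<And>t. t < - R \<Longrightarrow> q t = 0"
  shows "ennreal \<bar>q b\<bar> \<le> (\<integral>\<^sup>+t. ennreal \<bar>q' t\<bar> \<partial>lborel)"
proof -
  define a where "a = min b (- R - 1)"
  have ab: "a \<le> b" and qa: "q a = 0" using z[of a] by (auto simp: a_def)
  have i: "integrable lborel (\<lambda>t. indicat_real {a..b} t *\<^sub>R q' t)"
    by (intro borel_integrable_compact compact_Icc continuous_on_subset[OF c]) auto
  have "(\<integral>t. q' t * indicator {a..b} t \<partial>lborel) = q b - q a"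
    by (rule integral_FTC_Icc_real[OF ab]) (use d c in \<open>auto simp: continuous_on_eq_continuous_at\<close>)
  then have "\<bar>q b\<bar> = \<bar>\<integral>t. indicat_real {a..b} t *\<^sub>R q' t \<partial>lborel\<bar>" by (simp add: qa mult.commute)
  also have "\<dots> \<le> (\<integral>t. \<bar>indicat_real {a..b} t *\<^sub>R q' t\<bar> \<partial>lborel)" by (rule integral_abs_bound)
  finally have "ennreal \<bar>q b\<bar> \<le> ennreal (\<integral>t. \<bar>indicat_real {a..b} t *\<^sub>R q' t\<bar> \<partial>lborel)" by (rule ennreal_leI)
  also have "\<dots> = (\<integral>\<^sup>+t. ennreal \<bar>indicat_real {a..b} t *\<^sub>R q' t\<bar> \<partial>lborel)"
    by (rule nn_integral_eq_integral[symmetric]) (use integrable_abs[OF i] in auto)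
  also have "\<dots> \<le> (\<integral>\<^sup>+t. ennreal \<bar>q' t\<bar> \<partial>lborel)"
    by (intro nn_integral_mono ennreal_leI) (auto simp: indicator_def)
  finally show ?thesis .
qed

lemma C1c_line_bound:
  assumes q: "q \<in> C1c" and z: "\<And>t. l t = l0 + t *\<^sub>R axis i (1::real)"
  shows "ennreal \<bar>q (l s)\<bar> \<le> (\<integral>\<^sup>+t. ennreal \<bar>partial i q (l t)\<bar> \<partial>lborel)"
proof -
  obtain R where R: "\<And>x. norm x > R \<Longrightarrow> q x = 0" using C1cE[OF q] by metis
  show ?thesis
  proof (rule abs_le_nn_integral_deriv[where R = "R + norm l0" and q = "\<lambda>t. q (l t)" and b = s])
    fix t
    have "((\<lambda>t. l0 + t *\<^sub>R axis i (1::real)) has_derivative (\<lambda>h. h *\<^sub>R axis i 1)) (at t)"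
      by (auto intro!: derivative_eq_intros)
    then have "(l has_derivative (\<lambda>h. h *\<^sub>R axis i 1)) (at t)" using z by (metis (no_types, lifting) ext)
    from has_derivative_compose[OF this C1_has_derivative[OF C1cD[OF q]]]
    show "((\<lambda>t. q (l t)) has_real_derivative partial i q (l t)) (at t)"
      by (simp add: has_field_derivative_def inner_axis mult.commute[of _ "partial i q (l t)"])
  next
    show "continuous_on UNIV (\<lambda>t. partial i q (l t))"
      unfolding z by (intro continuous_on_compose2[OF C1_continuous_partial[OF C1cD[OF q], of UNIV]] continuous_intros) auto
    fix t assume "t < - (R + norm l0)"
    moreover have "\<bar>t\<bar> = norm (t *\<^sub>R axis i 1 :: R3)" by simp
    moreover have "norm (t *\<^sub>R axis i 1 :: R3) \<le> norm (l t) + norm l0"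
      using norm_triangle_ineq4[of "l t" l0] by (simp add: z)
    ultimately show "q (l t) = 0" by (intro R) linarith
  qed
qed

text \<open>Along each coordinate line \<open>p ^ 4\<close> is bounded by the integral of the
  modulus of its derivative, so \<open>p ^ 2\<close> is bounded by the root of such an integral in
  each of the three directions. The product of the three bounds is a Loomis-Whitney integrand above
  \<open>p ^ 6\<close>. The exponent 4 is the one that closes the argument in
  \<open>Sobolev_C1c\<close>: the derivative of \<open>p ^ 4\<close> contains \<open>p ^ 3\<close>,
  whose square is again \<open>p ^ 6\<close>.\<close>

lemma Gagliardo_Nirenberg_C1c:
  assumes p: "p \<in> C1c"
  shows "(\<integral>\<^sup>+x. ennreal ((p x)\<^sup>2 ^ 3) \<partial>lborel)\<^sup>2 \<le>
    (\<integral>\<^sup>+x. ennreal \<bar>partial 3 (\<lambda>x. p x ^ 4) x\<bar> \<partial>lborel) * ((\<integral>\<^sup>+x. ennreal \<bar>partial 2 (\<lambda>x. p x ^ 4) x\<bar> \<partial>lborel) * (\<integral>\<^sup>+x. ennreal \<bar>partial 1 (\<lambda>x. p x ^ 4) x\<bar> \<partial>lborel))"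
proof -
  let ?q = "\<lambda>x. p x ^ 4"
  have q: "?q \<in> C1c"
    using C1c_mult[OF C1cD[OF p] C1c_mult[OF C1cD[OF p] C1c_mult[OF C1cD[OF p] p]]] by (simp add: power4_eq_xxxx mult.assoc)
  define G where "G i x y z = ennreal \<bar>partial i ?q (tri (x, y, z))\<bar>" for i x y z
  have Gm0: "(\<lambda>x. ennreal \<bar>partial i ?q x\<bar>) \<in> borel_measurable borel" for i
  proof -
    have [measurable]: "partial i ?q \<in> borel_measurable borel"
      by (rule borel_measurable_continuous_onI[OF C1_continuous_partial[OF C1cD[OF q]]])
    show ?thesis by measurable
  qed
  have tm: "tri \<in> borel_measurable borel" by (rule borel_measurable_continuous_onI[OF continuous_tri])
  have Gm: "(\<lambda>p. G i (fst p) (fst (snd p)) (snd (snd p))) \<in> borel_measurable (lborel \<Otimes>\<^sub>M (lborel \<Otimes>\<^sub>M lborel))" for i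
    unfolding G_def lborel_prod using measurable_compose[OF tm Gm0] by simp
  have Gm': "(\<lambda>p. G i (f p) (g p) (h p)) \<in> borel_measurable M"
    if [measurable]: "f \<in> borel_measurable M" "g \<in> borel_measurable M" "h \<in> borel_measurable M" for i f g h and M :: "'a measure"
  proof -
    have "(\<lambda>p. (f p, (g p, h p))) \<in> M \<rightarrow>\<^sub>M (lborel \<Otimes>\<^sub>M (lborel \<Otimes>\<^sub>M lborel))" by measurable
    from measurable_compose[OF this Gm] show ?thesis by simp
  qed
  define A1 where "A1 y z = (\<integral>\<^sup>+x. G 1 x y z \<partial>lborel)" for y z
  define A2 where "A2 x z = (\<integral>\<^sup>+y. G 2 x y z \<partial>lborel)" for x z
  define A3 where "A3 x y = (\<integral>\<^sup>+z. G 3 x y z \<partial>lborel)" for x y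
  have m1: "(\<lambda>p. esqrt (A1 (fst p) (snd p))) \<in> borel_measurable (lborel \<Otimes>\<^sub>M lborel)"
    unfolding A1_def by (intro measurable_compose[OF _ measurable_esqrt] lborel.borel_measurable_nn_integral)
      (simp add: split_beta', intro Gm'; measurable)
  have m2: "(\<lambda>p. esqrt (A2 (fst p) (snd p))) \<in> borel_measurable (lborel \<Otimes>\<^sub>M lborel)"
    unfolding A2_def by (intro measurable_compose[OF _ measurable_esqrt] lborel.borel_measurable_nn_integral)
      (simp add: split_beta', intro Gm'; measurable)
  have m3: "(\<lambda>p. esqrt (A3 (fst p) (snd p))) \<in> borel_measurable (lborel \<Otimes>\<^sub>M lborel)"
    unfolding A3_def by (intro measurable_compose[OF _ measurable_esqrt] lborel.borel_measurable_nn_integral)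
      (simp add: split_beta', intro Gm'; measurable)
  have b1: "ennreal ((p (tri (x,y,z)))\<^sup>2) \<le> esqrt (A1 y z)" for x y z
  proof (rule ennreal_power2_le_imp_le)
    have "ennreal \<bar>?q (tri (x,y,z))\<bar> \<le> A1 y z" unfolding A1_def G_def
      by (rule C1c_line_bound[OF q, of "\<lambda>t. tri (t,y,z)" "tri (0,y,z)"]) (simp add: tri_def)
    then show "(ennreal ((p (tri (x,y,z)))\<^sup>2))\<^sup>2 \<le> (esqrt (A1 y z))\<^sup>2" by (simp add: ennreal_power flip: power_mult)
  qed
  have b2: "ennreal ((p (tri (x,y,z)))\<^sup>2) \<le> esqrt (A2 x z)" for x y z
  proof (rule ennreal_power2_le_imp_le)
    have "ennreal \<bar>?q (tri (x,y,z))\<bar> \<le> A2 x z" unfolding A2_def G_def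
      by (rule C1c_line_bound[OF q, of "\<lambda>t. tri (x,t,z)" "tri (x,0,z)"]) (simp add: tri_def)
    then show "(ennreal ((p (tri (x,y,z)))\<^sup>2))\<^sup>2 \<le> (esqrt (A2 x z))\<^sup>2" by (simp add: ennreal_power flip: power_mult)
  qed
  have b3: "ennreal ((p (tri (x,y,z)))\<^sup>2) \<le> esqrt (A3 x y)" for x y z
  proof (rule ennreal_power2_le_imp_le)
    have "ennreal \<bar>?q (tri (x,y,z))\<bar> \<le> A3 x y" unfolding A3_def G_def
      by (rule C1c_line_bound[OF q, of "\<lambda>t. tri (x,y,t)" "tri (x,y,0)"]) (simp add: tri_def)
    then show "(ennreal ((p (tri (x,y,z)))\<^sup>2))\<^sup>2 \<le> (esqrt (A3 x y))\<^sup>2" by (simp add: ennreal_power flip: power_mult)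
  qed
  have pm: "(\<lambda>x. ennreal ((p x)\<^sup>2 ^ 3)) \<in> borel_measurable borel"
  proof -
    have [measurable]: "p \<in> borel_measurable borel"
      by (rule borel_measurable_continuous_onI[OF C1_continuous[OF C1cD[OF p]]])
    show ?thesis by measurable
  qed
  have "(\<integral>\<^sup>+x. ennreal ((p x)\<^sup>2 ^ 3) \<partial>lborel) \<le>
     (\<integral>\<^sup>+x. \<integral>\<^sup>+y. \<integral>\<^sup>+z. esqrt (A3 x y) * (esqrt (A1 y z) * esqrt (A2 x z)) \<partial>lborel \<partial>lborel \<partial>lborel)"
    unfolding nn_integral_tri[OF pm]
  proof (intro nn_integral_mono)
    fix x y z
    let ?e = "ennreal ((p (tri (x,y,z)))\<^sup>2)"
    have "ennreal ((p (tri (x,y,z)))\<^sup>2 ^ 3) = ?e * (?e * ?e)"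
      by (simp only: power3_eq_cube ennreal_mult zero_le_power2 mult_nonneg_nonneg mult.assoc)
    also have "\<dots> \<le> esqrt (A3 x y) * (esqrt (A1 y z) * esqrt (A2 x z))" by (intro mult_mono b1 b2 b3) auto
    finally show "ennreal ((p (tri (x,y,z)))\<^sup>2 ^ 3) \<le> esqrt (A3 x y) * (esqrt (A1 y z) * esqrt (A2 x z))" .
  qed
  then have "(\<integral>\<^sup>+x. ennreal ((p x)\<^sup>2 ^ 3) \<partial>lborel)\<^sup>2 \<le>
     (\<integral>\<^sup>+x. \<integral>\<^sup>+y. \<integral>\<^sup>+z. esqrt (A3 x y) * (esqrt (A1 y z) * esqrt (A2 x z)) \<partial>lborel \<partial>lborel \<partial>lborel)\<^sup>2"
    by (rule power_mono) auto
  also have "\<dots> \<le> (\<integral>\<^sup>+x. \<integral>\<^sup>+y. (esqrt (A3 x y))\<^sup>2 \<partial>lborel \<partial>lborel) * ((\<integral>\<^sup>+x. \<integral>\<^sup>+z. (esqrt (A2 x z))\<^sup>2 \<partial>lborel \<partial>lborel) * (\<integral>\<^sup>+y. \<integral>\<^sup>+z. (esqrt (A1 y z))\<^sup>2 \<partial>lborel \<partial>lborel))"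
    by (rule Loomis_Whitney[OF m1 m2 m3])
  also have "(\<integral>\<^sup>+x. \<integral>\<^sup>+y. (esqrt (A3 x y))\<^sup>2 \<partial>lborel \<partial>lborel) = (\<integral>\<^sup>+x. ennreal \<bar>partial 3 ?q x\<bar> \<partial>lborel)"
    unfolding nn_integral_tri[OF Gm0] by (simp add: A3_def G_def)
  also have "(\<integral>\<^sup>+x. \<integral>\<^sup>+z. (esqrt (A2 x z))\<^sup>2 \<partial>lborel \<partial>lborel) = (\<integral>\<^sup>+x. ennreal \<bar>partial 2 ?q x\<bar> \<partial>lborel)"
  proof -
    have "(\<integral>\<^sup>+z. \<integral>\<^sup>+y. G 2 x y z \<partial>lborel \<partial>lborel) = (\<integral>\<^sup>+y. \<integral>\<^sup>+z. G 2 x y z \<partial>lborel \<partial>lborel)" for x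
      by (rule lborel_pair.Fubini') (simp add: split_beta', intro Gm'; measurable)
    then show ?thesis unfolding nn_integral_tri[OF Gm0] G_def[symmetric] by (simp add: A2_def)
  qed
  also have "(\<integral>\<^sup>+y. \<integral>\<^sup>+z. (esqrt (A1 y z))\<^sup>2 \<partial>lborel \<partial>lborel) = (\<integral>\<^sup>+x. ennreal \<bar>partial 1 ?q x\<bar> \<partial>lborel)"
  proof -
    have "(\<integral>\<^sup>+z. \<integral>\<^sup>+x. G 1 x y z \<partial>lborel \<partial>lborel) = (\<integral>\<^sup>+x. \<integral>\<^sup>+z. G 1 x y z \<partial>lborel \<partial>lborel)" for y
      by (rule lborel_pair.Fubini') (simp add: split_beta', intro Gm'; measurable)
    moreover have "(\<integral>\<^sup>+y. \<integral>\<^sup>+x. \<integral>\<^sup>+z. G 1 x y z \<partial>lborel \<partial>lborel \<partial>lborel) = (\<integral>\<^sup>+x. \<integral>\<^sup>+y. \<integral>\<^sup>+z. G 1 x y z \<partial>lborel \<partial>lborel \<partial>lborel)"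
      by (rule lborel_pair.Fubini')
        (simp add: split_beta', intro lborel.borel_measurable_nn_integral, simp add: split_beta', intro Gm'; measurable)
    ultimately show ?thesis unfolding nn_integral_tri[OF Gm0] G_def[symmetric] by (simp add: A1_def)
  qed
  finally show ?thesis .
qed

text \<open>With \<open>I\<close> for the integral of \<open>p ^ 6\<close>, Cauchy-Schwarz turns
  \<open>I^2 \<le> 64 * J 3 * J 2 * J 1\<close> into
  \<open>I^4 \<le> 64^2 * I^3 * D 3 * D 2 * D 1\<close>, and \<open>I^3\<close> cancels. Hence the
  constant \<open>4096 = 64^2\<close>.\<close>

lemma Sobolev_C1c:
  assumes p: "p \<in> C1c"
  shows "(LINT x|lebesgue. p x ^ 6) \<le> 4096 * ((LINT x|lebesgue. (partial 3 p x)\<^sup>2) * ((LINT x|lebesgue. (partial 2 p x)\<^sup>2) * (LINT x|lebesgue. (partial 1 p x)\<^sup>2)))"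
proof -
  define I where "I = (LINT x|lebesgue. p x ^ 6)"
  define D where "D i = (LINT x|lebesgue. (partial i p x)\<^sup>2)" for i
  define J where "J i = (LINT x|lebesgue. \<bar>p x ^ 3 * partial i p x\<bar>)" for i
  have pL: "partial i p \<in> L2" for i by (rule Cc_L2[OF C1c_partial_Cc[OF p]])
  have p3: "(\<lambda>x. p x ^ 3) \<in> Cc"
    using C1c_Cc[OF C1c_mult[OF C1cD[OF p] C1c_mult[OF C1cD[OF p] p]]] by (simp add: power3_eq_cube mult.assoc)
  have p3L: "(\<lambda>x. p x ^ 3) \<in> L2" by (rule Cc_L2[OF p3])
  have p6: "((p x)\<^sup>2) ^ 3 = p x ^ 6" "(p x ^ 3)\<^sup>2 = p x ^ 6" for x by (simp_all flip: power_mult)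
  have p6i: "integrable lebesgue (\<lambda>x. p x ^ 6)" using L2_square[OF p3L] by (simp add: p6)
  have I0: "I \<ge> 0" and D0: "D i \<ge> 0" and J0: "J i \<ge> 0" for i unfolding I_def D_def J_def by simp_all
  have JD: "(J i)\<^sup>2 \<le> I * D i" for i
    using L2_Cauchy_Schwarz[OF p3L pL[of i]] unfolding J_def I_def D_def p6 .
  have Ie: "(\<integral>\<^sup>+x. ennreal ((p x)\<^sup>2 ^ 3) \<partial>lborel) = ennreal I"
    using nn_integral_eq_integral[OF p6i] unfolding I_def p6 by (simp add: nn_integral_completion)
  have q: "partial i (\<lambda>x. p x ^ 4) x = 4 * (p x ^ 3 * partial i p x)" for i x
  proof -
    have "((\<lambda>t::real. t ^ 4) has_real_derivative 4 * t ^ 3) (at t)" for t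
      by (auto intro!: derivative_eq_intros)
    from C1_compose(2)[OF C1cD[OF p] this] show ?thesis
      by (simp add: fun_eq_iff vec_eq_iff continuous_intros)
  qed
  have Je: "(\<integral>\<^sup>+x. ennreal \<bar>partial i (\<lambda>x. p x ^ 4) x\<bar> \<partial>lborel) = ennreal (4 * J i)" for i
  proof -
    have "integrable lebesgue (\<lambda>x. 4 * \<bar>p x ^ 3 * partial i p x\<bar>)"
      by (intro integrable_mult_right integrable_abs L2_mult_integrable p3L pL)
    from nn_integral_eq_integral[OF this] have "(\<integral>\<^sup>+x. ennreal (4 * \<bar>p x ^ 3 * partial i p x\<bar>) \<partial>lebesgue) = ennreal (4 * J i)"
      by (simp add: J_def)
    then show ?thesis by (simp add: q abs_mult nn_integral_completion)
  qed
  have "(ennreal I)\<^sup>2 \<le> ennreal (4 * J 3) * (ennreal (4 * J 2) * ennreal (4 * J 1))"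
    using Gagliardo_Nirenberg_C1c[OF p] unfolding Ie Je .
  then have "ennreal (I\<^sup>2) \<le> ennreal ((4 * J 3) * ((4 * J 2) * (4 * J 1)))"
    by (simp only: ennreal_power[OF I0] ennreal_mult J0 mult_nonneg_nonneg zero_le_numeral)
  then have "I\<^sup>2 \<le> (4 * J 3) * ((4 * J 2) * (4 * J 1))" using I0 J0 by (simp add: ennreal_le_iff)
  then have "(I\<^sup>2)\<^sup>2 \<le> ((4 * J 3) * ((4 * J 2) * (4 * J 1)))\<^sup>2" by (intro power_mono) auto
  also have "\<dots> = 4096 * ((J 3)\<^sup>2 * ((J 2)\<^sup>2 * (J 1)\<^sup>2))" by (simp add: power_mult_distrib)
  also have "\<dots> \<le> 4096 * ((I * D 3) * ((I * D 2) * (I * D 1)))"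
    by (intro mult_left_mono mult_mono JD) (use I0 D0 in auto)
  finally have *: "I ^ 3 * I \<le> I ^ 3 * (4096 * (D 3 * (D 2 * D 1)))"
    by (simp add: power2_eq_square power3_eq_cube algebra_simps)
  show ?thesis
  proof (cases "I = 0")
    case True then show ?thesis using D0 by (simp add: I_def[symmetric] D_def[symmetric])
  next
    case False
    then have "I ^ 3 > 0" using I0 by simp
    then show ?thesis using * by (simp add: I_def[symmetric] D_def[symmetric])
  qed
qed

definition H1_sq :: "(R3 \<Rightarrow> real) \<Rightarrow> real" where
  "H1_sq u = (LINT x|lebesgue. (u x)\<^sup>2) + (\<Sum>i\<in>UNIV. LINT x|lebesgue. (weak_partial i u x)\<^sup>2)"

lemma H1_sq_nonneg: "H1_sq u \<ge> 0"
  unfolding H1_sq_def by (intro add_nonneg_nonneg sum_nonneg integral_nonneg_AE) auto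

lemma H1_sq_partial: "(LINT x|lebesgue. (weak_partial i u x)\<^sup>2) \<le> H1_sq u"
proof -
  have "(LINT x|lebesgue. (weak_partial i u x)\<^sup>2) \<le> (\<Sum>i\<in>UNIV. LINT x|lebesgue. (weak_partial i u x)\<^sup>2)"
    by (rule member_le_sum) auto
  moreover have "(LINT x|lebesgue. (u x)\<^sup>2) \<ge> 0" by simp
  ultimately show ?thesis unfolding H1_sq_def by linarith
qed

lemma H1_sq_L2: "(LINT x|lebesgue. (u x)\<^sup>2) \<le> H1_sq u"
  unfolding H1_sq_def by (simp add: sum_nonneg)

text \<open>Fatou's lemma along test functions that converge almost everywhere. The constant is
  \<open>4096 * 4 ^ 3\<close>, where 4 compares the squared norms of the approximating derivatives
  with \<open>H1_sq u\<close>.\<close>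

lemma Sobolev_H1:
  assumes u: "u \<in> H1"
  shows "integrable lebesgue (\<lambda>x. u x ^ 6)" "(LINT x|lebesgue. u x ^ 6) \<le> 262144 * H1_sq u ^ 3"
proof -
  have um [measurable]: "u \<in> borel_measurable lebesgue" using u H1_L2 L2_measurable by blast
  let ?N = "H1_sq u"
  have main: "(\<integral>\<^sup>+x. ennreal (u x ^ 6) \<partial>lebesgue) \<le> ennreal (262144 * ?N ^ 3)"
  proof (cases "?N = 0")
    case True
    then have "(LINT x|lebesgue. (u x)\<^sup>2) = 0" using H1_sq_L2[of u] by (simp add: order_antisym)
    then have "AE x in lebesgue. (u x)\<^sup>2 = 0"
      using integral_nonneg_eq_0_iff_AE[OF L2_square[OF H1_L2[OF u]]] by simp
    then have "(\<integral>\<^sup>+x. ennreal (u x ^ 6) \<partial>lebesgue) = (\<integral>\<^sup>+x. 0 \<partial>(lebesgue :: R3 measure))"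
      by (intro nn_integral_cong_AE) auto
    then show ?thesis by simp
  next
    case False
    then have N: "?N > 0" using H1_sq_nonneg[of u] by simp
    \<comment> \<open>The geometric part gives convergence almost everywhere; the bound by
      \<open>?N\<close> keeps the squared norms of the derivatives below \<open>4 * ?N\<close>. A
      positive tolerance requires \<open>?N > 0\<close>, whence the separate case above.\<close>
    define dl where "dl n = min ?N ((1/2) ^ n)" for n :: nat
    have dl: "dl n > 0" for n using N by (simp add: dl_def)
    have "\<exists>p. p \<in> C1c \<and> (LINT x|lebesgue. (u x - p x)\<^sup>2) < dl n \<and>
       (\<forall>i. (LINT x|lebesgue. (weak_partial i u x - partial i p x)\<^sup>2) < dl n)" for n
      by (rule H1_dense[OF u dl[of n]]) (use test_functions_C1c in blast)
    then have "\<forall>n. \<exists>p. p \<in> C1c \<and> (LINT x|lebesgue. (u x - p x)\<^sup>2) < dl n \<and>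
       (\<forall>i. (LINT x|lebesgue. (weak_partial i u x - partial i p x)\<^sup>2) < dl n)" by blast
    from choice[OF this] obtain p where p: "\<And>n. p n \<in> C1c" "\<And>n. (LINT x|lebesgue. (u x - p n x)\<^sup>2) < dl n"
       "\<And>n i. (LINT x|lebesgue. (weak_partial i u x - partial i (p n) x)\<^sup>2) < dl n" by blast
    have pm [measurable]: "p n \<in> borel_measurable lebesgue" for n using Cc_measurable[OF C1c_Cc[OF p(1)]] .
    have "AE x in lebesgue. (\<lambda>n. u x - p n x) \<longlonglongrightarrow> 0"
      by (rule AE_tendsto_0_if_geometric[OF L2_diff[OF H1_L2[OF u] Cc_L2[OF C1c_Cc[OF p(1)]]]])
        (use p(2) in \<open>auto simp: dl_def intro: less_imp_le\<close>)
    then have ae: "AE x in lebesgue. ennreal (u x ^ 6) \<le> liminf (\<lambda>n. ennreal (p n x ^ 6))"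
    proof eventually_elim
      case (elim x)
      have "(\<lambda>n. u x - (u x - p n x)) \<longlonglongrightarrow> u x - 0" by (intro tendsto_intros elim)
      then have "(\<lambda>n. ennreal (p n x ^ 6)) \<longlonglongrightarrow> ennreal (u x ^ 6)"
        by (intro tendsto_intros) simp
      from lim_imp_Liminf[OF trivial_limit_sequentially this] show ?case by (simp only: order_refl)
    qed
    have bn: "(\<integral>\<^sup>+x. ennreal (p n x ^ 6) \<partial>lebesgue) \<le> ennreal (262144 * ?N ^ 3)" for n
    proof -
      have pL: "partial i (p n) \<in> L2" for i by (rule Cc_L2[OF C1c_partial_Cc[OF p(1)]])
      have b: "(LINT x|lebesgue. (partial i (p n) x)\<^sup>2) \<le> 4 * ?N" for i
      proof -
        let ?w = "weak_partial i u"
        have wL: "?w \<in> L2" by (rule H1_weak_partial_L2[OF u])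
        have i: "integrable lebesgue (\<lambda>x. (?w x)\<^sup>2)" "integrable lebesgue (\<lambda>x. (?w x - partial i (p n) x)\<^sup>2)"
          using L2_square[OF wL] L2_square[OF L2_diff[OF wL pL]] by auto
        have "(LINT x|lebesgue. (partial i (p n) x)\<^sup>2) \<le> (LINT x|lebesgue. 2 * (?w x)\<^sup>2 + 2 * (?w x - partial i (p n) x)\<^sup>2)"
        proof (rule integral_mono[OF L2_square[OF pL]])
          show "(partial i (p n) x)\<^sup>2 \<le> 2 * (?w x)\<^sup>2 + 2 * (?w x - partial i (p n) x)\<^sup>2" for x
            using zero_le_power2[of "?w x + (?w x - partial i (p n) x)"] by (simp add: power2_eq_square algebra_simps)
        qed (use i in simp)
        also have "\<dots> = 2 * (LINT x|lebesgue. (?w x)\<^sup>2) + 2 * (LINT x|lebesgue. (?w x - partial i (p n) x)\<^sup>2)" using i by simp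
        also have "\<dots> \<le> 4 * ?N" using H1_sq_partial[of i u] p(3)[of i n] by (auto simp: dl_def)
        finally show ?thesis .
      qed
      have p3: "(\<lambda>x. p n x ^ 3) \<in> L2"
        using Cc_L2[OF C1c_Cc[OF C1c_mult[OF C1cD[OF p(1)] C1c_mult[OF C1cD[OF p(1)] p(1)]]], of n n n] by (simp add: power3_eq_cube mult.assoc)
      have p6i: "integrable lebesgue (\<lambda>x. p n x ^ 6)" using L2_square[OF p3] by (simp flip: power_mult)
      have "(LINT x|lebesgue. p n x ^ 6) \<le> 4096 * ((4 * ?N) * ((4 * ?N) * (4 * ?N)))"
        by (rule order_trans[OF Sobolev_C1c[OF p(1)]]) (intro mult_left_mono mult_mono b, use H1_sq_nonneg[of u] in auto)
      then have "(LINT x|lebesgue. p n x ^ 6) \<le> 262144 * ?N ^ 3" by (simp add: power3_eq_cube)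
      then show ?thesis using nn_integral_eq_integral[OF p6i] by (simp add: ennreal_leI)
    qed
    have "(\<integral>\<^sup>+x. ennreal (u x ^ 6) \<partial>lebesgue) \<le> (\<integral>\<^sup>+x. liminf (\<lambda>n. ennreal (p n x ^ 6)) \<partial>lebesgue)"
      by (rule nn_integral_mono_AE[OF ae])
    also have "\<dots> \<le> liminf (\<lambda>n. \<integral>\<^sup>+x. ennreal (p n x ^ 6) \<partial>lebesgue)"
      by (rule nn_integral_liminf) measurable
    also have "\<dots> \<le> ennreal (262144 * ?N ^ 3)"
      by (rule order_trans[OF Liminf_mono[OF always_eventually]], rule allI, rule bn) (simp add: Liminf_const)
    finally show ?thesis .
  qed
  show i: "integrable lebesgue (\<lambda>x. u x ^ 6)"
    by (rule integrableI_bounded) (use main in \<open>auto simp: le_less_trans\<close>)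
  have "ennreal (LINT x|lebesgue. u x ^ 6) \<le> ennreal (262144 * ?N ^ 3)"
    using main nn_integral_eq_integral[OF i] by simp
  then show "(LINT x|lebesgue. u x ^ 6) \<le> 262144 * ?N ^ 3"
    using H1_sq_nonneg[of u] by (simp add: ennreal_le_iff)
qed

section \<open>Rotations about the axis\<close>

definition rot :: "real \<Rightarrow> R3 \<Rightarrow> R3" where
  "rot t x = tri (cos t * x$1 - sin t * x$2, sin t * x$1 + cos t * x$2, x$3)"

lemma rot_nth [simp]: "rot t x $ 1 = cos t * x$1 - sin t * x$2" "rot t x $ 2 = sin t * x$1 + cos t * x$2" "rot t x $ 3 = x$3"
  by (simp_all add: rot_def)

lemma rot_rot: "rot s (rot t x) = rot (s + t) x"
  by (simp add: vec_eq_iff forall_3 sin_add cos_add algebra_simps)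

lemma rot_0 [simp]: "rot 0 x = x" "rot (2 * pi) x = x"
  by (simp_all add: vec_eq_iff forall_3)

lemma rot_radius [simp]: "radius (rot t x) = radius x"
proof -
  have "(cos t * x$1 - sin t * x$2)\<^sup>2 + (sin t * x$1 + cos t * x$2)\<^sup>2 = ((sin t)\<^sup>2 + (cos t)\<^sup>2) * ((x$1)\<^sup>2 + (x$2)\<^sup>2)"
    unfolding power2_eq_square by algebra
  then show ?thesis by (simp add: radius_def)
qed

lemma orthogonal_transformation_rot: "orthogonal_transformation (rot t)"
proof -
  have "linear (rot t)"
    by (rule linearI) (simp_all add: vec_eq_iff forall_3 algebra_simps)
  moreover have "rot t v \<bullet> rot t w = v \<bullet> w" for v w
  proof -
    have "rot t v \<bullet> rot t w = ((sin t)\<^sup>2 + (cos t)\<^sup>2) * (v$1 * w$1 + v$2 * w$2) + v$3 * w$3"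
      unfolding power2_eq_square by (simp add: inner_vec_def sum_3) algebra
    then show ?thesis by (simp add: inner_vec_def sum_3)
  qed
  ultimately show ?thesis by (simp add: orthogonal_transformation_def)
qed

lemma norm_rot [simp]: "norm (rot t x) = norm x"
  using orthogonal_transformation_rot orthogonal_transformation_norm by blast

lemma continuous_rot: "continuous_on S (\<lambda>p. rot (fst p) (snd p))" "continuous_on S' (rot t)"
  unfolding rot_def tri_def by (auto intro!: continuous_intros)

lemma distr_rot: "distr lborel borel (rot t) = lborel"
proof (rule lborel_eqI[symmetric])
  have m [measurable]: "rot t \<in> borel_measurable borel" by (rule borel_measurable_continuous_onI[OF continuous_rot(2)])
  fix l u :: R3 assume lu: "\<And>b. b \<in> Basis \<Longrightarrow> l \<bullet> b \<le> u \<bullet> b"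
  have v: "rot t -` box l u = rot (-t) ` box l u"
  proof (intro set_eqI iffI)
    fix x assume "x \<in> rot t -` box l u"
    then show "x \<in> rot (-t) ` box l u" by (intro image_eqI[of _ _ "rot t x"]) (auto simp: rot_rot)
  qed (auto simp: rot_rot)
  have S: "box l u \<in> lmeasurable" by simp
  have "emeasure (distr lborel borel (rot t)) (box l u) = emeasure lborel (rot (-t) ` box l u)"
    by (subst emeasure_distr) (auto simp: v)
  also have "\<dots> = emeasure lebesgue (rot (-t) ` box l u)"
    using measurable_sets[OF m, of "box l u"] v by simp
  also have "\<dots> = ennreal (measure lebesgue (rot (-t) ` box l u))"
    by (intro emeasure_eq_measure2 measurable_orthogonal_image[OF orthogonal_transformation_rot S])
  also have "\<dots> = ennreal (measure lebesgue (box l u))"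
    by (simp add: measure_orthogonal_image[OF orthogonal_transformation_rot S])
  also have "\<dots> = emeasure lebesgue (box l u)"
    by (rule emeasure_eq_measure2[OF S, symmetric])
  also have "\<dots> = ennreal (\<Prod>b\<in>Basis. (u - l) \<bullet> b)" using lu by simp
  finally show "emeasure (distr lborel borel (rot t)) (box l u) = ennreal (\<Prod>b\<in>Basis. (u - l) \<bullet> b)" .
qed simp

lemma measure_preserving_rot: "rot t \<in> lebesgue \<rightarrow>\<^sub>M lebesgue" "distr lebesgue lebesgue (rot t) = lebesgue"
  using measure_preserving_lebesgue[OF borel_measurable_continuous_onI[OF continuous_rot(2)] distr_rot] by auto

lemma lebesgue_integral_rot:
  assumes "f \<in> borel_measurable lebesgue"
  shows "(LINT x|lebesgue. f (rot t x) :: real) = (LINT x|lebesgue. f x)"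
  using integral_distr[OF measure_preserving_rot(1)[of t], of f] assms
  by (simp add: measure_preserving_rot(2))

lemma AE_rot:
  assumes "AE x in lebesgue. P x" shows "AE x in lebesgue. P (rot t x)"
proof -
  have "AE x in distr lebesgue lebesgue (rot t). P x"
    unfolding measure_preserving_rot(2) by (rule assms)
  then show ?thesis by (rule AE_distrD[OF measure_preserving_rot(1)])
qed

lemma AE_radius_pos: "AE x in lebesgue. radius x > 0"
proof (rule AE_I')
  show "{x::R3. x $ 1 = 0} \<in> null_sets lebesgue"
    using negligible_standard_hyperplane_cart[where k = 1] by (simp add: negligible_iff_null_sets)
  show "{x \<in> space lebesgue. \<not> radius x > 0} \<subseteq> {x. x $ 1 = 0}"
    by (auto simp: radius_def not_less real_sqrt_le_0_iff sum_power2_le_zero_iff)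
qed

text \<open>The exceptional null set may depend on the angle, which suits functions known up to null
  sets; Fubini's theorem in \<open>rot_average\<close> copes with the uncountably many
  angles.\<close>

definition rot_inv :: "(R3 \<Rightarrow> 'a) \<Rightarrow> bool" where
  "rot_inv g \<longleftrightarrow> (\<forall>t. AE x in lebesgue. g (rot t x) = g x)"

lemma cyl_sym_rot_inv: assumes "cyl_sym u" shows "rot_inv u"
  unfolding rot_inv_def
proof
  fix t
  obtain p where p: "AE x in lebesgue. u x = p (radius x) (x $ 3)" using assms by (auto simp: cyl_sym_def)
  show "AE x in lebesgue. u (rot t x) = u x"
    using p AE_rot[OF p, of t] by eventually_elim simp
qed

text \<open>A rotation of the variable changes neither \<open>g\<close> nor the measure, so the
  integral of \<open>g * p\<close> equals that of \<open>g\<close> times any rotated copy of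
  \<open>p\<close>; integrating over the angle and exchanging the order replaces \<open>p\<close> by
  its mean \<open>a\<close>. The mean is prescribed off the axis only, and \<open>p\<close> is
  merely Borel and bounded, so quotients by powers of \<open>radius\<close> are admissible.\<close>

lemma rot_average:
  assumes g: "locally_integrable g" "rot_inv g" and p: "p \<in> borel_measurable borel" "\<And>x. \<bar>p x\<bar> \<le> B" "\<And>x. norm x > R \<Longrightarrow> p x = 0"
    and a: "\<And>x. radius x > 0 \<Longrightarrow> ((\<lambda>t. p (rot t x)) has_integral 2 * pi * a x) {0..2*pi}"
  shows "integrable lebesgue (\<lambda>x. g x * p x)" "integrable lebesgue (\<lambda>x. g x * a x)"
    "(LINT x|lebesgue. g x * p x) = (LINT x|lebesgue. g x * a x)"
proof -
  note [measurable] = p(1)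
  have pl: "p \<in> borel_measurable lebesgue" using p(1) by (simp add: measurable_completion)
  have gm: "g \<in> borel_measurable lebesgue" by (rule locally_integrable_measurable[OF g(1)])
  show gp: "integrable lebesgue (\<lambda>x. g x * p x)" by (rule integrable_cutoff[OF g(1) pl p(2,3)])
  obtain g' where g' [measurable]: "g' \<in> borel_measurable lborel" and "AE x in lborel. g x = g' x"
    using completion_ex_borel_measurable_real[OF gm] by blast
  then have ae: "AE x in lebesgue. g x = g' x" using AE_completion by blast
  \<comment> \<open>The Borel representative \<open>g'\<close> and the indicator of the angles turn
    the double integral into one over a product of two Borel measures.\<close>
  define f where "f = (\<lambda>z::R3 \<times> real. g' (fst z) * (indicat_real {0..2*pi} (snd z) * p (rot (snd z) (fst z))))"
  have rm: "(\<lambda>z. rot (snd z) (fst z)) \<in> borel_measurable (lborel \<Otimes>\<^sub>M lborel)"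
  proof -
    have "continuous_on UNIV (\<lambda>z::R3 \<times> real. rot (snd z) (fst z))"
      unfolding rot_def tri_def by (intro continuous_intros)
    then show ?thesis unfolding lborel_prod by (simp add: borel_measurable_continuous_onI)
  qed
  have pm [measurable]: "(\<lambda>z. p (rot (snd z) (fst z))) \<in> borel_measurable (lborel \<Otimes>\<^sub>M lborel)"
    by (rule measurable_compose[OF rm p(1)])
  have fm: "f \<in> borel_measurable (lborel \<Otimes>\<^sub>M lborel)" unfolding f_def by measurable
  have pms [measurable]: "(\<lambda>t. p (rot t x)) \<in> borel_measurable borel" for x
    using measurable_compose[OF measurable_Pair1'[of x] pm] by simp
  have pt: "integrable lborel (\<lambda>t. indicat_real {0..2*pi} t * p (rot t x))" for x
  proof (rule Bochner_Integration.integrable_bound)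
    show "integrable lborel (\<lambda>t. B * indicat_real {0..2*pi} t)" by simp
    show "AE t in lborel. norm (indicat_real {0..2*pi} t * p (rot t x)) \<le> norm (B * indicat_real {0..2*pi} t)"
      using p(2) order_trans[OF p(2) abs_ge_self] by (auto simp: indicator_def)
  qed measurable
  have ig': "integrable lborel (\<lambda>x. indicat_real (cball 0 R) x * g' x)"
  proof -
    have "integrable lebesgue (\<lambda>x. indicat_real (cball 0 R) x * g' x)"
      by (rule locally_integrable_cball[OF locally_integrable_cong_AE[OF g(1) ae]])
    moreover have "(\<lambda>x. indicat_real (cball 0 R) x * g' x) \<in> borel_measurable lborel"
      by (intro borel_measurable_times borel_measurable_indicator g') auto
    ultimately show ?thesis using integrable_completion by blast
  qed
  \<comment> \<open>Rotations preserve the norm, so for every angle the integrand is supported in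
    the ball of radius \<open>R\<close>.\<close>
  have fi: "integrable (lborel \<Otimes>\<^sub>M lborel) f"
  proof (rule lborel_pair.Fubini_integrable[OF fm])
    show "integrable lborel (\<lambda>x. LINT y|lborel. norm (f (x, y)))"
    proof (rule Bochner_Integration.integrable_bound)
      show "integrable lborel (\<lambda>x. (2 * pi * B) * \<bar>indicat_real (cball 0 R) x * g' x\<bar>)"
        by (intro integrable_mult_right integrable_abs ig')
      show "(\<lambda>x. LINT y|lborel. norm (f (x, y))) \<in> borel_measurable lborel"
        by (rule lborel.borel_measurable_lebesgue_integral) (use fm in \<open>simp add: split_beta'\<close>)
      show "AE x in lborel. norm (LINT y|lborel. norm (f (x, y))) \<le> norm ((2 * pi * B) * \<bar>indicat_real (cball 0 R) x * g' x\<bar>)"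
      proof (rule AE_I2)
        fix x :: R3
        have B0: "B \<ge> 0" using order_trans[OF abs_ge_zero p(2)] .
        have "(LINT y|lborel. norm (f (x, y))) \<le> (LINT y|lborel. \<bar>indicat_real (cball 0 R) x * g' x\<bar> * (B * indicat_real {0..2*pi} y))"
        proof (rule integral_mono)
          have "integrable lborel (\<lambda>t. g' x * (indicat_real {0..2*pi} t * p (rot t x)))"
            by (rule integrable_mult_right[OF pt])
          from integrable_norm[OF this] show "integrable lborel (\<lambda>y. norm (f (x, y)))" by (simp add: f_def)
          show "integrable lborel (\<lambda>y. \<bar>indicat_real (cball 0 R) x * g' x\<bar> * (B * indicat_real {0..2*pi} y))" by simp
          show "norm (f (x, y)) \<le> \<bar>indicat_real (cball 0 R) x * g' x\<bar> * (B * indicat_real {0..2*pi} y)" for y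
            using p(2)[of "rot y x"] p(3)[of "rot y x"] B0
            by (cases "norm x > R") (auto simp: f_def indicator_def abs_mult intro: mult_left_mono)
        qed
        also have "\<dots> = (2 * pi * B) * \<bar>indicat_real (cball 0 R) x * g' x\<bar>" by simp
        finally show "norm (LINT y|lborel. norm (f (x, y))) \<le> norm ((2 * pi * B) * \<bar>indicat_real (cball 0 R) x * g' x\<bar>)"
          using B0 by simp
      qed
    qed
    show "AE x in lborel. integrable lborel (\<lambda>y. f (x, y))"
      unfolding f_def using pt by simp
  qed
  have ft: "(LINT x|lborel. f (x, t)) = indicat_real {0..2*pi} t * (LINT x|lebesgue. g x * p x)" for t
  proof -
    have m1: "(\<lambda>x. g' x * p (rot t x)) \<in> borel_measurable lborel"
      using measurable_compose[OF measurable_Pair2'[of t] pm] by simp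
    have gt: "AE x in lebesgue. g (rot t x) = g x" using g(2) by (simp add: rot_inv_def)
    have gpm: "(\<lambda>x. g x * p x) \<in> borel_measurable lebesgue" using gm pl by measurable
    have "(LINT x|lborel. g' x * p (rot t x)) = (LINT x|lebesgue. g' x * p (rot t x))"
      by (rule integral_completion[OF m1, symmetric])
    also have "\<dots> = (LINT x|lebesgue. g (rot t x) * p (rot t x))"
    proof (rule integral_cong_AE)
      show "(\<lambda>x. g' x * p (rot t x)) \<in> borel_measurable lebesgue" using m1 by (simp add: measurable_completion)
      show "(\<lambda>x. g (rot t x) * p (rot t x)) \<in> borel_measurable lebesgue"
        by (rule measurable_compose[OF measure_preserving_rot(1) gpm])
      show "AE x in lebesgue. g' x * p (rot t x) = g (rot t x) * p (rot t x)"
        using ae gt by eventually_elim simp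
    qed
    also have "\<dots> = (LINT x|lebesgue. g x * p x)" by (rule lebesgue_integral_rot[OF gpm])
    finally have "indicat_real {0..2*pi} t * (LINT x|lborel. g' x * p (rot t x)) = indicat_real {0..2*pi} t * (LINT x|lebesgue. g x * p x)" by simp
    moreover have "(LINT x|lborel. f (x, t)) = (LINT x|lborel. indicat_real {0..2*pi} t * (g' x * p (rot t x)))"
      by (simp add: f_def mult.left_commute)
    ultimately show ?thesis by simp
  qed
  have fx: "(LINT t|lborel. f (x, t)) = 2 * pi * (g' x * a x)" if "radius x > 0" for x
  proof -
    have "set_integrable lborel {0..2*pi} (\<lambda>t. p (rot t x))" using pt[of x] by (simp add: set_integrable_def)
    from set_borel_integral_eq_integral(2)[OF this]
    have "(LINT t|lborel. indicat_real {0..2*pi} t * p (rot t x)) = 2 * pi * a x"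
      using a[OF that] by (simp add: set_lebesgue_integral_def integral_unique)
    then show ?thesis by (simp add: f_def)
  qed
  have rad: "AE x in lborel. radius x > (0::real)" using AE_radius_pos by (simp add: AE_completion_iff)
  have i1: "integrable lborel (\<lambda>x. LINT t|lborel. f (x, t))" by (rule lborel_pair.integrable_fst'[OF fi])
  have "AE x in lebesgue. (LINT t|lborel. f (x, t)) = 2 * pi * (g x * a x)"
    using AE_radius_pos ae by eventually_elim (simp add: fx)
  then have ae2: "AE x in lebesgue. (1 / (2 * pi)) * (LINT t|lborel. f (x, t)) = g x * a x"
    by eventually_elim simp
  have i2: "integrable lebesgue (\<lambda>x. LINT t|lborel. f (x, t))"
    using i1 by (subst integrable_completion) auto
  have i3: "integrable lebesgue (\<lambda>x. (1 / (2 * pi)) * (LINT t|lborel. f (x, t)))"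
    by (rule integrable_mult_right[OF i2])
  have gam: "(\<lambda>x. g x * a x) \<in> borel_measurable lebesgue"
    by (rule measurable_lebesgue_cong_AE[OF borel_measurable_integrable[OF i3] ae2])
  show "integrable lebesgue (\<lambda>x. g x * a x)"
    using integrable_cong_AE[OF borel_measurable_integrable[OF i3] gam ae2] i3 by simp
  have "(LINT x|lebesgue. g x * a x) = (LINT x|lebesgue. (1 / (2 * pi)) * (LINT t|lborel. f (x, t)))"
    by (rule integral_cong_AE[OF gam borel_measurable_integrable[OF i3]]) (use ae2 in auto)
  also have "\<dots> = (1 / (2 * pi)) * (LINT x|lborel. LINT t|lborel. f (x, t))"
    using i1 by (simp add: integral_completion)
  also have "(LINT x|lborel. LINT t|lborel. f (x, t)) = (LINT t|lborel. LINT x|lborel. f (x, t))"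
    using lborel_pair.Fubini_integral[of "\<lambda>x t. f (x, t)"] fi by simp
  also have "\<dots> = 2 * pi * (LINT x|lebesgue. g x * p x)"
    unfolding ft by simp
  finally show "(LINT x|lebesgue. g x * p x) = (LINT x|lebesgue. g x * a x)" by simp
qed

lemma locally_integrable_rot:
  assumes "locally_integrable u" shows "locally_integrable (\<lambda>x. u (rot t x))"
proof (rule locally_integrable_bound[where g = "\<lambda>x. \<bar>u (rot t x)\<bar>"])
  have um: "u \<in> borel_measurable lebesgue" by (rule locally_integrable_measurable[OF assms])
  show "(\<lambda>x. u (rot t x)) \<in> borel_measurable lebesgue"
    by (rule measurable_compose[OF measure_preserving_rot(1) um])
  fix R
  have i: "integrable lebesgue (\<lambda>x. \<bar>indicat_real (cball 0 R) x * u x\<bar>)"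
    by (rule integrable_abs[OF locally_integrable_cball[OF assms]])
  then have "integrable (distr lebesgue lebesgue (rot t)) (\<lambda>x. \<bar>indicat_real (cball 0 R) x * u x\<bar>)"
    unfolding measure_preserving_rot(2) .
  then have "integrable lebesgue (\<lambda>x. \<bar>indicat_real (cball 0 R) (rot t x) * u (rot t x)\<bar>)"
    by (rule integrable_distr[OF measure_preserving_rot(1)])
  then show "integrable lebesgue (\<lambda>x. indicat_real (cball 0 R) x * \<bar>u (rot t x)\<bar>)"
    by (simp add: abs_mult indicator_def)
qed simp

lemma has_derivative_rot: "(rot t has_derivative rot t) (at x)"
  by (intro bounded_linear_imp_has_derivative linear_conv_bounded_linear[THEN iffD1]
      orthogonal_transformation_linear orthogonal_transformation_rot)

lemma inner_rot: "rot t v \<bullet> w = v \<bullet> rot (-t) w"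
proof -
  have "rot t v \<bullet> rot t (rot (-t) w) = v \<bullet> rot (-t) w"
    using orthogonal_transformation_rot[of t] unfolding orthogonal_transformation_def by blast
  then show ?thesis by (simp add: rot_rot)
qed

lemma C1_rot:
  assumes "p \<in> C1" shows "(\<lambda>x. p (rot t x)) \<in> C1" "grad (\<lambda>x. p (rot t x)) = (\<lambda>x. rot (-t) (grad p (rot t x)))"
proof -
  have d: "((\<lambda>x. p (rot t x)) has_derivative (\<lambda>h. rot (-t) (grad p (rot t x)) \<bullet> h)) (at x)" for x
    using has_derivative_compose[OF has_derivative_rot C1_has_derivative[OF assms]] by (simp add: inner_rot)
  have c: "continuous_on UNIV (\<lambda>x. rot (-t) (grad p (rot t x)))"
    by (intro continuous_on_compose2[OF continuous_rot(2)[of UNIV]]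
        continuous_on_compose2[OF C1_continuous_grad[OF assms, of UNIV]] continuous_rot(2)) auto
  show "(\<lambda>x. p (rot t x)) \<in> C1" "grad (\<lambda>x. p (rot t x)) = (\<lambda>x. rot (-t) (grad p (rot t x)))"
    using C1I[OF d c] by auto
qed

lemma C1c_rot: assumes "p \<in> C1c" shows "(\<lambda>x. p (rot t x)) \<in> C1c"
proof -
  obtain R where "\<And>x. norm x > R \<Longrightarrow> p x = 0" using C1cE[OF assms] by metis
  then have "\<forall>x. norm x > R \<longrightarrow> p (rot t x) = 0" by simp
  then show ?thesis using C1_rot(1)[OF C1cD[OF assms], of t] unfolding C1c_def by blast
qed

lemma locally_integrable_abs:
  assumes "locally_integrable u" shows "locally_integrable (\<lambda>x. \<bar>u x\<bar>)"
proof (rule locally_integrable_bound[where g = "\<lambda>x. \<bar>u x\<bar>"])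
  show "(\<lambda>x. \<bar>u x\<bar>) \<in> borel_measurable lebesgue"
    using locally_integrable_measurable[OF assms] by measurable
  show "integrable lebesgue (\<lambda>x. indicat_real (cball 0 R) x * \<bar>u x\<bar>)" for R
    using integrable_abs[OF locally_integrable_cball[OF assms, of 0 R]] by (simp add: abs_mult)
qed simp

section \<open>Weak derivatives of rotation invariant functions\<close>

lemma is_weak_partial_rot:
  assumes w: "\<And>i. is_weak_partial i u (v i)"
  shows "is_weak_partial i (\<lambda>x. u (rot t x)) (\<lambda>x. (\<chi> j. v j (rot t x)) \<bullet> rot t (axis i 1))"
proof -
  have u: "locally_integrable u" and v: "locally_integrable (v j)" for j using w by (auto simp: is_weak_partial_def)
  define c where "c j = rot t (axis i 1) $ j" for j
  have eq: "(\<chi> j. v j (rot t x)) \<bullet> rot t (axis i 1) = c 1 * v 1 (rot t x) + c 2 * v 2 (rot t x) + c 3 * v 3 (rot t x)" for x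
    by (simp add: inner_vec_def sum_3 c_def mult.commute del: rot_nth)
  have "locally_integrable (\<lambda>x. c 1 * v 1 (rot t x) + c 2 * v 2 (rot t x) + c 3 * v 3 (rot t x))"
    by (intro locally_integrable_add locally_integrable_cmult locally_integrable_rot v)
  moreover have "(LINT x|lebesgue. u (rot t x) * partial i p x) =
     - (LINT x|lebesgue. (c 1 * v 1 (rot t x) + c 2 * v 2 (rot t x) + c 3 * v 3 (rot t x)) * p x)"
    if "p \<in> test_functions" for p
  proof -
    have p: "p \<in> C1c" using that by (rule test_functions_C1c)
    define q where "q x = p (rot (-t) x)" for x
    have q: "q \<in> C1c" unfolding q_def by (rule C1c_rot[OF p])
    have pq: "p x = q (rot t x)" for x by (simp add: q_def rot_rot)
    have "partial i p x = c 1 * partial 1 q (rot t x) + c 2 * partial 2 q (rot t x) + c 3 * partial 3 q (rot t x)" for x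
    proof -
      have "p = (\<lambda>x. q (rot t x))" using pq by auto
      then have "grad p x = rot (-t) (grad q (rot t x))" using C1_rot(2)[OF C1cD[OF q], of t] by simp
      then have "partial i p x = rot (-t) (grad q (rot t x)) \<bullet> axis i 1" by (metis grad_nth cart_eq_inner_axis)
      also have "\<dots> = grad q (rot t x) \<bullet> rot t (axis i 1)" by (simp add: inner_rot)
      finally show ?thesis by (simp add: inner_vec_def sum_3 c_def mult.commute del: rot_nth)
    qed
    then have 1: "(LINT x|lebesgue. u (rot t x) * partial i p x) =
        (LINT x|lebesgue. (\<lambda>y. u y * (c 1 * partial 1 q y + c 2 * partial 2 q y + c 3 * partial 3 q y)) (rot t x))" by simp
    have i: "integrable lebesgue (\<lambda>y. u y * partial j q y)" "integrable lebesgue (\<lambda>y. v j y * q y)" for j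
      by (intro integrable_Cc u v C1c_Cc C1c_partial_Cc q)+
    have m: "(\<lambda>y. u y * (c 1 * partial 1 q y + c 2 * partial 2 q y + c 3 * partial 3 q y)) \<in> borel_measurable lebesgue"
      using locally_integrable_measurable[OF u] Cc_measurable[OF C1c_partial_Cc[OF q]] by measurable
    have m2: "(\<lambda>y. (c 1 * v 1 y + c 2 * v 2 y + c 3 * v 3 y) * q y) \<in> borel_measurable lebesgue"
      using locally_integrable_measurable[OF v] Cc_measurable[OF C1c_Cc[OF q]] by measurable
    have w': "(LINT y|lebesgue. u y * partial j q y) = - (LINT y|lebesgue. v j y * q y)" for j
      by (rule is_weak_partial_C1c[OF w q])
    have "(LINT y|lebesgue. u y * (c 1 * partial 1 q y + c 2 * partial 2 q y + c 3 * partial 3 q y)) =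
      (LINT y|lebesgue. c 1 * (u y * partial 1 q y) + c 2 * (u y * partial 2 q y) + c 3 * (u y * partial 3 q y))"
      by (simp add: algebra_simps)
    also have "\<dots> = - (c 1 * (LINT y|lebesgue. v 1 y * q y) + c 2 * (LINT y|lebesgue. v 2 y * q y) + c 3 * (LINT y|lebesgue. v 3 y * q y))"
      using i w' by simp
    also have "\<dots> = - (LINT y|lebesgue. c 1 * (v 1 y * q y) + c 2 * (v 2 y * q y) + c 3 * (v 3 y * q y))"
      using i by simp
    also have "\<dots> = - (LINT y|lebesgue. (c 1 * v 1 y + c 2 * v 2 y + c 3 * v 3 y) * q y)"
      by (simp add: algebra_simps)
    finally show ?thesis
      using lebesgue_integral_rot[OF m, of t] lebesgue_integral_rot[OF m2, of t] unfolding 1 by (simp add: pq)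
  qed
  ultimately show ?thesis
    unfolding is_weak_partial_def eq using locally_integrable_rot[OF u] by blast
qed

lemma rot_inv_weak_partials:
  assumes w: "\<And>i. is_weak_partial i u (v i)" and r: "rot_inv u"
  shows "AE x in lebesgue. v 1 x = cos t * v 1 (rot t x) + sin t * v 2 (rot t x)"
    "AE x in lebesgue. v 2 x = - sin t * v 1 (rot t x) + cos t * v 2 (rot t x)"
    "AE x in lebesgue. v 3 x = v 3 (rot t x)"
proof -
  have u: "AE x in lebesgue. u (rot t x) = u x" using r by (simp add: rot_inv_def)
  have *: "AE x in lebesgue. v i x = (\<chi> j. v j (rot t x)) \<bullet> rot t (axis i 1)" for i
    by (rule is_weak_partial_unique[OF w is_weak_partial_cong[OF is_weak_partial_rot[OF w, of i t] u]]) simp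
  show "AE x in lebesgue. v 1 x = cos t * v 1 (rot t x) + sin t * v 2 (rot t x)"
    "AE x in lebesgue. v 2 x = - sin t * v 1 (rot t x) + cos t * v 2 (rot t x)"
    "AE x in lebesgue. v 3 x = v 3 (rot t x)"
    using *[of 1] *[of 2] *[of 3] by (simp_all add: inner_vec_def sum_3 axis_def algebra_simps)
qed

text \<open>The gradient of an invariant function turns with the point. Its horizontal Cartesian
  components are therefore not invariant, but the product with the horizontal position vector
  is.\<close>

lemma rot_inv_radial_partial:
  assumes w: "\<And>i. is_weak_partial i u (v i)" and r: "rot_inv u"
  shows "rot_inv (\<lambda>x. x$1 * v 1 x + x$2 * v 2 x)" "rot_inv (v 3)"
proof -
  show "rot_inv (\<lambda>x. x$1 * v 1 x + x$2 * v 2 x)"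
    unfolding rot_inv_def
  proof
    fix t
    show "AE x in lebesgue. rot t x$1 * v 1 (rot t x) + rot t x$2 * v 2 (rot t x) = x$1 * v 1 x + x$2 * v 2 x"
      using rot_inv_weak_partials(1)[OF w r, of t] rot_inv_weak_partials(2)[OF w r, of t]
    proof eventually_elim
      case (elim x)
      show ?case unfolding elim rot_nth by algebra
    qed
  qed
  show "rot_inv (v 3)"
    unfolding rot_inv_def
  proof
    fix t show "AE x in lebesgue. v 3 (rot t x) = v 3 x"
      using rot_inv_weak_partials(3)[OF w r, of t] by eventually_elim simp
  qed
qed

text \<open>The angular derivative: differentiation along the orbits of \<open>rot\<close>.\<close>

definition dth :: "(R3 \<Rightarrow> real) \<Rightarrow> R3 \<Rightarrow> real" where
  "dth p x = x$1 * partial 2 p x - x$2 * partial 1 p x"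

lemma has_derivative_rot_angle: "((\<lambda>t. rot t x) has_derivative (\<lambda>h. h *\<^sub>R tri (- (rot t x $ 2), rot t x $ 1, 0))) (at t)"
  unfolding rot_def tri_def
  by (auto intro!: derivative_eq_intros simp: vec_eq_iff forall_3 axis_def algebra_simps)

lemma dth_has_derivative:
  assumes "p \<in> C1"
  shows "((\<lambda>t. p (rot t x)) has_real_derivative dth p (rot t x)) (at t)"
proof -
  have "(\<lambda>h. grad p (rot t x) \<bullet> (h *\<^sub>R tri (- (rot t x $ 2), rot t x $ 1, 0))) = (*) (dth p (rot t x))"
    by (simp add: fun_eq_iff dth_def inner_vec_def sum_3 algebra_simps del: rot_nth)
  then show ?thesis
    using has_derivative_compose[OF has_derivative_rot_angle C1_has_derivative[OF assms], of x t]
    by (simp add: has_field_derivative_def)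
qed

lemma dth_has_integral:
  assumes "p \<in> C1"
  shows "((\<lambda>t. dth p (rot t x)) has_integral 0) {0..2*pi}"
proof -
  have "((\<lambda>t. dth p (rot t x)) has_integral (p (rot (2*pi) x) - p (rot 0 x))) {0..2*pi}"
    by (rule fundamental_theorem_of_calculus)
      (auto intro: has_field_derivative_at_within dth_has_derivative[OF assms]
        simp: has_real_derivative_iff_has_vector_derivative[symmetric])
  then show ?thesis by simp
qed

lemma dth_Cc: assumes "p \<in> C1c" shows "dth p \<in> Cc"
proof -
  obtain R where R: "\<And>x. norm x > R \<Longrightarrow> grad p x = 0" using C1cE[OF assms] by metis
  then have "\<forall>x. norm x > R \<longrightarrow> dth p x = 0" by (simp add: dth_def vec_eq_iff)
  moreover have "continuous_on UNIV (dth p)"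
    unfolding dth_def[abs_def] by (intro continuous_intros C1_continuous_partial C1cD assms)
  ultimately show ?thesis by (auto simp: Cc_def)
qed

lemma Cc_borel: "p \<in> Cc \<Longrightarrow> (p :: R3 \<Rightarrow> real) \<in> borel_measurable borel"
  by (auto simp: Cc_def intro: borel_measurable_continuous_onI)

text \<open>The angular derivative of \<open>p\<close> integrates to zero over every full circle. In
  this weak form the invariance of \<open>g\<close> is available without any derivative of
  \<open>g\<close>.\<close>

lemma integral_rot_inv_dth:
  assumes g: "locally_integrable g" "rot_inv g" and p: "p \<in> C1c"
  shows "(LINT x|lebesgue. g x * dth p x) = 0"
proof -
  have d: "dth p \<in> Cc" by (rule dth_Cc[OF p])
  obtain B where B: "\<And>x. norm (dth p x) \<le> B" by (rule Cc_bounded[OF d]) blast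
  obtain R where R: "\<And>x. norm x > R \<Longrightarrow> dth p x = 0" using d by (auto simp: Cc_def)
  have "(LINT x|lebesgue. g x * dth p x) = (LINT x|lebesgue. g x * 0)"
    by (rule rot_average(3)[OF g Cc_borel[OF d], of B R]) (use B R dth_has_integral[OF C1cD[OF p]] in auto)
  then show ?thesis by simp
qed

lemma partial_coord_mult_C1:
  "p \<in> C1 \<Longrightarrow> i \<noteq> j \<Longrightarrow> partial i (\<lambda>x. x $ j * p x) x = x $ j * partial i p x"
  by (simp add: partial_coord_mult)

text \<open>The angular field has divergence zero, so no term of order zero appears:
  \<open>dth p\<close> is a difference of derivatives of \<open>x $ 1 * p x\<close> and
  \<open>x $ 2 * p x\<close>.\<close>

lemma weak_dth:
  assumes w1: "is_weak_partial 1 u v1" and w2: "is_weak_partial 2 u v2" and p: "p \<in> C1c"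
  shows "(LINT x|lebesgue. u x * dth p x) = - (LINT x|lebesgue. (x$1 * v2 x - x$2 * v1 x) * p x)"
proof -
  have l: "locally_integrable u" "locally_integrable v1" "locally_integrable v2"
    using w1 w2 by (auto simp: is_weak_partial_def)
  have c: "(\<lambda>x. x $ j * p x) \<in> C1c" for j by (rule C1c_mult[OF C1_coord(1) p])
  have i: "integrable lebesgue (\<lambda>x. u x * partial i (\<lambda>x. x $ j * p x) x)"
    "integrable lebesgue (\<lambda>x. v1 x * (x $ j * p x))" "integrable lebesgue (\<lambda>x. v2 x * (x $ j * p x))" for i j
    by (intro integrable_Cc l C1c_Cc C1c_partial_Cc c)+
  have "dth p x = partial 2 (\<lambda>x. x $ 1 * p x) x - partial 1 (\<lambda>x. x $ 2 * p x) x" for x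
    by (simp add: dth_def partial_coord_mult_C1[OF C1cD[OF p]])
  then have "(LINT x|lebesgue. u x * dth p x) = (LINT x|lebesgue. u x * partial 2 (\<lambda>x. x $ 1 * p x) x) - (LINT x|lebesgue. u x * partial 1 (\<lambda>x. x $ 2 * p x) x)"
    using i by (simp add: right_diff_distrib)
  also have "\<dots> = - ((LINT x|lebesgue. v2 x * (x $ 1 * p x)) - (LINT x|lebesgue. v1 x * (x $ 2 * p x)))"
    using is_weak_partial_C1c[OF w1 c] is_weak_partial_C1c[OF w2 c] by simp
  also have "(LINT x|lebesgue. v2 x * (x $ 1 * p x)) - (LINT x|lebesgue. v1 x * (x $ 2 * p x)) = (LINT x|lebesgue. v2 x * (x $ 1 * p x) - v1 x * (x $ 2 * p x))"
    using i by simp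
  also have "\<dots> = (LINT x|lebesgue. (x$1 * v2 x - x$2 * v1 x) * p x)"
    by (rule Bochner_Integration.integral_cong) (auto simp: algebra_simps)
  finally show ?thesis .
qed

lemma weak_dth_unique:
  assumes w1: "is_weak_partial 1 u v1" and w2: "is_weak_partial 2 u v2" and q: "locally_integrable q"
    and eq: "\<And>p. p \<in> C1c \<Longrightarrow> (LINT x|lebesgue. u x * dth p x) = - (LINT x|lebesgue. q x * p x)"
  shows "AE x in lebesgue. x$1 * v2 x - x$2 * v1 x = q x"
proof -
  have l: "locally_integrable v1" "locally_integrable v2" using w1 w2 by (auto simp: is_weak_partial_def)
  have l2: "locally_integrable (\<lambda>x. x$1 * v2 x + (-1) * (x$2 * v1 x))"
    by (intro locally_integrable_add locally_integrable_cmult locally_integrable_mult_continuous l C1_continuous[OF C1_coord(1)])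
  have "AE x in lebesgue. (x$1 * v2 x + (-1) * (x$2 * v1 x)) + (-1) * q x = 0"
  proof (rule orthogonal_test_functions_AE_zero)
    show "locally_integrable (\<lambda>x. (x$1 * v2 x + (-1) * (x$2 * v1 x)) + (-1) * q x)"
      by (intro locally_integrable_add[OF l2] locally_integrable_cmult q)
    fix p assume "p \<in> test_functions"
    then have p: "p \<in> C1c" by (rule test_functions_C1c)
    have i: "integrable lebesgue (\<lambda>x. (x$1 * v2 x - x$2 * v1 x) * p x)" "integrable lebesgue (\<lambda>x. q x * p x)"
      using integrable_Cc[OF l2 C1c_Cc[OF p]] integrable_Cc[OF q C1c_Cc[OF p]] by simp_all
    show "(LINT x|lebesgue. ((x$1 * v2 x + (-1) * (x$2 * v1 x)) + (-1) * q x) * p x) = 0"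
      using eq[OF p] weak_dth[OF w1 w2 p] Bochner_Integration.integral_diff[OF i] by (simp add: left_diff_distrib)
  qed
  then show ?thesis by eventually_elim simp
qed

lemma rot_inv_angular_partial:
  assumes w1: "is_weak_partial 1 u v1" and w2: "is_weak_partial 2 u v2" and r: "rot_inv u"
  shows "AE x in lebesgue. x$1 * v2 x - x$2 * v1 x = 0"
proof (rule weak_dth_unique[OF w1 w2])
  have "locally_integrable u" using w1 by (simp add: is_weak_partial_def)
  then show "(LINT x|lebesgue. u x * dth p x) = - (LINT x|lebesgue. 0 * p x)" if "p \<in> C1c" for p
    using integral_rot_inv_dth[OF _ r that] by simp
qed (rule locally_integrable_const)

section \<open>Functions singular on the axis\<close>

text \<open>An approximation of \<open>1 / r\<close> that is smooth across the axis.\<close>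

definition kap :: "real \<Rightarrow> R3 \<Rightarrow> real" where
  "kap e x = inverse (sqrt ((x$1)\<^sup>2 + (x$2)\<^sup>2 + e\<^sup>2))"

definition hor :: "R3 \<Rightarrow> R3" where "hor x = tri (x$1, x$2, 0)"

lemma hor_nth [simp]: "hor x $ 1 = x$1" "hor x $ 2 = x$2" "hor x $ 3 = 0" by (simp_all add: hor_def)

text \<open>The horizontal components of \<^term>\<open>ansatz u\<close> are \<open>u / r\<close> times \<open>sg 0 (-1)\<close> and \<open>sg 1 0\<close>.\<close>

definition sg :: "real \<Rightarrow> real \<Rightarrow> R3 \<Rightarrow> real" where "sg a b x = a * x$1 + b * x$2"

lemma kap_arg_pos: "e \<noteq> 0 \<Longrightarrow> (x$1)\<^sup>2 + (x$2)\<^sup>2 + e\<^sup>2 > (0::real)"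
  by (simp add: add_nonneg_pos)

lemma kap_pos: "e \<noteq> 0 \<Longrightarrow> kap e x > 0"
  using kap_arg_pos by (simp add: kap_def)

lemma kap_C1:
  assumes e: "e \<noteq> 0"
  shows "kap e \<in> C1" "grad (kap e) = (\<lambda>x. (- (kap e x ^ 3)) *\<^sub>R hor x)"
proof -
  have d: "(kap e has_derivative (\<lambda>h. ((- (kap e x ^ 3)) *\<^sub>R hor x) \<bullet> h)) (at x)" for x
  proof -
    let ?s = "(x$1)\<^sup>2 + (x$2)\<^sup>2 + e\<^sup>2"
    have s: "?s > 0" by (rule kap_arg_pos[OF e])
    have g: "((\<lambda>t. inverse (sqrt t)) has_real_derivative - (inverse (sqrt ?s) ^ 3) / 2) (at ?s)"
    proof -
      have key: "- (inverse a / 2 * inverse (a ^ Suc (Suc 0))) = - (inverse a ^ 3) / 2" for a :: real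
        by (simp add: power3_eq_cube)
      show ?thesis
        using DERIV_inverse_fun[OF DERIV_real_sqrt[OF s]] s unfolding key by simp
    qed
    have "((\<lambda>x::R3. (x$1)\<^sup>2 + (x$2)\<^sup>2 + e\<^sup>2) has_derivative (\<lambda>h. 2 * (hor x \<bullet> h))) (at x)"
      by (auto intro!: derivative_eq_intros bounded_linear_imp_has_derivative[OF bounded_linear_vec_nth]
          simp: inner_vec_def sum_3 algebra_simps)
    from has_derivative_compose[OF this g[unfolded has_field_derivative_def]]
    show ?thesis by (simp add: kap_def[abs_def] algebra_simps)
  qed
  have "continuous_on UNIV (kap e)"
    using d has_derivative_continuous continuous_at_imp_continuous_on by blast
  moreover have "continuous_on UNIV hor"
    unfolding hor_def tri_def by (intro continuous_intros)
  ultimately have c: "continuous_on UNIV (\<lambda>x. (- (kap e x ^ 3)) *\<^sub>R hor x)" by (intro continuous_intros)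
  show "kap e \<in> C1" "grad (kap e) = (\<lambda>x. (- (kap e x ^ 3)) *\<^sub>R hor x)"
    using C1I[OF d c] by auto
qed

lemma sg_C1: "sg a b \<in> C1" "grad (sg a b) = (\<lambda>x. tri (a, b, 0))"
proof -
  have d: "(sg a b has_derivative (\<lambda>h. tri (a, b, 0) \<bullet> h)) (at x)" for x
    unfolding sg_def
    by (auto intro!: derivative_eq_intros bounded_linear_imp_has_derivative[OF bounded_linear_vec_nth]
        simp: inner_vec_def sum_3)
  show "sg a b \<in> C1" "grad (sg a b) = (\<lambda>x. tri (a, b, 0))"
    using C1I[OF d continuous_on_const] by auto
qed

lemma radius_nonneg: "radius x \<ge> 0" by (simp add: radius_def)

lemma radius_square: "(radius x)\<^sup>2 = (x$1)\<^sup>2 + (x$2)\<^sup>2" by (simp add: radius_def)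

lemma abs_coord_le_radius: "\<bar>x$1\<bar> \<le> radius x" "\<bar>x$2\<bar> \<le> radius x"
  by (auto simp: radius_def intro!: real_le_rsqrt)

lemma hor_le_radius: "\<bar>hor x $ i\<bar> \<le> radius x"
  using abs_coord_le_radius radius_nonneg exhaust_3[of i] by auto

lemma sg_le_radius: "\<bar>sg a b x\<bar> \<le> (\<bar>a\<bar> + \<bar>b\<bar>) * radius x"
proof -
  have "\<bar>sg a b x\<bar> \<le> \<bar>a\<bar> * \<bar>x$1\<bar> + \<bar>b\<bar> * \<bar>x$2\<bar>"
    unfolding sg_def by (metis abs_mult abs_triangle_ineq)
  also have "\<dots> \<le> \<bar>a\<bar> * radius x + \<bar>b\<bar> * radius x"
    by (intro add_mono mult_left_mono abs_coord_le_radius) auto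
  finally show ?thesis by (simp add: algebra_simps)
qed

lemma continuous_radius: "continuous_on S radius"
  unfolding radius_def[abs_def] by (intro continuous_intros)

lemma measurable_radius [measurable]: "radius \<in> borel_measurable lebesgue" "radius \<in> borel_measurable borel"
  using continuous_measurable_lebesgue[OF continuous_radius] borel_measurable_continuous_onI[OF continuous_radius] by auto

lemma measurable_coord [measurable]: "(\<lambda>x::R3. x $ i) \<in> borel_measurable lebesgue"
  by (rule continuous_measurable_lebesgue[OF C1_continuous[OF C1_coord(1)]])

lemma radius_kap: "e \<noteq> 0 \<Longrightarrow> radius x * kap e x \<le> 1" "e \<noteq> 0 \<Longrightarrow> radius x > 0 \<Longrightarrow> kap e x \<le> 1 / radius x"
proof -
  assume e: "e \<noteq> 0"
  have "radius x \<le> sqrt ((x$1)\<^sup>2 + (x$2)\<^sup>2 + e\<^sup>2)" unfolding radius_def by (intro real_sqrt_le_mono) simp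
  moreover have "sqrt ((x$1)\<^sup>2 + (x$2)\<^sup>2 + e\<^sup>2) > 0" using kap_arg_pos[OF e] by simp
  ultimately show 1: "radius x * kap e x \<le> 1" by (simp add: kap_def field_simps)
  show "kap e x \<le> 1 / radius x" if "radius x > 0" using 1 that by (simp add: field_simps)
qed

abbreviation ep :: "nat \<Rightarrow> real" where "ep n \<equiv> inverse (real (Suc n))"

lemma ep_nonzero: "ep n \<noteq> 0" by simp

lemma kap_tendsto: "radius x > 0 \<Longrightarrow> (\<lambda>n. kap (ep n) x) \<longlonglongrightarrow> 1 / radius x"
proof -
  assume r: "radius x > 0"
  have "(\<lambda>n. kap (ep n) x) \<longlonglongrightarrow> inverse (sqrt ((x$1)\<^sup>2 + (x$2)\<^sup>2 + 0\<^sup>2))"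
    unfolding kap_def
    by (intro tendsto_intros LIMSEQ_inverse_real_of_nat) (use r in \<open>auto simp: radius_def\<close>)
  then show ?thesis by (simp add: radius_def inverse_eq_divide)
qed

text \<open>The classical partial derivative of \<open>sg a b / radius\<close> off the axis.\<close>

definition dsr :: "real \<Rightarrow> real \<Rightarrow> 3 \<Rightarrow> R3 \<Rightarrow> real" where
  "dsr a b i x = tri (a, b, 0) $ i / radius x - sg a b x * hor x $ i / radius x ^ 3"

lemma tri_bound: "\<bar>tri (a, b, 0) $ i\<bar> \<le> \<bar>a\<bar> + \<bar>b\<bar>"
  using exhaust_3[of i] by auto

lemma partial_sg_kap:
  assumes "e \<noteq> 0"
  shows "partial i (\<lambda>x. sg a b x * kap e x) x = kap e x * tri (a, b, 0) $ i - sg a b x * hor x $ i * kap e x ^ 3"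
  using fun_cong[OF C1_mult(2)[OF sg_C1(1)[of a b] kap_C1(1)[OF assms]], of x]
  by (simp add: vec_eq_iff sg_C1(2) kap_C1(2)[OF assms])

lemma partial_sg_kap_bound:
  assumes "e \<noteq> 0"
  shows "\<bar>partial i (\<lambda>x. sg a b x * kap e x) x\<bar> \<le> 2 * (\<bar>a\<bar> + \<bar>b\<bar>) * kap e x"
proof -
  let ?c = "\<bar>a\<bar> + \<bar>b\<bar>" and ?k = "kap e x" and ?r = "radius x"
  have k: "?k > 0" and r: "?r \<ge> 0" and rk: "?r * ?k \<le> 1" using kap_pos radius_nonneg radius_kap assms by auto
  have "\<bar>?k * tri (a, b, 0) $ i\<bar> \<le> ?k * ?c"
    using k tri_bound[of a b i] by (simp add: abs_mult)
  moreover have "\<bar>sg a b x * hor x $ i * ?k ^ 3\<bar> \<le> ?c * ?k"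
  proof -
    have "\<bar>sg a b x * hor x $ i * ?k ^ 3\<bar> = \<bar>sg a b x\<bar> * \<bar>hor x $ i\<bar> * ?k ^ 3" using k by (simp add: abs_mult)
    also have "\<dots> \<le> (?c * ?r) * ?r * ?k ^ 3"
      using k r by (intro mult_right_mono mult_mono sg_le_radius hor_le_radius) auto
    also have "\<dots> = ?c * ((?r * ?k) * (?r * ?k)) * ?k" by (simp add: power3_eq_cube)
    also have "\<dots> \<le> ?c * (1 * 1) * ?k"
      using k r rk by (intro mult_right_mono mult_left_mono mult_mono) auto
    finally show ?thesis by simp
  qed
  ultimately show ?thesis unfolding partial_sg_kap[OF assms] by (simp add: algebra_simps)
qed

text \<open>Off the axis, the bound for the regularised quotient is uniform once \<open>kap\<close>
  is replaced by the larger \<open>1 / radius\<close>, so it survives the limit. On the axis both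
  sides are 0 by the convention for division by zero.\<close>

lemma dsr_bound: "\<bar>dsr a b i x\<bar> \<le> 2 * (\<bar>a\<bar> + \<bar>b\<bar>) / radius x"
proof (cases "radius x = 0")
  case False
  then have r: "radius x > 0" using radius_nonneg[of x] by simp
  have lim: "(\<lambda>n. partial i (\<lambda>x. sg a b x * kap (ep n) x) x) \<longlonglongrightarrow> 1 / radius x * tri (a, b, 0) $ i - sg a b x * hor x $ i * (1 / radius x) ^ 3"
    unfolding partial_sg_kap[OF ep_nonzero] by (intro tendsto_intros kap_tendsto r)
  have "\<bar>1 / radius x * tri (a, b, 0) $ i - sg a b x * hor x $ i * (1 / radius x) ^ 3\<bar> \<le> 2 * (\<bar>a\<bar> + \<bar>b\<bar>) * (1 / radius x)"
  proof (rule LIMSEQ_le_const2[OF tendsto_rabs[OF lim]], intro exI allI impI)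
    fix n :: nat
    have "\<bar>partial i (\<lambda>x. sg a b x * kap (ep n) x) x\<bar> \<le> 2 * (\<bar>a\<bar> + \<bar>b\<bar>) * kap (ep n) x"
      by (rule partial_sg_kap_bound) simp
    also have "\<dots> \<le> 2 * (\<bar>a\<bar> + \<bar>b\<bar>) * (1 / radius x)"
      using r by (intro mult_left_mono radius_kap) auto
    finally show "\<bar>partial i (\<lambda>x. sg a b x * kap (ep n) x) x\<bar> \<le> 2 * (\<bar>a\<bar> + \<bar>b\<bar>) * (1 / radius x)" .
  qed
  then show ?thesis by (simp add: dsr_def power_one_over)
qed (simp add: dsr_def)

lemma measurable_sg [measurable]: "sg a b \<in> borel_measurable lebesgue"
  by (rule continuous_measurable_lebesgue[OF C1_continuous[OF sg_C1(1)]])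

lemma measurable_hor [measurable]: "(\<lambda>x. hor x $ i) \<in> borel_measurable lebesgue"
  using exhaust_3[of i] by auto

lemma measurable_dsr [measurable]: "dsr a b i \<in> borel_measurable lebesgue"
  unfolding dsr_def[abs_def] by measurable

lemma sg_over_radius_bound: "\<bar>sg a b x / radius x\<bar> \<le> \<bar>a\<bar> + \<bar>b\<bar>"
proof (cases "radius x = 0")
  case False
  then have r: "radius x > 0" using radius_nonneg[of x] by simp
  then show ?thesis using sg_le_radius[of a b x] by (simp add: abs_div divide_le_eq)
qed simp

lemma sg_kap_bound: "e \<noteq> 0 \<Longrightarrow> \<bar>sg a b x * kap e x\<bar> \<le> \<bar>a\<bar> + \<bar>b\<bar>"
proof -
  assume e: "e \<noteq> 0"
  have "\<bar>sg a b x * kap e x\<bar> \<le> ((\<bar>a\<bar> + \<bar>b\<bar>) * radius x) * kap e x"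
    using kap_pos[OF e, of x] sg_le_radius[of a b x] by (simp add: abs_mult)
  also have "\<dots> \<le> (\<bar>a\<bar> + \<bar>b\<bar>) * 1" unfolding mult.assoc by (intro mult_left_mono radius_kap e) auto
  finally show ?thesis by simp
qed

text \<open>The factor \<open>sg a b / radius\<close> is bounded but its gradient is of size
  \<open>1 / radius\<close>. Local integrability of \<open>u / radius\<close> provides the majorant
  for the derivative term, uniformly in the regularisation.\<close>

lemma is_weak_partial_sg_over_radius:
  assumes w: "is_weak_partial i u v" and ur: "locally_integrable (\<lambda>x. u x / radius x)"
  shows "is_weak_partial i (\<lambda>x. sg a b x / radius x * u x) (\<lambda>x. sg a b x / radius x * v x + dsr a b i x * u x)"
proof -
  let ?c = "\<bar>a\<bar> + \<bar>b\<bar>"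
  have l: "locally_integrable u" "locally_integrable v" using w by (auto simp: is_weak_partial_def)
  note [measurable] = locally_integrable_measurable[OF l(1)] locally_integrable_measurable[OF l(2)]
  show ?thesis
  proof (rule is_weak_partial_limit)
    show "is_weak_partial i (\<lambda>x. (sg a b x * kap (ep n) x) * u x) (\<lambda>x. (sg a b x * kap (ep n) x) * v x + partial i (\<lambda>x. sg a b x * kap (ep n) x) x * u x)" for n
      by (rule is_weak_partial_mult_C1[OF w C1_mult(1)[OF sg_C1(1) kap_C1(1)]]) simp
    show "AE x in lebesgue. (\<lambda>n. (sg a b x * kap (ep n) x) * u x) \<longlonglongrightarrow> sg a b x / radius x * u x"
      using AE_radius_pos
    proof eventually_elim
      case (elim x)
      have "(\<lambda>n. (sg a b x * kap (ep n) x) * u x) \<longlonglongrightarrow> (sg a b x * (1 / radius x)) * u x"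
        by (intro tendsto_intros kap_tendsto elim)
      then show ?case by simp
    qed
    show "AE x in lebesgue. \<bar>(sg a b x * kap (ep n) x) * u x\<bar> \<le> ?c * \<bar>u x\<bar>" for n
      unfolding abs_mult[of "_ * _" "u _"] by (intro AE_I2 mult_right_mono sg_kap_bound) auto
    show "locally_integrable (\<lambda>x. ?c * \<bar>u x\<bar>)" by (intro locally_integrable_cmult locally_integrable_abs l)
    show "AE x in lebesgue. (\<lambda>n. (sg a b x * kap (ep n) x) * v x + partial i (\<lambda>x. sg a b x * kap (ep n) x) x * u x)
       \<longlonglongrightarrow> sg a b x / radius x * v x + dsr a b i x * u x"
      using AE_radius_pos
    proof eventually_elim
      case (elim x)
      have "(\<lambda>n. (sg a b x * kap (ep n) x) * v x + (kap (ep n) x * tri (a, b, 0) $ i - sg a b x * hor x $ i * kap (ep n) x ^ 3) * u x)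
        \<longlonglongrightarrow> (sg a b x * (1 / radius x)) * v x + ((1 / radius x) * tri (a, b, 0) $ i - sg a b x * hor x $ i * (1 / radius x) ^ 3) * u x"
        by (intro tendsto_intros kap_tendsto elim)
      then show ?case unfolding partial_sg_kap[OF ep_nonzero] by (simp add: dsr_def power_one_over)
    qed
    show "AE x in lebesgue. \<bar>(sg a b x * kap (ep n) x) * v x + partial i (\<lambda>x. sg a b x * kap (ep n) x) x * u x\<bar>
       \<le> ?c * \<bar>v x\<bar> + (2 * ?c) * \<bar>u x / radius x\<bar>" for n
      using AE_radius_pos
    proof eventually_elim
      case (elim x)
      have "\<bar>(sg a b x * kap (ep n) x) * v x\<bar> \<le> ?c * \<bar>v x\<bar>"
        unfolding abs_mult[of "_ * _" "v _"] by (intro mult_right_mono sg_kap_bound) auto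
      moreover have "\<bar>partial i (\<lambda>x. sg a b x * kap (ep n) x) x * u x\<bar> \<le> (2 * ?c) * \<bar>u x / radius x\<bar>"
      proof -
        have "\<bar>partial i (\<lambda>x. sg a b x * kap (ep n) x) x\<bar> \<le> 2 * ?c * kap (ep n) x"
          by (rule partial_sg_kap_bound) simp
        also have "\<dots> \<le> 2 * ?c * (1 / radius x)"
          using elim by (intro mult_left_mono radius_kap) auto
        finally have "\<bar>partial i (\<lambda>x. sg a b x * kap (ep n) x) x\<bar> * \<bar>u x\<bar> \<le> (2 * ?c * (1 / radius x)) * \<bar>u x\<bar>"
          by (rule mult_right_mono) auto
        then show ?thesis using elim by (simp add: abs_mult abs_div)
      qed
      ultimately show ?case by linarith
    qed
    show "locally_integrable (\<lambda>x. ?c * \<bar>v x\<bar> + (2 * ?c) * \<bar>u x / radius x\<bar>)"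
      by (intro locally_integrable_add locally_integrable_cmult locally_integrable_abs l ur)
  qed measurable
qed

section \<open>The ansatz\<close>

lemma X_space_iff: "u \<in> X_space \<longleftrightarrow> u \<in> H1 \<and> cyl_sym u \<and> (\<lambda>x. u x / radius x) \<in> L2"
proof -
  have "(\<lambda>x. u x / radius x) \<in> borel_measurable lebesgue" if "u \<in> H1"
    using L2_measurable[OF H1_L2[OF that]] by measurable
  then show ?thesis by (auto simp: X_space_def L2_def power_divide)
qed

lemma dsr_simps:
  assumes "radius x > 0"
  shows "dsr 0 (-1) 1 x = (x$1 / radius x) * (x$2 / radius x) / radius x"
    "dsr 0 (-1) 2 x = - (x$1 / radius x)\<^sup>2 / radius x"
    "dsr 1 0 1 x = (x$2 / radius x)\<^sup>2 / radius x"
    "dsr 1 0 2 x = - (x$1 / radius x) * (x$2 / radius x) / radius x"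
    "dsr a b 3 x = 0"
proof -
  have r: "radius x \<noteq> 0" using assms by simp
  have sq: "(x$1)\<^sup>2 + (x$2)\<^sup>2 = radius x * radius x" using radius_square[of x] by (simp add: power2_eq_square)
  show "dsr 0 (-1) 1 x = (x$1 / radius x) * (x$2 / radius x) / radius x"
    "dsr 1 0 2 x = - (x$1 / radius x) * (x$2 / radius x) / radius x" "dsr a b 3 x = 0"
    by (simp_all add: dsr_def sg_def power3_eq_cube)
  have "- (1 / radius x) + x$2 * x$2 / radius x ^ 3 = - ((radius x * radius x - x$2 * x$2) / radius x ^ 3)"
    using r by (simp add: field_simps power3_eq_cube)
  also have "radius x * radius x - x$2 * x$2 = x$1 * x$1" using sq by (simp add: power2_eq_square)
  finally show "dsr 0 (-1) 2 x = - (x$1 / radius x)\<^sup>2 / radius x"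
    by (simp add: dsr_def sg_def power3_eq_cube power2_eq_square)
  have "1 / radius x - x$1 * x$1 / radius x ^ 3 = (radius x * radius x - x$1 * x$1) / radius x ^ 3"
    using r by (simp add: field_simps power3_eq_cube)
  also have "radius x * radius x - x$1 * x$1 = x$2 * x$2" using sq by (simp add: power2_eq_square)
  finally show "dsr 1 0 1 x = (x$2 / radius x)\<^sup>2 / radius x"
    by (simp add: dsr_def sg_def power3_eq_cube power2_eq_square)
qed

lemma ansatz_nth: "ansatz u x $ 1 = sg 0 (-1) x / radius x * u x" "ansatz u x $ 2 = sg 1 0 x / radius x * u x" "ansatz u x $ 3 = 0"
  by (simp_all add: ansatz_def sg_def)

lemma H1_sg_over_radius:
  assumes w: "u \<in> H1" and ur: "(\<lambda>x. u x / radius x) \<in> L2"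
  shows "(\<lambda>x. sg a b x / radius x * u x) \<in> H1"
    "AE x in lebesgue. weak_partial i (\<lambda>x. sg a b x / radius x * u x) x = sg a b x / radius x * weak_partial i u x + dsr a b i x * u x"
proof -
  have *: "is_weak_partial i (\<lambda>x. sg a b x / radius x * u x) (\<lambda>x. sg a b x / radius x * weak_partial i u x + dsr a b i x * u x)" for i
    by (rule is_weak_partial_sg_over_radius[OF H1_is_weak_partial[OF w] L2_locally_integrable[OF ur]])
  have m [measurable]: "(\<lambda>x. sg a b x / radius x) \<in> borel_measurable lebesgue" "u \<in> borel_measurable lebesgue"
    using L2_measurable[OF H1_L2[OF w]] by measurable
  have 1: "(\<lambda>x. sg a b x / radius x * z x) \<in> L2" if "z \<in> L2" for z
    by (rule L2_bounded_mult[OF that m(1) sg_over_radius_bound])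
  have 2: "(\<lambda>x. dsr a b i x * u x) \<in> L2" for i
  proof (rule L2_mono[OF L2_cmult[OF ur, of "2 * (\<bar>a\<bar> + \<bar>b\<bar>)"]])
    show "AE x in lebesgue. \<bar>dsr a b i x * u x\<bar> \<le> \<bar>2 * (\<bar>a\<bar> + \<bar>b\<bar>) * (u x / radius x)\<bar>"
    proof (rule AE_I2)
      fix x
      have "\<bar>dsr a b i x\<bar> * \<bar>u x\<bar> \<le> (2 * (\<bar>a\<bar> + \<bar>b\<bar>) / radius x) * \<bar>u x\<bar>"
        by (intro mult_right_mono dsr_bound) auto
      then show "\<bar>dsr a b i x * u x\<bar> \<le> \<bar>2 * (\<bar>a\<bar> + \<bar>b\<bar>) * (u x / radius x)\<bar>"
        using radius_nonneg[of x] by (simp add: abs_mult abs_div)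
    qed
  qed measurable
  show "(\<lambda>x. sg a b x / radius x * u x) \<in> H1"
    unfolding H1_iff using 1[OF H1_L2[OF w]] L2_add[OF 1[OF H1_weak_partial_L2[OF w]] 2] * by blast
  show "AE x in lebesgue. weak_partial i (\<lambda>x. sg a b x / radius x * u x) x = sg a b x / radius x * weak_partial i u x + dsr a b i x * u x"
    by (rule weak_partial_AE[OF *])
qed

lemma zero_H1: "(\<lambda>x. 0) \<in> H1" "AE x in lebesgue. weak_partial i (\<lambda>x. 0) x = 0"
proof -
  have *: "is_weak_partial i (\<lambda>x. 0) (\<lambda>x. 0)" for i
    unfolding is_weak_partial_def using locally_integrable_const[of 0] by simp
  have "(\<lambda>x. 0) \<in> L2" by (simp add: L2_def)
  then show "(\<lambda>x. 0) \<in> H1" unfolding H1_iff using * by blast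
  show "AE x in lebesgue. weak_partial i (\<lambda>x. 0) x = 0" by (rule weak_partial_AE[OF *])
qed

lemma ansatz_H1_vec:
  assumes w: "u \<in> H1" and ur: "(\<lambda>x. u x / radius x) \<in> L2" and E: "AE x in lebesgue. E x = ansatz u x"
  shows "E \<in> H1_vec"
    "AE x in lebesgue. weak_partial i (\<lambda>y. E y $ 1) x = sg 0 (-1) x / radius x * weak_partial i u x + dsr 0 (-1) i x * u x"
    "AE x in lebesgue. weak_partial i (\<lambda>y. E y $ 2) x = sg 1 0 x / radius x * weak_partial i u x + dsr 1 0 i x * u x"
    "AE x in lebesgue. weak_partial i (\<lambda>y. E y $ 3) x = 0"
proof -
  have e1: "AE x in lebesgue. sg 0 (-1) x / radius x * u x = E x $ 1"
    using E by eventually_elim (simp only: ansatz_nth)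
  have e2: "AE x in lebesgue. sg 1 0 x / radius x * u x = E x $ 2"
    using E by eventually_elim (simp only: ansatz_nth)
  have e3: "AE x in lebesgue. 0 = E x $ 3"
    using E by eventually_elim (simp only: ansatz_nth)
  show "E \<in> H1_vec"
    unfolding H1_vec_def forall_3 mem_Collect_eq
    using H1_cong_AE[OF H1_sg_over_radius(1)[OF w ur] e1] H1_cong_AE[OF H1_sg_over_radius(1)[OF w ur] e2]
      H1_cong_AE[OF zero_H1(1) e3] by simp
  show "AE x in lebesgue. weak_partial i (\<lambda>y. E y $ 1) x = sg 0 (-1) x / radius x * weak_partial i u x + dsr 0 (-1) i x * u x"
    unfolding weak_partial_cong[OF e1, symmetric] by (rule H1_sg_over_radius(2)[OF w ur])
  show "AE x in lebesgue. weak_partial i (\<lambda>y. E y $ 2) x = sg 1 0 x / radius x * weak_partial i u x + dsr 1 0 i x * u x"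
    unfolding weak_partial_cong[OF e2, symmetric] by (rule H1_sg_over_radius(2)[OF w ur])
  show "AE x in lebesgue. weak_partial i (\<lambda>y. E y $ 3) x = 0"
    unfolding weak_partial_cong[OF e3, symmetric] by (rule zero_H1(2))
qed

section \<open>Gradient, divergence and curl of fields of the ansatz\<close>

definition grad_inner :: "(R3 \<Rightarrow> R3) \<Rightarrow> (R3 \<Rightarrow> R3) \<Rightarrow> R3 \<Rightarrow> real" where
  "grad_inner E W x = (\<Sum>j\<in>UNIV. weak_grad (\<lambda>y. E y $ j) x \<bullet> weak_grad (\<lambda>y. W y $ j) x)"

definition wdiv :: "(R3 \<Rightarrow> R3) \<Rightarrow> R3 \<Rightarrow> real" where
  "wdiv E x = (\<Sum>j\<in>UNIV. weak_partial j (\<lambda>y. E y $ j) x)"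

lemma weak_grad_nth [simp]: "weak_grad u x $ i = weak_partial i u x" by (simp add: weak_grad_def)

lemma cos_sin_radius: "radius x > 0 \<Longrightarrow> (x$1 / radius x) * (x$1 / radius x) + (x$2 / radius x) * (x$2 / radius x) = 1"
proof -
  assume r: "radius x > 0"
  have "(x$1 / radius x) * (x$1 / radius x) + (x$2 / radius x) * (x$2 / radius x) = ((x$1)\<^sup>2 + (x$2)\<^sup>2) / (radius x)\<^sup>2"
    by (simp add: power2_eq_square add_divide_distrib)
  then show ?thesis using r unfolding radius_square[symmetric] by simp
qed

text \<open>Each field is a scalar times the azimuthal unit vector. The mixed terms vanish because a
  vector of constant length is orthogonal to its derivatives, and the squared gradient of the unit
  vector is \<open>1 / r^2\<close>.\<close>

lemma grad_inner_ansatz: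
  assumes u: "u \<in> H1" "(\<lambda>x. u x / radius x) \<in> L2" "AE x in lebesgue. E x = ansatz u x"
    and v: "v \<in> H1" "(\<lambda>x. v x / radius x) \<in> L2" "AE x in lebesgue. W x = ansatz v x"
  shows "AE x in lebesgue. grad_inner E W x = weak_grad u x \<bullet> weak_grad v x + u x * v x / (radius x)\<^sup>2"
  using ansatz_H1_vec(2)[OF u, of 1] ansatz_H1_vec(2)[OF u, of 2] ansatz_H1_vec(2)[OF u, of 3]
    ansatz_H1_vec(3)[OF u, of 1] ansatz_H1_vec(3)[OF u, of 2] ansatz_H1_vec(3)[OF u, of 3]
    ansatz_H1_vec(4)[OF u, of 1] ansatz_H1_vec(4)[OF u, of 2] ansatz_H1_vec(4)[OF u, of 3]
    ansatz_H1_vec(2)[OF v, of 1] ansatz_H1_vec(2)[OF v, of 2] ansatz_H1_vec(2)[OF v, of 3]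
    ansatz_H1_vec(3)[OF v, of 1] ansatz_H1_vec(3)[OF v, of 2] ansatz_H1_vec(3)[OF v, of 3] AE_radius_pos
proof eventually_elim
  case (elim x)
  \<comment> \<open>Cosine and sine of the polar angle and the inverse radius; the algebra below
    uses only \<open>c * c + s * s = 1\<close>.\<close>
  define c s i where "c = x$1 / radius x" and "s = x$2 / radius x" and "i = 1 / radius x"
  define p q where "p = (\<lambda>k. weak_partial k u x)" and "q = (\<lambda>k. weak_partial k v x)"
  have cs: "c * c + s * s = 1" using cos_sin_radius elim by (simp add: c_def s_def)
  have d: "dsr 0 (-1) 1 x = c * s * i" "dsr 0 (-1) 2 x = - (c * c) * i" "dsr 1 0 1 x = s * s * i" "dsr 1 0 2 x = - c * s * i"
    "dsr 0 (-1) 3 x = 0" "dsr 1 0 3 x = 0"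
    using dsr_simps[of x] elim by (simp_all add: c_def s_def i_def power2_eq_square)
  have sgs: "sg 0 (-1) x / radius x = - s" "sg 1 0 x / radius x = c" by (simp_all add: sg_def c_def s_def)
  have "grad_inner E W x = (- s * p 1 + c * s * i * u x) * (- s * q 1 + c * s * i * v x) + (- s * p 2 + - (c * c) * i * u x) * (- s * q 2 + - (c * c) * i * v x)
     + (- s * p 3) * (- s * q 3) + ((c * p 1 + s * s * i * u x) * (c * q 1 + s * s * i * v x) + (c * p 2 + - c * s * i * u x) * (c * q 2 + - c * s * i * v x) + (c * p 3) * (c * q 3))"
    unfolding grad_inner_def inner_vec_def sum_3 weak_grad_nth elim d sgs p_def q_def by simp
  also have "\<dots> = p 1 * q 1 + p 2 * q 2 + p 3 * q 3 + (i * i) * (u x * v x)"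
    using cs by algebra
  also have "\<dots> = weak_grad u x \<bullet> weak_grad v x + u x * v x / (radius x)\<^sup>2"
    by (simp add: inner_vec_def sum_3 p_def q_def i_def power2_eq_square)
  finally show ?case .
qed

text \<open>The azimuthal unit field is divergence free; what is left is the angular derivative of
  \<open>u\<close> divided by \<open>radius\<close>, and invariance makes it vanish.\<close>

lemma wdiv_ansatz:
  assumes u: "u \<in> H1" "(\<lambda>x. u x / radius x) \<in> L2" "AE x in lebesgue. E x = ansatz u x" and r: "rot_inv u"
  shows "AE x in lebesgue. wdiv E x = 0"
  using ansatz_H1_vec(2)[OF u, of 1] ansatz_H1_vec(3)[OF u, of 2] ansatz_H1_vec(4)[OF u, of 3] AE_radius_pos
    rot_inv_angular_partial[OF H1_is_weak_partial[OF u(1)] H1_is_weak_partial[OF u(1)] r]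
proof eventually_elim
  case (elim x)
  have "wdiv E x = (x$1 * weak_partial 2 u x - x$2 * weak_partial 1 u x) / radius x"
    unfolding wdiv_def sum_3 elim(1-3) using dsr_simps[OF elim(4)] by (simp add: sg_def diff_divide_distrib)
  then show ?case using elim(5) by simp
qed

lemma H1_vec_nth: "E \<in> H1_vec \<Longrightarrow> (\<lambda>x. E x $ i) \<in> H1" by (simp add: H1_vec_def)

lemma H1_vec_add: "E \<in> H1_vec \<Longrightarrow> W \<in> H1_vec \<Longrightarrow> (\<lambda>x. E x + W x) \<in> H1_vec"
  by (simp add: H1_vec_def H1_add)

lemma div_free_wdiv:
  assumes E: "E \<in> H1_vec" and d: "AE x in lebesgue. wdiv E x = 0"
  shows "div_free E"
  unfolding div_free_def
proof (intro conjI allI ballI)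
  show l: "locally_integrable (\<lambda>x. E x $ i)" for i
    by (rule L2_locally_integrable[OF H1_L2[OF H1_vec_nth[OF E]]])
  fix p assume "p \<in> test_functions"
  then have p: "p \<in> C1c" by (rule test_functions_C1c)
  let ?D = "\<lambda>i. weak_partial i (\<lambda>x. E x $ i)"
  have i: "integrable lebesgue (\<lambda>x. E x $ i * partial i p x)" "integrable lebesgue (\<lambda>x. ?D i x * p x)" for i
    by (intro integrable_Cc l C1c_Cc C1c_partial_Cc p L2_locally_integrable H1_weak_partial_L2 H1_vec_nth E)+
  have w: "(LINT x|lebesgue. E x $ i * partial i p x) = - (LINT x|lebesgue. ?D i x * p x)" for i
    by (rule is_weak_partial_C1c[OF H1_is_weak_partial[OF H1_vec_nth[OF E]] p])
  have "(LINT x|lebesgue. E x \<bullet> (\<chi> i. partial i p x)) =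
      (LINT x|lebesgue. E x $ 1 * partial 1 p x + E x $ 2 * partial 2 p x + E x $ 3 * partial 3 p x)"
    by (simp add: inner_vec_def sum_3)
  also have "\<dots> = - ((LINT x|lebesgue. ?D 1 x * p x) + (LINT x|lebesgue. ?D 2 x * p x) + (LINT x|lebesgue. ?D 3 x * p x))"
    using i w by simp
  also have "\<dots> = - (LINT x|lebesgue. ?D 1 x * p x + ?D 2 x * p x + ?D 3 x * p x)"
    using i by simp
  also have "(LINT x|lebesgue. ?D 1 x * p x + ?D 2 x * p x + ?D 3 x * p x) = (LINT x|(lebesgue :: R3 measure). 0)"
  proof (rule integral_cong_AE)
    show "(\<lambda>x. ?D 1 x * p x + ?D 2 x * p x + ?D 3 x * p x) \<in> borel_measurable lebesgue"
      using i(2) by (intro borel_measurable_add borel_measurable_integrable)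
    show "AE x in lebesgue. ?D 1 x * p x + ?D 2 x * p x + ?D 3 x * p x = 0"
      using d by eventually_elim (simp add: wdiv_def sum_3 distrib_right[symmetric])
  qed simp
  finally show "distr_div E p = 0" by (simp add: distr_div_def)
qed

text \<open>Before integration, the two sides differ by the six expressions
  \<open>D i i * D' j j - D j i * D' i j\<close> with \<open>i \<noteq> j\<close>, each of which
  integrates to zero by \<open>H1_partial_swap\<close>.\<close>

lemma curl_identity:
  assumes E: "E \<in> H1_vec" and W: "W \<in> H1_vec"
  shows "integrable lebesgue (\<lambda>x. weak_curl E x \<bullet> weak_curl W x)" "integrable lebesgue (grad_inner E W)"
    "integrable lebesgue (\<lambda>x. wdiv E x * wdiv W x)"
    "(LINT x|lebesgue. weak_curl E x \<bullet> weak_curl W x) = (LINT x|lebesgue. grad_inner E W x) - (LINT x|lebesgue. wdiv E x * wdiv W x)"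
proof -
  define D where "D i j = weak_partial i (\<lambda>y. E y $ j)" for i j
  define D' where "D' i j = weak_partial i (\<lambda>y. W y $ j)" for i j
  have DL: "D i j \<in> L2" "D' i j \<in> L2" for i j
    unfolding D_def D'_def by (intro H1_weak_partial_L2 H1_vec_nth E W)+
  have I: "integrable lebesgue (\<lambda>x. D i j x * D' k l x)" for i j k l
    by (rule L2_mult_integrable[OF DL])
  have curl: "weak_curl E x \<bullet> weak_curl W x = (D 2 3 x - D 3 2 x) * (D' 2 3 x - D' 3 2 x) + (D 3 1 x - D 1 3 x) * (D' 3 1 x - D' 1 3 x)
     + (D 1 2 x - D 2 1 x) * (D' 1 2 x - D' 2 1 x)" for x
    by (simp add: weak_curl_def inner_vec_def sum_3 D_def D'_def)
  have gr: "grad_inner E W x = (D 1 1 x * D' 1 1 x + D 2 1 x * D' 2 1 x + D 3 1 x * D' 3 1 x) + (D 1 2 x * D' 1 2 x + D 2 2 x * D' 2 2 x + D 3 2 x * D' 3 2 x)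
      + (D 1 3 x * D' 1 3 x + D 2 3 x * D' 2 3 x + D 3 3 x * D' 3 3 x)" for x
    by (simp add: grad_inner_def inner_vec_def sum_3 D_def D'_def)
  have dv: "wdiv E x * wdiv W x = (D 1 1 x + D 2 2 x + D 3 3 x) * (D' 1 1 x + D' 2 2 x + D' 3 3 x)" for x
    by (simp add: wdiv_def sum_3 D_def D'_def)
  have sw: "(LINT x|lebesgue. D i j x * D' j i x) = (LINT x|lebesgue. D j j x * D' i i x)" for i j
    unfolding D_def D'_def by (rule H1_partial_swap[OF H1_vec_nth[OF E] H1_vec_nth[OF W]])
  show i1: "integrable lebesgue (\<lambda>x. weak_curl E x \<bullet> weak_curl W x)"
    unfolding curl left_diff_distrib right_diff_distrib by (intro Bochner_Integration.integrable_add Bochner_Integration.integrable_diff I)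
  show i2: "integrable lebesgue (grad_inner E W)"
    unfolding gr[abs_def] by (intro Bochner_Integration.integrable_add I)
  show i3: "integrable lebesgue (\<lambda>x. wdiv E x * wdiv W x)"
    unfolding dv distrib_left distrib_right by (intro Bochner_Integration.integrable_add I)
  have "(LINT x|lebesgue. weak_curl E x \<bullet> weak_curl W x - grad_inner E W x + wdiv E x * wdiv W x) =
    (LINT x|lebesgue. (D 2 2 x * D' 3 3 x - D 3 2 x * D' 2 3 x) + (D 3 3 x * D' 2 2 x - D 2 3 x * D' 3 2 x)
     + (D 1 1 x * D' 3 3 x - D 3 1 x * D' 1 3 x) + (D 3 3 x * D' 1 1 x - D 1 3 x * D' 3 1 x)
     + (D 1 1 x * D' 2 2 x - D 2 1 x * D' 1 2 x) + (D 2 2 x * D' 1 1 x - D 1 2 x * D' 2 1 x))"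
    by (rule Bochner_Integration.integral_cong) (auto simp: curl gr dv algebra_simps)
  also have "\<dots> = 0"
    using sw[of 3 2] sw[of 2 3] sw[of 3 1] sw[of 1 3] sw[of 2 1] sw[of 1 2] by (simp add: I)
  finally show "(LINT x|lebesgue. weak_curl E x \<bullet> weak_curl W x) = (LINT x|lebesgue. grad_inner E W x) - (LINT x|lebesgue. wdiv E x * wdiv W x)"
    using i1 i2 i3 by simp
qed

lemma norm_ansatz: "radius x > 0 \<Longrightarrow> (norm (ansatz u x))\<^sup>2 = (u x)\<^sup>2"
proof -
  assume r: "radius x > 0"
  have "(norm (ansatz u x))\<^sup>2 = ((x$1 / radius x) * (x$1 / radius x) + (x$2 / radius x) * (x$2 / radius x)) * (u x)\<^sup>2"
    unfolding power2_norm_eq_inner inner_vec_def sum_3 ansatz_nth by (simp add: sg_def power2_eq_square algebra_simps)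
  then show ?thesis using cos_sin_radius[OF r] by simp
qed

lemma ansatz_norm:
  assumes u: "u \<in> H1" "(\<lambda>x. u x / radius x) \<in> L2" "AE x in lebesgue. E x = ansatz u x"
  shows "H1_vec_norm E = X_norm u"
proof -
  note E = ansatz_H1_vec(1)[OF u]
  have eq: "AE x in lebesgue. (\<Sum>i\<in>UNIV. (norm (weak_grad (\<lambda>y. E y $ i) x))\<^sup>2) + (norm (E x))\<^sup>2 =
     (norm (weak_grad u x))\<^sup>2 + (u x)\<^sup>2 / (radius x)\<^sup>2 + (u x)\<^sup>2"
    using grad_inner_ansatz[OF u u] AE_radius_pos u(3)
    by eventually_elim (simp add: grad_inner_def power2_norm_eq_inner[symmetric] norm_ansatz power2_eq_square[of "u _"])
  have [measurable]: "u \<in> borel_measurable lebesgue" "weak_partial i u \<in> borel_measurable lebesgue"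
     "(\<lambda>x. E x $ j) \<in> borel_measurable lebesgue" "weak_partial i (\<lambda>y. E y $ j) \<in> borel_measurable lebesgue" for i j
    using L2_measurable H1_L2 H1_weak_partial_L2 u(1) H1_vec_nth[OF E] by auto
  have "(LINT x|lebesgue. (\<Sum>i\<in>UNIV. (norm (weak_grad (\<lambda>y. E y $ i) x))\<^sup>2) + (norm (E x))\<^sup>2) =
    (LINT x|lebesgue. (norm (weak_grad u x))\<^sup>2 + (u x)\<^sup>2 / (radius x)\<^sup>2 + (u x)\<^sup>2)"
  proof (rule integral_cong_AE[OF _ _ eq])
    show "(\<lambda>x. (\<Sum>i\<in>UNIV. (norm (weak_grad (\<lambda>y. E y $ i) x))\<^sup>2) + (norm (E x))\<^sup>2) \<in> borel_measurable lebesgue"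
      unfolding power2_norm_eq_inner inner_vec_def weak_grad_nth by measurable
    show "(\<lambda>x. (norm (weak_grad u x))\<^sup>2 + (u x)\<^sup>2 / (radius x)\<^sup>2 + (u x)\<^sup>2) \<in> borel_measurable lebesgue"
      unfolding power2_norm_eq_inner inner_vec_def weak_grad_nth by measurable
  qed
  then show ?thesis by (simp add: H1_vec_norm_def X_norm_def)
qed

text \<open>At this point \<open>u\<close> itself has no known weak derivatives, only its product
  with \<open>sg a b / radius\<close> has. The invariant function \<open>kap * u\<close> is
  therefore tested with \<open>sg a b * p\<close>, where the angular derivative of the factor
  \<open>sg a b\<close> is \<open>sg b (- a)\<close>; then \<open>kap\<close> tends to
  \<open>1 / radius\<close>.\<close>

lemma weak_dth_sg_over_radius:
  assumes uL: "u \<in> L2" and r: "rot_inv u"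
    and w1: "is_weak_partial 1 (\<lambda>x. sg a b x / radius x * u x) v1" and w2: "is_weak_partial 2 (\<lambda>x. sg a b x / radius x * u x) v2"
  shows "AE x in lebesgue. x$1 * v2 x - x$2 * v1 x = sg b (- a) x / radius x * u x"
proof (rule weak_dth_unique[OF w1 w2])
  have um [measurable]: "u \<in> borel_measurable lebesgue" by (rule L2_measurable[OF uL])
  have l: "locally_integrable u" by (rule L2_locally_integrable[OF uL])
  show lq: "locally_integrable (\<lambda>x. sg b (- a) x / radius x * u x)"
    by (rule locally_integrable_mult_bounded[OF l _ sg_over_radius_bound]) measurable
  fix p assume p: "p \<in> C1c"
  have dC: "dth p \<in> Cc" by (rule dth_Cc[OF p])
  have [measurable]: "p \<in> borel_measurable lebesgue" "dth p \<in> borel_measurable lebesgue" "kap (ep n) \<in> borel_measurable lebesgue" for n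
    using Cc_measurable C1c_Cc p dC continuous_measurable_lebesgue[OF C1_continuous[OF kap_C1(1)[OF ep_nonzero]]] by auto
  have lim: "(\<lambda>n. LINT x|lebesgue. (sg c d x * kap (ep n) x * u x) * q x) \<longlonglongrightarrow> (LINT x|lebesgue. (sg c d x / radius x * u x) * q x)"
    if q: "q \<in> Cc" for q c d
  proof (rule integral_dominated_convergence[where w = "\<lambda>x. (\<bar>c\<bar> + \<bar>d\<bar>) * \<bar>u x * q x\<bar>"])
    have [measurable]: "q \<in> borel_measurable lebesgue" by (rule Cc_measurable[OF q])
    show "(\<lambda>x. sg c d x / radius x * u x * q x) \<in> borel_measurable lebesgue" by measurable
    show "(\<lambda>x. sg c d x * kap (ep n) x * u x * q x) \<in> borel_measurable lebesgue" for n by measurable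
    show "integrable lebesgue (\<lambda>x. (\<bar>c\<bar> + \<bar>d\<bar>) * \<bar>u x * q x\<bar>)"
      by (intro integrable_mult_right integrable_abs integrable_Cc l q)
    show "AE x in lebesgue. (\<lambda>n. sg c d x * kap (ep n) x * u x * q x) \<longlonglongrightarrow> sg c d x / radius x * u x * q x"
      using AE_radius_pos
    proof eventually_elim
      case (elim x)
      have "(\<lambda>n. sg c d x * kap (ep n) x * u x * q x) \<longlonglongrightarrow> sg c d x * (1 / radius x) * u x * q x"
        by (intro tendsto_intros kap_tendsto elim)
      then show ?case by simp
    qed
    show "AE x in lebesgue. norm (sg c d x * kap (ep n) x * u x * q x) \<le> (\<bar>c\<bar> + \<bar>d\<bar>) * \<bar>u x * q x\<bar>" for n
    proof (rule AE_I2)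
      fix x
      have "norm (sg c d x * kap (ep n) x * u x * q x) = \<bar>sg c d x * kap (ep n) x\<bar> * \<bar>u x * q x\<bar>"
        by (simp add: abs_mult)
      also have "\<dots> \<le> (\<bar>c\<bar> + \<bar>d\<bar>) * \<bar>u x * q x\<bar>" by (intro mult_right_mono sg_kap_bound) auto
      finally show "norm (sg c d x * kap (ep n) x * u x * q x) \<le> (\<bar>c\<bar> + \<bar>d\<bar>) * \<bar>u x * q x\<bar>" .
    qed
  qed
  have eqn: "(LINT x|lebesgue. (sg a b x * kap (ep n) x * u x) * dth p x) = - (LINT x|lebesgue. (sg b (- a) x * kap (ep n) x * u x) * p x)" for n
  proof -
    let ?g = "\<lambda>x. kap (ep n) x * u x"
    have gl: "locally_integrable ?g"
      by (rule locally_integrable_mult_continuous[OF l C1_continuous[OF kap_C1(1)[OF ep_nonzero]]])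
    have gr: "rot_inv ?g"
      unfolding rot_inv_def
    proof
      fix t
      have k: "kap e (rot t x) = kap e x" for e x
        using rot_radius[of t x] by (simp add: kap_def radius_def del: rot_radius rot_nth)
      have "AE x in lebesgue. u (rot t x) = u x" using r by (simp add: rot_inv_def)
      then show "AE x in lebesgue. kap (ep n) (rot t x) * u (rot t x) = kap (ep n) x * u x"
        by eventually_elim (simp only: k)
    qed
    have sp: "(\<lambda>x. sg a b x * p x) \<in> C1c" by (rule C1c_mult[OF sg_C1(1) p])
    have d: "dth (\<lambda>x. sg a b x * p x) x = sg a b x * dth p x + sg b (- a) x * p x" for x
      using fun_cong[OF C1_mult(2)[OF sg_C1(1)[of a b] C1cD[OF p]], of x]
      by (simp add: dth_def vec_eq_iff sg_C1(2) forall_3) (simp add: sg_def algebra_simps)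
    have "0 = (LINT x|lebesgue. ?g x * dth (\<lambda>x. sg a b x * p x) x)"
      using integral_rot_inv_dth[OF gl gr sp] by simp
    also have "\<dots> = (LINT x|lebesgue. (sg a b x * kap (ep n) x * u x) * dth p x + (sg b (- a) x * kap (ep n) x * u x) * p x)"
      unfolding d by (rule Bochner_Integration.integral_cong) (auto simp: algebra_simps)
    also have "\<dots> = (LINT x|lebesgue. (sg a b x * kap (ep n) x * u x) * dth p x) + (LINT x|lebesgue. (sg b (- a) x * kap (ep n) x * u x) * p x)"
    proof (rule Bochner_Integration.integral_add)
      have *: "locally_integrable (\<lambda>x. (sg c d x * kap (ep n) x) * u x)" for c d
        by (intro locally_integrable_mult_continuous[OF l] continuous_on_mult C1_continuous sg_C1(1) kap_C1(1)[OF ep_nonzero])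
      show "integrable lebesgue (\<lambda>x. (sg a b x * kap (ep n) x * u x) * dth p x)" by (rule integrable_Cc[OF * dC])
      show "integrable lebesgue (\<lambda>x. (sg b (- a) x * kap (ep n) x * u x) * p x)" by (rule integrable_Cc[OF * C1c_Cc[OF p]])
    qed
    finally show ?thesis by simp
  qed
  show "(LINT x|lebesgue. sg a b x / radius x * u x * dth p x) = - (LINT x|lebesgue. sg b (- a) x / radius x * u x * p x)"
    using LIMSEQ_unique[OF lim[OF dC, of a b] tendsto_minus[OF lim[OF C1c_Cc[OF p], of b "- a"], unfolded eqn[symmetric]]] .
qed

text \<open>The angular derivative turns \<open>E\<close> by a right angle, so \<open>\<bar>E\<bar> \<le> r \<bar>\<nabla>E\<bar>\<close>, which puts \<open>u / r\<close> in \<open>L\<^sup>2\<close>.\<close>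

lemma H1_vec_ansatz:
  assumes E: "E \<in> H1_vec" "AE x in lebesgue. E x = ansatz u x" and r: "rot_inv u"
  shows "u \<in> H1" "(\<lambda>x. u x / radius x) \<in> L2"
proof -
  let ?E = "\<lambda>j x. E x $ j" and ?V = "\<lambda>i j. weak_partial i (\<lambda>x. E x $ j)"
  have EH: "?E j \<in> H1" and EL: "?E j \<in> L2" and VL: "?V i j \<in> L2" and wp: "is_weak_partial i (?E j) (?V i j)" for i j
    using E(1) H1_vec_nth H1_L2 H1_weak_partial_L2 H1_is_weak_partial by blast+
  have e1: "AE x in lebesgue. E x $ 1 = sg 0 (-1) x / radius x * u x" and e2: "AE x in lebesgue. E x $ 2 = sg 1 0 x / radius x * u x"
    using E(2) by (eventually_elim, simp only: ansatz_nth)+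
  have ue: "AE x in lebesgue. sg 0 (-1) x / radius x * E x $ 1 + sg 1 0 x / radius x * E x $ 2 = u x"
    using e1 e2 AE_radius_pos
  proof eventually_elim
    case (elim x)
    have "sg 0 (-1) x / radius x * E x $ 1 + sg 1 0 x / radius x * E x $ 2 =
       ((x$1 / radius x) * (x$1 / radius x) + (x$2 / radius x) * (x$2 / radius x)) * u x"
      unfolding elim by (simp add: sg_def algebra_simps)
    then show ?case using cos_sin_radius[OF elim(3)] by simp
  qed
  have sL: "(\<lambda>x. sg a b x / radius x * z x) \<in> L2" if "z \<in> L2" for a b z
    by (rule L2_bounded_mult[OF that _ sg_over_radius_bound]) measurable
  have uL: "u \<in> L2"
    by (rule L2_cong_AE[OF L2_add[OF sL[OF EL] sL[OF EL]] ue])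
  have um [measurable]: "u \<in> borel_measurable lebesgue" by (rule L2_measurable[OF uL])
  have w1: "is_weak_partial i (\<lambda>x. sg 0 (-1) x / radius x * u x) (?V i 1)" for i
    by (rule is_weak_partial_cong[OF wp e1]) simp
  have w2: "is_weak_partial i (\<lambda>x. sg 1 0 x / radius x * u x) (?V i 2)" for i
    by (rule is_weak_partial_cong[OF wp e2]) simp
  have a1: "AE x in lebesgue. x$1 * ?V 2 1 x - x$2 * ?V 1 1 x = sg (-1) (-0) x / radius x * u x"
    by (rule weak_dth_sg_over_radius[OF uL r w1 w1])
  have a2: "AE x in lebesgue. x$1 * ?V 2 2 x - x$2 * ?V 1 2 x = sg 0 (-1) x / radius x * u x"
    by (rule weak_dth_sg_over_radius[OF uL r w2 w2])
  have bnd: "AE x in lebesgue. (u x / radius x)\<^sup>2 \<le> (?V 2 1 x)\<^sup>2 + (?V 1 1 x)\<^sup>2 + (?V 2 2 x)\<^sup>2 + (?V 1 2 x)\<^sup>2"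
    using a1 a2 AE_radius_pos
  proof eventually_elim
    case (elim x)
    let ?c = "x$1 / radius x" and ?s = "x$2 / radius x"
    have cs: "?c * ?c + ?s * ?s = 1" by (rule cos_sin_radius[OF elim(3)])
    have CS: "(?c * p - ?s * q)\<^sup>2 \<le> p\<^sup>2 + q\<^sup>2" for p q
    proof -
      have "p\<^sup>2 + q\<^sup>2 - (?c * p - ?s * q)\<^sup>2 = (?s * p + ?c * q)\<^sup>2"
        unfolding power2_eq_square using cs by algebra
      then show ?thesis using zero_le_power2[of "?s * p + ?c * q"] by linarith
    qed
    have d: "?c * ?V 2 1 x - ?s * ?V 1 1 x = - ?c * (u x / radius x)" "?c * ?V 2 2 x - ?s * ?V 1 2 x = - ?s * (u x / radius x)"
      using arg_cong[OF elim(1), of "\<lambda>z. z / radius x"] arg_cong[OF elim(2), of "\<lambda>z. z / radius x"]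
      by (simp_all add: sg_def diff_divide_distrib)
    have "(u x / radius x)\<^sup>2 = (- ?c * (u x / radius x))\<^sup>2 + (- ?s * (u x / radius x))\<^sup>2"
      unfolding power2_eq_square using cs by algebra
    also have "\<dots> \<le> ((?V 2 1 x)\<^sup>2 + (?V 1 1 x)\<^sup>2) + ((?V 2 2 x)\<^sup>2 + (?V 1 2 x)\<^sup>2)"
      unfolding d[symmetric] by (intro add_mono CS)
    finally show ?case by simp
  qed
  show ur: "(\<lambda>x. u x / radius x) \<in> L2"
    by (rule L2_bound[OF _ _ bnd]) (use VL L2_square in auto)
  \<comment> \<open>\<open>u\<close> is the inner product of \<open>E\<close> with the azimuthal
    unit vector. To differentiate that product, the components of \<open>E\<close> divided by
    \<open>radius\<close> have to be square integrable, which the bound by \<open>u / radius\<close>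
    now gives.\<close>
  have Er: "(\<lambda>x. E x $ j / radius x) \<in> L2" if j: "j = 1 \<or> j = 2" for j
  proof (rule L2_mono[OF ur])
    show "(\<lambda>x. E x $ j / radius x) \<in> borel_measurable lebesgue" using L2_measurable[OF EL[of j]] by measurable
    have "AE x in lebesgue. \<bar>E x $ j\<bar> \<le> \<bar>u x\<bar>"
      using e1 e2
    proof eventually_elim
      case (elim x)
      have "\<bar>sg a b x / radius x * u x\<bar> \<le> (\<bar>a\<bar> + \<bar>b\<bar>) * \<bar>u x\<bar>" for a b
        unfolding abs_mult[of "_ / _"] by (intro mult_right_mono sg_over_radius_bound) auto
      from this[of 0 "-1"] this[of 1 0] show ?case using j elim by auto
    qed
    then show "AE x in lebesgue. \<bar>E x $ j / radius x\<bar> \<le> \<bar>u x / radius x\<bar>"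
      by eventually_elim (auto simp: abs_div intro: divide_right_mono)
  qed
  have 1: "(\<lambda>x. sg 0 (-1) x / radius x * E x $ 1) \<in> H1" by (rule H1_sg_over_radius(1)[OF EH Er]) simp
  have 2: "(\<lambda>x. sg 1 0 x / radius x * E x $ 2) \<in> H1" by (rule H1_sg_over_radius(1)[OF EH Er]) simp
  show "u \<in> H1" by (rule H1_cong_AE[OF H1_add(1)[OF 1 2] ue])
qed

text \<open>\<open>h\<close> is prescribed on all real multiples of a unit vector, so
  \<open>u x\<close> may be negative; the interval integrals are oriented, and the substitution
  respects this.\<close>

lemma prim_h_ansatz:
  assumes h: "AE x in lebesgue. \<forall>w a. norm w = 1 \<longrightarrow> h x (a *\<^sub>R w) = f x a *\<^sub>R w"
    and c: "\<And>x. continuous_on UNIV (f x)" and E: "AE x in lebesgue. E x = ansatz u x"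
  shows "AE x in lebesgue. prim_h h x (E x) = prim_f f x (u x)"
  using h E AE_radius_pos
proof eventually_elim
  case (elim x)
  define e where "e = (1 / radius x) *\<^sub>R tri (- x$2, x$1, 0)"
  have Ee: "E x = u x *\<^sub>R e"
    unfolding elim(2) by (simp add: vec_eq_iff forall_3 e_def ansatz_def)
  have "(norm e)\<^sup>2 = (x$1 / radius x) * (x$1 / radius x) + (x$2 / radius x) * (x$2 / radius x)"
    unfolding power2_norm_eq_inner by (simp add: inner_vec_def sum_3 e_def)
  then have "(norm e)\<^sup>2 = 1" using cos_sin_radius[OF elim(3)] by simp
  then have ne: "norm e = 1" by (simp add: power2_eq_1_iff) (use norm_ge_zero[of e] in linarith)
  have ee: "e \<bullet> e = 1" using ne by (simp add: norm_eq_1)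
  have hx: "h x (t *\<^sub>R E x) \<bullet> E x = u x *\<^sub>R f x (u x * t)" for t
  proof -
    have "h x (t *\<^sub>R E x) = f x (u x * t) *\<^sub>R e"
      using elim(1) ne by (simp add: Ee mult.commute)
    then show ?thesis by (simp add: Ee ee)
  qed
  have "(LBINT t=ereal 0..ereal 1. u x *\<^sub>R f x (u x * t)) = (LBINT y=ereal (u x * 0)..ereal (u x * 1). f x y)"
    by (rule interval_integral_substitution_finite)
      (auto intro!: derivative_eq_intros continuous_on_subset[OF c])
  then show ?case unfolding prim_h_def prim_f_def hx by simp
qed

section \<open>The nonlinearity\<close>

lemma AE_lborel_dense:
  assumes "AE s in lborel. P (s::real)" "a < b"
  obtains s where "a < s" "s < b" "P s"
proof -
  have "\<exists>s. a < s \<and> s < b \<and> P s"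
  proof (rule ccontr)
    assume "\<nexists>s. a < s \<and> s < b \<and> P s"
    then have "AE s in lborel. s \<notin> {a<..<b}" using assms(1) by (auto elim!: eventually_mono)
    then have "emeasure lborel {a<..<b} = 0"
      by (subst (asm) AE_iff_measurable[of "{a<..<b}"]) auto
    then show False using assms(2) by simp
  qed
  then show thesis using that by blast
qed

text \<open>By Fubini almost every section is measurable, and continuity passes to all sections.\<close>

lemma section_measurable:
  fixes f :: "R3 \<Rightarrow> real \<Rightarrow> real"
  assumes f: "(\<lambda>(x, s). f x s) \<in> borel_measurable (lebesgue :: (R3 \<times> real) measure)"
    and c: "\<And>x. continuous_on UNIV (f x)"
  shows "(\<lambda>x. f x s) \<in> borel_measurable lebesgue"
proof -
  obtain g where g: "g \<in> borel_measurable lborel" and ae: "AE z in lborel. (\<lambda>(x, s). f x s) z = g z"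
    using completion_ex_borel_measurable_real[OF f] by blast
  obtain N where N: "N \<in> null_sets (lborel :: (R3 \<times> real) measure)" and Ns: "{z. (\<lambda>(x, s). f x s) z \<noteq> g z} \<subseteq> N"
    using ae unfolding eventually_ae_filter by auto
  have Nm: "N \<in> sets (lborel \<Otimes>\<^sub>M lborel)" using N unfolding lborel_prod by auto
  have "(\<integral>\<^sup>+y. emeasure lborel ((\<lambda>x. (x, y)) -` N) \<partial>lborel) = 0"
    using N lborel_pair.emeasure_pair_measure_alt2[OF Nm] unfolding lborel_prod by auto
  then have N0: "AE s in lborel. emeasure lborel ((\<lambda>x. (x, s)) -` N) = 0"
    by (subst (asm) nn_integral_0_iff_AE) (use lborel_pair.measurable_emeasure_Pair2[OF Nm] in auto)
  have "AE s in lborel. (\<lambda>x. f x s) \<in> borel_measurable lebesgue"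
    using N0
  proof eventually_elim
    case (elim s)
    have sN: "(\<lambda>x. (x, s)) -` N \<in> null_sets lborel"
      using elim measurable_sets[OF measurable_Pair2' Nm, of s] by (auto simp: null_sets_def)
    have "AE x in lborel. g (x, s) = f x s"
    proof (rule AE_I'[OF sN], rule subsetI)
      fix x assume "x \<in> {x \<in> space lborel. g (x, s) \<noteq> f x s}"
      then have "(x, s) \<in> {z. (\<lambda>(x, s). f x s) z \<noteq> g z}" by auto
      then show "x \<in> (\<lambda>x. (x, s)) -` N" using Ns by blast
    qed
    then have gf: "AE x in lebesgue. g (x, s) = f x s" by (rule AE_completion)
    have "(\<lambda>x. g (x, s)) \<in> borel_measurable lborel"
      using measurable_compose[OF measurable_Pair2'[of s] g[unfolded lborel_prod[symmetric]]] by simp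
    from measurable_lebesgue_cong_AE[OF measurable_completion[OF this] gf] show ?case .
  qed
  then have "\<exists>s'. s < s' \<and> s' < s + ep n \<and> (\<lambda>x. f x s') \<in> borel_measurable lebesgue" for n
    by (rule AE_lborel_dense[where a = s and b = "s + ep n"]) auto
  then obtain s' where s': "\<And>n. s < s' n" "\<And>n. s' n < s + ep n" "\<And>n. (\<lambda>x. f x (s' n)) \<in> borel_measurable lebesgue" by metis
  have lim: "s' \<longlonglongrightarrow> s"
  proof (rule tendsto_sandwich[of "\<lambda>n. s" _ _ "\<lambda>n. s + ep n"])
    have "(\<lambda>n. s + ep n) \<longlonglongrightarrow> s + 0" by (intro tendsto_intros LIMSEQ_inverse_real_of_nat)
    then show "(\<lambda>n. s + ep n) \<longlonglongrightarrow> s" by simp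
  qed (use s' in \<open>auto intro: always_eventually less_imp_le\<close>)
  show ?thesis
  proof (rule borel_measurable_LIMSEQ_real[OF _ s'(3)])
    fix x
    have "isCont (f x) s" using c by (simp add: continuous_on_eq_continuous_at)
    then show "(\<lambda>n. f x (s' n)) \<longlonglongrightarrow> f x s" using lim by (rule isCont_tendsto_compose)
  qed
qed

text \<open>Rounding the second argument down to multiples of \<open>1 / (n + 1)\<close> leaves
  countably many sections, each measurable; continuity in the second argument gives the
  limit.\<close>

lemma caratheodory_measurable:
  fixes f :: "R3 \<Rightarrow> real \<Rightarrow> real"
  assumes f: "\<And>s. (\<lambda>x. f x s) \<in> borel_measurable lebesgue" and c: "\<And>x. continuous_on UNIV (f x)"
  shows "(\<lambda>z. f (fst z) (snd z)) \<in> borel_measurable (lebesgue \<Otimes>\<^sub>M borel)"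
proof (rule borel_measurable_LIMSEQ_real)
  let ?g = "\<lambda>n z. f (fst z) (real_of_int \<lfloor>snd z * real (Suc n)\<rfloor> / real (Suc n))"
  show "?g n \<in> borel_measurable (lebesgue \<Otimes>\<^sub>M borel)" for n
  proof (rule measurable_compose_countable[of "\<lambda>i z. f (fst z) (real_of_int i / real (Suc n))"])
    show "(\<lambda>z. f (fst z) (real_of_int i / real (Suc n))) \<in> borel_measurable (lebesgue \<Otimes>\<^sub>M borel)" for i
      by (rule measurable_compose[OF measurable_fst f])
    show "(\<lambda>z. \<lfloor>snd z * real (Suc n)\<rfloor>) \<in> (lebesgue \<Otimes>\<^sub>M borel) \<rightarrow>\<^sub>M count_space UNIV" by measurable
  qed
  fix z :: "R3 \<times> real"
  let ?s = "snd z"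
  have "(\<lambda>n. real_of_int \<lfloor>?s * real (Suc n)\<rfloor> / real (Suc n)) \<longlonglongrightarrow> ?s"
  proof (rule tendsto_sandwich[of "\<lambda>n. ?s - ep n" _ _ "\<lambda>n. ?s"])
    have "?s - ep n \<le> real_of_int \<lfloor>?s * real (Suc n)\<rfloor> / real (Suc n)" for n
    proof -
      have "?s * real (Suc n) - 1 \<le> real_of_int \<lfloor>?s * real (Suc n)\<rfloor>" by linarith
      then have "(?s * real (Suc n) - 1) / real (Suc n) \<le> real_of_int \<lfloor>?s * real (Suc n)\<rfloor> / real (Suc n)"
        by (intro divide_right_mono) auto
      then show ?thesis by (simp add: diff_divide_distrib inverse_eq_divide)
    qed
    then show "\<forall>\<^sub>F n in sequentially. ?s - ep n \<le> real_of_int \<lfloor>?s * real (Suc n)\<rfloor> / real (Suc n)" by simp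
    have "real_of_int \<lfloor>?s * real (Suc n)\<rfloor> / real (Suc n) \<le> ?s" for n
      by (subst pos_divide_le_eq) (auto simp del: of_nat_Suc)
    then show "\<forall>\<^sub>F n in sequentially. real_of_int \<lfloor>?s * real (Suc n)\<rfloor> / real (Suc n) \<le> ?s" by simp
    have "(\<lambda>n. ?s - ep n) \<longlonglongrightarrow> ?s - 0" by (intro tendsto_intros LIMSEQ_inverse_real_of_nat)
    then show "(\<lambda>n. ?s - ep n) \<longlonglongrightarrow> ?s" by simp
  qed simp
  moreover have "isCont (f (fst z)) ?s" using c by (simp add: continuous_on_eq_continuous_at)
  ultimately show "(\<lambda>n. ?g n z) \<longlonglongrightarrow> f (fst z) (snd z)" using isCont_tendsto_compose by blast
qed

text \<open>With fixed limits of integration the upper end becomes a parameter of the integrand;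
  measurability of the primitive in \<open>x\<close> is proved in this form.\<close>

lemma prim_f_substitution:
  assumes "continuous_on UNIV (f x)"
  shows "prim_f f x s = (LBINT t=ereal 0..ereal 1. s * f x (s * t))"
proof -
  have "(LBINT t=ereal 0..ereal 1. s *\<^sub>R f x (s * t)) = (LBINT y=ereal (s * 0)..ereal (s * 1). f x y)"
    by (rule interval_integral_substitution_finite)
      (auto intro!: derivative_eq_intros continuous_on_subset[OF assms])
  then show ?thesis by (simp add: prim_f_def)
qed

lemma prim_f_has_derivative:
  assumes c: "continuous_on UNIV (f x)"
  shows "(prim_f f x has_real_derivative f x s) (at s)"
proof -
  define a where "a = \<bar>s\<bar> + 1"
  have "((\<lambda>u. LBINT y=ereal 0..ereal u. f x y) has_vector_derivative f x s) (at s within {-a..a})"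
    using interval_integral_FTC2[of "-a" 0 a "f x" s] continuous_on_subset[OF c]
    by (auto simp: a_def zero_ereal_def)
  moreover have "at s within {-a..a} = at s"
    by (rule at_within_interior) (auto simp: a_def)
  ultimately show ?thesis
    by (simp add: prim_f_def[abs_def] has_real_derivative_iff_has_vector_derivative)
qed

lemma prim_f_0 [simp]: "prim_f f x 0 = 0"
  by (simp add: prim_f_def)

text \<open>Collects the pointwise hypotheses that hold off one null set, so that the estimates
  below are proved at a fixed point and enter integrals through a single exceptional set.\<close>

definition good_pt :: "(R3 \<Rightarrow> real \<Rightarrow> real) \<Rightarrow> (R3 \<Rightarrow> R3 \<Rightarrow> R3) \<Rightarrow> real \<Rightarrow> R3 \<Rightarrow> bool" where
  "good_pt f h c x \<longleftrightarrow> continuous_on UNIV (f x) \<and> (\<forall>s. \<bar>f x s\<bar> \<le> c * (\<bar>s\<bar> + \<bar>s\<bar> ^ 5)) \<and>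
     (\<forall>w a. norm w = 1 \<longrightarrow> h x (a *\<^sub>R w) = f x a *\<^sub>R w)"

lemma growth_mono: "0 \<le> s \<Longrightarrow> s \<le> m \<Longrightarrow> 0 \<le> c \<Longrightarrow> c * (s + s ^ 5) \<le> c * (m + m ^ 5)" for s m c :: real
  by (intro mult_left_mono add_mono power_mono) auto

context
  fixes f h c x
  assumes g: "good_pt f h c x" and c: "c \<ge> 0"
begin

lemma good_cont: "continuous_on UNIV (f x)" and good_growth: "\<bar>f x s\<bar> \<le> c * (\<bar>s\<bar> + \<bar>s\<bar> ^ 5)"
  and good_h: "norm w = 1 \<Longrightarrow> h x (a *\<^sub>R w) = f x a *\<^sub>R w"
  using g by (auto simp: good_pt_def)

lemma good_prim_h: "prim_h h x w = prim_f f x (norm w)"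
proof (cases "w = 0")
  case False
  define e where "e = (1 / norm w) *\<^sub>R w"
  have e: "norm e = 1" "w = norm w *\<^sub>R e" using False by (auto simp: e_def)
  have ee: "e \<bullet> e = 1" using e(1) by (simp add: norm_eq_1)
  have "h x (t *\<^sub>R w) \<bullet> w = norm w * f x (norm w * t)" for t
  proof -
    have "h x (t *\<^sub>R w) = f x (norm w * t) *\<^sub>R e"
      using good_h[OF e(1), of "norm w * t"] e(2) by (metis mult.commute scaleR_scaleR)
    then have "h x (t *\<^sub>R w) \<bullet> w = (f x (norm w * t) *\<^sub>R e) \<bullet> (norm w *\<^sub>R e)" using e(2) by metis
    then show ?thesis by (simp add: ee)
  qed
  then show ?thesis by (simp add: prim_h_def prim_f_substitution[of f x, OF good_cont])
qed (simp add: prim_h_def)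

lemma good_h_eq: "h x w = (f x (norm w) / norm w) *\<^sub>R w"
proof (cases "w = 0")
  case True
  have "h x (0 *\<^sub>R axis 1 1) = f x 0 *\<^sub>R axis 1 1" by (rule good_h) simp
  moreover have "f x 0 = 0" using good_growth[of 0] by simp
  ultimately show ?thesis using True by simp
next
  case False
  then have "h x (norm w *\<^sub>R ((1 / norm w) *\<^sub>R w)) = f x (norm w) *\<^sub>R ((1 / norm w) *\<^sub>R w)"
    by (intro good_h) simp
  then show ?thesis using False by simp
qed

lemma good_h_bound: "norm (h x w) \<le> c * (norm w + norm w ^ 5)"
proof (cases "w = 0")
  case False then show ?thesis using good_growth[of "norm w"] by (simp add: good_h_eq)
qed (simp add: good_h_eq)

lemma good_lipschitz:
  assumes "\<bar>s\<bar> \<le> m" "\<bar>t\<bar> \<le> m"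
  shows "\<bar>prim_f f x s - prim_f f x t\<bar> \<le> c * (m + m ^ 5) * \<bar>s - t\<bar>"
proof -
  have "norm (prim_f f x s - prim_f f x t) \<le> c * (m + m ^ 5) * norm (s - t)"
  proof (rule field_differentiable_bound[of "{-m..m}"])
    show "(prim_f f x has_field_derivative f x z) (at z within {-m..m})" for z
      using prim_f_has_derivative[of f x, OF good_cont] has_field_derivative_at_within by blast
    show "norm (f x z) \<le> c * (m + m ^ 5)" if "z \<in> {-m..m}" for z
    proof -
      have "\<bar>z\<bar> \<le> m" using that by auto
      then have "\<bar>f x z\<bar> \<le> c * (m + m ^ 5)" by (rule order_trans[OF good_growth growth_mono[OF abs_ge_zero _ c]])
      then show ?thesis by simp
    qed
  qed (use assms in auto)
  then show ?thesis by simp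
qed

lemma good_prim_f_bound: "\<bar>prim_f f x s\<bar> \<le> c * (\<bar>s\<bar>\<^sup>2 + \<bar>s\<bar> ^ 6)"
proof -
  have "\<bar>prim_f f x s\<bar> \<le> c * (\<bar>s\<bar> + \<bar>s\<bar> ^ 5) * \<bar>s\<bar>"
    using good_lipschitz[of s "\<bar>s\<bar>" 0] by simp
  also have "c * (\<bar>s\<bar> + \<bar>s\<bar> ^ 5) * \<bar>s\<bar> = c * (\<bar>s\<bar>\<^sup>2 + \<bar>s\<bar> ^ 6)"
    by (simp only: distrib_right mult.assoc power_Suc2[symmetric] power2_eq_square) simp
  finally show ?thesis .
qed

text \<open>The potential depends on the norm alone, so the chain rule goes through
  \<open>norm\<close>, which is not differentiable at the origin. In
  \<open>remainder_estimate\<close> the points with \<open>E x = 0\<close> fall under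
  \<open>good_remainder_large\<close>.\<close>

lemma good_has_derivative:
  assumes "e \<noteq> 0" shows "(prim_h h x has_derivative (\<lambda>w. h x e \<bullet> w)) (at e)"
proof -
  have "(norm has_derivative (\<lambda>w. (inverse (norm e) *\<^sub>R e) \<bullet> w)) (at e)"
    using has_derivative_norm[OF assms] by (simp add: sgn_div_norm inner_commute)
  from has_derivative_compose[OF this prim_f_has_derivative[of f x, OF good_cont, unfolded has_field_derivative_def]]
  have "((\<lambda>w. prim_f f x (norm w)) has_derivative (\<lambda>w. h x e \<bullet> w)) (at e)"
    by (simp add: good_h_eq divide_inverse mult.assoc)
  then show ?thesis by (simp add: good_prim_h[abs_def])
qed

text \<open>On the segment from \<open>e\<close> to \<open>e + w\<close> the norm stays below
  \<open>2 * norm e\<close>, and the growth bound is evaluated there, which costs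
  \<open>2^5 + 1 = 33\<close>. The constant \<open>66 = 2^6 + 2\<close> is the one of the opposite
  regime, shared so that one \<open>K\<close> serves both.\<close>

lemma good_remainder_small:
  assumes "norm w \<le> norm e"
  shows "\<bar>prim_h h x (e + w) - prim_h h x e - h x e \<bullet> w\<bar> \<le> 66 * c * (norm e + norm e ^ 5) * norm w"
proof -
  let ?m = "norm e" and ?n = "norm w"
  have "\<bar>norm (e + w) - ?m\<bar> \<le> ?n" using norm_triangle_ineq3[of "e + w" e] by simp
  moreover have "\<bar>prim_f f x (norm (e + w)) - prim_f f x ?m\<bar> \<le> c * (2 * ?m + (2 * ?m) ^ 5) * \<bar>norm (e + w) - ?m\<bar>"
    by (rule good_lipschitz) (use norm_triangle_ineq[of e w] assms in auto)
  moreover have "0 \<le> c * (2 * ?m + (2 * ?m) ^ 5)" using c by simp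
  ultimately have "\<bar>prim_f f x (norm (e + w)) - prim_f f x ?m\<bar> \<le> c * (2 * ?m + (2 * ?m) ^ 5) * ?n"
    by (meson mult_left_mono order_trans)
  moreover have "\<bar>h x e \<bullet> w\<bar> \<le> c * (?m + ?m ^ 5) * ?n"
    by (rule order_trans[OF Cauchy_Schwarz_ineq2]) (intro mult_right_mono good_h_bound, simp)
  ultimately have "\<bar>prim_h h x (e + w) - prim_h h x e - h x e \<bullet> w\<bar> \<le> c * (2 * ?m + (2 * ?m) ^ 5) * ?n + c * (?m + ?m ^ 5) * ?n"
    by (simp add: good_prim_h)
  also have "\<dots> = 3 * (c * (?m * ?n)) + 33 * (c * (?m ^ 5 * ?n))"
    by (simp add: power_mult_distrib algebra_simps)
  also have "\<dots> \<le> 66 * (c * (?m * ?n)) + 66 * (c * (?m ^ 5 * ?n))"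
    using c by (intro add_mono mult_right_mono) auto
  finally show ?thesis by (simp add: algebra_simps)
qed

lemma good_remainder_large:
  assumes "norm e \<le> norm w"
  shows "\<bar>prim_h h x (e + w) - prim_h h x e - h x e \<bullet> w\<bar> \<le> 66 * c * ((norm w)\<^sup>2 + norm w ^ 6)"
proof -
  let ?n = "norm w"
  have "norm (e + w) \<le> 2 * ?n" using norm_triangle_ineq[of e w] assms by linarith
  then have 1: "(norm (e + w))\<^sup>2 \<le> (2 * ?n)\<^sup>2" "norm (e + w) ^ 6 \<le> (2 * ?n) ^ 6" by (intro power_mono; simp)+
  have 2: "(norm e)\<^sup>2 \<le> ?n\<^sup>2" "norm e ^ 6 \<le> ?n ^ 6" "norm e ^ 5 \<le> ?n ^ 5" using assms by (intro power_mono; simp)+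
  have "\<bar>prim_h h x (e + w)\<bar> \<le> c * ((2 * ?n)\<^sup>2 + (2 * ?n) ^ 6)"
    unfolding good_prim_h using 1 c by (intro order_trans[OF good_prim_f_bound] mult_left_mono add_mono) auto
  moreover have "\<bar>prim_h h x e\<bar> \<le> c * (?n\<^sup>2 + ?n ^ 6)"
    unfolding good_prim_h using 2 c by (intro order_trans[OF good_prim_f_bound] mult_left_mono add_mono) auto
  moreover have "\<bar>h x e \<bullet> w\<bar> \<le> c * (?n + ?n ^ 5) * ?n"
  proof (rule order_trans[OF Cauchy_Schwarz_ineq2], rule mult_right_mono)
    show "norm (h x e) \<le> c * (?n + ?n ^ 5)"
      using 2 c assms by (intro order_trans[OF good_h_bound] mult_left_mono add_mono) auto
  qed simp
  moreover have "c * (?n + ?n ^ 5) * ?n = c * (?n\<^sup>2 + ?n ^ 6)"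
    by (simp add: algebra_simps numeral_eq_Suc)
  ultimately have "\<bar>prim_h h x (e + w) - prim_h h x e - h x e \<bullet> w\<bar> \<le> c * ((2 * ?n)\<^sup>2 + (2 * ?n) ^ 6) + 2 * (c * (?n\<^sup>2 + ?n ^ 6))"
    by linarith
  also have "\<dots> = 6 * (c * ?n\<^sup>2) + 66 * (c * ?n ^ 6)" by (simp add: power_mult_distrib algebra_simps)
  also have "\<dots> \<le> 66 * (c * ?n\<^sup>2) + 66 * (c * ?n ^ 6)" using c by (intro add_mono mult_right_mono) auto
  finally show ?thesis by (simp add: algebra_simps)
qed

end

section \<open>Norms of vector fields and the embedding into L^6\<close>

lemma H1_vec_norm_square:
  assumes "E \<in> H1_vec"
  shows "integrable lebesgue (\<lambda>x. (norm (E x))\<^sup>2)"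
    "(H1_vec_norm E)\<^sup>2 = (LINT x|lebesgue. grad_inner E E x) + (LINT x|lebesgue. (norm (E x))\<^sup>2)"
    "H1_sq (\<lambda>x. E x $ j) \<le> (H1_vec_norm E)\<^sup>2"
    "(LINT x|lebesgue. grad_inner E E x) = (\<Sum>j\<in>UNIV. \<Sum>i\<in>UNIV. LINT x|lebesgue. (weak_partial i (\<lambda>y. E y $ j) x)\<^sup>2)"
proof -
  have L: "(\<lambda>x. E x $ j) \<in> L2" "weak_partial i (\<lambda>y. E y $ j) \<in> L2" for i j
    using assms H1_vec_nth H1_L2 H1_weak_partial_L2 by blast+
  have n2: "(norm (E x))\<^sup>2 = (\<Sum>j\<in>UNIV. (E x $ j)\<^sup>2)" for x
    unfolding power2_norm_eq_inner by (simp add: inner_vec_def power2_eq_square)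
  show i: "integrable lebesgue (\<lambda>x. (norm (E x))\<^sup>2)"
    unfolding n2 by (intro Bochner_Integration.integrable_sum L2_square L)
  have gg: "grad_inner E E x = (\<Sum>j\<in>UNIV. \<Sum>i\<in>UNIV. (weak_partial i (\<lambda>y. E y $ j) x)\<^sup>2)" for x
    by (simp add: grad_inner_def inner_vec_def power2_eq_square)
  have gi: "integrable lebesgue (grad_inner E E)" by (rule curl_identity(2)[OF assms assms])
  have "(H1_vec_norm E)\<^sup>2 = (LINT x|lebesgue. (\<Sum>i\<in>UNIV. (norm (weak_grad (\<lambda>y. E y $ i) x))\<^sup>2) + (norm (E x))\<^sup>2)"
    unfolding H1_vec_norm_def by (intro real_sqrt_pow2 integral_nonneg_AE) (auto simp: sum_nonneg)
  also have "\<dots> = (LINT x|lebesgue. grad_inner E E x + (norm (E x))\<^sup>2)"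
    by (simp add: grad_inner_def power2_norm_eq_inner)
  also have "\<dots> = (LINT x|lebesgue. grad_inner E E x) + (LINT x|lebesgue. (norm (E x))\<^sup>2)"
    using gi i by simp
  finally show N: "(H1_vec_norm E)\<^sup>2 = (LINT x|lebesgue. grad_inner E E x) + (LINT x|lebesgue. (norm (E x))\<^sup>2)" .
  show gs: "(LINT x|lebesgue. grad_inner E E x) = (\<Sum>j\<in>UNIV. \<Sum>i\<in>UNIV. LINT x|lebesgue. (weak_partial i (\<lambda>y. E y $ j) x)\<^sup>2)"
    unfolding gg by (subst Bochner_Integration.integral_sum, intro Bochner_Integration.integrable_sum L2_square L)
      (intro sum.cong refl Bochner_Integration.integral_sum L2_square L)
  have ns: "(LINT x|lebesgue. (norm (E x))\<^sup>2) = (\<Sum>j\<in>UNIV. LINT x|lebesgue. (E x $ j)\<^sup>2)"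
    unfolding n2 by (intro Bochner_Integration.integral_sum L2_square L)
  have "H1_sq (\<lambda>x. E x $ j) \<le> (\<Sum>j\<in>UNIV. H1_sq (\<lambda>x. E x $ j))"
    by (rule member_le_sum) (auto simp: H1_sq_nonneg)
  also have "\<dots> = (H1_vec_norm E)\<^sup>2"
    unfolding N gs ns H1_sq_def by (simp add: sum.distrib)
  finally show "H1_sq (\<lambda>x. E x $ j) \<le> (H1_vec_norm E)\<^sup>2" .
qed

lemma H1_vec_norm_nonneg: "H1_vec_norm E \<ge> 0"
  unfolding H1_vec_norm_def by (intro real_sqrt_ge_zero integral_nonneg_AE) (auto simp: sum_nonneg)

lemma sum3_cube_le: "(a + b + d) ^ 3 \<le> 27 * (a ^ 3 + b ^ 3 + d ^ 3)" if "a \<ge> 0" "b \<ge> 0" "d \<ge> 0" for a b d :: real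
proof -
  define m where "m = max a (max b d)"
  have "(a + b + d) ^ 3 \<le> (3 * m) ^ 3" using that by (intro power_mono) (auto simp: m_def)
  also have "\<dots> = 27 * m ^ 3" by (simp add: power_mult_distrib)
  also have "m ^ 3 \<le> a ^ 3 + b ^ 3 + d ^ 3"
    using that unfolding m_def max_def by (auto intro: add_nonneg_nonneg)
  finally show ?thesis by simp
qed

text \<open>The constant is \<open>27 * 3 * 262144\<close>: 27 from \<open>sum3_cube_le\<close>, 3
  for the components, and the constant of \<open>Sobolev_H1\<close> for each of them.\<close>

lemma H1_vec_L6:
  assumes E: "E \<in> H1_vec"
  shows "integrable lebesgue (\<lambda>x. norm (E x) ^ 6)" "(LINT x|lebesgue. norm (E x) ^ 6) \<le> 21233664 * H1_vec_norm E ^ 6"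
proof -
  let ?N = "H1_vec_norm E"
  have i: "integrable lebesgue (\<lambda>x. (E x $ j) ^ 6)" for j by (rule Sobolev_H1(1)[OF H1_vec_nth[OF E]])
  have b: "(LINT x|lebesgue. (E x $ j) ^ 6) \<le> 262144 * ?N ^ 6" for j
  proof -
    have "(LINT x|lebesgue. (E x $ j) ^ 6) \<le> 262144 * H1_sq (\<lambda>x. E x $ j) ^ 3" by (rule Sobolev_H1(2)[OF H1_vec_nth[OF E]])
    also have "\<dots> \<le> 262144 * (?N\<^sup>2) ^ 3"
      by (intro mult_left_mono power_mono H1_vec_norm_square(3) E H1_sq_nonneg) auto
    finally show ?thesis by (simp flip: power_mult)
  qed
  have [measurable]: "(\<lambda>x. E x $ j) \<in> borel_measurable lebesgue" for j using L2_measurable[OF H1_L2[OF H1_vec_nth[OF E]]] .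
  have n6: "norm (E x) ^ 6 = ((E x $ 1)\<^sup>2 + (E x $ 2)\<^sup>2 + (E x $ 3)\<^sup>2) ^ 3" for x
  proof -
    have "norm (E x) ^ 6 = ((norm (E x))\<^sup>2) ^ 3" by (simp flip: power_mult)
    then show ?thesis unfolding power2_norm_eq_inner by (simp add: inner_vec_def sum_3 power2_eq_square)
  qed
  have le: "norm (E x) ^ 6 \<le> 27 * ((E x $ 1) ^ 6 + (E x $ 2) ^ 6 + (E x $ 3) ^ 6)" for x
    unfolding n6 using sum3_cube_le[of "(E x $ 1)\<^sup>2" "(E x $ 2)\<^sup>2" "(E x $ 3)\<^sup>2"] by (simp flip: power_mult)
  have iR: "integrable lebesgue (\<lambda>x. 27 * ((E x $ 1) ^ 6 + (E x $ 2) ^ 6 + (E x $ 3) ^ 6))" using i by simp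
  show i6: "integrable lebesgue (\<lambda>x. norm (E x) ^ 6)"
  proof (rule Bochner_Integration.integrable_bound[OF iR])
    show "(\<lambda>x. norm (E x) ^ 6) \<in> borel_measurable lebesgue" unfolding n6 by measurable
    show "AE x in lebesgue. norm (norm (E x) ^ 6) \<le> norm (27 * ((E x $ 1) ^ 6 + (E x $ 2) ^ 6 + (E x $ 3) ^ 6))"
      using le order_trans[OF le abs_ge_self] by (intro AE_I2) simp
  qed
  have "(LINT x|lebesgue. norm (E x) ^ 6) \<le> (LINT x|lebesgue. 27 * ((E x $ 1) ^ 6 + (E x $ 2) ^ 6 + (E x $ 3) ^ 6))"
    by (rule integral_mono[OF i6 iR le])
  also have "\<dots> = 27 * ((LINT x|lebesgue. (E x $ 1) ^ 6) + (LINT x|lebesgue. (E x $ 2) ^ 6) + (LINT x|lebesgue. (E x $ 3) ^ 6))"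
    using i by simp
  also have "\<dots> \<le> 27 * (262144 * ?N ^ 6 + 262144 * ?N ^ 6 + 262144 * ?N ^ 6)"
    using b by (intro mult_left_mono add_mono) auto
  finally show "(LINT x|lebesgue. norm (E x) ^ 6) \<le> 21233664 * ?N ^ 6" by simp
qed

lemma H1_vec_measurable:
  assumes "E \<in> H1_vec" shows "E \<in> borel_measurable lebesgue"
proof (rule borel_measurable_euclidean_space[THEN iffD2], rule ballI)
  fix b :: R3 assume "b \<in> Basis"
  then obtain i where "b = axis i 1" by (auto simp: Basis_cart_real)
  then show "(\<lambda>x. E x \<bullet> b) \<in> borel_measurable lebesgue"
    using L2_measurable[OF H1_L2[OF H1_vec_nth[OF assms, of i]]] by (simp add: cart_eq_inner_axis)
qed

lemma H1_vec_cmult: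
  assumes "W \<in> H1_vec" shows "(\<lambda>x. s *\<^sub>R W x) \<in> H1_vec"
  using assms H1_cmult(1) by (simp add: H1_vec_def)

lemma weak_curl_add:
  assumes "E \<in> H1_vec" "W \<in> H1_vec"
  shows "AE x in lebesgue. weak_curl (\<lambda>x. E x + W x) x = weak_curl E x + weak_curl W x"
proof -
  have *: "AE x in lebesgue. weak_partial i (\<lambda>y. (E y + W y) $ j) x = weak_partial i (\<lambda>y. E y $ j) x + weak_partial i (\<lambda>y. W y $ j) x" for i j
    using H1_add(2)[OF H1_vec_nth[OF assms(1)] H1_vec_nth[OF assms(2)]] by simp
  show ?thesis
    using *[of 2 3] *[of 3 2] *[of 3 1] *[of 1 3] *[of 1 2] *[of 2 1]
    by eventually_elim (simp add: weak_curl_def vec_eq_iff forall_3)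
qed

lemma weak_partial_vec_cmult:
  assumes "W \<in> H1_vec"
  shows "AE x in lebesgue. weak_partial i (\<lambda>y. (s *\<^sub>R W y) $ j) x = s * weak_partial i (\<lambda>y. W y $ j) x"
  using H1_cmult(2)[OF H1_vec_nth[OF assms]] by simp

lemma weak_curl_cmult:
  assumes "W \<in> H1_vec"
  shows "AE x in lebesgue. weak_curl (\<lambda>x. s *\<^sub>R W x) x = s *\<^sub>R weak_curl W x"
proof -
  note * = weak_partial_vec_cmult[OF assms, of _ s]
  show ?thesis
    using *[of 2 3] *[of 3 2] *[of 3 1] *[of 1 3] *[of 1 2] *[of 2 1]
    by eventually_elim (simp add: weak_curl_def vec_eq_iff forall_3 right_diff_distrib)
qed

lemma weak_curl_measurable:
  assumes "E \<in> H1_vec" shows "weak_curl E \<in> borel_measurable lebesgue"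
proof (rule borel_measurable_euclidean_space[THEN iffD2], rule ballI)
  fix b :: R3 assume "b \<in> Basis"
  then obtain i where b: "b = axis i 1" by (auto simp: Basis_cart_real)
  have [measurable]: "weak_partial k (\<lambda>y. E y $ j) \<in> borel_measurable lebesgue" for k j
    by (rule L2_measurable[OF H1_weak_partial_L2[OF H1_vec_nth[OF assms]]])
  have "(\<lambda>x. weak_curl E x $ i) \<in> borel_measurable lebesgue"
    using exhaust_3[of i] by (auto simp: weak_curl_def intro!: borel_measurable_diff)
  then show "(\<lambda>x. weak_curl E x \<bullet> b) \<in> borel_measurable lebesgue" by (simp add: b cart_eq_inner_axis)
qed

lemma H1_vec_norm_cmult:
  assumes "W \<in> H1_vec" shows "H1_vec_norm (\<lambda>x. s *\<^sub>R W x) = \<bar>s\<bar> * H1_vec_norm W"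
proof -
  note sW = H1_vec_cmult[OF assms, of s]
  have "AE x in lebesgue. \<forall>i. weak_partial i (\<lambda>y. (s *\<^sub>R W y) $ j) x = s * weak_partial i (\<lambda>y. W y $ j) x" for j
    by (subst AE_all_countable) (rule allI, rule weak_partial_vec_cmult[OF assms])
  then have "AE x in lebesgue. \<forall>j i. weak_partial i (\<lambda>y. (s *\<^sub>R W y) $ j) x = s * weak_partial i (\<lambda>y. W y $ j) x"
    by (subst AE_all_countable) blast
  then have "AE x in lebesgue. grad_inner (\<lambda>x. s *\<^sub>R W x) (\<lambda>x. s *\<^sub>R W x) x = s\<^sup>2 * grad_inner W W x"
    by eventually_elim (simp add: grad_inner_def inner_vec_def sum_distrib_left power2_eq_square mult_ac del: vector_scaleR_component)
  then have "(LINT x|lebesgue. grad_inner (\<lambda>x. s *\<^sub>R W x) (\<lambda>x. s *\<^sub>R W x) x) = (LINT x|lebesgue. s\<^sup>2 * grad_inner W W x)"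
    by (intro integral_cong_AE borel_measurable_integrable curl_identity(2)[OF sW sW] integrable_mult_right curl_identity(2)[OF assms assms])
  moreover have "(LINT x|lebesgue. (norm (s *\<^sub>R W x))\<^sup>2) = s\<^sup>2 * (LINT x|lebesgue. (norm (W x))\<^sup>2)"
    by (simp add: power_mult_distrib)
  ultimately have "(H1_vec_norm (\<lambda>x. s *\<^sub>R W x))\<^sup>2 = (\<bar>s\<bar> * H1_vec_norm W)\<^sup>2"
    unfolding H1_vec_norm_square(2)[OF sW] power_mult_distrib H1_vec_norm_square(2)[OF assms]
    by (simp add: algebra_simps)
  then show ?thesis
    using H1_vec_norm_nonneg by (intro power2_eq_imp_eq[of "H1_vec_norm (\<lambda>x. s *\<^sub>R W x)"]) auto
qed

text \<open>The split is at \<open>m = d * w\<close>. The factor \<open>th\<close> has to stay on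
  the part in \<open>m\<close>, where dominated convergence will send it to zero; the part in
  \<open>w\<close> receives the freely chosen small factor \<open>d\<close>.\<close>

lemma weighted_young:
  fixes th m w :: real
  assumes "0 \<le> th" "th \<le> 1" "0 \<le> m" "0 \<le> w" "0 < d" "d \<le> 1"
  shows "th * (m + m ^ 5) * w \<le> d * (w\<^sup>2 + w ^ 6) + th / d * (m\<^sup>2 + m ^ 6)"
proof (cases "m \<le> d * w")
  case True
  have "th * (m + m ^ 5) * w \<le> 1 * (d * w + (d * w) ^ 5) * w"
    using assms True by (intro mult_right_mono mult_mono add_mono power_mono) auto
  also have "\<dots> \<le> (d * w + d * w ^ 5) * w"
  proof -
    have "d ^ 5 \<le> d ^ 1" using assms by (intro power_decreasing) auto
    then have "d ^ 5 * w ^ 5 \<le> d * w ^ 5" using assms by (intro mult_right_mono) auto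
    then show ?thesis using assms by (auto simp: power_mult_distrib intro: mult_right_mono)
  qed
  also have "\<dots> = d * (w\<^sup>2 + w ^ 6)" by (simp add: algebra_simps numeral_eq_Suc)
  also have "\<dots> \<le> d * (w\<^sup>2 + w ^ 6) + th / d * (m\<^sup>2 + m ^ 6)" using assms by simp
  finally show ?thesis .
next
  case False
  then have "w \<le> m / d" using assms by (simp add: field_simps)
  then have "th * (m + m ^ 5) * w \<le> th * (m + m ^ 5) * (m / d)" using assms by (intro mult_left_mono) auto
  also have "\<dots> = th / d * (m\<^sup>2 + m ^ 6)" by (simp add: algebra_simps numeral_eq_Suc add_divide_distrib)
  also have "\<dots> \<le> d * (w\<^sup>2 + w ^ 6) + th / d * (m\<^sup>2 + m ^ 6)" using assms by simp
  finally show ?thesis .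
qed

section \<open>The first variation of the energy\<close>

locale problem =
  fixes V :: "R3 \<Rightarrow> real" and f :: "R3 \<Rightarrow> real \<Rightarrow> real" and h :: "R3 \<Rightarrow> R3 \<Rightarrow> R3" and c CV :: real
  assumes V_meas: "V \<in> borel_measurable lebesgue" and V_bound: "AE x in lebesgue. \<bar>V x\<bar> \<le> CV"
    and f_meas: "\<And>s. (\<lambda>x. f x s) \<in> borel_measurable lebesgue" and f_cont: "\<And>x. continuous_on UNIV (f x)"
    and c_pos: "c > 0" and good: "AE x in lebesgue. good_pt f h c x"
begin

lemma c_nonneg: "c \<ge> 0" using c_pos by simp

text \<open>The graph of \<open>u\<close> is a null set of the product, so Lebesgue measurability of
  \<open>f\<close> in both variables together says nothing about \<open>f x (u x)\<close>.
  Measurable sections and continuity in the second variable do, by way of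
  \<open>caratheodory_measurable\<close>.\<close>

lemma f_comp_measurable:
  assumes "u \<in> borel_measurable lebesgue" shows "(\<lambda>x. f x (u x)) \<in> borel_measurable lebesgue"
proof -
  have "(\<lambda>x. (x, u x)) \<in> lebesgue \<rightarrow>\<^sub>M (lebesgue \<Otimes>\<^sub>M borel)" using assms by measurable
  from measurable_compose[OF this caratheodory_measurable[OF f_meas f_cont]] show ?thesis by simp
qed

lemma h_inner_AE: "AE x in lebesgue. h x (E x) \<bullet> W x = (f x (norm (E x)) / norm (E x)) * (E x \<bullet> W x)"
  using good by eventually_elim (simp add: good_h_eq[OF _ c_nonneg])

lemma h_inner_measurable:
  assumes [measurable]: "E \<in> borel_measurable lebesgue" "W \<in> borel_measurable lebesgue"
  shows "(\<lambda>x. h x (E x) \<bullet> W x) \<in> borel_measurable lebesgue"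
proof (rule measurable_lebesgue_cong_AE)
  have [measurable]: "(\<lambda>x. f x (norm (E x))) \<in> borel_measurable lebesgue" by (rule f_comp_measurable) measurable
  show "(\<lambda>x. (f x (norm (E x)) / norm (E x)) * (E x \<bullet> W x)) \<in> borel_measurable lebesgue" by measurable
  show "AE x in lebesgue. (f x (norm (E x)) / norm (E x)) * (E x \<bullet> W x) = h x (E x) \<bullet> W x"
    using h_inner_AE[of E W] by eventually_elim simp
qed

lemma prim_f_measurable:
  assumes u: "u \<in> borel_measurable lebesgue"
  shows "(\<lambda>x. prim_f f x (u x)) \<in> borel_measurable lebesgue"
proof -
  have m: "(\<lambda>z. (fst z, u (fst z) * snd z)) \<in> (lebesgue \<Otimes>\<^sub>M lborel) \<rightarrow>\<^sub>M (lebesgue \<Otimes>\<^sub>M borel)" using u by measurable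
  have [measurable]: "(\<lambda>z. f (fst z) (u (fst z) * snd z)) \<in> borel_measurable (lebesgue \<Otimes>\<^sub>M lborel)"
    using measurable_compose[OF m caratheodory_measurable[OF f_meas f_cont]] by simp
  have "(\<lambda>x. LINT t|lborel. indicat_real {0<..<1} t * (u x * f x (u x * t))) \<in> borel_measurable lebesgue"
    by (rule lborel.borel_measurable_lebesgue_integral) (use u in \<open>simp add: split_beta'\<close>)
  moreover have "prim_f f x (u x) = (LINT t|lborel. indicat_real {0<..<1} t * (u x * f x (u x * t)))" for x
    unfolding prim_f_substitution[OF f_cont]
    by (simp add: interval_lebesgue_integral_def set_lebesgue_integral_def zero_ereal_def one_ereal_def
        mult.left_commute[of "indicat_real _ _" "u x"])
  ultimately show ?thesis by simp
qed

lemma prim_h_measurable: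
  assumes "E \<in> borel_measurable lebesgue"
  shows "(\<lambda>x. prim_h h x (E x)) \<in> borel_measurable lebesgue"
proof (rule measurable_lebesgue_cong_AE)
  show "(\<lambda>x. prim_f f x (norm (E x))) \<in> borel_measurable lebesgue"
    by (rule prim_f_measurable) (use assms in measurable)
  show "AE x in lebesgue. prim_f f x (norm (E x)) = prim_h h x (E x)"
    using good by eventually_elim (simp add: good_prim_h[OF _ c_nonneg])
qed

lemma prim_h_integrable:
  assumes E: "E \<in> H1_vec" shows "integrable lebesgue (\<lambda>x. prim_h h x (E x))"
proof (rule Bochner_Integration.integrable_bound)
  show "integrable lebesgue (\<lambda>x. c * ((norm (E x))\<^sup>2 + norm (E x) ^ 6))"
    using H1_vec_norm_square(1)[OF E] H1_vec_L6(1)[OF E] by simp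
  show "(\<lambda>x. prim_h h x (E x)) \<in> borel_measurable lebesgue" by (rule prim_h_measurable[OF H1_vec_measurable[OF E]])
  show "AE x in lebesgue. norm (prim_h h x (E x)) \<le> norm (c * ((norm (E x))\<^sup>2 + norm (E x) ^ 6))"
    using good
  proof eventually_elim
    case (elim x)
    show ?case using good_prim_f_bound[OF elim c_nonneg, of "norm (E x)"] c_nonneg by (simp add: good_prim_h[OF elim c_nonneg])
  qed
qed

lemma h_inner_integrable:
  assumes E: "E \<in> H1_vec" and W: "W \<in> H1_vec" shows "integrable lebesgue (\<lambda>x. h x (E x) \<bullet> W x)"
proof (rule Bochner_Integration.integrable_bound)
  show "integrable lebesgue (\<lambda>x. c * ((norm (W x))\<^sup>2 + norm (W x) ^ 6 + ((norm (E x))\<^sup>2 + norm (E x) ^ 6)))"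
    using H1_vec_norm_square(1)[OF E] H1_vec_L6(1)[OF E] H1_vec_norm_square(1)[OF W] H1_vec_L6(1)[OF W] by simp
  show "(\<lambda>x. h x (E x) \<bullet> W x) \<in> borel_measurable lebesgue"
    by (rule h_inner_measurable[OF H1_vec_measurable[OF E] H1_vec_measurable[OF W]])
  show "AE x in lebesgue. norm (h x (E x) \<bullet> W x) \<le> norm (c * ((norm (W x))\<^sup>2 + norm (W x) ^ 6 + ((norm (E x))\<^sup>2 + norm (E x) ^ 6)))"
    using good
  proof eventually_elim
    case (elim x)
    have "\<bar>h x (E x) \<bullet> W x\<bar> \<le> c * (norm (E x) + norm (E x) ^ 5) * norm (W x)"
      by (rule order_trans[OF Cauchy_Schwarz_ineq2]) (intro mult_right_mono good_h_bound[OF elim c_nonneg], simp)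
    also have "\<dots> \<le> c * ((norm (W x))\<^sup>2 + norm (W x) ^ 6 + ((norm (E x))\<^sup>2 + norm (E x) ^ 6))"
      using weighted_young[of 1 "norm (E x)" "norm (W x)" 1] c_nonneg unfolding mult.assoc
      by (intro mult_left_mono) auto
    finally show ?case using c_nonneg by simp
  qed
qed

definition Rem :: "(R3 \<Rightarrow> R3) \<Rightarrow> (R3 \<Rightarrow> R3) \<Rightarrow> R3 \<Rightarrow> real" where
  "Rem E W x = prim_h h x (E x + W x) - prim_h h x (E x) - h x (E x) \<bullet> W x"

lemma Rem_integrable:
  assumes E: "E \<in> H1_vec" and W: "W \<in> H1_vec" shows "integrable lebesgue (Rem E W)"
  unfolding Rem_def[abs_def]
  using prim_h_integrable[OF H1_vec_add[OF E W]] prim_h_integrable[OF E] h_inner_integrable[OF E W] by simp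

text \<open>A sequence \<open>W n\<close> with norms below \<open>1 / 2 ^ n\<close> violating the estimate tends to zero almost everywhere.
  Where \<open>\<bar>W n\<bar> \<ge> \<bar>E\<bar>\<close>, the remainder is controlled by the Sobolev inequality. Elsewhere it is a
  factor \<open>th n \<rightarrow> 0\<close> times its trivial bound, and dominated convergence applies.\<close>

lemma remainder_estimate:
  assumes E: "E \<in> H1_vec" and e: "e > 0"
  shows "\<exists>d>0. \<forall>W\<in>H1_vec. H1_vec_norm W < d \<longrightarrow> (LINT x|lebesgue. \<bar>Rem E W x\<bar>) \<le> e * H1_vec_norm W"
proof (rule ccontr)
  assume neg: "\<not> ?thesis"
  have "\<exists>W. W \<in> H1_vec \<and> H1_vec_norm W < (1/2) ^ n \<and> (LINT x|lebesgue. \<bar>Rem E W x\<bar>) > e * H1_vec_norm W" for n :: nat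
  proof -
    have "(1/2::real) ^ n > 0" by simp
    then show ?thesis using neg by (meson not_le)
  qed
  then have "\<forall>n. \<exists>W. W \<in> H1_vec \<and> H1_vec_norm W < (1/2) ^ n \<and> (LINT x|lebesgue. \<bar>Rem E W x\<bar>) > e * H1_vec_norm W" by blast
  from choice[OF this] obtain W where W: "\<And>n. W n \<in> H1_vec" "\<And>n. H1_vec_norm (W n) < (1/2) ^ n"
    "\<And>n. (LINT x|lebesgue. \<bar>Rem E (W n) x\<bar>) > e * H1_vec_norm (W n)" by blast
  define N where "N n = H1_vec_norm (W n)" for n
  define m where "m x = norm (E x)" for x
  define w where "w n x = norm (W n x)" for n x
  define K where "K = 66 * c"
  define S :: real where "S = 21233664"
  have K: "K > 0" using c_pos by (simp add: K_def)
  have N0: "N n \<ge> 0" for n by (simp add: N_def H1_vec_norm_nonneg)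
  have [measurable]: "E \<in> borel_measurable lebesgue" "W n \<in> borel_measurable lebesgue" for n
    using H1_vec_measurable E W(1) by auto
  have mm [measurable]: "m \<in> borel_measurable lebesgue" "w n \<in> borel_measurable lebesgue" for n
    unfolding m_def w_def by measurable
  have Rm [measurable]: "Rem E (W n) \<in> borel_measurable lebesgue" for n
    by (rule borel_measurable_integrable[OF Rem_integrable[OF E W(1)]])
  have wi: "integrable lebesgue (\<lambda>x. (w n x)\<^sup>2)" "integrable lebesgue (\<lambda>x. w n x ^ 6)" for n
    unfolding w_def by (rule H1_vec_norm_square(1)[OF W(1)] H1_vec_L6(1)[OF W(1)])+
  have mi: "integrable lebesgue (\<lambda>x. (m x)\<^sup>2 + m x ^ 6)"
    unfolding m_def using H1_vec_norm_square(1)[OF E] H1_vec_L6(1)[OF E] by simp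
  have w2: "(LINT x|lebesgue. (w n x)\<^sup>2) \<le> (N n)\<^sup>2" for n
  proof -
    have "(LINT x|lebesgue. grad_inner (W n) (W n) x) \<ge> 0"
      unfolding H1_vec_norm_square(4)[OF W(1)] by (intro sum_nonneg integral_nonneg_AE) auto
    then show ?thesis unfolding N_def H1_vec_norm_square(2)[OF W(1)] w_def by simp
  qed
  have w6: "(LINT x|lebesgue. w n x ^ 6) \<le> S * N n ^ 6" for n
    unfolding w_def S_def N_def by (rule H1_vec_L6(2)[OF W(1)])
  have wlim: "AE x in lebesgue. (\<lambda>n. w n x) \<longlonglongrightarrow> 0"
  proof (rule AE_tendsto_0_if_geometric)
    show "w n \<in> L2" for n using wi(1) mm(2) by (simp add: L2_def)
    show "(LINT x|lebesgue. (w n x)\<^sup>2) \<le> (1/2) ^ n" for n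
    proof -
      have l: "N n \<le> (1/2) ^ n" using W(2)[of n] by (simp add: N_def)
      have "(1/2::real) ^ n \<le> 1" by (intro power_le_one) auto
      then have "N n \<le> 1" using l by linarith
      then have "N n * N n \<le> N n * 1" using N0[of n] by (intro mult_left_mono) auto
      then show ?thesis using w2[of n] l by (simp add: power2_eq_square)
    qed
  qed
  \<comment> \<open>The estimate is violated strictly, so \<open>W n\<close> cannot vanish almost
    everywhere. Positivity permits dividing by \<open>N n\<close> below.\<close>
  have Npos: "N n > 0" for n
  proof (rule ccontr)
    assume "\<not> N n > 0"
    then have N: "N n = 0" using N0[of n] by simp
    have "(LINT x|lebesgue. (w n x)\<^sup>2) = 0" using w2[of n] N by (simp add: order_antisym)
    then have "AE x in lebesgue. (w n x)\<^sup>2 = 0"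
      using integral_nonneg_eq_0_iff_AE[OF wi(1)] by simp
    then have "AE x in lebesgue. \<bar>Rem E (W n) x\<bar> = 0"
      by eventually_elim (simp add: w_def Rem_def)
    then have "(LINT x|lebesgue. \<bar>Rem E (W n) x\<bar>) = (LINT x|(lebesgue :: R3 measure). 0)"
      by (intro integral_cong_AE) auto
    then show False using W(3)[of n] N by (simp add: N_def)
  qed
  \<comment> \<open>The ratio of the remainder to its bound in \<open>good_remainder_small\<close>,
    set to 0 where that bound does not apply or is zero.\<close>
  define th where "th n x = (if 0 < w n x \<and> w n x \<le> m x then \<bar>Rem E (W n) x\<bar> / (K * (m x + m x ^ 5) * w n x) else 0)" for n x
  have thme [measurable]: "th n \<in> borel_measurable lebesgue" for n unfolding th_def by measurable
  have th01: "AE x in lebesgue. 0 \<le> th n x \<and> th n x \<le> 1" for n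
    using good
  proof eventually_elim
    case (elim x)
    show ?case
    proof (cases "0 < w n x \<and> w n x \<le> m x")
      case True
      then have mp: "K * (m x + m x ^ 5) * w n x > 0" using K by (intro mult_pos_pos add_pos_pos) auto
      have "\<bar>Rem E (W n) x\<bar> \<le> K * (m x + m x ^ 5) * w n x"
        using good_remainder_small[OF elim c_nonneg, of "W n x" "E x"] True by (simp add: Rem_def K_def m_def w_def)
      then show ?thesis using True mp by (simp add: th_def)
    qed (auto simp: th_def)
  qed
  have thlim: "AE x in lebesgue. (\<lambda>n. th n x) \<longlonglongrightarrow> 0"
    using good wlim
  proof eventually_elim
    case (elim x)
    show ?case
    proof (cases "E x = 0")
      case True
      then have "th n x = 0" for n by (auto simp: th_def m_def)
      then show ?thesis by simp
    next
      case False
      then have mp: "K * (m x + m x ^ 5) > 0" using K by (simp add: m_def add_pos_pos)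
      show ?thesis
      proof (rule LIMSEQ_I)
        fix r :: real assume r: "r > 0"
        define r' where "r' = r / 2 * (K * (m x + m x ^ 5))"
        have r': "r' > 0" using r mp by (simp add: r'_def)
        obtain d where d: "d > 0" "\<And>y. norm (y - E x) < d \<Longrightarrow> norm (prim_h h x y - prim_h h x (E x) - h x (E x) \<bullet> (y - E x)) \<le> r' * norm (y - E x)"
          using good_has_derivative[OF elim(1) c_nonneg False] r' unfolding has_derivative_at_alt by blast
        obtain n0 where n0: "\<And>n. n \<ge> n0 \<Longrightarrow> norm (w n x - 0) < d"
          using LIMSEQ_D[OF elim(2) d(1)] by blast
        have "norm (th n x - 0) < r" if n: "n \<ge> n0" for n
        proof (cases "0 < w n x \<and> w n x \<le> m x")
          case True
          have "\<bar>Rem E (W n) x\<bar> \<le> r' * w n x"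
            using d(2)[of "E x + W n x"] n0[OF n] by (simp add: Rem_def w_def)
          also have "\<dots> = r / 2 * (K * (m x + m x ^ 5) * w n x)" by (simp add: r'_def)
          finally have "\<bar>Rem E (W n) x\<bar> / (K * (m x + m x ^ 5) * w n x) \<le> r / 2"
            using True mp by (subst pos_divide_le_eq) auto
          moreover have q: "th n x = \<bar>Rem E (W n) x\<bar> / (K * (m x + m x ^ 5) * w n x)"
            using True by (simp add: th_def)
          moreover have "0 \<le> th n x"
            unfolding q using True mp by (intro divide_nonneg_nonneg) auto
          ultimately have "th n x \<le> r / 2" "\<bar>th n x - 0\<bar> = th n x" by (simp_all only: diff_0_right abs_of_nonneg)
          then show ?thesis using r unfolding real_norm_def by linarith
        qed (use r in \<open>auto simp: th_def\<close>)
        then show "\<exists>no. \<forall>n\<ge>no. norm (th n x - 0) < r" by blast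
      qed
    qed
  qed
  define T where "T n = (LINT x|lebesgue. th n x * ((m x)\<^sup>2 + m x ^ 6))" for n
  have thi: "integrable lebesgue (\<lambda>x. th n x * ((m x)\<^sup>2 + m x ^ 6))" for n
  proof (rule Bochner_Integration.integrable_bound[OF mi])
    show "AE x in lebesgue. norm (th n x * ((m x)\<^sup>2 + m x ^ 6)) \<le> norm ((m x)\<^sup>2 + m x ^ 6)"
      using th01[of n] by eventually_elim (auto simp: abs_mult intro: mult_left_le_one_le)
  qed measurable
  have Tlim: "T \<longlonglongrightarrow> 0"
  proof -
    have "T \<longlonglongrightarrow> (LINT x|(lebesgue :: R3 measure). 0)"
      unfolding T_def
    proof (rule integral_dominated_convergence[OF _ _ mi])
      show "AE x in lebesgue. (\<lambda>n. th n x * ((m x)\<^sup>2 + m x ^ 6)) \<longlonglongrightarrow> 0"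
        using thlim
      proof eventually_elim
        case (elim x)
        then have "(\<lambda>n. th n x * ((m x)\<^sup>2 + m x ^ 6)) \<longlonglongrightarrow> 0 * ((m x)\<^sup>2 + m x ^ 6)" by (intro tendsto_intros)
        then show ?case by simp
      qed
      show "AE x in lebesgue. norm (th n x * ((m x)\<^sup>2 + m x ^ 6)) \<le> (m x)\<^sup>2 + m x ^ 6" for n
        using th01[of n] by eventually_elim (auto simp: abs_mult m_def intro: mult_left_le_one_le)
    qed measurable
    then show ?thesis by simp
  qed
  \<comment> \<open>For fixed \<open>d\<close> only the middle term survives as \<open>n\<close>
    grows, and \<open>d\<close> will be chosen to make it at most \<open>e / 2\<close>, in
    contradiction to the left-hand side.\<close>
  have bound: "e \<le> K * (N n + S * N n ^ 5) + K * (d * (1 + S)) + K / d * T n" if d: "0 < d" "d \<le> 1" for n d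
  proof -
    let ?N = "N n"
    have pt: "AE x in lebesgue. \<bar>Rem E (W n) x\<bar> \<le> (K * ((w n x)\<^sup>2 + w n x ^ 6)) + ?N * (K * (d * ((w n x)\<^sup>2 / ?N\<^sup>2 + w n x ^ 6 / ?N ^ 6)) + K / d * (th n x * ((m x)\<^sup>2 + m x ^ 6)))"
      using good th01[of n]
    proof eventually_elim
      case (elim x)
      have nn: "0 \<le> K * ((w n x)\<^sup>2 + w n x ^ 6)" using K by simp
      have nn2: "0 \<le> ?N * (K * (d * ((w n x)\<^sup>2 / ?N\<^sup>2 + w n x ^ 6 / ?N ^ 6)) + K / d * (th n x * ((m x)\<^sup>2 + m x ^ 6)))"
        using K d elim N0[of n] by (intro mult_nonneg_nonneg add_nonneg_nonneg) (auto simp: m_def w_def)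
      consider "w n x = 0" | "m x < w n x" | "0 < w n x \<and> w n x \<le> m x" by (fastforce simp: w_def)
      then show ?case
      proof cases
        case 1 then have "Rem E (W n) x = 0" by (simp add: w_def Rem_def)
        then show ?thesis using nn nn2 by simp
      next
        case 2
        then have "\<bar>Rem E (W n) x\<bar> \<le> K * ((w n x)\<^sup>2 + w n x ^ 6)"
          using good_remainder_large[OF elim(1) c_nonneg, of "E x" "W n x"] by (simp add: Rem_def K_def m_def w_def)
        then show ?thesis using nn2 by linarith
      next
        case 3
        then have mp: "K * (m x + m x ^ 5) * w n x > 0" using K by (intro mult_pos_pos add_pos_pos) auto
        then have nz: "K * (m x + m x ^ 5) * w n x \<noteq> 0" by linarith
        have "th n x = \<bar>Rem E (W n) x\<bar> / (K * (m x + m x ^ 5) * w n x)" using 3 by (simp add: th_def)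
        then have "\<bar>Rem E (W n) x\<bar> = th n x * (K * (m x + m x ^ 5) * w n x)"
          by (rule nonzero_eq_divide_eq[OF nz, THEN iffD1, symmetric])
        also have "\<dots> = ?N * (K * (th n x * (m x + m x ^ 5) * (w n x / ?N)))" using Npos[of n] by simp
        \<comment> \<open>Young's inequality is applied to \<open>w n x / ?N\<close>, whose
          integrals of the second and sixth power are bounded by 1 and \<open>S\<close> for every
          \<open>n\<close>.\<close>
        also have "\<dots> \<le> ?N * (K * (d * ((w n x / ?N)\<^sup>2 + (w n x / ?N) ^ 6) + th n x / d * ((m x)\<^sup>2 + m x ^ 6)))"
          using elim(2) d K Npos[of n] by (intro mult_left_mono weighted_young) (auto simp: m_def w_def)
        also have "\<dots> = ?N * (K * (d * ((w n x)\<^sup>2 / ?N\<^sup>2 + w n x ^ 6 / ?N ^ 6)) + K / d * (th n x * ((m x)\<^sup>2 + m x ^ 6)))"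
          by (simp add: power_divide algebra_simps)
        finally show ?thesis using nn by linarith
      qed
    qed
    have i1: "integrable lebesgue (\<lambda>x. K * ((w n x)\<^sup>2 + w n x ^ 6))" using wi[of n] by simp
    have i2: "integrable lebesgue (\<lambda>x. K * (d * ((w n x)\<^sup>2 / ?N\<^sup>2 + w n x ^ 6 / ?N ^ 6)) + K / d * (th n x * ((m x)\<^sup>2 + m x ^ 6)))"
      using wi[of n] thi[of n] by (intro Bochner_Integration.integrable_add integrable_mult_right) auto
    have "e * ?N \<le> (LINT x|lebesgue. \<bar>Rem E (W n) x\<bar>)" using W(3)[of n] by (simp add: N_def)
    also have "\<dots> \<le> (LINT x|lebesgue. (K * ((w n x)\<^sup>2 + w n x ^ 6)) + ?N * (K * (d * ((w n x)\<^sup>2 / ?N\<^sup>2 + w n x ^ 6 / ?N ^ 6)) + K / d * (th n x * ((m x)\<^sup>2 + m x ^ 6))))"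
      by (rule integral_mono_AE[OF integrable_abs[OF Rem_integrable[OF E W(1)]] _ pt])
        (intro Bochner_Integration.integrable_add i1 integrable_mult_right i2)
    also have "\<dots> = K * ((LINT x|lebesgue. (w n x)\<^sup>2) + (LINT x|lebesgue. w n x ^ 6)) +
       ?N * (K * (d * ((LINT x|lebesgue. (w n x)\<^sup>2) / ?N\<^sup>2 + (LINT x|lebesgue. w n x ^ 6) / ?N ^ 6)) + K / d * T n)"
      using i1 i2 wi[of n] thi[of n] by (simp add: T_def)
    also have "\<dots> \<le> K * (?N\<^sup>2 + S * ?N ^ 6) + ?N * (K * (d * (?N\<^sup>2 / ?N\<^sup>2 + (S * ?N ^ 6) / ?N ^ 6)) + K / d * T n)"
      using K d Npos[of n] w2[of n] w6[of n]
      by (intro add_mono mult_left_mono add_right_mono divide_right_mono) auto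
    also have "\<dots> = ?N * (K * (?N + S * ?N ^ 5) + K * (d * (1 + S)) + K / d * T n)"
      using Npos[of n] by (simp add: algebra_simps numeral_eq_Suc)
    finally have "?N * e \<le> ?N * (K * (?N + S * ?N ^ 5) + K * (d * (1 + S)) + K / d * T n)" by (simp add: mult.commute)
    then show ?thesis using Npos[of n] by simp
  qed
  have Nlim: "N \<longlonglongrightarrow> 0"
  proof (rule tendsto_sandwich[of "\<lambda>n. 0" _ _ "\<lambda>n. (1/2) ^ n"])
    show "(\<lambda>n. (1/2::real) ^ n) \<longlonglongrightarrow> 0" by (rule LIMSEQ_power_zero) simp
  qed (use N0 W(2) in \<open>auto simp: N_def intro!: always_eventually less_imp_le\<close>)
  define d where "d = min 1 (e / (2 * K * (1 + S)))"
  have S: "S > 0" by (simp add: S_def)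
  have d: "0 < d" "d \<le> 1" "K * (d * (1 + S)) \<le> e / 2"
  proof -
    show "0 < d" "d \<le> 1" using e K S by (auto simp: d_def)
    have "K * (d * (1 + S)) \<le> K * ((e / (2 * K * (1 + S))) * (1 + S))"
      using K S by (intro mult_left_mono mult_right_mono) (auto simp: d_def)
    also have "\<dots> = e / 2"
    proof -
      have "K \<noteq> 0" "1 + S \<noteq> 0" using K S by auto
      then show ?thesis by simp
    qed
    finally show "K * (d * (1 + S)) \<le> e / 2" .
  qed
  have "(\<lambda>n. K * (N n + S * N n ^ 5) + K * (d * (1 + S)) + K / d * T n) \<longlonglongrightarrow> K * (0 + S * 0 ^ 5) + K * (d * (1 + S)) + K / d * 0"
    by (intro tendsto_intros Nlim Tlim)
  then have "e \<le> K * (0 + S * 0 ^ 5) + K * (d * (1 + S)) + K / d * 0"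
    by (rule LIMSEQ_le_const) (use bound[OF d(1,2)] in auto)
  then show False using d(3) e by simp
qed

section \<open>Differentiability of the energy of fields\<close>

definition Lin :: "(R3 \<Rightarrow> R3) \<Rightarrow> (R3 \<Rightarrow> R3) \<Rightarrow> real" where
  "Lin E W = (LINT x|lebesgue. weak_curl E x \<bullet> weak_curl W x) + (LINT x|lebesgue. V x * (E x \<bullet> W x)) - (LINT x|lebesgue. h x (E x) \<bullet> W x)"

lemma CV_nonneg: "CV \<ge> 0"
proof (rule ccontr)
  assume "\<not> CV \<ge> 0"
  then have "AE x in (lebesgue :: R3 measure). False" using V_bound by (auto elim!: eventually_mono)
  then have "emeasure lebesgue (UNIV :: R3 set) = 0"
    by (subst (asm) AE_iff_measurable[of UNIV]) auto
  then show False by simp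
qed

lemma V_inner_integrable:
  assumes E: "E \<in> H1_vec" and W: "W \<in> H1_vec"
  shows "integrable lebesgue (\<lambda>x. V x * (E x \<bullet> W x))"
proof (rule Bochner_Integration.integrable_bound)
  show "integrable lebesgue (\<lambda>x. CV * ((norm (E x))\<^sup>2 + (norm (W x))\<^sup>2))"
    using H1_vec_norm_square(1)[OF E] H1_vec_norm_square(1)[OF W] by simp
  show "(\<lambda>x. V x * (E x \<bullet> W x)) \<in> borel_measurable lebesgue"
    using V_meas H1_vec_measurable[OF E] H1_vec_measurable[OF W] by measurable
  show "AE x in lebesgue. norm (V x * (E x \<bullet> W x)) \<le> norm (CV * ((norm (E x))\<^sup>2 + (norm (W x))\<^sup>2))"
    using V_bound
  proof eventually_elim
    case (elim x)
    have "2 * (norm (E x) * norm (W x)) \<le> (norm (E x))\<^sup>2 + (norm (W x))\<^sup>2"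
      using sum_squares_bound[of "norm (E x)" "norm (W x)"] by simp
    moreover have "0 \<le> norm (E x) * norm (W x)" by simp
    ultimately have "\<bar>E x \<bullet> W x\<bar> \<le> (norm (E x))\<^sup>2 + (norm (W x))\<^sup>2"
      using Cauchy_Schwarz_ineq2[of "E x" "W x"] by linarith
    then have "\<bar>V x\<bar> * \<bar>E x \<bullet> W x\<bar> \<le> CV * ((norm (E x))\<^sup>2 + (norm (W x))\<^sup>2)"
      using elim by (intro mult_mono) auto
    then show ?case using CV_nonneg by (simp add: abs_mult)
  qed
qed

lemma energy_expansion:
  assumes E: "E \<in> H1_vec" and W: "W \<in> H1_vec"
  shows "energy_M V h (\<lambda>x. E x + W x) - energy_M V h E - Lin E W =
     1/2 * (LINT x|lebesgue. weak_curl W x \<bullet> weak_curl W x) + 1/2 * (LINT x|lebesgue. V x * (W x \<bullet> W x)) - (LINT x|lebesgue. Rem E W x)"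
proof -
  note EW = H1_vec_add[OF E W]
  have c: "integrable lebesgue (\<lambda>x. weak_curl A x \<bullet> weak_curl B x)" if "A \<in> H1_vec" "B \<in> H1_vec" for A B
    by (rule curl_identity(1)[OF that])
  have "(LINT x|lebesgue. (norm (weak_curl (\<lambda>x. E x + W x) x))\<^sup>2) =
     (LINT x|lebesgue. weak_curl E x \<bullet> weak_curl E x + 2 * (weak_curl E x \<bullet> weak_curl W x) + weak_curl W x \<bullet> weak_curl W x)"
  proof (rule integral_cong_AE)
    show "(\<lambda>x. (norm (weak_curl (\<lambda>x. E x + W x) x))\<^sup>2) \<in> borel_measurable lebesgue"
      using weak_curl_measurable[OF EW] by measurable
    show "(\<lambda>x. weak_curl E x \<bullet> weak_curl E x + 2 * (weak_curl E x \<bullet> weak_curl W x) + weak_curl W x \<bullet> weak_curl W x) \<in> borel_measurable lebesgue"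
      using weak_curl_measurable[OF E] weak_curl_measurable[OF W] by measurable
    show "AE x in lebesgue. (norm (weak_curl (\<lambda>x. E x + W x) x))\<^sup>2 = weak_curl E x \<bullet> weak_curl E x + 2 * (weak_curl E x \<bullet> weak_curl W x) + weak_curl W x \<bullet> weak_curl W x"
      using weak_curl_add[OF E W] by eventually_elim (simp add: power2_norm_eq_inner inner_add_left inner_add_right inner_commute)
  qed
  also have "\<dots> = (LINT x|lebesgue. (norm (weak_curl E x))\<^sup>2) + 2 * (LINT x|lebesgue. weak_curl E x \<bullet> weak_curl W x) + (LINT x|lebesgue. weak_curl W x \<bullet> weak_curl W x)"
    using c[OF E E] c[OF E W] c[OF W W] by (simp add: power2_norm_eq_inner)
  finally have 1: "(LINT x|lebesgue. (norm (weak_curl (\<lambda>x. E x + W x) x))\<^sup>2) = (LINT x|lebesgue. (norm (weak_curl E x))\<^sup>2) + 2 * (LINT x|lebesgue. weak_curl E x \<bullet> weak_curl W x) + (LINT x|lebesgue. weak_curl W x \<bullet> weak_curl W x)" .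
  have "(LINT x|lebesgue. V x * (norm (E x + W x))\<^sup>2) = (LINT x|lebesgue. V x * (E x \<bullet> E x) + 2 * (V x * (E x \<bullet> W x)) + V x * (W x \<bullet> W x))"
    by (rule Bochner_Integration.integral_cong) (auto simp: power2_norm_eq_inner inner_add_left inner_add_right inner_commute algebra_simps)
  also have "\<dots> = (LINT x|lebesgue. V x * (norm (E x))\<^sup>2) + 2 * (LINT x|lebesgue. V x * (E x \<bullet> W x)) + (LINT x|lebesgue. V x * (W x \<bullet> W x))"
    using V_inner_integrable[OF E E] V_inner_integrable[OF E W] V_inner_integrable[OF W W] by (simp add: power2_norm_eq_inner)
  finally have 2: "(LINT x|lebesgue. V x * (norm (E x + W x))\<^sup>2) = (LINT x|lebesgue. V x * (norm (E x))\<^sup>2) + 2 * (LINT x|lebesgue. V x * (E x \<bullet> W x)) + (LINT x|lebesgue. V x * (W x \<bullet> W x))" .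
  have 3: "(LINT x|lebesgue. Rem E W x) = (LINT x|lebesgue. prim_h h x (E x + W x)) - (LINT x|lebesgue. prim_h h x (E x)) - (LINT x|lebesgue. h x (E x) \<bullet> W x)"
    unfolding Rem_def using prim_h_integrable[OF EW] prim_h_integrable[OF E] h_inner_integrable[OF E W] by simp
  show ?thesis
    unfolding energy_M_def Lin_def 1 2 3 by (simp add: algebra_simps)
qed

lemma energy_frechet:
  assumes E: "E \<in> H1_vec" and e: "e > 0"
  shows "\<exists>d>0. \<forall>W\<in>H1_vec. H1_vec_norm W < d \<longrightarrow> \<bar>energy_M V h (\<lambda>x. E x + W x) - energy_M V h E - Lin E W\<bar> \<le> e * H1_vec_norm W"
proof -
  obtain d where d: "d > 0" "\<And>W. W \<in> H1_vec \<Longrightarrow> H1_vec_norm W < d \<Longrightarrow> (LINT x|lebesgue. \<bar>Rem E W x\<bar>) \<le> e / 2 * H1_vec_norm W"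
    using remainder_estimate[OF E, of "e/2"] e by auto
  show ?thesis
  \<comment> \<open>Half of \<open>e\<close> is reserved for the remainder. The quadratic part is at
    most \<open>(1 + CV) / 2\<close> times the squared norm, which dictates the second
    radius.\<close>
  proof (intro exI[of _ "min d (e / (1 + CV))"] conjI ballI impI)
    show "0 < min d (e / (1 + CV))" using d e CV_nonneg by simp
    fix W assume W: "W \<in> H1_vec" and N: "H1_vec_norm W < min d (e / (1 + CV))"
    let ?N = "H1_vec_norm W"
    have N0: "?N \<ge> 0" by (rule H1_vec_norm_nonneg)
    have gi: "0 \<le> (LINT x|lebesgue. grad_inner W W x)"
      unfolding H1_vec_norm_square(4)[OF W] by (intro sum_nonneg integral_nonneg_AE) auto
    have nW: "0 \<le> (LINT x|lebesgue. (norm (W x))\<^sup>2)" by simp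
    have "0 \<le> (LINT x|lebesgue. wdiv W x * wdiv W x)" by simp
    then have a: "(LINT x|lebesgue. weak_curl W x \<bullet> weak_curl W x) \<le> ?N\<^sup>2"
      unfolding curl_identity(4)[OF W W] H1_vec_norm_square(2)[OF W] using nW by linarith
    have a0: "0 \<le> (LINT x|lebesgue. weak_curl W x \<bullet> weak_curl W x)" by simp
    have b: "\<bar>LINT x|lebesgue. V x * (W x \<bullet> W x)\<bar> \<le> CV * ?N\<^sup>2"
    proof -
      have "\<bar>LINT x|lebesgue. V x * (W x \<bullet> W x)\<bar> \<le> (LINT x|lebesgue. \<bar>V x * (W x \<bullet> W x)\<bar>)" by (rule integral_abs_bound)
      also have "\<dots> \<le> (LINT x|lebesgue. CV * (norm (W x))\<^sup>2)"
      proof (rule integral_mono_AE[OF integrable_abs[OF V_inner_integrable[OF W W]]])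
        show "integrable lebesgue (\<lambda>x. CV * (norm (W x))\<^sup>2)" using H1_vec_norm_square(1)[OF W] by simp
        show "AE x in lebesgue. \<bar>V x * (W x \<bullet> W x)\<bar> \<le> CV * (norm (W x))\<^sup>2"
          using V_bound by eventually_elim (auto simp: abs_mult power2_norm_eq_inner intro: mult_right_mono)
      qed
      also have "\<dots> = CV * (LINT x|lebesgue. (norm (W x))\<^sup>2)" by simp
      also have "\<dots> \<le> CV * ?N\<^sup>2"
        unfolding H1_vec_norm_square(2)[OF W] using gi CV_nonneg by (intro mult_left_mono) auto
      finally show ?thesis .
    qed
    have r: "\<bar>LINT x|lebesgue. Rem E W x\<bar> \<le> e / 2 * ?N"
      by (rule order_trans[OF integral_abs_bound d(2)[OF W]]) (use N in simp)
    have "(1 + CV) * ?N \<le> e" using N CV_nonneg by (simp add: field_simps)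
    then have "(1 + CV) * ?N * ?N \<le> e * ?N" using N0 by (intro mult_right_mono) auto
    then have q: "?N\<^sup>2 + CV * ?N\<^sup>2 \<le> e * ?N" by (simp add: power2_eq_square algebra_simps)
    show "\<bar>energy_M V h (\<lambda>x. E x + W x) - energy_M V h E - Lin E W\<bar> \<le> e * ?N"
    proof -
      have "\<bar>1/2 * a + 1/2 * b - r\<bar> \<le> n"
        if "0 \<le> a" "a \<le> p" "\<bar>b\<bar> \<le> q" "\<bar>r\<bar> \<le> n / 2" "p + q \<le> n" for a b r p q n :: real
        using that unfolding abs_le_iff by linarith
      from this[OF a0 a b _ q] show ?thesis unfolding energy_expansion[OF E W] using r by simp
    qed
  qed
qed

lemma Lin_cmult:
  assumes E: "E \<in> H1_vec" and W: "W \<in> H1_vec"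
  shows "Lin E (\<lambda>x. s *\<^sub>R W x) = s * Lin E W"
proof -
  have "(LINT x|lebesgue. weak_curl E x \<bullet> weak_curl (\<lambda>x. s *\<^sub>R W x) x) = (LINT x|lebesgue. s * (weak_curl E x \<bullet> weak_curl W x))"
  proof (rule integral_cong_AE)
    show "(\<lambda>x. weak_curl E x \<bullet> weak_curl (\<lambda>x. s *\<^sub>R W x) x) \<in> borel_measurable lebesgue"
      by (rule borel_measurable_integrable[OF curl_identity(1)[OF E H1_vec_cmult[OF W]]])
    show "(\<lambda>x. s * (weak_curl E x \<bullet> weak_curl W x)) \<in> borel_measurable lebesgue"
      using borel_measurable_integrable[OF curl_identity(1)[OF E W]] by measurable
    show "AE x in lebesgue. weak_curl E x \<bullet> weak_curl (\<lambda>x. s *\<^sub>R W x) x = s * (weak_curl E x \<bullet> weak_curl W x)"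
      using weak_curl_cmult[OF W, of s] by eventually_elim simp
  qed
  moreover have "(LINT x|lebesgue. V x * (E x \<bullet> (s *\<^sub>R W x))) = s * (LINT x|lebesgue. V x * (E x \<bullet> W x))"
    by (simp add: mult.left_commute)
  ultimately show ?thesis by (simp add: Lin_def algebra_simps)
qed

lemma critical_M_if_Lin_zero:
  assumes E: "E \<in> H1_vec" and L: "\<And>W. W \<in> H1_vec \<Longrightarrow> Lin E W = 0"
  shows "weak_solution_M V h E"
  unfolding weak_solution_M_def critical_point_def
  using E energy_frechet[OF E] L by simp

text \<open>The increment along the line through \<open>W\<close> is both small by assumption and
  close to \<open>s * Lin E W\<close>; dividing by \<open>s\<close> leaves an arbitrary tolerance.
  Single lines suit critical points on \<open>X_space\<close>, where the directions available are of
  the form \<open>ansatz v\<close>.\<close>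

lemma Lin_zero_if_directional:
  assumes E: "E \<in> H1_vec" and W: "W \<in> H1_vec"
    and cr: "\<And>e. e > 0 \<Longrightarrow> \<exists>d>0. \<forall>s. \<bar>s\<bar> * H1_vec_norm W < d \<longrightarrow> \<bar>energy_M V h (\<lambda>x. E x + s *\<^sub>R W x) - energy_M V h E\<bar> \<le> e * (\<bar>s\<bar> * H1_vec_norm W)"
  shows "Lin E W = 0"
proof (rule eq_0_if_abs_le_all_mult[of _ "2 * H1_vec_norm W"])
  fix e :: real assume e: "e > 0"
  let ?N = "H1_vec_norm W"
  have N0: "?N \<ge> 0" by (rule H1_vec_norm_nonneg)
  obtain d1 where d1: "d1 > 0" "\<And>s. \<bar>s\<bar> * ?N < d1 \<Longrightarrow> \<bar>energy_M V h (\<lambda>x. E x + s *\<^sub>R W x) - energy_M V h E\<bar> \<le> e * (\<bar>s\<bar> * ?N)"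
    using cr[OF e] by blast
  obtain d2 where d2: "d2 > 0" "\<And>W. W \<in> H1_vec \<Longrightarrow> H1_vec_norm W < d2 \<Longrightarrow> \<bar>energy_M V h (\<lambda>x. E x + W x) - energy_M V h E - Lin E W\<bar> \<le> e * H1_vec_norm W"
    using energy_frechet[OF E e] by blast
  \<comment> \<open>The \<open>+ 1\<close> covers directions of norm zero.\<close>
  define s where "s = min d1 d2 / (2 * (?N + 1))"
  have s: "s > 0" using d1 d2 N0 by (simp add: s_def)
  have "s * ?N \<le> min d1 d2 / 2"
  proof -
    have "s * ?N \<le> s * (?N + 1)" using s by (intro mult_left_mono) auto
    also have "\<dots> = min d1 d2 / 2" using N0 by (simp add: s_def field_simps)
    finally show ?thesis .
  qed
  then have sN: "\<bar>s\<bar> * ?N < d1" "\<bar>s\<bar> * ?N < d2" using d1(1) d2(1) s by auto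
  have "\<bar>energy_M V h (\<lambda>x. E x + s *\<^sub>R W x) - energy_M V h E - s * Lin E W\<bar> \<le> e * (\<bar>s\<bar> * ?N)"
    using d2(2)[OF H1_vec_cmult[OF W, of s]] sN by (simp add: H1_vec_norm_cmult[OF W] Lin_cmult[OF E W])
  then have "\<bar>s * Lin E W\<bar> \<le> 2 * (e * (\<bar>s\<bar> * ?N))" using d1(2)[OF sN(1)] by linarith
  then have "s * \<bar>Lin E W\<bar> \<le> s * (e * (2 * ?N))" using s by (simp add: abs_mult algebra_simps)
  then show "\<bar>Lin E W\<bar> \<le> e * (2 * ?N)" using s by simp
qed

lemma prim_ansatz_AE:
  assumes "AE x in lebesgue. E x = ansatz u x"
  shows "AE x in lebesgue. prim_h h x (E x) = prim_f f x (u x)"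
proof -
  have "AE x in lebesgue. \<forall>w a. norm w = 1 \<longrightarrow> h x (a *\<^sub>R w) = f x a *\<^sub>R w"
    using good by eventually_elim (simp add: good_pt_def)
  then show ?thesis by (rule prim_h_ansatz[OF _ f_cont assms])
qed

lemma energy_ansatz:
  assumes u: "u \<in> H1" "(\<lambda>x. u x / radius x) \<in> L2" "AE x in lebesgue. E x = ansatz u x" and r: "rot_inv u"
  shows "energy_M V h E = energy_S V f u"
proof -
  note E = ansatz_H1_vec(1)[OF u]
  have um [measurable]: "u \<in> borel_measurable lebesgue" "weak_partial i u \<in> borel_measurable lebesgue" for i
    using L2_measurable H1_L2 H1_weak_partial_L2 u(1) by auto
  have i1: "integrable lebesgue (\<lambda>x. (norm (weak_grad u x))\<^sup>2 + (u x)\<^sup>2 / (radius x)\<^sup>2)"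
  proof -
    have "(norm (weak_grad u x))\<^sup>2 + (u x)\<^sup>2 / (radius x)\<^sup>2 = (\<Sum>i\<in>UNIV. (weak_partial i u x)\<^sup>2) + (u x / radius x)\<^sup>2" for x
      unfolding power2_norm_eq_inner by (simp add: inner_vec_def power2_eq_square)
    then show ?thesis
      using L2_square[OF u(2)] L2_square[OF H1_weak_partial_L2[OF u(1)]] by simp
  qed
  have nE: "AE x in lebesgue. (norm (E x))\<^sup>2 = (u x)\<^sup>2"
    using u(3) AE_radius_pos by eventually_elim (simp add: norm_ansatz)
  have dv: "(LINT x|lebesgue. wdiv E x * wdiv E x) = (LINT x|(lebesgue :: R3 measure). 0)"
    by (rule integral_cong_AE[OF borel_measurable_integrable[OF curl_identity(3)[OF E E]]])
      (use wdiv_ansatz[OF u r] in auto)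
  have "(LINT x|lebesgue. (norm (weak_curl E x))\<^sup>2) = (LINT x|lebesgue. grad_inner E E x)"
    using curl_identity(4)[OF E E] dv by (simp add: power2_norm_eq_inner)
  also have "\<dots> = (LINT x|lebesgue. (norm (weak_grad u x))\<^sup>2 + (u x)\<^sup>2 / (radius x)\<^sup>2)"
    by (rule integral_cong_AE[OF borel_measurable_integrable[OF curl_identity(2)[OF E E]] borel_measurable_integrable[OF i1]])
      (use grad_inner_ansatz[OF u u] in \<open>simp add: power2_norm_eq_inner power2_eq_square[of "u _"]\<close>)
  finally have 1: "(LINT x|lebesgue. (norm (weak_curl E x))\<^sup>2) = (LINT x|lebesgue. (norm (weak_grad u x))\<^sup>2 + (u x)\<^sup>2 / (radius x)\<^sup>2)" .
  have m2: "(\<lambda>x. V x * (u x)\<^sup>2) \<in> borel_measurable lebesgue" using V_meas by measurable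
  have VE: "integrable lebesgue (\<lambda>x. V x * (norm (E x))\<^sup>2)" using V_inner_integrable[OF E E] by (simp add: power2_norm_eq_inner)
  have ae2: "AE x in lebesgue. V x * (norm (E x))\<^sup>2 = V x * (u x)\<^sup>2" using nE by eventually_elim simp
  have 2: "(LINT x|lebesgue. V x * (norm (E x))\<^sup>2) = (LINT x|lebesgue. V x * (u x)\<^sup>2)"
    by (rule integral_cong_AE[OF borel_measurable_integrable[OF VE] m2 ae2])
  have i2: "integrable lebesgue (\<lambda>x. V x * (u x)\<^sup>2)"
    using integrable_cong_AE[OF borel_measurable_integrable[OF VE] m2 ae2] VE by simp
  have 3: "(LINT x|lebesgue. prim_h h x (E x)) = (LINT x|lebesgue. prim_f f x (u x))"
    by (rule integral_cong_AE[OF prim_h_measurable[OF H1_vec_measurable[OF E]] prim_f_measurable[OF um(1)] prim_ansatz_AE[OF u(3)]])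
  have 4: "(LINT x|lebesgue. (norm (weak_grad u x))\<^sup>2 + (u x)\<^sup>2 / (radius x)\<^sup>2 + V x * (u x)\<^sup>2) =
     (LINT x|lebesgue. (norm (weak_grad u x))\<^sup>2 + (u x)\<^sup>2 / (radius x)\<^sup>2) + (LINT x|lebesgue. V x * (u x)\<^sup>2)"
    by (rule Bochner_Integration.integral_add[OF i1 i2])
  show ?thesis unfolding energy_M_def energy_S_def 1 2 3 4 by (simp add: algebra_simps)
qed

end

section \<open>Averages over rotations\<close>

definition avg :: "(R3 \<Rightarrow> real) \<Rightarrow> R3 \<Rightarrow> real" where
  "avg p x = 1 / (2 * pi) * integral {0..2*pi} (\<lambda>t. p (rot t x))"

lemma continuous_rot_angle: "continuous_on S (\<lambda>t. rot t x)"
  unfolding rot_def tri_def by (intro continuous_intros)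

lemma continuous_comp_rot_angle: "continuous_on UNIV p \<Longrightarrow> continuous_on S (\<lambda>t. p (rot t x))"
  by (rule continuous_on_compose2[OF _ continuous_rot_angle]) auto

lemma avg_has_integral:
  assumes "continuous_on UNIV p"
  shows "((\<lambda>t. p (rot t x)) has_integral 2 * pi * avg p x) {0..2*pi}"
  using integrable_integral[OF integrable_continuous_interval[OF continuous_comp_rot_angle[OF assms]]]
  by (simp add: avg_def)

lemma avg_eqI:
  assumes "((\<lambda>t. p (rot t x)) has_integral i) {0..2*pi}" shows "avg p x = i / (2 * pi)"
  using integral_unique[OF assms] by (simp add: avg_def)

lemma avg_bound:
  assumes "continuous_on UNIV p" "\<And>t. \<bar>p (rot t x)\<bar> \<le> B"
  shows "\<bar>avg p x\<bar> \<le> B"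
proof -
  have "norm (integral {0..2*pi} (\<lambda>t. p (rot t x))) \<le> B * (2 * pi - 0)"
    by (rule integral_bound) (use assms continuous_comp_rot_angle in auto)
  then show ?thesis by (simp add: avg_def abs_mult field_simps)
qed

lemma mean_bound: "norm (i::real) \<le> B * (2 * pi - 0) \<Longrightarrow> norm (1 / (2 * pi) * i) \<le> B"
  by (simp add: abs_mult field_simps)

lemma rot_lin: "rot t (x + y) = rot t x + rot t y" "rot t (s *\<^sub>R x) = s *\<^sub>R rot t x" "rot t (x - y) = rot t x - rot t y"
  by (simp_all add: vec_eq_iff forall_3 algebra_simps)

text \<open>When the point moves by \<open>h\<close>, its rotated copies move by
  \<open>rot t h\<close>, so the direction turns along under the integral. The Taylor bound is
  uniform in the base point and hence in the angle.\<close>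

lemma avg_C1:
  assumes p: "p \<in> C1c"
  shows "avg p \<in> C1" "\<And>x v. grad (avg p) x \<bullet> v = 1 / (2 * pi) * integral {0..2*pi} (\<lambda>t. grad p (rot t x) \<bullet> rot t v)"
proof -
  have pc: "continuous_on UNIV p" and gc: "continuous_on UNIV (grad p)"
    using C1_continuous C1_continuous_grad C1cD[OF p] by auto
  have gcr: "continuous_on {0..2*pi} (\<lambda>t. grad p (rot t x) \<bullet> rot t v)" for x v
    by (intro continuous_intros continuous_rot_angle continuous_on_compose2[OF gc continuous_rot_angle]) auto
  note gi = integrable_continuous_interval[OF gcr]
  define G where "G x = (\<chi> i. 1 / (2 * pi) * integral {0..2*pi} (\<lambda>t. grad p (rot t x) \<bullet> rot t (axis i 1)))" for x
  have Gv: "G x \<bullet> v = 1 / (2 * pi) * integral {0..2*pi} (\<lambda>t. grad p (rot t x) \<bullet> rot t v)" for x v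
  proof -
    have v: "v = v$1 *\<^sub>R axis 1 1 + v$2 *\<^sub>R axis 2 1 + v$3 *\<^sub>R axis 3 1"
      by (simp add: vec_eq_iff forall_3 axis_def)
    have "integral {0..2*pi} (\<lambda>t. grad p (rot t x) \<bullet> rot t v) =
      integral {0..2*pi} (\<lambda>t. v$1 * (grad p (rot t x) \<bullet> rot t (axis 1 1)) + v$2 * (grad p (rot t x) \<bullet> rot t (axis 2 1)) + v$3 * (grad p (rot t x) \<bullet> rot t (axis 3 1)))"
      by (subst v) (simp only: rot_lin inner_add_right inner_scaleR_right)
    also have "\<dots> = v$1 * integral {0..2*pi} (\<lambda>t. grad p (rot t x) \<bullet> rot t (axis 1 1)) + v$2 * integral {0..2*pi} (\<lambda>t. grad p (rot t x) \<bullet> rot t (axis 2 1)) + v$3 * integral {0..2*pi} (\<lambda>t. grad p (rot t x) \<bullet> rot t (axis 3 1))"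
      using gi by (simp add: integral_add integrable_add integrable_on_mult_right del: rot_nth)
    finally show ?thesis by (simp add: G_def inner_vec_def sum_3 algebra_simps del: rot_nth)
  qed
  have d: "(avg p has_derivative (\<lambda>h. G x \<bullet> h)) (at x)" for x
    unfolding has_derivative_at_alt
  proof (intro conjI allI impI)
    show "bounded_linear (\<lambda>h. G x \<bullet> h)" by (rule bounded_linear_inner_right)
    fix e :: real assume e: "e > 0"
    obtain d where d: "d > 0" "\<And>a h. norm h < d \<Longrightarrow> \<bar>p (a + h) - p a - grad p a \<bullet> h\<bar> \<le> e * norm h"
      using C1c_uniform_taylor[OF p e] by metis
    show "\<exists>d>0. \<forall>y. norm (y - x) < d \<longrightarrow> norm (avg p y - avg p x - G x \<bullet> (y - x)) \<le> e * norm (y - x)"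
    proof (intro exI[of _ d] conjI allI impI d(1))
      fix y assume y: "norm (y - x) < d"
      let ?r = "\<lambda>t. p (rot t y) - p (rot t x) - grad p (rot t x) \<bullet> rot t (y - x)"
      have I: "integral {0..2*pi} ?r = integral {0..2*pi} (\<lambda>t. p (rot t y)) - integral {0..2*pi} (\<lambda>t. p (rot t x)) - integral {0..2*pi} (\<lambda>t. grad p (rot t x) \<bullet> rot t (y - x))"
        by (simp only: integral_diff integrable_diff gi integrable_continuous_interval[OF continuous_comp_rot_angle[OF pc]])
      have "avg p y - avg p x - G x \<bullet> (y - x) = 1 / (2 * pi) * integral {0..2*pi} ?r"
        by (simp only: Gv avg_def I right_diff_distrib)
      moreover have "norm (1 / (2 * pi) * integral {0..2*pi} ?r) \<le> e * norm (y - x)"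
      proof (rule mean_bound)
      show "norm (integral {0..2*pi} ?r) \<le> (e * norm (y - x)) * (2 * pi - 0)"
      proof (rule integral_bound)
        show "continuous_on {0..2*pi} ?r" by (intro continuous_intros continuous_comp_rot_angle pc gcr)
        show "norm (?r t) \<le> e * norm (y - x)" for t
          using d(2)[of "rot t (y - x)" "rot t x"] y by (simp flip: rot_lin(1))
      qed simp
      qed
      ultimately show "norm (avg p y - avg p x - G x \<bullet> (y - x)) \<le> e * norm (y - x)"
        by (simp only:)
    qed
  qed
  have c: "continuous_on UNIV G"
  proof -
    have "continuous (at x) (\<lambda>x. 1 / (2 * pi) * integral {0..2*pi} (\<lambda>t. grad p (rot t x) \<bullet> rot t (axis i 1)))" for x i
      unfolding continuous_at_eps_delta dist_norm
    proof (intro allI impI)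
      fix e :: real assume e: "e > 0"
      obtain d where d: "d > 0" "\<And>x y. norm (x - y) < d \<Longrightarrow> norm (grad p x - grad p y) < e / 2"
        using Cc_uniformly_continuous[OF C1c_grad_Cc[OF p], of "e / 2"] e by (auto simp: half_gt_zero_iff)
      show "\<exists>d>0. \<forall>y. norm (y - x) < d \<longrightarrow> norm (1 / (2 * pi) * integral {0..2*pi} (\<lambda>t. grad p (rot t y) \<bullet> rot t (axis i 1)) - 1 / (2 * pi) * integral {0..2*pi} (\<lambda>t. grad p (rot t x) \<bullet> rot t (axis i 1))) < e"
      proof (intro exI[of _ d] conjI allI impI d(1))
        fix y assume y: "norm (y - x) < d"
        let ?r = "\<lambda>t. grad p (rot t y) \<bullet> rot t (axis i 1) - grad p (rot t x) \<bullet> rot t (axis i 1)"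
        have n: "norm (integral {0..2*pi} ?r) \<le> e / 2 * (2 * pi - 0)"
        proof (rule integral_bound)
          show "continuous_on {0..2*pi} ?r" by (intro continuous_on_diff gcr)
          show "norm (?r t) \<le> e / 2" for t
          proof -
            have "norm (?r t) \<le> norm (grad p (rot t y) - grad p (rot t x)) * norm (rot t (axis i 1))"
              unfolding inner_diff_left[symmetric] by (simp add: Cauchy_Schwarz_ineq2 del: norm_rot)
            also have "\<dots> \<le> e / 2" using d(2)[of "rot t y" "rot t x"] y by (simp flip: rot_lin)
            finally show ?thesis .
          qed
        qed simp
        have I: "integral {0..2*pi} ?r = integral {0..2*pi} (\<lambda>t. grad p (rot t y) \<bullet> rot t (axis i 1)) - integral {0..2*pi} (\<lambda>t. grad p (rot t x) \<bullet> rot t (axis i 1))"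
          by (rule integral_diff[OF gi gi])
        have "norm (1 / (2 * pi) * integral {0..2*pi} (\<lambda>t. grad p (rot t y) \<bullet> rot t (axis i 1)) - 1 / (2 * pi) * integral {0..2*pi} (\<lambda>t. grad p (rot t x) \<bullet> rot t (axis i 1))) \<le> e / 2"
          using mean_bound[OF n] by (simp only: I right_diff_distrib)
        then show "norm (1 / (2 * pi) * integral {0..2*pi} (\<lambda>t. grad p (rot t y) \<bullet> rot t (axis i 1)) - 1 / (2 * pi) * integral {0..2*pi} (\<lambda>t. grad p (rot t x) \<bullet> rot t (axis i 1))) < e"
          using e by linarith
      qed
    qed
    then show ?thesis unfolding G_def by (intro continuous_on_vec_lambda continuous_at_imp_continuous_on) blast
  qed
  show "avg p \<in> C1" by (rule C1I(1)[OF d c])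
  show "grad (avg p) x \<bullet> v = 1 / (2 * pi) * integral {0..2*pi} (\<lambda>t. grad p (rot t x) \<bullet> rot t v)" for x v
    unfolding C1I(2)[OF d c] by (rule Gv)
qed

lemma avg_C1c:
  assumes p: "p \<in> C1c" shows "avg p \<in> C1c"
proof -
  obtain R where "\<And>x. norm x > R \<Longrightarrow> p x = 0" using C1cE[OF p] by metis
  then have "\<forall>x. norm x > R \<longrightarrow> avg p x = 0" by (simp add: avg_def)
  then show ?thesis using avg_C1(1)[OF p] by (auto simp: C1c_def)
qed

lemma rot_hor: "rot t (hor x) = hor (rot t x)"
  by (simp add: vec_eq_iff forall_3)

lemma avg_radial: assumes "p \<in> C1c" shows "hor x \<bullet> grad (avg p) x = avg (\<lambda>x. hor x \<bullet> grad p x) x"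
  using avg_C1(2)[OF assms, of x "hor x"] by (simp add: avg_def rot_hor inner_commute)

lemma avg_vertical: assumes "p \<in> C1c" shows "partial 3 (avg p) x = avg (partial 3 p) x"
proof -
  have "rot t (axis 3 1) = axis 3 1" for t by (simp add: vec_eq_iff forall_3 axis_def)
  then show ?thesis using avg_C1(2)[OF assms, of x "axis 3 1"] by (simp add: avg_def inner_axis)
qed

text \<open>The gradient formula turns the angular derivative of the average into the integral of
  \<open>dth p\<close> over a full circle, which is zero; so the average is constant along
  orbits.\<close>

lemma avg_rot: assumes p: "p \<in> C1c" shows "avg p (rot s x) = avg p x"
proof -
  have "dth (avg p) y = 0" for y
  proof -
    have r: "rot t (tri (- y$2, y$1, 0)) = tri (- rot t y $ 2, rot t y $ 1, 0)" for t
      by (simp add: vec_eq_iff forall_3)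
    have "dth (avg p) y = grad (avg p) y \<bullet> tri (- y$2, y$1, 0)"
      by (simp add: dth_def inner_vec_def sum_3)
    also have "\<dots> = 1 / (2 * pi) * integral {0..2*pi} (\<lambda>t. dth p (rot t y))"
      unfolding avg_C1(2)[OF p] r by (simp add: dth_def inner_vec_def sum_3 algebra_simps del: rot_nth)
    also have "\<dots> = 0" using integral_unique[OF dth_has_integral[OF C1cD[OF p]]] by simp
    finally show ?thesis .
  qed
  then have "((\<lambda>t. avg p (rot t x)) has_real_derivative 0) (at t)" for t
    using dth_has_derivative[OF avg_C1(1)[OF p], of x t] by simp
  then have "avg p (rot s x) = avg p (rot 0 x)" by (intro DERIV_isconst_all) blast
  then show ?thesis by simp
qed

text \<open>Every orbit meets the half-plane \<open>x $ 2 = 0\<close>, \<open>x $ 1 \<ge> 0\<close>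
  in a point fixed by \<open>radius x\<close> and \<open>x $ 3\<close>; the profile is the
  restriction of \<open>b\<close> to it.\<close>

lemma rot_invariant_cyl_sym:
  assumes "\<And>t x. b (rot t x) = b x" shows "cyl_sym b"
proof -
  have "b x = b (tri (radius x, 0, x$3))" for x
  proof -
    have "\<exists>t. x$1 = radius x * cos t \<and> x$2 = radius x * sin t"
    proof (cases "radius x = 0")
      case True
      then have "x$1 = 0" "x$2 = 0" using abs_coord_le_radius[of x] by auto
      then show ?thesis using True by simp
    next
      case False
      then have "(x$1 / radius x)\<^sup>2 + (x$2 / radius x)\<^sup>2 = 1"
        using cos_sin_radius[of x] radius_nonneg[of x] by (simp add: power2_eq_square)
      then obtain t where "x$1 / radius x = cos t" "x$2 / radius x = sin t" using sincos_total_2pi by metis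
      then show ?thesis using False by (intro exI[of _ t]) (simp add: field_simps)
    qed
    then obtain t where "x$1 = radius x * cos t" "x$2 = radius x * sin t" by blast
    then have "x = rot t (tri (radius x, 0, x$3))" by (simp add: vec_eq_iff forall_3)
    then show ?thesis using assms by metis
  qed
  then show ?thesis unfolding cyl_sym_def by (intro exI[of _ "\<lambda>r z. b (tri (r, 0, z))"]) simp
qed

text \<open>Exhibits \<open>sg a b\<close> as an angular derivative, hence as a function of mean
  zero on every circle about the axis.\<close>

lemma sg_dth: "dth (sg (- b) a) x = sg a b x"
  using fun_cong[OF sg_C1(2)[of "-b" a], of x] by (simp add: dth_def vec_eq_iff forall_3 sg_def)

lemma C1c_bounds:
  assumes p: "p \<in> C1c"
  obtains B where "B > 0" "\<And>x. \<bar>p x\<bar> \<le> B" "\<And>x. norm (grad p x) \<le> B" "\<And>x y. \<bar>p x - p y\<bar> \<le> B * norm (x - y)"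
proof -
  obtain B1 where B1: "\<And>x. norm (p x) \<le> B1" by (rule Cc_bounded[OF C1c_Cc[OF p]]) blast
  obtain B2 where B2: "\<And>x. norm (grad p x) \<le> B2" "B2 > 0" by (rule Cc_bounded[OF C1c_grad_Cc[OF p]]) blast
  show thesis
  proof (rule that[of "max B1 B2"])
    show "max B1 B2 > 0" using B2 by auto
    show "\<bar>p x\<bar> \<le> max B1 B2" for x using B1[of x] by (simp add: le_max_iff_disj)
    show g: "norm (grad p x) \<le> max B1 B2" for x using B2(1)[of x] by (simp add: le_max_iff_disj)
    have "norm (p x - p y) \<le> max B1 B2 * norm (x - y)" for x y
    proof (rule differentiable_bound[of UNIV p "\<lambda>x h. grad p x \<bullet> h"])
      show "(p has_derivative (\<lambda>h. grad p x \<bullet> h)) (at x within UNIV)" for x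
        using C1_has_derivative[OF C1cD[OF p]] by simp
      show "onorm (\<lambda>h. grad p x \<bullet> h) \<le> max B1 B2" for x
        by (rule onorm_le) (metis Cauchy_Schwarz_ineq2 g mult_right_mono norm_ge_zero order_trans real_norm_def)
    qed auto
    then show "\<bar>p x - p y\<bar> \<le> max B1 B2 * norm (x - y)" for x y by simp
  qed
qed

lemma norm_hor: "norm (hor x) = radius x"
  by (simp add: norm_eq_sqrt_inner inner_vec_def sum_3 radius_def power2_eq_square)

lemma hor_tri: "hor x \<bullet> tri (a, b, 0) = sg a b x"
  by (simp add: inner_vec_def sum_3 sg_def mult.commute)

lemma dth_bound: "\<bar>dth p x\<bar> \<le> radius x * norm (grad p x)"
proof -
  have "norm (tri (- x$2, x$1, 0)) = radius x"
    by (simp add: norm_eq_sqrt_inner inner_vec_def sum_3 radius_def power2_eq_square add.commute)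
  moreover have "dth p x = tri (- x$2, x$1, 0) \<bullet> grad p x" by (simp add: dth_def inner_vec_def sum_3)
  ultimately show ?thesis by (metis Cauchy_Schwarz_ineq2)
qed

lemma continuous_hor: "continuous_on S hor"
  unfolding hor_def[abs_def] tri_def by (intro continuous_intros)

section \<open>Averages of \<open>sg a b\<close> times a smooth function near the axis\<close>

context
  fixes p :: "R3 \<Rightarrow> real" and a b B :: real
  assumes p: "p \<in> C1c" and B: "B > 0" "\<And>x. \<bar>p x\<bar> \<le> B" "\<And>x. norm (grad p x) \<le> B" "\<And>x y. \<bar>p x - p y\<bar> \<le> B * norm (x - y)"
begin

abbreviation (input) psi where "psi \<equiv> (\<lambda>x. sg a b x * p x)"
abbreviation (input) cc where "cc \<equiv> (\<bar>a\<bar> + \<bar>b\<bar>) * B"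

lemma psi_C1c: "psi \<in> C1c" by (rule C1c_mult[OF sg_C1(1) p])

lemma psi_grad: "grad psi x = sg a b x *\<^sub>R grad p x + p x *\<^sub>R tri (a, b, 0)"
  using fun_cong[OF C1_mult(2)[OF sg_C1(1)[of a b] C1cD[OF p]], of x] by (simp add: sg_C1(2))

lemma psi_radial: "hor x \<bullet> grad psi x = psi x + sg a b x * (hor x \<bullet> grad p x)"
  unfolding psi_grad by (simp add: inner_add_right hor_tri)

lemma psi_vertical: "partial 3 psi x = sg a b x * partial 3 p x"
  using psi_grad[of x] by (simp add: vec_eq_iff forall_3)

lemma continuous_pieces: "continuous_on S p" "continuous_on S (sg a b)" "continuous_on S (\<lambda>x. hor x \<bullet> grad p x)" "continuous_on S (partial 3 p)" "continuous_on S (dth p)"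
proof -
  show "continuous_on S p" "continuous_on S (sg a b)" "continuous_on S (partial 3 p)"
    by (intro C1_continuous C1_continuous_partial C1cD[OF p] sg_C1(1))+
  show "continuous_on S (\<lambda>x. hor x \<bullet> grad p x)"
    by (intro continuous_intros continuous_hor C1_continuous_grad C1cD[OF p])
  show "continuous_on S (dth p)"
    unfolding dth_def[abs_def] by (intro continuous_intros C1_continuous_partial C1cD p)
qed

lemma radial_bound: "\<bar>sg a b x * (hor x \<bullet> grad p x)\<bar> \<le> cc * (radius x)\<^sup>2"
proof -
  have "\<bar>hor x \<bullet> grad p x\<bar> \<le> radius x * B"
    using Cauchy_Schwarz_ineq2[of "hor x" "grad p x"] mult_left_mono[OF B(3)[of x] radius_nonneg[of x]] by (simp add: norm_hor)
  then have "\<bar>sg a b x\<bar> * \<bar>hor x \<bullet> grad p x\<bar> \<le> ((\<bar>a\<bar> + \<bar>b\<bar>) * radius x) * (radius x * B)"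
    by (intro mult_mono sg_le_radius) (auto intro: mult_nonneg_nonneg radius_nonneg)
  then show ?thesis by (simp add: abs_mult power2_eq_square algebra_simps)
qed

lemma vertical_bound: "\<bar>sg a b x * partial 3 p x\<bar> \<le> cc * radius x"
proof -
  have "\<bar>partial 3 p x\<bar> \<le> B" using component_le_norm_cart[of "grad p x" 3] B(3)[of x] by simp
  then have "\<bar>sg a b x\<bar> * \<bar>partial 3 p x\<bar> \<le> ((\<bar>a\<bar> + \<bar>b\<bar>) * radius x) * B"
    by (intro mult_mono sg_le_radius) (auto intro: mult_nonneg_nonneg radius_nonneg)
  then show ?thesis by (simp add: abs_mult algebra_simps)
qed

text \<open>The factor \<open>sg a b\<close> alone gives one power of \<open>radius\<close>. Since
  it has mean zero on circles, the value of \<open>p\<close> at the foot point \<open>?z\<close> on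
  the axis may be subtracted, and the Lipschitz bound contributes the second power. The uniform
  bounds on the cofactors in \<open>Lam_C1c\<close> rest on this.\<close>

lemma avg_psi_bound: "\<bar>avg psi x\<bar> \<le> cc * (radius x)\<^sup>2"
proof -
  let ?z = "tri (0, 0, x$3)"
  let ?q = "\<lambda>y. sg a b y * (p y - p ?z)"
  have i0: "((\<lambda>t. sg a b (rot t x) * p ?z) has_integral 0 * p ?z) {0..2*pi}"
    using has_integral_mult_left[OF dth_has_integral[OF sg_C1(1)[of "-b" a]], of x "p ?z"] by (simp only: sg_dth)
  have "((\<lambda>t. psi (rot t x) - sg a b (rot t x) * p ?z) has_integral (2 * pi * avg psi x - 0 * p ?z)) {0..2*pi}"
    by (rule has_integral_diff[OF avg_has_integral i0]) (intro continuous_intros continuous_pieces)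
  then have "avg ?q x = avg psi x"
    by (intro trans[OF avg_eqI]) (auto simp: right_diff_distrib)
  moreover have "\<bar>avg ?q x\<bar> \<le> cc * (radius x)\<^sup>2"
  proof (rule avg_bound)
    show "continuous_on UNIV ?q" by (intro continuous_intros continuous_pieces)
    fix t
    have "rot t x - ?z = hor (rot t x)" by (simp add: vec_eq_iff forall_3)
    then have "\<bar>p (rot t x) - p ?z\<bar> \<le> B * radius x" using B(4)[of "rot t x" ?z] by (simp add: norm_hor)
    then have "\<bar>sg a b (rot t x)\<bar> * \<bar>p (rot t x) - p ?z\<bar> \<le> ((\<bar>a\<bar> + \<bar>b\<bar>) * radius x) * (B * radius x)"
      using sg_le_radius[of a b "rot t x"] B(1) radius_nonneg by (intro mult_mono) (auto intro: mult_nonneg_nonneg)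
    also have "((\<bar>a\<bar> + \<bar>b\<bar>) * radius x) * (B * radius x) = cc * (radius x)\<^sup>2" by (simp add: power2_eq_square)
    finally show "\<bar>?q (rot t x)\<bar> \<le> cc * (radius x)\<^sup>2" unfolding abs_mult .
  qed
  ultimately show ?thesis by simp
qed

text \<open>Pairing the gradient with \<open>hor x\<close> gives \<open>radius x\<close> times the
  radial derivative. Under this operation \<open>sg a b\<close>, being homogeneous of degree one,
  reproduces itself and yields the first summand.\<close>

lemma avg_psi_radial: "hor x \<bullet> grad (avg psi) x = avg psi x + avg (\<lambda>x. sg a b x * (hor x \<bullet> grad p x)) x"
proof -
  have "hor x \<bullet> grad (avg psi) x = avg (\<lambda>x. psi x + sg a b x * (hor x \<bullet> grad p x)) x"
    unfolding avg_radial[OF psi_C1c] psi_radial ..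
  also have "\<dots> = avg psi x + avg (\<lambda>x. sg a b x * (hor x \<bullet> grad p x)) x"
  proof -
    have c: "continuous_on UNIV psi" "continuous_on UNIV (\<lambda>x. sg a b x * (hor x \<bullet> grad p x))"
      by (intro continuous_intros continuous_pieces)+
    show ?thesis
      using avg_eqI[OF has_integral_add[OF avg_has_integral[OF c(1)] avg_has_integral[OF c(2)]], of x]
      by (simp add: add_divide_distrib)
  qed
  finally show ?thesis .
qed

lemma avg_radial_bound: "\<bar>avg (\<lambda>x. sg a b x * (hor x \<bullet> grad p x)) x\<bar> \<le> cc * (radius x)\<^sup>2"
proof (rule avg_bound)
  show "continuous_on UNIV (\<lambda>x. sg a b x * (hor x \<bullet> grad p x))" by (intro continuous_intros continuous_pieces)
  show "\<bar>sg a b (rot t x) * (hor (rot t x) \<bullet> grad p (rot t x))\<bar> \<le> cc * (radius x)\<^sup>2" for t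
    using radial_bound[of "rot t x"] by simp
qed

lemma avg_psi_vertical: "partial 3 (avg psi) x = avg (\<lambda>x. sg a b x * partial 3 p x) x"
  unfolding avg_vertical[OF psi_C1c] psi_vertical ..

lemma avg_vertical_bound: "\<bar>avg (\<lambda>x. sg a b x * partial 3 p x) x\<bar> \<le> cc * radius x"
proof (rule avg_bound)
  show "continuous_on UNIV (\<lambda>x. sg a b x * partial 3 p x)" by (intro continuous_intros continuous_pieces)
  show "\<bar>sg a b (rot t x) * partial 3 p (rot t x)\<bar> \<le> cc * radius x" for t
    using vertical_bound[of "rot t x"] by simp
qed

text \<open>Integration by parts on the circle, with \<open>sg a b\<close> as the angular derivative
  of \<open>sg (- b) a\<close>. It expresses a quantity of order zero through \<open>dth p\<close>,
  with which the gradient of \<open>sg a b / radius\<close> pairs in \<open>Lam\<close>.\<close>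

lemma avg_angular: "avg psi x = - avg (\<lambda>x. sg (- b) a x * dth p x) x"
proof -
  have tp: "(\<lambda>x. sg (- b) a x * p x) \<in> C1c" by (rule C1c_mult[OF sg_C1(1) p])
  have d: "dth (\<lambda>x. sg (- b) a x * p x) y = psi y + sg (- b) a y * dth p y" for y
    using fun_cong[OF C1_mult(2)[OF sg_C1(1)[of "-b" a] C1cD[OF p]], of y]
    by (simp add: dth_def vec_eq_iff sg_C1(2) forall_3) (simp add: sg_def algebra_simps)
  have c: "continuous_on UNIV psi" "continuous_on UNIV (\<lambda>x. sg (- b) a x * dth p x)"
    by (intro continuous_intros continuous_pieces C1_continuous[OF sg_C1(1)])+
  have "((\<lambda>t. dth (\<lambda>x. sg (- b) a x * p x) (rot t x)) has_integral 2 * pi * avg psi x + 2 * pi * avg (\<lambda>x. sg (- b) a x * dth p x) x) {0..2*pi}"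
    unfolding d by (rule has_integral_add[OF avg_has_integral[OF c(1)] avg_has_integral[OF c(2)]])
  from has_integral_unique[OF this dth_has_integral[OF C1cD[OF tp]]]
  have "2 * pi * (avg psi x + avg (\<lambda>x. sg (- b) a x * dth p x) x) = 0" by (simp add: algebra_simps)
  then show ?thesis by simp
qed

end

section \<open>Symmetric criticality\<close>

lemma cyl_symI: "AE x in lebesgue. u x = p (radius x) (x$3) \<Longrightarrow> cyl_sym u"
  unfolding cyl_sym_def by blast

lemma X_space_add:
  assumes "u \<in> X_space" "v \<in> X_space" shows "(\<lambda>x. u x + v x) \<in> X_space"
proof -
  obtain p q where "AE x in lebesgue. u x = p (radius x) (x$3)" "AE x in lebesgue. v x = q (radius x) (x$3)"
    using assms by (auto simp: X_space_iff cyl_sym_def)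
  then have "AE x in lebesgue. u x + v x = p (radius x) (x$3) + q (radius x) (x$3)" by eventually_elim simp
  then have "cyl_sym (\<lambda>x. u x + v x)" by (rule cyl_symI[of _ "\<lambda>r z. p r z + q r z"])
  moreover have "(\<lambda>x. (u x + v x) / radius x) \<in> L2"
    using L2_add[of "\<lambda>x. u x / radius x" "\<lambda>x. v x / radius x"] assms by (simp add: X_space_iff add_divide_distrib)
  ultimately show ?thesis using assms H1_add(1) by (simp add: X_space_iff)
qed

lemma X_space_cmult:
  assumes "u \<in> X_space" shows "(\<lambda>x. s * u x) \<in> X_space"
proof -
  obtain p where "AE x in lebesgue. u x = p (radius x) (x$3)"
    using assms by (auto simp: X_space_iff cyl_sym_def)
  then have "AE x in lebesgue. s * u x = s * p (radius x) (x$3)" by eventually_elim simp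
  then have "cyl_sym (\<lambda>x. s * u x)" by (rule cyl_symI[of _ "\<lambda>r z. s * p r z"])
  moreover have "(\<lambda>x. (s * u x) / radius x) \<in> L2"
    using L2_cmult[of "\<lambda>x. u x / radius x" s] assms by (simp add: X_space_iff)
  ultimately show ?thesis using assms H1_cmult(1) by (simp add: X_space_iff)
qed

lemma ansatz_add: "ansatz (\<lambda>x. u x + v x) x = ansatz u x + ansatz v x"
  by (simp add: ansatz_def add_divide_distrib scaleR_add_left)

lemma ansatz_cmult: "ansatz (\<lambda>x. s * u x) x = s *\<^sub>R ansatz u x"
  by (simp add: ansatz_def)

lemma ansatz_inner: "radius x > 0 \<Longrightarrow> ansatz u x \<bullet> ansatz v x = u x * v x"
proof -
  assume r: "radius x > 0"
  have "ansatz u x \<bullet> ansatz v x = ((x$1 / radius x) * (x$1 / radius x) + (x$2 / radius x) * (x$2 / radius x)) * (u x * v x)"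
    unfolding inner_vec_def sum_3 ansatz_nth by (simp add: sg_def algebra_simps)
  then show ?thesis using cos_sin_radius[OF r] by simp
qed

lemma kap_rot: "kap e (rot t x) = kap e x"
  using rot_radius[of t x] by (simp add: kap_def radius_def del: rot_radius rot_nth)

lemma radius_le_norm: "radius x \<le> norm x"
  unfolding radius_def norm_eq_sqrt_inner by (intro real_sqrt_le_mono) (simp add: inner_vec_def sum_3 power2_eq_square)

text \<open>If the integrals of \<open>w^2\<close> and \<open>w^6\<close> are of order
  \<open>t^2\<close> and \<open>t^6\<close>, then after integration each term on the right is of
  order \<open>t\<close>.\<close>

lemma small_young:
  fixes m w t :: real
  assumes "0 \<le> m" "0 \<le> w" "0 < t"
  shows "(m + m ^ 5) * w \<le> t * (m\<^sup>2 + m ^ 6) + w\<^sup>2 / t + w ^ 6 / t ^ 5"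
proof (cases "w \<le> t * m")
  case True
  then have "(m + m ^ 5) * w \<le> (m + m ^ 5) * (t * m)" using assms by (intro mult_left_mono) auto
  also have "\<dots> = t * (m\<^sup>2 + m ^ 6)" by (simp add: algebra_simps numeral_eq_Suc)
  also have "\<dots> \<le> t * (m\<^sup>2 + m ^ 6) + w\<^sup>2 / t + w ^ 6 / t ^ 5" using assms by simp
  finally show ?thesis .
next
  case False
  then have m: "m \<le> w / t" using assms by (simp add: field_simps)
  have "(m + m ^ 5) * w \<le> (w / t + (w / t) ^ 5) * w"
    using assms by (intro mult_right_mono add_mono power_mono m) auto
  also have "\<dots> = w\<^sup>2 / t + w ^ 6 / t ^ 5" by (simp add: algebra_simps numeral_eq_Suc power_divide)
  also have "\<dots> \<le> t * (m\<^sup>2 + m ^ 6) + w\<^sup>2 / t + w ^ 6 / t ^ 5" using assms by simp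
  finally show ?thesis .
qed

locale cyl_problem = problem +
  assumes V_rot: "rot_inv V" and f_rot: "\<And>t x s. f (rot t x) s = f x s"
begin

lemma f_comp_integrable_power:
  assumes u: "u \<in> H1" shows "integrable lebesgue (\<lambda>x. (u x)\<^sup>2 + u x ^ 6)"
  using L2_square[OF H1_L2[OF u]] Sobolev_H1(1)[OF u] by simp

lemma f_comp_locally_integrable:
  assumes u: "u \<in> H1" shows "locally_integrable (\<lambda>x. f x (u x))"
proof (rule locally_integrable_bound)
  show "(\<lambda>x. f x (u x)) \<in> borel_measurable lebesgue" by (rule f_comp_measurable[OF L2_measurable[OF H1_L2[OF u]]])
  show "integrable lebesgue (\<lambda>x. indicat_real (cball 0 R) x * (c * (2 + ((u x)\<^sup>2 + u x ^ 6))))" for R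
  proof -
    have "integrable lebesgue (\<lambda>x. indicat_real (cball 0 R) x *\<^sub>R ((u x)\<^sup>2 + u x ^ 6))"
      by (rule integrable_mult_indicator[OF _ f_comp_integrable_power[OF u]]) auto
    then have "integrable lebesgue (\<lambda>x. c * (2 * indicat_real (cball 0 R) x + indicat_real (cball 0 R) x * ((u x)\<^sup>2 + u x ^ 6)))"
      using integrable_cball_lebesgue[of 0 R] by simp
    then show ?thesis by (simp add: algebra_simps)
  qed
  show "AE x in lebesgue. \<bar>f x (u x)\<bar> \<le> c * (2 + ((u x)\<^sup>2 + u x ^ 6))"
    using good
  proof eventually_elim
    case (elim x)
    have p: "s \<le> 1 + s * s" for s :: real using zero_le_power2[of "s - 1/2"] by (simp add: power2_eq_square algebra_simps)
    have "\<bar>u x\<bar> ^ 5 \<le> 1 + \<bar>u x\<bar> ^ 6"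
    proof (cases "\<bar>u x\<bar> \<le> 1")
      case True then have "\<bar>u x\<bar> ^ 5 \<le> 1" by (intro power_le_one) auto
      then show ?thesis by (simp add: add_increasing2)
    next
      case False then have "\<bar>u x\<bar> ^ 5 \<le> \<bar>u x\<bar> ^ 6" by (intro power_increasing) auto
      then show ?thesis by simp
    qed
    then have "\<bar>u x\<bar> + \<bar>u x\<bar> ^ 5 \<le> 2 + ((u x)\<^sup>2 + u x ^ 6)"
      using p[of "\<bar>u x\<bar>"] by (simp add: power2_eq_square)
    then show ?case using good_growth[OF elim c_nonneg, of "u x"] c_nonneg by (meson mult_left_mono order_trans)
  qed
qed

lemma f_comp_mult_integrable:
  assumes u: "u \<in> H1" and v: "v \<in> H1" shows "integrable lebesgue (\<lambda>x. f x (u x) * v x)"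
proof (rule Bochner_Integration.integrable_bound)
  show "integrable lebesgue (\<lambda>x. c * (((v x)\<^sup>2 + v x ^ 6) + ((u x)\<^sup>2 + u x ^ 6)))"
    by (rule integrable_mult_right, rule Bochner_Integration.integrable_add)
      (rule f_comp_integrable_power[OF u] f_comp_integrable_power[OF v])+
  show "(\<lambda>x. f x (u x) * v x) \<in> borel_measurable lebesgue"
    using f_comp_measurable[OF L2_measurable[OF H1_L2[OF u]]] L2_measurable[OF H1_L2[OF v]] by measurable
  show "AE x in lebesgue. norm (f x (u x) * v x) \<le> norm (c * (((v x)\<^sup>2 + v x ^ 6) + ((u x)\<^sup>2 + u x ^ 6)))"
    using good
  proof eventually_elim
    case (elim x)
    have "\<bar>f x (u x)\<bar> * \<bar>v x\<bar> \<le> c * (\<bar>u x\<bar> + \<bar>u x\<bar> ^ 5) * \<bar>v x\<bar>"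
      by (intro mult_right_mono good_growth[OF elim c_nonneg]) auto
    also have "\<dots> \<le> c * (((v x)\<^sup>2 + v x ^ 6) + ((u x)\<^sup>2 + u x ^ 6))"
      using weighted_young[of 1 "\<bar>u x\<bar>" "\<bar>v x\<bar>" 1] c_nonneg unfolding mult.assoc
      by (intro mult_left_mono) auto
    finally show ?case using c_nonneg by (simp add: abs_mult)
  qed
qed

lemma V_mult_L2: assumes "u \<in> L2" shows "(\<lambda>x. V x * u x) \<in> L2"
proof (rule L2_mono[OF L2_cmult[OF assms, of CV]])
  show "(\<lambda>x. V x * u x) \<in> borel_measurable lebesgue" using V_meas L2_measurable[OF assms] by measurable
  show "AE x in lebesgue. \<bar>V x * u x\<bar> \<le> \<bar>CV * u x\<bar>"
    using V_bound by eventually_elim (use CV_nonneg in \<open>auto simp: abs_mult intro: mult_right_mono\<close>)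
qed

lemma h_ansatz_AE:
  assumes "AE x in lebesgue. E x = ansatz u x"
  shows "AE x in lebesgue. h x (E x) \<bullet> W x = f x (u x) * (sg 0 (-1) x / radius x) * W x $ 1 + f x (u x) * (sg 1 0 x / radius x) * W x $ 2"
  using good assms AE_radius_pos
proof eventually_elim
  case (elim x)
  define e where "e = (1 / radius x) *\<^sub>R tri (- x$2, x$1, 0)"
  have Ee: "E x = u x *\<^sub>R e"
    unfolding elim(2) by (simp add: vec_eq_iff forall_3 e_def ansatz_def)
  have "(norm e)\<^sup>2 = (x$1 / radius x) * (x$1 / radius x) + (x$2 / radius x) * (x$2 / radius x)"
    unfolding power2_norm_eq_inner by (simp add: inner_vec_def sum_3 e_def)
  then have "(norm e)\<^sup>2 = 1" using cos_sin_radius[OF elim(3)] by simp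
  then have ne: "norm e = 1" by (simp add: power2_eq_1_iff) (use norm_ge_zero[of e] in linarith)
  have "h x (E x) = f x (u x) *\<^sub>R e" unfolding Ee by (rule good_h[OF elim(1) c_nonneg ne])
  then show ?case by (simp add: inner_vec_def sum_3 e_def sg_def)
qed

lemma Lin_ansatz:
  assumes u: "u \<in> H1" "(\<lambda>x. u x / radius x) \<in> L2" "AE x in lebesgue. E x = ansatz u x" and r: "rot_inv u"
    and v: "v \<in> H1" "(\<lambda>x. v x / radius x) \<in> L2"
  shows "Lin E (ansatz v) = (LINT x|lebesgue. weak_grad u x \<bullet> weak_grad v x + (u x / radius x) * (v x / radius x) + (V x * u x) * v x - f x (u x) * v x)"
proof -
  let ?W = "ansatz v"
  have Wv: "AE x in lebesgue. ?W x = ansatz v x" by simp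
  note E = ansatz_H1_vec(1)[OF u] and W = ansatz_H1_vec(1)[OF v Wv]
  have i1: "integrable lebesgue (\<lambda>x. weak_grad u x \<bullet> weak_grad v x + (u x / radius x) * (v x / radius x))"
    unfolding inner_vec_def weak_grad_nth inner_real_def
    by (intro Bochner_Integration.integrable_add Bochner_Integration.integrable_sum L2_mult_integrable H1_weak_partial_L2 u v)
  have i2: "integrable lebesgue (\<lambda>x. (V x * u x) * v x)" by (intro L2_mult_integrable V_mult_L2 H1_L2 u v)
  have i3: "integrable lebesgue (\<lambda>x. f x (u x) * v x)" by (rule f_comp_mult_integrable[OF u(1) v(1)])
  have "(LINT x|lebesgue. wdiv E x * wdiv ?W x) = (LINT x|(lebesgue :: R3 measure). 0)"
    by (rule integral_cong_AE[OF borel_measurable_integrable[OF curl_identity(3)[OF E W]]])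
      (use wdiv_ansatz[OF u r] in auto)
  then have "(LINT x|lebesgue. weak_curl E x \<bullet> weak_curl ?W x) = (LINT x|lebesgue. grad_inner E ?W x)"
    using curl_identity(4)[OF E W] by simp
  also have "\<dots> = (LINT x|lebesgue. weak_grad u x \<bullet> weak_grad v x + (u x / radius x) * (v x / radius x))"
    by (rule integral_cong_AE[OF borel_measurable_integrable[OF curl_identity(2)[OF E W]] borel_measurable_integrable[OF i1]])
      (use grad_inner_ansatz[OF u v Wv] in \<open>simp add: power2_eq_square\<close>)
  finally have 1: "(LINT x|lebesgue. weak_curl E x \<bullet> weak_curl ?W x) = (LINT x|lebesgue. weak_grad u x \<bullet> weak_grad v x + (u x / radius x) * (v x / radius x))" .
  have 2: "(LINT x|lebesgue. V x * (E x \<bullet> ?W x)) = (LINT x|lebesgue. (V x * u x) * v x)"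
  proof (rule integral_cong_AE[OF borel_measurable_integrable[OF V_inner_integrable[OF E W]] borel_measurable_integrable[OF i2]])
    show "AE x in lebesgue. V x * (E x \<bullet> ?W x) = (V x * u x) * v x"
      using u(3) AE_radius_pos by eventually_elim (simp add: ansatz_inner)
  qed
  have 3: "(LINT x|lebesgue. h x (E x) \<bullet> ?W x) = (LINT x|lebesgue. f x (u x) * v x)"
  proof (rule integral_cong_AE[OF borel_measurable_integrable[OF h_inner_integrable[OF E W]] borel_measurable_integrable[OF i3]])
    show "AE x in lebesgue. h x (E x) \<bullet> ?W x = f x (u x) * v x"
      using h_ansatz_AE[OF u(3), of ?W] AE_radius_pos
    proof eventually_elim
      case (elim x)
      have "h x (E x) \<bullet> ?W x = f x (u x) * v x * ((x$1 / radius x) * (x$1 / radius x) + (x$2 / radius x) * (x$2 / radius x))"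
        unfolding elim(1) ansatz_nth by (simp add: sg_def algebra_simps)
      then show ?case using cos_sin_radius[OF elim(2)] by simp
    qed
  qed
  show ?thesis unfolding Lin_def 1 2 3 using i1 i2 i3 by simp
qed

text \<open>Along directions \<open>ansatz v\<close> the two energies agree on the whole line and
  the two norms coincide, so criticality on \<open>X_space\<close> becomes criticality along these
  lines.\<close>

lemma Lin_zero_if_critical:
  assumes cr: "weak_solution_S V f u" and E: "AE x in lebesgue. E x = ansatz u x" and v: "v \<in> X_space"
  shows "Lin E (ansatz v) = 0"
proof -
  have u: "u \<in> X_space" using cr by (simp add: weak_solution_S_def critical_point_def)
  note uX = u[unfolded X_space_iff] and vX = v[unfolded X_space_iff]
  have EH: "E \<in> H1_vec" and WH: "ansatz v \<in> H1_vec"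
    using ansatz_H1_vec(1) uX vX E by auto
  show ?thesis
  proof (rule Lin_zero_if_directional[OF EH WH])
    fix e :: real assume "e > 0"
    then obtain d where d: "d > 0" "\<And>z. z \<in> X_space \<Longrightarrow> X_norm z < d \<Longrightarrow> \<bar>energy_S V f (\<lambda>x. u x + z x) - energy_S V f u\<bar> \<le> e * X_norm z"
      using cr unfolding weak_solution_S_def critical_point_def by blast
    show "\<exists>d>0. \<forall>s. \<bar>s\<bar> * H1_vec_norm (ansatz v) < d \<longrightarrow> \<bar>energy_M V h (\<lambda>x. E x + s *\<^sub>R ansatz v x) - energy_M V h E\<bar> \<le> e * (\<bar>s\<bar> * H1_vec_norm (ansatz v))"
    proof (intro exI[of _ d] conjI allI impI d(1))
      fix s assume s: "\<bar>s\<bar> * H1_vec_norm (ansatz v) < d"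
      have sv: "(\<lambda>x. s * v x) \<in> X_space" by (rule X_space_cmult[OF v])
      note svX = sv[unfolded X_space_iff]
      have usv: "(\<lambda>x. u x + s * v x) \<in> X_space" by (rule X_space_add[OF u sv])
      note usvX = usv[unfolded X_space_iff]
      have N: "X_norm (\<lambda>x. s * v x) = \<bar>s\<bar> * H1_vec_norm (ansatz v)"
        using ansatz_norm[of "\<lambda>x. s * v x" "\<lambda>x. s *\<^sub>R ansatz v x"] svX H1_vec_norm_cmult[OF WH, of s] by (simp add: ansatz_cmult)
      have "energy_M V h (\<lambda>x. E x + s *\<^sub>R ansatz v x) = energy_S V f (\<lambda>x. u x + s * v x)"
      proof (rule energy_ansatz)
        show "AE x in lebesgue. E x + s *\<^sub>R ansatz v x = ansatz (\<lambda>x. u x + s * v x) x"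
          using E by eventually_elim (simp add: ansatz_add ansatz_cmult)
      qed (use usvX cyl_sym_rot_inv in auto)
      moreover have "energy_M V h E = energy_S V f u"
        by (rule energy_ansatz) (use uX E cyl_sym_rot_inv in auto)
      ultimately show "\<bar>energy_M V h (\<lambda>x. E x + s *\<^sub>R ansatz v x) - energy_M V h E\<bar> \<le> e * (\<bar>s\<bar> * H1_vec_norm (ansatz v))"
        using d(2)[OF sv] s N by simp
    qed
  qed
qed

text \<open>The first variation at \<^term>\<open>ansatz u\<close> in a direction \<open>W\<close> is
  \<open>Lam 0 (-1) u W\<^sub>1 + Lam 1 0 u W\<^sub>2\<close>.\<close>

definition Lam :: "real \<Rightarrow> real \<Rightarrow> (R3 \<Rightarrow> real) \<Rightarrow> (R3 \<Rightarrow> real) \<Rightarrow> real" where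
  "Lam a b u w = (LINT x|lebesgue. weak_grad (\<lambda>x. sg a b x / radius x * u x) x \<bullet> weak_grad w x
     + V x * (sg a b x / radius x * u x) * w x - f x (u x) * (sg a b x / radius x) * w x)"

text \<open>The average \<open>beta\<close> of \<open>sg a b * p\<close> over rotations vanishes to second order on the axis, so
  \<open>kap e * beta\<close> lies in \<^const>\<open>X_space\<close> and is an admissible test function. In the limit
  \<open>e \<rightarrow> 0\<close>, the average is undone because its cofactors are invariant under rotations.\<close>

lemma Lam_C1c:
  assumes u: "u \<in> X_space" and L: "\<And>v. v \<in> X_space \<Longrightarrow> Lin (ansatz u) (ansatz v) = 0" and p: "p \<in> C1c"
  shows "Lam a b u p = 0"
proof -
  have uH: "u \<in> H1" and ur: "(\<lambda>x. u x / radius x) \<in> L2" and uc: "rot_inv u"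
    using u cyl_sym_rot_inv by (auto simp: X_space_iff)
  have uL: "u \<in> L2" by (rule H1_L2[OF uH])
  have DL: "weak_partial i u \<in> L2" for i by (rule H1_weak_partial_L2[OF uH])
  obtain B where B: "B > 0" "\<And>x. \<bar>p x\<bar> \<le> B" "\<And>x. norm (grad p x) \<le> B" "\<And>x y. \<bar>p x - p y\<bar> \<le> B * norm (x - y)"
    by (rule C1c_bounds[OF p]) blast
  define cc where "cc = (\<bar>a\<bar> + \<bar>b\<bar>) * B"
  have cc0: "cc \<ge> 0" using B(1) by (simp add: cc_def)
  define beta where "beta = avg (\<lambda>x. sg a b x * p x)"
  \<comment> \<open>The product of \<open>hor x\<close> with the gradient of \<open>beta\<close>
    exceeds \<open>beta\<close> by \<open>A1\<close>, and the vertical derivative of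
    \<open>beta\<close> is \<open>A3\<close>; as averages, both come with explicit bounds in
    \<open>radius\<close>.\<close>
  define A1 where "A1 = avg (\<lambda>x. sg a b x * (hor x \<bullet> grad p x))"
  define A3 where "A3 = avg (\<lambda>x. sg a b x * partial 3 p x)"
  have psiC: "(\<lambda>x. sg a b x * p x) \<in> C1c" by (rule psi_C1c[OF p B])
  have bC: "beta \<in> C1c" unfolding beta_def by (rule avg_C1c[OF psiC])
  have A1e: "A1 x = hor x \<bullet> grad beta x - beta x" for x
    unfolding A1_def beta_def using avg_psi_radial[OF p B] by simp
  have A3e: "A3 x = partial 3 beta x" for x
    unfolding A3_def beta_def using avg_psi_vertical[OF p B] by simp
  have bb: "\<bar>beta x\<bar> \<le> cc * (radius x)\<^sup>2" for x unfolding beta_def cc_def by (rule avg_psi_bound[OF p B])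
  have A1b: "\<bar>A1 x\<bar> \<le> cc * (radius x)\<^sup>2" for x unfolding A1_def cc_def by (rule avg_radial_bound[OF p B])
  have A3b: "\<bar>A3 x\<bar> \<le> cc * radius x" for x unfolding A3_def cc_def by (rule avg_vertical_bound[OF p B])
  obtain R where R: "\<And>x. norm x > R \<Longrightarrow> beta x = 0" "\<And>x. norm x > R \<Longrightarrow> grad beta x = 0" "R > 0"
    using C1cE[OF bC] by metis
  have A1R: "A1 x = 0" if "norm x > R" for x using R(1,2)[OF that] unfolding A1e by simp
  have A3R: "A3 x = 0" if "norm x > R" for x using R(2)[OF that] unfolding A3e by (metis grad_nth zero_index)
  have meas [measurable]: "beta \<in> borel_measurable lebesgue" "A1 \<in> borel_measurable lebesgue" "A3 \<in> borel_measurable lebesgue"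
    "kap (ep n) \<in> borel_measurable lebesgue" "u \<in> borel_measurable lebesgue" "weak_partial i u \<in> borel_measurable lebesgue" for n i
  proof -
    show "beta \<in> borel_measurable lebesgue" by (rule Cc_measurable[OF C1c_Cc[OF bC]])
    show "A1 \<in> borel_measurable lebesgue"
      unfolding A1e[abs_def] by (intro continuous_measurable_lebesgue continuous_intros continuous_hor C1_continuous_grad C1_continuous C1cD bC)
    show "A3 \<in> borel_measurable lebesgue"
      unfolding A3e[abs_def] by (intro continuous_measurable_lebesgue C1_continuous_partial C1cD bC)
    show "kap (ep n) \<in> borel_measurable lebesgue" by (intro continuous_measurable_lebesgue C1_continuous kap_C1(1) ep_nonzero)
  qed (intro L2_measurable uL DL)+
  \<comment> \<open>The radial derivative of \<open>u\<close>. Together with the vertical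
    derivative, \<open>w\<close> and \<open>q\<close> it gives the four rotation invariant factors
    through which \<open>u\<close> enters the first variation.\<close>
  define g1 where "g1 x = (x$1 * weak_partial 1 u x + x$2 * weak_partial 2 u x) / radius x" for x
  define w where "w x = u x / radius x" for x
  define q where "q x = V x * u x - f x (u x)" for x
  have g1l: "locally_integrable g1"
  proof (rule L2_locally_integrable, rule L2_mono[OF L2_add[OF L2_abs[OF DL[of 1]] L2_abs[OF DL[of 2]]]])
    show "g1 \<in> borel_measurable lebesgue" unfolding g1_def by measurable
    show "AE x in lebesgue. \<bar>g1 x\<bar> \<le> \<bar>\<bar>weak_partial 1 u x\<bar> + \<bar>weak_partial 2 u x\<bar>\<bar>"
      using AE_radius_pos
    proof eventually_elim
      case (elim x)
      have "\<bar>x$1 * weak_partial 1 u x + x$2 * weak_partial 2 u x\<bar> \<le> radius x * \<bar>weak_partial 1 u x\<bar> + radius x * \<bar>weak_partial 2 u x\<bar>"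
        using abs_coord_le_radius[of x] by (intro order_trans[OF abs_triangle_ineq] add_mono) (auto simp: abs_mult intro: mult_right_mono)
      then show ?case using elim by (simp add: g1_def abs_div divide_le_eq algebra_simps)
    qed
  qed
  have g3l: "locally_integrable (weak_partial 3 u)" by (rule L2_locally_integrable[OF DL])
  have wl: "locally_integrable w" unfolding w_def by (rule L2_locally_integrable[OF ur])
  have fl: "locally_integrable (\<lambda>x. f x (u x))" by (rule f_comp_locally_integrable[OF uH])
  have ql: "locally_integrable q"
    using locally_integrable_add[OF L2_locally_integrable[OF V_mult_L2[OF uL]] locally_integrable_cmult[OF fl, of "-1"]]
    by (simp add: q_def[abs_def])
  note [measurable] = locally_integrable_measurable[OF g1l] locally_integrable_measurable[OF wl] locally_integrable_measurable[OF ql]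
  have g1r: "rot_inv g1"
    unfolding rot_inv_def
  proof
    fix t
    have "AE x in lebesgue. rot t x$1 * weak_partial 1 u (rot t x) + rot t x$2 * weak_partial 2 u (rot t x) = x$1 * weak_partial 1 u x + x$2 * weak_partial 2 u x"
      using rot_inv_radial_partial(1)[OF H1_is_weak_partial[OF uH] uc] unfolding rot_inv_def by blast
    then show "AE x in lebesgue. g1 (rot t x) = g1 x" by eventually_elim (simp add: g1_def del: rot_nth)
  qed
  have g3r: "rot_inv (weak_partial 3 u)" by (rule rot_inv_radial_partial(2)[OF H1_is_weak_partial[OF uH] uc])
  have wr: "rot_inv w" unfolding rot_inv_def
  proof
    fix t have "AE x in lebesgue. u (rot t x) = u x" using uc by (simp add: rot_inv_def)
    then show "AE x in lebesgue. w (rot t x) = w x" by eventually_elim (simp add: w_def)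
  qed
  have qr: "rot_inv q" unfolding rot_inv_def
  proof
    fix t
    have "AE x in lebesgue. u (rot t x) = u x" "AE x in lebesgue. V (rot t x) = V x"
      using uc V_rot by (simp_all add: rot_inv_def)
    then show "AE x in lebesgue. q (rot t x) = q x" by eventually_elim (simp add: q_def f_rot)
  qed
  have ang: "AE x in lebesgue. x$1 * weak_partial 2 u x - x$2 * weak_partial 1 u x = 0"
    by (rule rot_inv_angular_partial[OF H1_is_weak_partial[OF uH] H1_is_weak_partial[OF uH] uc])
  \<comment> \<open>The angular derivative of \<open>u\<close> vanishes, so its gradient is
    determined by the radial and the vertical derivative.\<close>
  have split: "AE x in lebesgue. \<forall>z. weak_grad u x \<bullet> z = g1 x * ((hor x \<bullet> z) / radius x) + weak_partial 3 u x * z$3"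
    using ang AE_radius_pos
  proof eventually_elim
    case (elim x)
    let ?c = "x$1 / radius x" and ?s = "x$2 / radius x" and ?p = "weak_partial 1 u x" and ?q = "weak_partial 2 u x"
    have cs: "?c * ?c + ?s * ?s = 1" by (rule cos_sin_radius[OF elim(2)])
    have a0: "?c * ?q - ?s * ?p = 0" using elim(1) elim(2) by (simp add: field_simps)
    show ?case
    proof
      fix z :: R3
      have "weak_grad u x \<bullet> z = ?p * z$1 + ?q * z$2 + weak_partial 3 u x * z$3" by (simp add: inner_vec_def sum_3)
      also have "?p * z$1 + ?q * z$2 = (?c * ?p + ?s * ?q) * (?c * z$1 + ?s * z$2)" using cs a0 by algebra
      also have "\<dots> = g1 x * ((hor x \<bullet> z) / radius x)" by (simp add: g1_def inner_vec_def sum_3 add_divide_distrib)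
      finally show "weak_grad u x \<bullet> z = g1 x * ((hor x \<bullet> z) / radius x) + weak_partial 3 u x * z$3" .
    qed
  qed
  define bn where "bn n x = kap (ep n) x * beta x" for n x
  have bnC: "bn n \<in> C1c" for n unfolding bn_def by (rule C1c_mult[OF kap_C1(1)[OF ep_nonzero] bC])
  have bng: "grad (bn n) x = kap (ep n) x *\<^sub>R grad beta x - (beta x * kap (ep n) x ^ 3) *\<^sub>R hor x" for n x
    unfolding bn_def[abs_def] C1_mult(2)[OF kap_C1(1)[OF ep_nonzero] C1cD[OF bC]] kap_C1(2)[OF ep_nonzero] by simp
  have rk: "radius x * kap (ep n) x \<le> 1" "kap (ep n) x > 0" for n x using radius_kap(1) kap_pos ep_nonzero by auto
  have bnr: "\<bar>bn n x / radius x\<bar> \<le> cc" for n x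
  proof (cases "radius x = 0")
    case False
    then have r: "radius x > 0" using radius_nonneg[of x] by simp
    have "\<bar>bn n x\<bar> \<le> kap (ep n) x * (cc * (radius x)\<^sup>2)" using bb[of x] rk(2)[of n x] by (simp add: bn_def abs_mult)
    also have "\<dots> = cc * (radius x * kap (ep n) x) * radius x" by (simp add: power2_eq_square)
    also have "\<dots> \<le> cc * 1 * radius x" using rk(1)[of x n] cc0 r by (intro mult_right_mono mult_left_mono) auto
    finally show ?thesis using r by (simp add: abs_div divide_le_eq)
  qed (simp add: cc0)
  have bnX: "bn n \<in> X_space" for n
    unfolding X_space_iff
  proof (intro conjI)
    show "bn n \<in> H1" by (rule C1c_H1(1)[OF bnC])
    show "cyl_sym (bn n)"
      by (rule rot_invariant_cyl_sym) (simp add: bn_def kap_rot beta_def avg_rot[OF psiC])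
    show "(\<lambda>x. bn n x / radius x) \<in> L2"
    proof (rule L2_bound)
      show "(\<lambda>x. bn n x / radius x) \<in> borel_measurable lebesgue" unfolding bn_def by measurable
      show "integrable lebesgue (\<lambda>x::R3. cc\<^sup>2 * indicat_real (cball 0 R) x)" using integrable_cball_lebesgue[of 0 R] by simp
      show "AE x in lebesgue. (bn n x / radius x)\<^sup>2 \<le> cc\<^sup>2 * indicat_real (cball 0 R) x"
      proof (rule AE_I2)
        fix x show "(bn n x / radius x)\<^sup>2 \<le> cc\<^sup>2 * indicat_real (cball 0 R) x"
        proof (cases "norm x > R")
          case True then show ?thesis using R(1) by (simp add: bn_def)
        next
          case False then show ?thesis using power_mono[OF bnr[of n x], of 2] by (simp add: power_divide)
        qed
      qed
    qed
  qed
  \<comment> \<open>\<open>c1\<close>, \<open>c3\<close>, \<open>c4\<close> and \<open>c5\<close>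
    are the cofactors of \<open>g1\<close>, the vertical derivative, \<open>w\<close> and
    \<open>q\<close> when the direction is \<open>bn n\<close>. No angular cofactor occurs, by
    \<open>split\<close>.\<close>
  define c1 where "c1 n x = (kap (ep n) x * (beta x + A1 x) - beta x * kap (ep n) x ^ 3 * (radius x)\<^sup>2) / radius x" for n x
  define c3 where "c3 n x = kap (ep n) x * A3 x" for n x
  define c4 where "c4 n x = kap (ep n) x * beta x / radius x" for n x
  define c5 where "c5 n x = kap (ep n) x * beta x" for n x
  define Phi where "Phi n x = g1 x * c1 n x + weak_partial 3 u x * c3 n x + w x * c4 n x + q x * c5 n x" for n x
  \<comment> \<open>In the limit the two occurrences of \<open>beta\<close> in \<open>c1\<close>
    cancel, because \<open>beta * kap^3 * r^2\<close> and \<open>kap * beta\<close> both tend to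
    \<open>beta / r\<close>; this leaves \<open>A1 / r^2\<close>.\<close>
  define Psi where "Psi x = g1 x * (A1 x / (radius x)\<^sup>2) + weak_partial 3 u x * (A3 x / radius x) + w x * (beta x / (radius x)\<^sup>2) + q x * (beta x / radius x)" for x
  have Phim: "Phi n \<in> borel_measurable lebesgue" for n
    unfolding Phi_def c1_def c3_def c4_def c5_def by measurable
  have Psim: "Psi \<in> borel_measurable lebesgue"
    unfolding Psi_def by measurable
  have Phi0: "(LINT x|lebesgue. Phi n x) = 0" for n
  proof -
    have bX: "bn n \<in> H1" "(\<lambda>x. bn n x / radius x) \<in> L2" using bnX[of n] by (auto simp: X_space_iff)
    have "0 = (LINT x|lebesgue. weak_grad u x \<bullet> weak_grad (bn n) x + (u x / radius x) * (bn n x / radius x) + (V x * u x) * bn n x - f x (u x) * bn n x)"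
      using L[OF bnX[of n]] Lin_ansatz[OF uH ur _ uc bX, of "ansatz u"] by simp
    also have "\<dots> = (LINT x|lebesgue. Phi n x)"
    proof (rule integral_cong_AE[OF _ Phim])
      have [measurable]: "V \<in> borel_measurable lebesgue" "(\<lambda>x. f x (u x)) \<in> borel_measurable lebesgue" "bn n \<in> borel_measurable lebesgue"
         "weak_partial i (bn n) \<in> borel_measurable lebesgue" for i
        using V_meas f_comp_measurable[OF meas(5)] L2_measurable[OF H1_L2[OF bX(1)]] L2_measurable[OF H1_weak_partial_L2[OF bX(1)]] by auto
      show "(\<lambda>x. weak_grad u x \<bullet> weak_grad (bn n) x + (u x / radius x) * (bn n x / radius x) + (V x * u x) * bn n x - f x (u x) * bn n x) \<in> borel_measurable lebesgue"
        unfolding inner_vec_def weak_grad_nth sum_3 by measurable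
      have "AE x in lebesgue. \<forall>i. weak_partial i (bn n) x = partial i (bn n) x"
        by (subst AE_all_countable) (rule allI, rule C1c_H1(2)[OF bnC])
      then show "AE x in lebesgue. weak_grad u x \<bullet> weak_grad (bn n) x + (u x / radius x) * (bn n x / radius x) + (V x * u x) * bn n x - f x (u x) * bn n x = Phi n x"
        using split
      proof eventually_elim
        case (elim x)
        have wg: "weak_grad (bn n) x = grad (bn n) x" using elim(1) by (simp add: vec_eq_iff)
        have h1: "hor x \<bullet> grad (bn n) x = kap (ep n) x * (beta x + A1 x) - beta x * kap (ep n) x ^ 3 * (radius x)\<^sup>2"
          unfolding bng inner_diff_right A1e by (simp add: norm_hor[symmetric] power2_norm_eq_inner)
        have h3: "grad (bn n) x $ 3 = kap (ep n) x * A3 x" unfolding bng A3e by simp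
        have "weak_grad u x \<bullet> weak_grad (bn n) x = g1 x * c1 n x + weak_partial 3 u x * c3 n x"
          unfolding wg elim(2)[rule_format] h1 h3 by (simp add: c1_def c3_def)
        then show ?case by (simp add: Phi_def w_def q_def c4_def c5_def bn_def algebra_simps)
      qed
    qed
    finally show ?thesis by simp
  qed
  \<comment> \<open>\<open>3 * cc\<close> covers \<open>c1\<close>: two parts from
    \<open>beta + A1\<close> and one from the derivative of \<open>kap\<close>. In \<open>c5\<close>
    a power of \<open>radius\<close> is left over, bounded by \<open>R\<close> on the
    support.\<close>
  define M where "M = 3 * cc + cc * R"
  have M: "3 * cc \<le> M" "cc \<le> M" "cc * R \<le> M" using cc0 R(3) by (auto simp: M_def)
  have cb: "\<bar>c1 n x\<bar> \<le> M" "\<bar>c3 n x\<bar> \<le> M" "\<bar>c4 n x\<bar> \<le> M" "\<bar>c5 n x\<bar> \<le> M" if r: "radius x > 0" for n x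
  proof -
    let ?k = "kap (ep n) x" and ?r = "radius x"
    have k: "?k > 0" "?r * ?k \<le> 1" using rk by auto
    have "\<bar>?k * (beta x + A1 x)\<bar> \<le> ?k * (cc * ?r\<^sup>2 + cc * ?r\<^sup>2)"
      using k(1) bb[of x] A1b[of x] by (simp add: abs_mult)
    also have "\<dots> = 2 * cc * (?r * ?k) * ?r" by (simp add: power2_eq_square)
    also have "\<dots> \<le> 2 * cc * 1 * ?r" using k cc0 r by (intro mult_right_mono mult_left_mono) auto
    finally have 1: "\<bar>?k * (beta x + A1 x)\<bar> \<le> 2 * cc * ?r" by simp
    have "\<bar>beta x * ?k ^ 3 * ?r\<^sup>2\<bar> = \<bar>beta x\<bar> * ?k ^ 3 * ?r\<^sup>2" using k(1) by (simp add: abs_mult)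
    also have "\<dots> \<le> (cc * ?r\<^sup>2) * ?k ^ 3 * ?r\<^sup>2"
      using k(1) by (intro mult_right_mono bb) auto
    also have "\<dots> = cc * (?r * ?k) ^ 3 * ?r" by (simp add: power2_eq_square power3_eq_cube)
    also have "\<dots> \<le> cc * 1 * ?r" using k cc0 r by (intro mult_right_mono mult_left_mono power_le_one) auto
    finally have 2: "\<bar>beta x * ?k ^ 3 * ?r\<^sup>2\<bar> \<le> cc * ?r" by simp
    have "\<bar>?k * (beta x + A1 x) - beta x * ?k ^ 3 * ?r\<^sup>2\<bar> \<le> 3 * cc * ?r" using 1 2 by linarith
    then have "\<bar>c1 n x\<bar> \<le> 3 * cc" using r by (simp add: c1_def abs_div divide_le_eq)
    then show "\<bar>c1 n x\<bar> \<le> M" using M by linarith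
    have "\<bar>c3 n x\<bar> \<le> ?k * (cc * ?r)" using k(1) A3b[of x] by (simp add: c3_def abs_mult)
    also have "\<dots> = cc * (?r * ?k)" by simp
    also have "\<dots> \<le> cc * 1" using k cc0 by (intro mult_left_mono) auto
    finally show "\<bar>c3 n x\<bar> \<le> M" using M by simp
    show "\<bar>c4 n x\<bar> \<le> M" using bnr[of n x] M by (simp add: c4_def bn_def)
    show "\<bar>c5 n x\<bar> \<le> M"
    proof (cases "norm x > R")
      case True then show ?thesis using R(1) M cc0 by (simp add: c5_def)
    next
      case False
      have "\<bar>c5 n x\<bar> \<le> cc * ?r" using bnr[of n x] r by (simp add: c5_def bn_def abs_div divide_le_eq)
      also have "\<dots> \<le> cc * R" using radius_le_norm[of x] False cc0 by (intro mult_left_mono) auto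
      finally show ?thesis using M by simp
    qed
  qed
  have cz: "c1 n x = 0" "c3 n x = 0" "c4 n x = 0" "c5 n x = 0" if "norm x > R" for n x
    using that R(1) A1R A3R by (simp_all add: c1_def c3_def c4_def c5_def)
  have Dint: "integrable lebesgue (\<lambda>x. M * (indicat_real (cball 0 R) x * (\<bar>g1 x\<bar> + \<bar>weak_partial 3 u x\<bar> + \<bar>w x\<bar> + \<bar>q x\<bar>)))"
    by (intro integrable_mult_right locally_integrable_cball locally_integrable_add locally_integrable_abs g1l g3l wl ql)
  have "(\<lambda>n. LINT x|lebesgue. Phi n x) \<longlonglongrightarrow> (LINT x|lebesgue. Psi x)"
  proof (rule integral_dominated_convergence[OF Psim Phim Dint])
    show "AE x in lebesgue. (\<lambda>n. Phi n x) \<longlonglongrightarrow> Psi x"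
      using AE_radius_pos
    proof eventually_elim
      case (elim x)
      have r: "radius x \<noteq> 0" using elim by simp
      have "(\<lambda>n. Phi n x) \<longlonglongrightarrow> g1 x * ((1 / radius x * (beta x + A1 x) - beta x * (1 / radius x) ^ 3 * (radius x)\<^sup>2) / radius x)
        + weak_partial 3 u x * (1 / radius x * A3 x) + w x * (1 / radius x * beta x / radius x) + q x * (1 / radius x * beta x)"
        unfolding Phi_def c1_def c3_def c4_def c5_def by (intro tendsto_intros kap_tendsto elim r)
      also have "(1 / radius x * (beta x + A1 x) - beta x * (1 / radius x) ^ 3 * (radius x)\<^sup>2) / radius x = A1 x / (radius x)\<^sup>2"
        using r by (simp add: field_simps power2_eq_square power3_eq_cube)
      finally show ?case by (simp add: Psi_def power2_eq_square)
    qed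
    show "AE x in lebesgue. norm (Phi n x) \<le> M * (indicat_real (cball 0 R) x * (\<bar>g1 x\<bar> + \<bar>weak_partial 3 u x\<bar> + \<bar>w x\<bar> + \<bar>q x\<bar>))" for n
      using AE_radius_pos
    proof eventually_elim
      case (elim x)
      show ?case
      proof (cases "norm x > R")
        case True then show ?thesis by (simp add: Phi_def cz)
      next
        case False
        have t: "\<bar>y * z\<bar> \<le> M * \<bar>y\<bar>" if "\<bar>z\<bar> \<le> M" for y z using mult_right_mono[OF that, of "\<bar>y\<bar>"] by (simp add: abs_mult mult.commute)
        have "\<bar>Phi n x\<bar> \<le> M * \<bar>g1 x\<bar> + M * \<bar>weak_partial 3 u x\<bar> + M * \<bar>w x\<bar> + M * \<bar>q x\<bar>"
          unfolding Phi_def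
          by (intro order_trans[OF abs_triangle_ineq] add_mono t cb[OF elim])
        then show ?thesis using False by (simp add: algebra_simps)
      qed
    qed
  qed
  then have Psi0: "(LINT x|lebesgue. Psi x) = 0"
    using LIMSEQ_unique[OF _ tendsto_const] by (simp add: Phi0)
  \<comment> \<open>Counterparts of the cofactors in \<open>Psi\<close> before averaging. For
    \<open>p4\<close> the representation \<open>avg_angular\<close> is taken, so that the sum of the
    four products is almost everywhere the integrand of \<open>Lam a b u p\<close>.\<close>
  define p1 where "p1 x = sg a b x * (hor x \<bullet> grad p x) / (radius x)\<^sup>2" for x
  define p3 where "p3 x = sg a b x * partial 3 p x / radius x" for x
  define p4 where "p4 x = - (sg (-b) a x * dth p x / (radius x)\<^sup>2)" for x
  define p5 where "p5 x = sg a b x * p x / radius x" for x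
  note cp = continuous_pieces[OF p B]
  have cm: "sg a' b' \<in> borel_measurable borel" "(\<lambda>x. hor x \<bullet> grad p x) \<in> borel_measurable borel" "partial 3 p \<in> borel_measurable borel"
    "dth p \<in> borel_measurable borel" "p \<in> borel_measurable borel" for a' b'
    by (intro borel_measurable_continuous_onI cp C1_continuous sg_C1(1))+
  note [measurable] = cm
  have pm: "p1 \<in> borel_measurable borel" "p3 \<in> borel_measurable borel" "p4 \<in> borel_measurable borel" "p5 \<in> borel_measurable borel"
    unfolding p1_def p3_def p4_def p5_def by measurable
  obtain S where S: "\<And>x. norm x > S \<Longrightarrow> p x = 0" "\<And>x. norm x > S \<Longrightarrow> grad p x = 0" using C1cE[OF p] by metis
  have pz: "p1 x = 0" "p3 x = 0" "p4 x = 0" "p5 x = 0" if "norm x > S" for x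
  proof -
    have "partial i p x = 0" for i using S(2)[OF that] by (metis grad_nth zero_index)
    then show "p1 x = 0" "p3 x = 0" "p4 x = 0" "p5 x = 0"
      by (simp_all add: p1_def p3_def p4_def p5_def dth_def S[OF that])
  qed
  have pb: "\<bar>p1 x\<bar> \<le> cc" "\<bar>p3 x\<bar> \<le> cc" "\<bar>p4 x\<bar> \<le> cc" "\<bar>p5 x\<bar> \<le> cc" for x
  proof -
    have "\<bar>p1 x\<bar> \<le> cc \<and> \<bar>p3 x\<bar> \<le> cc \<and> \<bar>p4 x\<bar> \<le> cc \<and> \<bar>p5 x\<bar> \<le> cc"
    proof (cases "radius x = 0")
      case True then show ?thesis using cc0 by (simp add: p1_def p3_def p4_def p5_def)
    next
      case False
      then have r: "radius x > 0" using radius_nonneg[of x] by simp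
      have d: "\<bar>sg (-b) a x\<bar> * \<bar>dth p x\<bar> \<le> ((\<bar>-b\<bar> + \<bar>a\<bar>) * radius x) * (radius x * B)"
        using r B(1) dth_bound[of p x] mult_left_mono[OF B(3)[of x], of "radius x"]
        by (intro mult_mono sg_le_radius) (auto intro: order_trans)
      have e: "\<bar>sg a b x\<bar> * \<bar>p x\<bar> \<le> ((\<bar>a\<bar> + \<bar>b\<bar>) * radius x) * B"
        using r by (intro mult_mono sg_le_radius B(2)) (auto intro: mult_nonneg_nonneg)
      show ?thesis
        using radial_bound[OF p B, of a b x] vertical_bound[OF p B, of a b x] d e r
        by (simp add: p1_def p3_def p4_def p5_def cc_def abs_div divide_le_eq abs_mult power2_eq_square algebra_simps)
    qed
    then show "\<bar>p1 x\<bar> \<le> cc" "\<bar>p3 x\<bar> \<le> cc" "\<bar>p4 x\<bar> \<le> cc" "\<bar>p5 x\<bar> \<le> cc" by auto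
  qed
  have hi: "((\<lambda>t. F (rot t x) * k) has_integral 2 * pi * (avg F x * k)) {0..2*pi}" if "continuous_on UNIV F" for F x k
    using has_integral_mult_left[OF avg_has_integral[OF that], of x k] by (simp add: mult.assoc)
  have h1: "((\<lambda>t. p1 (rot t x)) has_integral 2 * pi * (A1 x / (radius x)\<^sup>2)) {0..2*pi}" for x
    using hi[of "\<lambda>x. sg a b x * (hor x \<bullet> grad p x)" x "inverse ((radius x)\<^sup>2)"] cp(2,3)
    by (simp add: p1_def A1_def divide_inverse continuous_on_mult del: rot_nth)
  have h3: "((\<lambda>t. p3 (rot t x)) has_integral 2 * pi * (A3 x / radius x)) {0..2*pi}" for x
    using hi[of "\<lambda>x. sg a b x * partial 3 p x" x "inverse (radius x)"] cp(2,4)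
    by (simp add: p3_def A3_def divide_inverse continuous_on_mult del: rot_nth)
  have h4: "((\<lambda>t. p4 (rot t x)) has_integral 2 * pi * (beta x / (radius x)\<^sup>2)) {0..2*pi}" for x
    using hi[of "\<lambda>x. sg (-b) a x * dth p x" x "- inverse ((radius x)\<^sup>2)"] cp(5) C1_continuous[OF sg_C1(1)] avg_angular[OF p B, of a b x]
    by (simp add: p4_def beta_def divide_inverse continuous_on_mult del: rot_nth)
  have h5: "((\<lambda>t. p5 (rot t x)) has_integral 2 * pi * (beta x / radius x)) {0..2*pi}" for x
    using hi[of "\<lambda>x. sg a b x * p x" x "inverse (radius x)"] cp(1,2)
    by (simp add: p5_def beta_def divide_inverse continuous_on_mult del: rot_nth)
  note a1 = rot_average[where R = S, OF g1l g1r pm(1) pb(1) pz(1) h1]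
  note a3 = rot_average[where R = S, OF g3l g3r pm(2) pb(2) pz(2) h3]
  note a4 = rot_average[where R = S, OF wl wr pm(3) pb(3) pz(3) h4]
  note a5 = rot_average[where R = S, OF ql qr pm(4) pb(4) pz(4) h5]
  have "0 = (LINT x|lebesgue. g1 x * (A1 x / (radius x)\<^sup>2)) + (LINT x|lebesgue. weak_partial 3 u x * (A3 x / radius x))
      + (LINT x|lebesgue. w x * (beta x / (radius x)\<^sup>2)) + (LINT x|lebesgue. q x * (beta x / radius x))"
    using Psi0 a1(2) a3(2) a4(2) a5(2) unfolding Psi_def by simp
  also have "\<dots> = (LINT x|lebesgue. g1 x * p1 x + weak_partial 3 u x * p3 x + w x * p4 x + q x * p5 x)"
    using a1(1,3) a3(1,3) a4(1,3) a5(1,3) by simp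
  also have "\<dots> = Lam a b u p"
    unfolding Lam_def
  proof (rule integral_cong_AE)
    let ?F = "\<lambda>x. sg a b x / radius x * u x"
    have FH: "?F \<in> H1" by (rule H1_sg_over_radius(1)[OF uH ur])
    have [measurable]: "V \<in> borel_measurable lebesgue" "(\<lambda>x. f x (u x)) \<in> borel_measurable lebesgue" "p \<in> borel_measurable lebesgue"
       "weak_partial i p \<in> borel_measurable lebesgue" "weak_partial i ?F \<in> borel_measurable lebesgue" for i
      using V_meas f_comp_measurable[OF meas(5)] L2_measurable[OF H1_L2] L2_measurable[OF H1_weak_partial_L2] C1c_H1(1)[OF p] FH by auto
    show "(\<lambda>x. g1 x * p1 x + weak_partial 3 u x * p3 x + w x * p4 x + q x * p5 x) \<in> borel_measurable lebesgue"
      using a1(1) a3(1) a4(1) a5(1) by (intro borel_measurable_add borel_measurable_integrable)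
    show "(\<lambda>x. weak_grad ?F x \<bullet> weak_grad p x + V x * (sg a b x / radius x * u x) * p x - f x (u x) * (sg a b x / radius x) * p x) \<in> borel_measurable lebesgue"
      unfolding inner_vec_def weak_grad_nth sum_3 by measurable
    have "AE x in lebesgue. \<forall>i. weak_partial i p x = partial i p x"
      by (subst AE_all_countable) (rule allI, rule C1c_H1(2)[OF p])
    moreover have "AE x in lebesgue. \<forall>i. weak_partial i ?F x = sg a b x / radius x * weak_partial i u x + dsr a b i x * u x"
      by (subst AE_all_countable) (rule allI, rule H1_sg_over_radius(2)[OF uH ur])
    ultimately show "AE x in lebesgue. g1 x * p1 x + weak_partial 3 u x * p3 x + w x * p4 x + q x * p5 x =
       weak_grad ?F x \<bullet> weak_grad p x + V x * (sg a b x / radius x * u x) * p x - f x (u x) * (sg a b x / radius x) * p x"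
      using split AE_radius_pos
    proof eventually_elim
      case (elim x)
      let ?r = "radius x"
      have r: "?r \<noteq> 0" using elim by simp
      have wg: "weak_grad p x = grad p x" using elim(1) by (simp add: vec_eq_iff)
      have wF: "weak_grad ?F x = (sg a b x / ?r) *\<^sub>R weak_grad u x + u x *\<^sub>R (\<chi> i. dsr a b i x)"
        using elim(2) by (simp add: vec_eq_iff mult.commute)
      \<comment> \<open>The quotient \<open>sg a b / radius\<close> depends on the angle only, so
        its gradient is tangential to the orbits and pairs with \<open>dth p\<close> alone.\<close>
      have ds: "(\<chi> i. dsr a b i x) \<bullet> grad p x = - (sg (-b) a x * dth p x) / ?r ^ 3"
      proof -
        have "(\<chi> i. dsr a b i x) \<bullet> grad p x = ((a * partial 1 p x + b * partial 2 p x) * ?r\<^sup>2 - sg a b x * (x$1 * partial 1 p x + x$2 * partial 2 p x)) / ?r ^ 3"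
          using r by (simp add: inner_vec_def sum_3 dsr_def field_simps power2_eq_square power3_eq_cube)
        also have "(a * partial 1 p x + b * partial 2 p x) * ?r\<^sup>2 - sg a b x * (x$1 * partial 1 p x + x$2 * partial 2 p x) = - (sg (-b) a x * dth p x)"
          unfolding radius_square by (simp add: sg_def dth_def power2_eq_square algebra_simps)
        finally show ?thesis .
      qed
      have "weak_grad ?F x \<bullet> weak_grad p x = (sg a b x / ?r) * (weak_grad u x \<bullet> grad p x) + u x * ((\<chi> i. dsr a b i x) \<bullet> grad p x)"
        unfolding wg wF by (simp only: inner_add_left inner_scaleR_left)
      also have "\<dots> = g1 x * p1 x + weak_partial 3 u x * p3 x + w x * p4 x"
        unfolding elim(3)[rule_format] ds by (simp add: p1_def p3_def p4_def w_def power2_eq_square power3_eq_cube algebra_simps)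
      finally have "weak_grad ?F x \<bullet> weak_grad p x = g1 x * p1 x + weak_partial 3 u x * p3 x + w x * p4 x" .
      moreover have "q x * p5 x = V x * (sg a b x / ?r * u x) * p x - f x (u x) * (sg a b x / ?r) * p x"
        using r by (simp add: q_def p5_def field_simps)
      ultimately show ?case by linarith
    qed
  qed
  finally show ?thesis by simp
qed

section \<open>Extension of the first variation to all directions in H^1\<close>

lemma Lam_integrable:
  assumes u: "u \<in> X_space" and w: "w \<in> H1"
  shows "integrable lebesgue (\<lambda>x. weak_grad (\<lambda>x. sg a b x / radius x * u x) x \<bullet> weak_grad w x)"
    "integrable lebesgue (\<lambda>x. V x * (sg a b x / radius x * u x) * w x)"
    "integrable lebesgue (\<lambda>x. f x (u x) * (sg a b x / radius x) * w x)"
proof -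
  have uH: "u \<in> H1" and ur: "(\<lambda>x. u x / radius x) \<in> L2" using u by (auto simp: X_space_iff)
  note F = H1_sg_over_radius(1)[OF uH ur, of a b]
  show "integrable lebesgue (\<lambda>x. weak_grad (\<lambda>x. sg a b x / radius x * u x) x \<bullet> weak_grad w x)"
    unfolding inner_vec_def weak_grad_nth inner_real_def
    by (intro Bochner_Integration.integrable_sum L2_mult_integrable H1_weak_partial_L2 F w)
  show "integrable lebesgue (\<lambda>x. V x * (sg a b x / radius x * u x) * w x)"
    by (intro L2_mult_integrable V_mult_L2 H1_L2 F w)
  show "integrable lebesgue (\<lambda>x. f x (u x) * (sg a b x / radius x) * w x)"
  proof (rule Bochner_Integration.integrable_bound)
    show "integrable lebesgue (\<lambda>x. (\<bar>a\<bar> + \<bar>b\<bar>) * (f x (u x) * w x))"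
      by (rule integrable_mult_right[OF f_comp_mult_integrable[OF uH w]])
    have [measurable]: "(\<lambda>x. f x (u x)) \<in> borel_measurable lebesgue" "w \<in> borel_measurable lebesgue"
        "(\<lambda>x. sg a b x / radius x) \<in> borel_measurable lebesgue"
      using f_comp_measurable[OF L2_measurable[OF H1_L2[OF uH]]] L2_measurable[OF H1_L2[OF w]] by auto
    show "(\<lambda>x. f x (u x) * (sg a b x / radius x) * w x) \<in> borel_measurable lebesgue" by measurable
    have "norm (f x (u x) * (sg a b x / radius x) * w x) \<le> norm ((\<bar>a\<bar> + \<bar>b\<bar>) * (f x (u x) * w x))" for x
      using mult_right_mono[OF sg_over_radius_bound[of a b x], of "\<bar>f x (u x) * w x\<bar>"]
      by (simp add: abs_mult mult_ac)
    then show "AE x in lebesgue. norm (f x (u x) * (sg a b x / radius x) * w x) \<le> norm ((\<bar>a\<bar> + \<bar>b\<bar>) * (f x (u x) * w x))"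
      by simp
  qed
qed

lemma Lam_split:
  assumes u: "u \<in> X_space" and w: "w \<in> H1"
  shows "Lam a b u w = (LINT x|lebesgue. weak_grad (\<lambda>x. sg a b x / radius x * u x) x \<bullet> weak_grad w x)
    + (LINT x|lebesgue. V x * (sg a b x / radius x * u x) * w x) - (LINT x|lebesgue. f x (u x) * (sg a b x / radius x) * w x)"
  unfolding Lam_def using Lam_integrable[OF u w, of a b] by simp

lemma Lam_add:
  assumes u: "u \<in> X_space" and w: "w \<in> H1" and v: "v \<in> H1"
  shows "Lam a b u (\<lambda>x. w x + v x) = Lam a b u w + Lam a b u v"
proof -
  note wv = H1_add(1)[OF w v]
  let ?g = "\<lambda>w x. weak_grad (\<lambda>x. sg a b x / radius x * u x) x \<bullet> weak_grad w x"
  have "AE x in lebesgue. \<forall>i. weak_partial i (\<lambda>x. w x + v x) x = weak_partial i w x + weak_partial i v x"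
    by (subst AE_all_countable) (rule allI, rule H1_add(2)[OF w v])
  then have ae: "AE x in lebesgue. ?g (\<lambda>x. w x + v x) x = ?g w x + ?g v x"
    by eventually_elim (simp add: inner_vec_def sum.distrib algebra_simps)
  have "(LINT x|lebesgue. ?g (\<lambda>x. w x + v x) x) = (LINT x|lebesgue. ?g w x + ?g v x)"
    by (rule integral_cong_AE[OF _ _ ae]; intro borel_measurable_integrable Bochner_Integration.integrable_add Lam_integrable u w v wv)
  then show ?thesis
    unfolding Lam_split[OF u w] Lam_split[OF u v] Lam_split[OF u wv]
    using Lam_integrable[OF u w, of a b] Lam_integrable[OF u v, of a b] by (simp add: distrib_left)
qed

text \<open>The nonlinear term has critical growth, so closeness in L^2 is not enough and the
  Sobolev inequality has to bound the sixth power of \<open>v\<close>. The number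
  \<open>16777216 = 262144 * 4 ^ 3\<close> comes from the bound on \<open>H1_sq v\<close>, and the
  additional 1 from the square of \<open>v\<close>.\<close>

lemma f_comp_small:
  assumes u: "u \<in> H1" and v: "v \<in> H1" and t: "t > 0" "(LINT x|lebesgue. (v x)\<^sup>2) \<le> t\<^sup>2" "H1_sq v \<le> 4 * t\<^sup>2"
  shows "(LINT x|lebesgue. \<bar>f x (u x) * v x\<bar>) \<le> t * (c * ((LINT x|lebesgue. (u x)\<^sup>2 + u x ^ 6) + 16777217))"
proof -
  note iu = f_comp_integrable_power[OF u] and v2 = L2_square[OF H1_L2[OF v]] and v6 = Sobolev_H1(1)[OF v]
  have "(LINT x|lebesgue. v x ^ 6) \<le> 262144 * (4 * t\<^sup>2) ^ 3"
    using Sobolev_H1(2)[OF v] power_mono[OF t(3) H1_sq_nonneg, of 3] by linarith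
  then have "(LINT x|lebesgue. v x ^ 6) / t ^ 5 \<le> 16777216 * t ^ 6 / t ^ 5"
    using t(1) by (intro divide_right_mono) (simp_all add: power_mult_distrib flip: power_mult)
  also have "\<dots> = 16777216 * t" using t(1) by (simp add: numeral_eq_Suc)
  finally have s6: "(LINT x|lebesgue. v x ^ 6) / t ^ 5 \<le> 16777216 * t" .
  have s2: "(LINT x|lebesgue. (v x)\<^sup>2) / t \<le> t" using t by (simp add: divide_le_eq power2_eq_square)
  have "(LINT x|lebesgue. \<bar>f x (u x) * v x\<bar>) \<le> (LINT x|lebesgue. c * (t * ((u x)\<^sup>2 + u x ^ 6) + (v x)\<^sup>2 / t + v x ^ 6 / t ^ 5))"
  proof (rule integral_mono_AE)
    show "integrable lebesgue (\<lambda>x. \<bar>f x (u x) * v x\<bar>)" by (rule integrable_abs[OF f_comp_mult_integrable[OF u v]])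
    show "integrable lebesgue (\<lambda>x. c * (t * ((u x)\<^sup>2 + u x ^ 6) + (v x)\<^sup>2 / t + v x ^ 6 / t ^ 5))" using iu v2 v6 by simp
    show "AE x in lebesgue. \<bar>f x (u x) * v x\<bar> \<le> c * (t * ((u x)\<^sup>2 + u x ^ 6) + (v x)\<^sup>2 / t + v x ^ 6 / t ^ 5)"
      using good
    proof eventually_elim
      case (elim x)
      have "\<bar>f x (u x) * v x\<bar> \<le> c * (\<bar>u x\<bar> + \<bar>u x\<bar> ^ 5) * \<bar>v x\<bar>"
        unfolding abs_mult by (intro mult_right_mono good_growth[OF elim c_nonneg]) auto
      also have "\<dots> \<le> c * (t * ((u x)\<^sup>2 + u x ^ 6) + (v x)\<^sup>2 / t + v x ^ 6 / t ^ 5)"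
        using small_young[of "\<bar>u x\<bar>" "\<bar>v x\<bar>" t] t(1) c_nonneg unfolding mult.assoc
        by (intro mult_left_mono) auto
      finally show ?case .
    qed
  qed
  also have "\<dots> = c * (t * (LINT x|lebesgue. (u x)\<^sup>2 + u x ^ 6) + (LINT x|lebesgue. (v x)\<^sup>2) / t + (LINT x|lebesgue. v x ^ 6) / t ^ 5)"
  proof -
    have "integrable lebesgue (\<lambda>x. t * ((u x)\<^sup>2 + u x ^ 6))" "integrable lebesgue (\<lambda>x. (v x)\<^sup>2 / t)" "integrable lebesgue (\<lambda>x. v x ^ 6 / t ^ 5)"
      using iu v2 v6 by simp_all
    then show ?thesis by (simp only: integral_mult_right_zero Bochner_Integration.integral_add Bochner_Integration.integrable_add integral_divide_zero)
  qed
  also have "\<dots> \<le> c * (t * (LINT x|lebesgue. (u x)\<^sup>2 + u x ^ 6) + t + 16777216 * t)"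
    using s2 s6 c_nonneg t(1) by (intro mult_left_mono add_mono) auto
  also have "\<dots> = t * (c * ((LINT x|lebesgue. (u x)\<^sup>2 + u x ^ 6) + 16777217))" by (simp only: distrib_left distrib_right) simp
  finally show ?thesis .
qed

lemma L2_small_pairing:
  assumes "F \<in> L2" "v \<in> L2" "t > 0" "(LINT x|lebesgue. (v x)\<^sup>2) \<le> t\<^sup>2"
  shows "\<bar>LINT x|lebesgue. F x * v x\<bar> \<le> t * ((LINT x|lebesgue. (F x)\<^sup>2) + 1)"
proof -
  have "\<bar>LINT x|lebesgue. F x * v x\<bar> \<le> (LINT x|lebesgue. \<bar>F x * v x\<bar>)" by (rule integral_abs_bound)
  also have "\<dots> \<le> t * (LINT x|lebesgue. (F x)\<^sup>2) + (LINT x|lebesgue. (v x)\<^sup>2) / t" by (rule L2_weighted_bound[OF assms(1-3)])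
  also have "(LINT x|lebesgue. (v x)\<^sup>2) / t \<le> t" using assms by (simp add: divide_le_eq power2_eq_square)
  finally show ?thesis by (simp add: distrib_left)
qed

text \<open>Each of the three parts of \<open>Lam\<close> is continuous in the H^1 norm: two as
  pairings in L^2, the nonlinear one by \<open>f_comp_small\<close>. \<open>K\<close> collects the
  three bounds, and \<open>Lam_C1c\<close> disposes of the approximating function.\<close>

lemma Lam_zero:
  assumes u: "u \<in> X_space" and L: "\<And>v. v \<in> X_space \<Longrightarrow> Lin (ansatz u) (ansatz v) = 0" and w: "w \<in> H1"
  shows "Lam a b u w = 0"
proof -
  have uH: "u \<in> H1" and ur: "(\<lambda>x. u x / radius x) \<in> L2" using u by (auto simp: X_space_iff)
  let ?F = "\<lambda>x. sg a b x / radius x * u x"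
  note F = H1_sg_over_radius(1)[OF uH ur, of a b]
  define K where "K = (\<Sum>i\<in>UNIV. (LINT x|lebesgue. (weak_partial i ?F x)\<^sup>2) + 1) + ((LINT x|lebesgue. (V x * ?F x)\<^sup>2) + 1)
     + (\<bar>a\<bar> + \<bar>b\<bar>) * (c * ((LINT x|lebesgue. (u x)\<^sup>2 + u x ^ 6) + 16777217))"
  show ?thesis
  proof (rule eq_0_if_abs_le_all_mult[of _ K])
    fix t :: real assume t: "t > 0"
    obtain p where p: "p \<in> C1c" "(LINT x|lebesgue. (w x - p x)\<^sup>2) < t\<^sup>2"
        "\<And>i. (LINT x|lebesgue. (weak_partial i w x - partial i p x)\<^sup>2) < t\<^sup>2"
      by (rule H1_dense[OF w zero_less_power[OF t, of 2]]) (use test_functions_C1c in blast)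
    note pH = C1c_H1(1)[OF p(1)]
    define v where "v x = w x + (-1) * p x" for x
    have vH: "v \<in> H1" unfolding v_def[abs_def] by (intro H1_add(1) H1_cmult(1) w pH)
    have v2: "(LINT x|lebesgue. (v x)\<^sup>2) \<le> t\<^sup>2" using p(2) by (simp add: v_def)
    have vi: "(LINT x|lebesgue. (weak_partial i v x)\<^sup>2) \<le> t\<^sup>2" for i
    proof -
      have "AE x in lebesgue. weak_partial i v x = weak_partial i w x - partial i p x"
        using H1_add(2)[OF w H1_cmult(1)[OF pH], of i "-1"] H1_cmult(2)[OF pH, of i "-1"] C1c_H1(2)[OF p(1), of i]
        unfolding v_def[abs_def] by eventually_elim simp
      moreover have "weak_partial i v \<in> borel_measurable lebesgue" "weak_partial i w \<in> borel_measurable lebesgue" "partial i p \<in> borel_measurable lebesgue"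
        using L2_measurable H1_weak_partial_L2 vH w Cc_measurable[OF C1c_partial_Cc[OF p(1)]] by auto
      ultimately have "(LINT x|lebesgue. (weak_partial i v x)\<^sup>2) = (LINT x|lebesgue. (weak_partial i w x - partial i p x)\<^sup>2)"
        by (intro integral_cong_AE) auto
      then show ?thesis using p(3)[of i] by simp
    qed
    \<comment> \<open>Four squared norms, of \<open>v\<close> and of its three derivatives, each at
      most \<open>t^2\<close>.\<close>
    have vs: "H1_sq v \<le> 4 * t\<^sup>2"
      using v2 vi[of 1] vi[of 2] vi[of 3] by (simp add: H1_sq_def sum_3)
    have "Lam a b u w = Lam a b u (\<lambda>x. p x + v x)" by (simp add: v_def)
    also have "\<dots> = Lam a b u v"
    proof -
      have "Lam a b u p = 0" by (rule Lam_C1c[OF u _ p(1)]) (rule L)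
      then show ?thesis by (simp add: Lam_add[OF u pH vH])
    qed
    finally have Lv: "Lam a b u w = Lam a b u v" .
    have g: "\<bar>LINT x|lebesgue. weak_grad ?F x \<bullet> weak_grad v x\<bar> \<le> t * (\<Sum>i\<in>UNIV. (LINT x|lebesgue. (weak_partial i ?F x)\<^sup>2) + 1)"
    proof -
      have eq: "(LINT x|lebesgue. weak_grad ?F x \<bullet> weak_grad v x) = (\<Sum>i\<in>UNIV. LINT x|lebesgue. weak_partial i ?F x * weak_partial i v x)"
        unfolding inner_vec_def weak_grad_nth inner_real_def
        by (intro Bochner_Integration.integral_sum L2_mult_integrable H1_weak_partial_L2 F vH)
      show ?thesis
        unfolding eq sum_distrib_left
        by (rule order_trans[OF sum_abs]) (intro sum_mono L2_small_pairing H1_weak_partial_L2 F vH t vi)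
    qed
    have i: "\<bar>LINT x|lebesgue. V x * ?F x * v x\<bar> \<le> t * ((LINT x|lebesgue. (V x * ?F x)\<^sup>2) + 1)"
      by (rule L2_small_pairing[OF V_mult_L2[OF H1_L2[OF F]] H1_L2[OF vH] t v2])
    have n: "\<bar>LINT x|lebesgue. f x (u x) * (sg a b x / radius x) * v x\<bar> \<le> t * ((\<bar>a\<bar> + \<bar>b\<bar>) * (c * ((LINT x|lebesgue. (u x)\<^sup>2 + u x ^ 6) + 16777217)))"
    proof -
      have "\<bar>LINT x|lebesgue. f x (u x) * (sg a b x / radius x) * v x\<bar> \<le> (LINT x|lebesgue. \<bar>f x (u x) * (sg a b x / radius x) * v x\<bar>)"
        by (rule integral_abs_bound)
      also have "\<dots> \<le> (LINT x|lebesgue. (\<bar>a\<bar> + \<bar>b\<bar>) * \<bar>f x (u x) * v x\<bar>)"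
      proof (rule integral_mono)
        show "integrable lebesgue (\<lambda>x. \<bar>f x (u x) * (sg a b x / radius x) * v x\<bar>)" by (rule integrable_abs[OF Lam_integrable(3)[OF u vH]])
        show "integrable lebesgue (\<lambda>x. (\<bar>a\<bar> + \<bar>b\<bar>) * \<bar>f x (u x) * v x\<bar>)"
          by (intro integrable_mult_right integrable_abs f_comp_mult_integrable uH vH)
        show "\<bar>f x (u x) * (sg a b x / radius x) * v x\<bar> \<le> (\<bar>a\<bar> + \<bar>b\<bar>) * \<bar>f x (u x) * v x\<bar>" for x
          using mult_right_mono[OF sg_over_radius_bound[of a b x], of "\<bar>f x (u x) * v x\<bar>"] by (simp add: abs_mult mult_ac)
      qed
      also have "\<dots> \<le> (\<bar>a\<bar> + \<bar>b\<bar>) * (t * (c * ((LINT x|lebesgue. (u x)\<^sup>2 + u x ^ 6) + 16777217)))"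
        unfolding integral_mult_right_zero by (intro mult_left_mono f_comp_small uH vH t v2 vs) auto
      finally show ?thesis by (simp only: mult.left_commute)
    qed
    have comb: "\<bar>A + B - C\<bar> \<le> t * (\<alpha> + \<beta> + \<gamma>)" if "\<bar>A\<bar> \<le> t * \<alpha>" "\<bar>B\<bar> \<le> t * \<beta>" "\<bar>C\<bar> \<le> t * \<gamma>" for A B C \<alpha> \<beta> \<gamma>
      using that unfolding distrib_left by linarith
    show "\<bar>Lam a b u w\<bar> \<le> t * K"
      unfolding Lv Lam_split[OF u vH] K_def by (rule comb[OF g i n])
  qed
qed

text \<open>As \<open>E\<close> is divergence free, the pairing of curls equals the pairing of
  gradients for every \<open>W\<close>, whatever its divergence. The components then decouple: the
  third one of \<open>E\<close> is zero, and the other two give the two functionals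
  \<open>Lam\<close>.\<close>

lemma Lin_zero:
  assumes cr: "weak_solution_S V f u" and E: "AE x in lebesgue. E x = ansatz u x" and W: "W \<in> H1_vec"
  shows "Lin E W = 0"
proof -
  have u: "u \<in> X_space" using cr by (simp add: weak_solution_S_def critical_point_def)
  then have uH: "u \<in> H1" and ur: "(\<lambda>x. u x / radius x) \<in> L2" and uc: "rot_inv u"
    using cyl_sym_rot_inv by (auto simp: X_space_iff)
  note EH = ansatz_H1_vec(1)[OF uH ur E] and W1 = H1_vec_nth[OF W, of 1] and W2 = H1_vec_nth[OF W, of 2]
  let ?F = "\<lambda>a b x. sg a b x / radius x * u x"
  let ?W1 = "\<lambda>x. W x $ 1" and ?W2 = "\<lambda>x. W x $ 2"
  have "(LINT x|lebesgue. wdiv E x * wdiv W x) = (LINT x|(lebesgue :: R3 measure). 0)"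
    by (rule integral_cong_AE[OF borel_measurable_integrable[OF curl_identity(3)[OF EH W]]])
      (use wdiv_ansatz[OF uH ur E uc] in auto)
  then have c: "(LINT x|lebesgue. weak_curl E x \<bullet> weak_curl W x) = (LINT x|lebesgue. grad_inner E W x)"
    using curl_identity(4)[OF EH W] by simp
  have e1: "AE x in lebesgue. E x $ 1 = ?F 0 (-1) x" and e2: "AE x in lebesgue. E x $ 2 = ?F 1 0 x"
    using E by (eventually_elim, simp only: ansatz_nth)+
  have ae3: "AE x in lebesgue. \<forall>i. weak_partial i (\<lambda>y. E y $ 3) x = 0"
    by (subst AE_all_countable) (rule allI, rule ansatz_H1_vec(4)[OF uH ur E])
  have wg: "weak_grad (\<lambda>y. E y $ 1) = weak_grad (?F 0 (-1))" "weak_grad (\<lambda>y. E y $ 2) = weak_grad (?F 1 0)"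
    using weak_partial_cong[OF e1] weak_partial_cong[OF e2] by (simp_all add: weak_grad_def fun_eq_iff)
  have "(LINT x|lebesgue. grad_inner E W x) = (LINT x|lebesgue. weak_grad (?F 0 (-1)) x \<bullet> weak_grad ?W1 x + weak_grad (?F 1 0) x \<bullet> weak_grad ?W2 x)"
  proof (rule integral_cong_AE[OF borel_measurable_integrable[OF curl_identity(2)[OF EH W]]])
    show "(\<lambda>x. weak_grad (?F 0 (-1)) x \<bullet> weak_grad ?W1 x + weak_grad (?F 1 0) x \<bullet> weak_grad ?W2 x) \<in> borel_measurable lebesgue"
      by (intro borel_measurable_add borel_measurable_integrable Lam_integrable(1) u W1 W2)
    show "AE x in lebesgue. grad_inner E W x = weak_grad (?F 0 (-1)) x \<bullet> weak_grad ?W1 x + weak_grad (?F 1 0) x \<bullet> weak_grad ?W2 x"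
      using ae3
    proof eventually_elim
      case (elim x)
      then have "weak_grad (\<lambda>y. E y $ 3) x = 0" by (simp add: vec_eq_iff)
      then show ?case unfolding grad_inner_def sum_3 wg by (simp only: inner_zero_left add_0_right)
    qed
  qed
  also have "\<dots> = (LINT x|lebesgue. weak_grad (?F 0 (-1)) x \<bullet> weak_grad ?W1 x) + (LINT x|lebesgue. weak_grad (?F 1 0) x \<bullet> weak_grad ?W2 x)"
    by (rule Bochner_Integration.integral_add[OF Lam_integrable(1)[OF u W1] Lam_integrable(1)[OF u W2]])
  finally have 1: "(LINT x|lebesgue. grad_inner E W x) = (LINT x|lebesgue. weak_grad (?F 0 (-1)) x \<bullet> weak_grad ?W1 x) + (LINT x|lebesgue. weak_grad (?F 1 0) x \<bullet> weak_grad ?W2 x)" .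
  have "(LINT x|lebesgue. V x * (E x \<bullet> W x)) = (LINT x|lebesgue. V x * ?F 0 (-1) x * ?W1 x + V x * ?F 1 0 x * ?W2 x)"
  proof (rule integral_cong_AE[OF borel_measurable_integrable[OF V_inner_integrable[OF EH W]]])
    show "(\<lambda>x. V x * ?F 0 (-1) x * ?W1 x + V x * ?F 1 0 x * ?W2 x) \<in> borel_measurable lebesgue"
      by (intro borel_measurable_add borel_measurable_integrable Lam_integrable(2) u W1 W2)
    show "AE x in lebesgue. V x * (E x \<bullet> W x) = V x * ?F 0 (-1) x * ?W1 x + V x * ?F 1 0 x * ?W2 x"
      using E
    proof eventually_elim
      case (elim x)
      show ?case unfolding elim inner_vec_def sum_3 ansatz_nth inner_real_def by (simp only: distrib_left mult_zero_left add_0_right mult.assoc)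
    qed
  qed
  also have "\<dots> = (LINT x|lebesgue. V x * ?F 0 (-1) x * ?W1 x) + (LINT x|lebesgue. V x * ?F 1 0 x * ?W2 x)"
    by (rule Bochner_Integration.integral_add[OF Lam_integrable(2)[OF u W1] Lam_integrable(2)[OF u W2]])
  finally have 2: "(LINT x|lebesgue. V x * (E x \<bullet> W x)) = (LINT x|lebesgue. V x * ?F 0 (-1) x * ?W1 x) + (LINT x|lebesgue. V x * ?F 1 0 x * ?W2 x)" .
  have "(LINT x|lebesgue. h x (E x) \<bullet> W x) = (LINT x|lebesgue. f x (u x) * (sg 0 (-1) x / radius x) * ?W1 x + f x (u x) * (sg 1 0 x / radius x) * ?W2 x)"
  proof (rule integral_cong_AE[OF borel_measurable_integrable[OF h_inner_integrable[OF EH W]] _ h_ansatz_AE[OF E]])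
    show "(\<lambda>x. f x (u x) * (sg 0 (-1) x / radius x) * ?W1 x + f x (u x) * (sg 1 0 x / radius x) * ?W2 x) \<in> borel_measurable lebesgue"
      by (intro borel_measurable_add borel_measurable_integrable Lam_integrable(3) u W1 W2)
  qed
  also have "\<dots> = (LINT x|lebesgue. f x (u x) * (sg 0 (-1) x / radius x) * ?W1 x) + (LINT x|lebesgue. f x (u x) * (sg 1 0 x / radius x) * ?W2 x)"
    by (rule Bochner_Integration.integral_add[OF Lam_integrable(3)[OF u W1] Lam_integrable(3)[OF u W2]])
  finally have 3: "(LINT x|lebesgue. h x (E x) \<bullet> W x) = (LINT x|lebesgue. f x (u x) * (sg 0 (-1) x / radius x) * ?W1 x) + (LINT x|lebesgue. f x (u x) * (sg 1 0 x / radius x) * ?W2 x)" .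
  have L: "Lin (ansatz u) (ansatz v) = 0" if "v \<in> X_space" for v
    by (rule Lin_zero_if_critical[OF cr _ that]) simp
  have "Lam 0 (-1) u ?W1 = 0" "Lam 1 0 u ?W2 = 0"
    by (rule Lam_zero[OF u _ W1], rule L, assumption) (rule Lam_zero[OF u _ W2], rule L)
  then show ?thesis
    unfolding Lin_def c 1 2 3 Lam_split[OF u W1] Lam_split[OF u W2] by linarith
qed

section \<open>The two implications\<close>

lemma weak_solution_S_if_M:
  assumes E: "E \<in> H1_vec" and Eu: "AE x in lebesgue. E x = ansatz u x" and u: "cyl_sym u" and M: "weak_solution_M V h E"
  shows "u \<in> X_space" "weak_solution_S V f u"
proof -
  note H = H1_vec_ansatz[OF E Eu cyl_sym_rot_inv[OF u]]
  show uX: "u \<in> X_space" using H u by (simp add: X_space_iff)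
  show "weak_solution_S V f u"
    unfolding weak_solution_S_def critical_point_def
  proof (intro conjI uX allI impI)
    fix e :: real assume "e > 0"
    then obtain d where d: "d > 0" "\<And>W. W \<in> H1_vec \<Longrightarrow> H1_vec_norm W < d \<Longrightarrow> \<bar>energy_M V h (\<lambda>x. E x + W x) - energy_M V h E\<bar> \<le> e * H1_vec_norm W"
      using M unfolding weak_solution_M_def critical_point_def by blast
    show "\<exists>d>0. \<forall>v\<in>X_space. X_norm v < d \<longrightarrow> \<bar>energy_S V f (\<lambda>x. u x + v x) - energy_S V f u\<bar> \<le> e * X_norm v"
    proof (intro exI[of _ d] conjI ballI impI d(1))
      fix v assume v: "v \<in> X_space" and n: "X_norm v < d"
      note vX = v[unfolded X_space_iff] and uvX = X_space_add[OF uX v, unfolded X_space_iff]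
      have W: "ansatz v \<in> H1_vec" and N: "H1_vec_norm (ansatz v) = X_norm v"
        using ansatz_H1_vec(1)[of v "ansatz v"] ansatz_norm[of v "ansatz v"] vX by auto
      have "energy_M V h (\<lambda>x. E x + ansatz v x) = energy_S V f (\<lambda>x. u x + v x)"
      proof (rule energy_ansatz)
        show "AE x in lebesgue. E x + ansatz v x = ansatz (\<lambda>x. u x + v x) x"
          using Eu by eventually_elim (simp add: ansatz_add)
      qed (use uvX cyl_sym_rot_inv in auto)
      moreover have "energy_M V h E = energy_S V f u" by (rule energy_ansatz[OF H Eu cyl_sym_rot_inv[OF u]])
      ultimately show "\<bar>energy_S V f (\<lambda>x. u x + v x) - energy_S V f u\<bar> \<le> e * X_norm v"
        using d(2)[OF W] n N by simp
    qed
  qed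
qed

lemma ansatz_div_energy:
  assumes u: "u \<in> X_space" and E: "AE x in lebesgue. E x = ansatz u x"
  shows "E \<in> H1_vec" "div_free E" "energy_M V h E = energy_S V f u"
proof -
  have H: "u \<in> H1" "(\<lambda>x. u x / radius x) \<in> L2" and r: "rot_inv u"
    using u cyl_sym_rot_inv by (auto simp: X_space_iff)
  show EH: "E \<in> H1_vec" by (rule ansatz_H1_vec(1)[OF H E])
  show "div_free E" by (rule div_free_wdiv[OF EH wdiv_ansatz[OF H E r]])
  show "energy_M V h E = energy_S V f u" by (rule energy_ansatz[OF H E r])
qed

lemma weak_solution_M_if_S:
  assumes S: "weak_solution_S V f u" and E: "AE x in lebesgue. E x = ansatz u x"
  shows "weak_solution_M V h E"
proof (rule critical_M_if_Lin_zero)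
  have "u \<in> X_space" using S by (simp add: weak_solution_S_def critical_point_def)
  then show "E \<in> H1_vec" using E by (rule ansatz_div_energy)
qed (rule Lin_zero[OF S E])

end

lemma O2_invariant_rot:
  assumes "O2_invariant f" shows "f (rot t x) s = f x s"
proof -
  let ?g = "vector [vector [cos t, - sin t], vector [sin t, cos t]] :: real ^ 2 ^ 2"
  have "transpose ?g ** ?g = mat 1"
    by (simp add: vec_eq_iff forall_2 matrix_matrix_mult_def transpose_def mat_def sum_2)
  then have "orthogonal_matrix ?g" by (simp add: orthogonal_matrix)
  moreover have "O2_act ?g x = rot t x" by (simp add: O2_act_def vec_eq_iff forall_3)
  ultimately show ?thesis using assms unfolding O2_invariant_def by metis
qed

theorem theorem1p1:
  fixes V :: "real ^ 3 \<Rightarrow> real"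
    and f :: "real ^ 3 \<Rightarrow> real \<Rightarrow> real"
    and h :: "real ^ 3 \<Rightarrow> real ^ 3 \<Rightarrow> real ^ 3"
  assumes "V \<in> Linf"
    and "cyl_sym V"
    and "AE x in lebesgue. V (x + axis 3 1) = V x"
    and "(INF l\<in>schroedinger_spectrum V. ereal l) > 0"
    and "(\<lambda>(x, s). f x s) \<in> borel_measurable (lebesgue :: ((real ^ 3) \<times> real) measure)"
    and "O2_invariant f"
    and "\<And>x. continuous_on UNIV (f x)"
    and "\<exists>c>0. AE x in lebesgue. \<forall>s. \<bar>f x s\<bar> \<le> c * (\<bar>s\<bar> + \<bar>s\<bar> ^ 5)"
    and "AE x in lebesgue. \<forall>w a. norm w = 1 \<longrightarrow> h x (a *\<^sub>R w) = f x a *\<^sub>R w"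
  shows "(\<forall>E u. E \<in> H1_vec \<longrightarrow> cyl_sym u \<longrightarrow> (AE x in lebesgue. E x = ansatz u x) \<longrightarrow>
             weak_solution_M V h E \<longrightarrow>
             u \<in> H1 \<and> weak_solution_S V f u \<and> div_free E \<and> energy_M V h E = energy_S V f u) \<and>
         (\<forall>E u. u \<in> H1 \<longrightarrow> cyl_sym u \<longrightarrow> weak_solution_S V f u \<longrightarrow>
             (AE x in lebesgue. E x = ansatz u x) \<longrightarrow>
             E \<in> H1_vec \<and> weak_solution_M V h E \<and> div_free E \<and> energy_M V h E = energy_S V f u)"
proof -
  obtain CV where V: "V \<in> borel_measurable lebesgue" "AE x in lebesgue. \<bar>V x\<bar> \<le> CV" using assms(1) by (auto simp: Linf_def)
  obtain c where c: "c > 0" "AE x in lebesgue. \<forall>s. \<bar>f x s\<bar> \<le> c * (\<bar>s\<bar> + \<bar>s\<bar> ^ 5)" using assms(8) by blast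
  interpret cyl_problem V f h c CV
  proof
    show "AE x in lebesgue. good_pt f h c x"
      using c(2) assms(9) by eventually_elim (use assms(7) in \<open>simp add: good_pt_def\<close>)
  qed (use V c(1) assms(7) section_measurable[OF assms(5,7)] cyl_sym_rot_inv[OF assms(2)] O2_invariant_rot[OF assms(6)] in auto)
  show ?thesis
  proof (intro conjI allI impI)
    fix E u assume A: "E \<in> H1_vec" "cyl_sym u" "AE x in lebesgue. E x = ansatz u x" "weak_solution_M V h E"
    note S = weak_solution_S_if_M[OF A(1,3,2,4)]
    show "u \<in> H1" using S(1) by (simp add: X_space_iff)
    show "weak_solution_S V f u" by (rule S(2))
    show "div_free E" "energy_M V h E = energy_S V f u" by (rule ansatz_div_energy[OF S(1) A(3)])+
  next
    fix E u assume A: "weak_solution_S V f u" "AE x in lebesgue. E x = ansatz u x"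
    \<comment> \<open>A critical point belongs to its space by definition, which includes the
      integrability of \<open>u^2 / r^2\<close>.\<close>
    have u: "u \<in> X_space" using A(1) by (simp add: weak_solution_S_def critical_point_def)
    show "E \<in> H1_vec" "div_free E" "energy_M V h E = energy_S V f u" by (rule ansatz_div_energy[OF u A(2)])+
    show "weak_solution_M V h E" by (rule weak_solution_M_if_S[OF A])
  qed
qed

end
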